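(* Let $\mathbb{F}$ be a real closed field, $\mathbb{K}=\mathbb{F}[\sqrt{-1}]$, and $\mathbb{L}=\mathbb{F}\times\mathbb{K}$. Let $(V,\mathbb{L},\beta,Q)$ be a twisted composition of rank $8$ and let $E=\mathrm{End}_{\mathbb{L}}(V)$ be the corresponding trialitarian algebra. Suppose that $E$ is given a Type III grading by an abelian group $G$. Then there exist exactly two $G$-gradings on the twisted composition $V$ that induce the given grading on $E$. If $V=\bigoplus_{g\in G}V_g$ is one of them, then the other is $V=\bigoplus_{g\in G}aV_g$, where $a=(1,-1)\in\mathbb{L}$ is the unique nontrivial element of the center of the group $\mathrm{Spin}(V,\mathbb{L},\beta,Q)(\mathbb{F})$ of $\mathbb{L}$-linear automorphisms of $(V,\mathbb{L},\beta,Q)$ (an element of $\mathbb{L}^\times$ being viewed as the operator of multiplication by it).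
   Context: Let $\iota$ be the nontrivial automorphism of $\mathbb{K}$ over $\mathbb{F}$. For $\ell=(b,c)\in\mathbb{L}=\mathbb{F}\times\mathbb{K}$ put $\ell^\sharp=(c\iota(c),b\iota(c))$. Twisted composition of rank $8$ over $\mathbb{L}$: a free $\mathbb{L}$-module $V$ of rank $8$ with a nonsingular $\mathbb{L}$-valued quadratic form $Q$ (polar form $b_Q$) and an $\mathbb{F}$-quadratic map $\beta\colon V\to V$ such that $\beta(\ell v)=\ell^\sharp\beta(v)$, $Q(\beta(v))=Q(v)^\sharp$ and $b_Q(v,\beta(v))\in\mathbb{F}$ for all $v\in V,\ell\in\mathbb{L}$. Put $\beta(x,y)=\beta(x+y)-\beta(x)-\beta(y)$. An $\mathbb{L}$-linear automorphism is an $\mathbb{L}$-linear bijection of $V$ commuting with $\beta$ and preserving $Q$. Trialitarian structure on $E=\mathrm{End}_{\mathbb{L}}(V)$: $\sigma$ is the $\mathbb{L}$-linear involution of $E$ adjoint to $b_Q$. Identify $\mathbb{L}\otimes_{\mathbb{F}}\mathbb{K}\simeq\mathbb{K}^3$ via $(b,c)\otimes c'\mapsto(bc',cc',\iota(c)c')$ and let $\rho(\ell_1,\ell_2,\ell_3)=(\ell_2,\ell_3,\ell_1)$. On $V\otimes\mathbb{K}$ (with $\beta,Q$ extended) there is a unique bilinear product $*$, $\rho$-semilinear in the first and $\rho^2$-semilinear in the second argument, with $x*x=\beta(x)$, $Q(x*y)=\rho(Q(x))\rho^2(Q(y))$ and $b_Q(x*y,z)=\rho(b_Q(y*z,x))=\rho^2(b_Q(z*x,y))$.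 Put $l_x(y)=x*y=r_y(x)$. Identify the Clifford algebra $\mathfrak{Cl}(E,\sigma)$ of the algebra with involution $(E,\sigma)$ with the even Clifford algebra $\mathfrak{Cl}_0(V,Q)$ so that the canonical map $\kappa\colon E\to\mathfrak{Cl}(E,\sigma)$ sends the operator $z\mapsto x\,b_Q(y,z)$ to $x\cdot y$. The trialitarian structure $\alpha\colon\mathfrak{Cl}(E,\sigma)\to E\otimes\mathbb{K}=\mathrm{End}_{\mathbb{L}\otimes\mathbb{K}}(V\otimes\mathbb{K})$ is the algebra homomorphism with $\alpha(x\cdot y)=l_xr_y$ for $x,y\in V$ (an isomorphism onto $E\otimes\mathbb{K}$, linear over $\mathbb{L}$ when $\mathbb{L}$ acts on the target through $\rho$). Gradings: a $G$-grading on the twisted composition is a $G$-grading on the $\mathbb{F}$-algebra $\mathbb{L}$ together with a decomposition $V=\bigoplus_{g}V_g$ into $\mathbb{F}$-subspaces such that $\mathbb{L}_gV_h\subset V_{gh}$, $\beta(V_g,V_h)\subset V_{gh}$ and $b_Q(V_g,V_h)\subset\mathbb{L}_{gh}$. It induces on $E$ the grading $E_g=\{f\in E\mid f(V_h)\subset V_{gh}\ \forall h\in G\}$. A $G$-grading on the trialitarian algebra $E$ is a $G$-grading on the $\mathbb{F}$-algebra $E$ such that $\sigma$ and $\alpha$ preserve degree, where $\mathfrak{Cl}(E,\sigma)$ carries the unique algebra grading making $\kappa$ degree-preserving. A grading is of Type III if the image of the corresponding homomorphism of group schemes $G^D\to\mathbf{Aut}_{\mathbb{F}}(\mathbb{L})$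 has order $3$, i.e., the support of the grading restricted to the center $\mathbb{L}$ generates a subgroup of order $3$ in $G$; for such a grading of $E$, $\mathbb{K}$ in $E\otimes\mathbb{K}$ has degree $e$. *)

theory Defs
  imports
    "HOL-Library.Poly_Mapping"
    "HOL-Algebra.QuotRing"
    "HOL-Algebra.Module"
    "HOL-Algebra.Algebraic_Closure_Type"
begin

section \<open>Scalars\<close>

class real_closed_field = linordered_field +
  assumes ex_sqrt: "0 \<le> a \<Longrightarrow> \<exists>b. b ^ 2 = a"
    and odd_degree_root: "odd n \<Longrightarrow> f n \<noteq> 0 \<Longrightarrow> \<exists>x. (\<Sum>k\<le>n. f k * x ^ k) = 0"

text \<open>
  For an \<open>F\<close>-space \<open>A\<close>, \<open>A cplx\<close> is \<open>A \<otimes>\<^sub>F F[\<surd>-1]\<close>, with \<open>Cplx x y\<close> standing for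
  \<open>x \<otimes> 1 + y \<otimes> \<surd>-1\<close>.  So \<open>F cplx\<close> is the field \<open>K\<close>.
\<close>

datatype 'a cplx = Cplx (re: 'a) (im: 'a)

instantiation cplx :: (ab_group_add) ab_group_add
begin
definition "0 = Cplx 0 0"
definition "x + y = Cplx (re x + re y) (im x + im y)"
definition "- x = Cplx (- re x) (- im x)"
definition "x - y = Cplx (re x - re y) (im x - im y)"
instance
  by standard
    (auto simp: zero_cplx_def plus_cplx_def uminus_cplx_def minus_cplx_def algebra_simps)
end

instantiation cplx :: (comm_ring_1) comm_ring_1
begin
definition "1 = Cplx 1 0"
definition "x * y = Cplx (re x * re y - im x * im y) (re x * im y + im x * re y)"
instance
  by standard
    (auto simp: zero_cplx_def one_cplx_def plus_cplx_def times_cplx_def uminus_cplx_def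
      minus_cplx_def algebra_simps)
end

instantiation cplx :: (linordered_field) field
begin
definition "inverse x =
  Cplx (re x / (re x * re x + im x * im x)) (- im x / (re x * re x + im x * im x))"
definition "x div y = x * inverse (y :: 'a cplx)"
instance
proof
  fix x y :: "'a cplx"
  show "inverse (0 :: 'a cplx) = 0"
    by (simp add: zero_cplx_def inverse_cplx_def)
  show "x div y = x * inverse y"
    by (rule divide_cplx_def)
  assume "x \<noteq> 0"
  then have "re x * re x + im x * im x \<noteq> 0"
    by (cases x) (auto simp: zero_cplx_def sum_squares_eq_zero_iff)
  then show "inverse x * x = 1"
    by (simp add: inverse_cplx_def times_cplx_def one_cplx_def add_divide_distrib [symmetric])
qed
end

definition inc :: "'a::zero \<Rightarrow> 'a cplx" where
  "inc x = Cplx x 0"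

definition imag_unit :: "'f::comm_ring_1 cplx" where
  "imag_unit = Cplx 0 1"

definition conj :: "'f::ab_group_add cplx \<Rightarrow> 'f cplx" where
  "conj c = Cplx (re c) (- im c)"

text \<open>The cubic \<open>F\<close>-algebra \<open>L = F \<times> K\<close>.\<close>

datatype 'f cubic = Cubic (fst_part: 'f) (snd_part: "'f cplx")

instantiation cubic :: (comm_ring_1) comm_ring_1
begin
definition "0 = Cubic 0 0"
definition "1 = Cubic 1 1"
definition "l + m = Cubic (fst_part l + fst_part m) (snd_part l + snd_part m)"
definition "- l = Cubic (- fst_part l) (- snd_part l)"
definition "l - m = Cubic (fst_part l - fst_part m) (snd_part l - snd_part m)"
definition "l * m = Cubic (fst_part l * fst_part m) (snd_part l * snd_part m)"
instance
  by standard
    (auto simp: zero_cubic_def one_cubic_def plus_cubic_def times_cubic_def uminus_cubic_def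
      minus_cubic_def algebra_simps)
end

definition of_F :: "'f \<Rightarrow> 'f::comm_ring_1 cubic" where
  "of_F c = Cubic c (inc c)"

text \<open>\<open>c \<cdot> conj c\<close> lies in \<open>F\<close>, whence the use of \<open>re\<close>.\<close>

definition sharp :: "'f::comm_ring_1 cubic \<Rightarrow> 'f cubic" where
  "sharp l = Cubic (re (snd_part l * conj (snd_part l)))
                   (inc (fst_part l) * conj (snd_part l))"

text \<open>The identification of \<open>L \<otimes> K\<close> with \<open>K \<times> K \<times> K\<close> and the automorphism \<open>\<rho>\<close> of \<open>L \<otimes> K\<close>.\<close>

definition to_K3 :: "'f::comm_ring_1 cubic cplx \<Rightarrow> 'f cplx \<times> 'f cplx \<times> 'f cplx" where
  "to_K3 t = (let l = re t; m = im t in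
     (inc (fst_part l) + inc (fst_part m) * imag_unit,
      snd_part l + snd_part m * imag_unit,
      conj (snd_part l) + conj (snd_part m) * imag_unit))"

lemma bij_to_K3: "bij (to_K3 :: 'f::linordered_field cubic cplx \<Rightarrow> _)"
proof (rule bijI)
  show "inj (to_K3 :: 'f cubic cplx \<Rightarrow> _)"
  proof (rule injI)
    fix s t :: "'f cubic cplx"
    assume st: "to_K3 s = to_K3 t"
    obtain a b c d e f where s: "s = Cplx (Cubic a (Cplx b c)) (Cubic d (Cplx e f))"
      by (metis cplx.exhaust cubic.exhaust)
    obtain a' b' c' d' e' f' where t: "t = Cplx (Cubic a' (Cplx b' c')) (Cubic d' (Cplx e' f'))"
      by (metis cplx.exhaust cubic.exhaust)
    from st have "a = a'" "d = d'" and 1: "b - f = b' - f'" "c + e = c' + e'"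
      and 2: "b + f = b' + f'" "e - c = e' - c'"
      by (auto simp: s t to_K3_def Let_def inc_def imag_unit_def conj_def plus_cplx_def
          times_cplx_def)
    from 1 2 have "2 * b = 2 * b'" "2 * f = 2 * f'" "2 * c = 2 * c'" "2 * e = 2 * e'"
      by (auto simp only: mult_2; algebra)+
    then show "s = t"
      using \<open>a = a'\<close> \<open>d = d'\<close> by (simp add: s t)
  qed
  show "surj (to_K3 :: 'f cubic cplx \<Rightarrow> _)"
  proof (rule surjI)
    fix q :: "'f cplx \<times> 'f cplx \<times> 'f cplx"
    obtain a d x y z w where q: "q = (Cplx a d, Cplx x y, Cplx z w)"
      by (metis cplx.exhaust prod.exhaust)
    show "to_K3 ((\<lambda>(p, q, r). Cplx
        (Cubic (re p) (Cplx ((re q + re r) / 2) ((im q - im r) / 2)))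
        (Cubic (im p) (Cplx ((im q + im r) / 2) ((re r - re q) / 2)))) q) = q"
      by (simp add: q to_K3_def inc_def imag_unit_def conj_def plus_cplx_def times_cplx_def
          field_simps)
  qed
qed

definition rho :: "'f::comm_ring_1 cubic cplx \<Rightarrow> 'f cubic cplx" where
  "rho t = inv_into UNIV to_K3 (case to_K3 t of (p, q, r) \<Rightarrow> (q, r, p))"


section \<open>Quadratic maps and twisted compositions\<close>

definition polar :: "('a::ab_group_add \<Rightarrow> 'b::ab_group_add) \<Rightarrow> 'a \<Rightarrow> 'a \<Rightarrow> 'b" where
  "polar q x y = q (x + y) - q x - q y"

definition quadratic_map ::
  "('r::comm_ring_1 \<Rightarrow> 'a::ab_group_add \<Rightarrow> 'a) \<Rightarrow> ('r \<Rightarrow> 'b::ab_group_add \<Rightarrow> 'b) \<Rightarrow> ('a \<Rightarrow> 'b) \<Rightarrow> bool"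
where
  "quadratic_map s t q \<longleftrightarrow>
     (\<forall>c x. q (s c x) = t (c ^ 2) (q x)) \<and>
     (\<forall>x. Modules.module_hom s t (polar q x)) \<and>
     (\<forall>y. Modules.module_hom s t (\<lambda>x. polar q x y))"

text \<open>Nonsingularity: the polar form identifies \<open>V\<close> with its dual.\<close>

definition nonsingular ::
  "('r::comm_ring_1 \<Rightarrow> 'a::ab_group_add \<Rightarrow> 'a) \<Rightarrow> ('a \<Rightarrow> 'r) \<Rightarrow> bool" where
  "nonsingular s q \<longleftrightarrow>
     (\<forall>\<phi>. Modules.module_hom s (*) \<phi> \<longrightarrow> (\<exists>!x. \<forall>y. \<phi> y = polar q x y))"

definition free_of_rank ::
  "nat \<Rightarrow> ('r::comm_ring_1 \<Rightarrow> 'a::ab_group_add \<Rightarrow> 'a) \<Rightarrow> bool" where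
  "free_of_rank n s \<longleftrightarrow> Modules.module s \<and>
     (\<exists>B. finite B \<and> card B = n \<and> \<not> module.dependent s B \<and> module.span s B = UNIV)"

definition F_scale :: "('f::comm_ring_1 cubic \<Rightarrow> 'v \<Rightarrow> 'v) \<Rightarrow> 'f \<Rightarrow> 'v \<Rightarrow> 'v" where
  "F_scale s c = s (of_F c)"

definition twisted_composition8 ::
  "('f::comm_ring_1 cubic \<Rightarrow> 'v::ab_group_add \<Rightarrow> 'v) \<Rightarrow> ('v \<Rightarrow> 'v) \<Rightarrow> ('v \<Rightarrow> 'f cubic) \<Rightarrow> bool"
where
  "twisted_composition8 s \<beta> Q \<longleftrightarrow>
     free_of_rank 8 s \<and>
     quadratic_map s (*) Q \<and> nonsingular s Q \<and>
     quadratic_map (F_scale s) (F_scale s) \<beta> \<and>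
     (\<forall>l v. \<beta> (s l v) = s (sharp l) (\<beta> v)) \<and>
     (\<forall>v. Q (\<beta> v) = sharp (Q v)) \<and>
     (\<forall>v. polar Q v (\<beta> v) \<in> range of_F)"

definition spin_points ::
  "('f::comm_ring_1 cubic \<Rightarrow> 'v::ab_group_add \<Rightarrow> 'v) \<Rightarrow> ('v \<Rightarrow> 'v) \<Rightarrow> ('v \<Rightarrow> 'f cubic) \<Rightarrow> ('v \<Rightarrow> 'v) set"
where
  "spin_points s \<beta> Q =
     {f. Modules.module_hom s s f \<and> bij f \<and> (\<forall>v. f (\<beta> v) = \<beta> (f v)) \<and> (\<forall>v. Q (f v) = Q v)}"

definition spin_center ::
  "('f::comm_ring_1 cubic \<Rightarrow> 'v::ab_group_add \<Rightarrow> 'v) \<Rightarrow> ('v \<Rightarrow> 'v) \<Rightarrow> ('v \<Rightarrow> 'f cubic) \<Rightarrow> ('v \<Rightarrow> 'v) set"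
where
  "spin_center s \<beta> Q =
     {z \<in> spin_points s \<beta> Q. \<forall>f \<in> spin_points s \<beta> Q. z \<circ> f = f \<circ> z}"


section \<open>Extension of scalars to \<open>K\<close> and the product on \<open>V \<otimes> K\<close>\<close>

definition ext_bilin ::
  "('a \<Rightarrow> 'b \<Rightarrow> 'c::ab_group_add) \<Rightarrow> 'a cplx \<Rightarrow> 'b cplx \<Rightarrow> 'c cplx" where
  "ext_bilin f x y =
     Cplx (f (re x) (re y) - f (im x) (im y)) (f (re x) (im y) + f (im x) (re y))"

definition ext_quad ::
  "('a::ab_group_add \<Rightarrow> 'b::ab_group_add) \<Rightarrow> 'a cplx \<Rightarrow> 'b cplx" where
  "ext_quad q x = Cplx (q (re x) - q (im x)) (polar q (re x) (im x))"

text \<open>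
  The conditions characterising the product \<open>*\<close> on \<open>V \<otimes> K\<close>.  They determine it uniquely.
\<close>

definition triality_product ::
  "('f::comm_ring_1 cubic \<Rightarrow> 'v::ab_group_add \<Rightarrow> 'v) \<Rightarrow> ('v \<Rightarrow> 'v) \<Rightarrow> ('v \<Rightarrow> 'f cubic) \<Rightarrow>
     ('v cplx \<Rightarrow> 'v cplx \<Rightarrow> 'v cplx) \<Rightarrow> bool"
where
  "triality_product s \<beta> Q star \<longleftrightarrow>
     (let sK = ext_bilin s; QK = ext_quad Q; bK = polar (ext_quad Q) in
       (\<forall>x x' y. star (x + x') y = star x y + star x' y) \<and>
       (\<forall>x y y'. star x (y + y') = star x y + star x y') \<and>
       (\<forall>t x y. star (sK t x) y = sK (rho t) (star x y)) \<and>
       (\<forall>t x y. star x (sK t y) = sK (rho (rho t)) (star x y)) \<and>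
       (\<forall>x. star x x = ext_quad \<beta> x) \<and>
       (\<forall>x y. QK (star x y) = rho (QK x) * rho (rho (QK y))) \<and>
       (\<forall>x y z. bK (star x y) z = rho (bK (star y z) x)) \<and>
       (\<forall>x y z. bK (star x y) z = rho (rho (bK (star z x) y))))"


section \<open>Algebras over \<open>F\<close>\<close>

text \<open>
  An \<open>F\<close>-algebra is a record \<open>('f, 'a) module\<close>, i.e. a ring together with an action of \<open>F\<close>
  (the locale \<open>algebra\<close> is for commutative algebras only).
\<close>

definition L_alg :: "('f::comm_ring_1, 'f cubic) module" where
  "L_alg = \<lparr>carrier = UNIV, monoid.mult = (*), one = 1, ring.zero = 0, add = (+),
            module.smult = (\<lambda>c l. of_F c * l)\<rparr>"

text \<open>
  \<open>End_alg s e\<close>: the endomorphisms of a module with scalar multiplication \<open>s\<close>, as an algebra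
  over \<open>F\<close>, which acts through the map \<open>e\<close> from \<open>F\<close> to the scalars.
\<close>

definition End_alg ::
  "('r::comm_ring_1 \<Rightarrow> 'a::ab_group_add \<Rightarrow> 'a) \<Rightarrow> ('f \<Rightarrow> 'r) \<Rightarrow> ('f, 'a \<Rightarrow> 'a) module" where
  "End_alg s e =
     \<lparr>carrier = {f. Modules.module_hom s s f}, monoid.mult = (\<circ>), one = id,
      ring.zero = (\<lambda>_. 0), add = (\<lambda>f g x. f x + g x), module.smult = (\<lambda>c f x. s (e c) (f x))\<rparr>"

abbreviation E_alg ::
  "('f::comm_ring_1 cubic \<Rightarrow> 'v::ab_group_add \<Rightarrow> 'v) \<Rightarrow> ('f, 'v \<Rightarrow> 'v) module" where
  "E_alg s \<equiv> End_alg s of_F"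

abbreviation EK_alg ::
  "('f::comm_ring_1 cubic \<Rightarrow> 'v::ab_group_add \<Rightarrow> 'v) \<Rightarrow> ('f, 'v cplx \<Rightarrow> 'v cplx) module" where
  "EK_alg s \<equiv> End_alg (ext_bilin s) (\<lambda>c. inc (of_F c))"

definition adjoint_inv ::
  "('f::comm_ring_1 cubic \<Rightarrow> 'v::ab_group_add \<Rightarrow> 'v) \<Rightarrow> ('v \<Rightarrow> 'f cubic) \<Rightarrow> ('v \<Rightarrow> 'v) \<Rightarrow> ('v \<Rightarrow> 'v)"
where
  "adjoint_inv s Q f =
     (THE f'. f' \<in> carrier (E_alg s) \<and> (\<forall>x y. polar Q (f x) y = polar Q x (f' y)))"


section \<open>The even Clifford algebra\<close>

text \<open>
  The Clifford algebra of \<open>(V, Q)\<close> is presented as the \<open>L\<close>-algebra generated by the set \<open>V\<close>,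
  subject to \<open>L\<close>-linearity of the generators and to \<open>v \<cdot> v = Q v\<close>.  The free \<open>L\<close>-algebra on the
  set \<open>V\<close> is the monoid algebra of the monoid of words in \<open>V\<close>, which \<open>poly_mapping\<close> wants
  written additively.
\<close>

datatype 'v word = Word (letters: "'v list")

instantiation word :: (type) monoid_add
begin
definition "0 = Word []"
definition "u + w = Word (letters u @ letters w)"
instance
  by standard (auto simp: zero_word_def plus_word_def)
end

type_synonym ('v, 'f) free_alg = "'v word \<Rightarrow>\<^sub>0 'f cubic"

definition gen :: "'v \<Rightarrow> ('v, 'f::comm_ring_1) free_alg" where
  "gen v = Poly_Mapping.single (Word [v]) 1"

definition scal :: "'f::comm_ring_1 cubic \<Rightarrow> ('v, 'f) free_alg" where
  "scal l = Poly_Mapping.single 0 l"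

definition cliff_ideal ::
  "('f::comm_ring_1 cubic \<Rightarrow> 'v::ab_group_add \<Rightarrow> 'v) \<Rightarrow> ('v \<Rightarrow> 'f cubic) \<Rightarrow> ('v, 'f) free_alg set"
where
  "cliff_ideal s Q = Idl\<^bsub>ring_of_type_algebra\<^esub>
     ({gen (x + y) - gen x - gen y | x y. True} \<union>
      {gen (s l x) - scal l * gen x | l x. True} \<union>
      {gen x * gen x - scal (Q x) | x. True})"

definition cliff ::
  "('f::comm_ring_1 cubic \<Rightarrow> 'v::ab_group_add \<Rightarrow> 'v) \<Rightarrow> ('v \<Rightarrow> 'f cubic) \<Rightarrow> ('v, 'f) free_alg set ring"
where
  "cliff s Q = ring_of_type_algebra Quot cliff_ideal s Q"

definition cliff_class ::
  "('f::comm_ring_1 cubic \<Rightarrow> 'v::ab_group_add \<Rightarrow> 'v) \<Rightarrow> ('v \<Rightarrow> 'f cubic) \<Rightarrow>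
     ('v, 'f) free_alg \<Rightarrow> ('v, 'f) free_alg set"
where
  "cliff_class s Q a = cliff_ideal s Q +>\<^bsub>ring_of_type_algebra\<^esub> a"

definition cliff0_alg ::
  "('f::comm_ring_1 cubic \<Rightarrow> 'v::ab_group_add \<Rightarrow> 'v) \<Rightarrow> ('v \<Rightarrow> 'f cubic) \<Rightarrow>
     ('f, ('v, 'f) free_alg set) module"
where
  "cliff0_alg s Q =
     \<lparr>carrier = cliff_class s Q ` {a. \<forall>w \<in> Poly_Mapping.keys a. even (length (letters w))},
      monoid.mult = monoid.mult (cliff s Q), one = one (cliff s Q),
      ring.zero = ring.zero (cliff s Q), add = add (cliff s Q),
      module.smult = (\<lambda>c A. cliff_class s Q (scal (of_F c)) \<otimes>\<^bsub>cliff s Q\<^esub> A)\<rparr>"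

definition cliff_prod ::
  "('f::comm_ring_1 cubic \<Rightarrow> 'v::ab_group_add \<Rightarrow> 'v) \<Rightarrow> ('v \<Rightarrow> 'f cubic) \<Rightarrow>
     'v \<Rightarrow> 'v \<Rightarrow> ('v, 'f) free_alg set"
where
  "cliff_prod s Q x y = cliff_class s Q (gen x * gen y)"

text \<open>
  The canonical map from \<open>E\<close> to the Clifford algebra, and the trialitarian structure \<open>\<alpha>\<close>
  belonging to a product on \<open>V \<otimes> K\<close>.  On the respective carriers both are uniquely
  determined: the operators \<open>z \<mapsto> x b(y, z)\<close> span \<open>E\<close>, and the elements \<open>x \<cdot> y\<close> generate the
  even Clifford algebra.
\<close>

definition canonical_map ::
  "('f::comm_ring_1 cubic \<Rightarrow> 'v::ab_group_add \<Rightarrow> 'v) \<Rightarrow> ('v \<Rightarrow> 'f cubic) \<Rightarrow>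
     (('v \<Rightarrow> 'v) \<Rightarrow> ('v, 'f) free_alg set) \<Rightarrow> bool"
where
  "canonical_map s Q \<kappa> \<longleftrightarrow>
     \<kappa> \<in> hom (add_monoid (E_alg s)) (add_monoid (cliff0_alg s Q)) \<and>
     (\<forall>x y. \<kappa> (\<lambda>z. s (polar Q y z) x) = cliff_prod s Q x y)"

definition trialitarian_map ::
  "('f::comm_ring_1 cubic \<Rightarrow> 'v::ab_group_add \<Rightarrow> 'v) \<Rightarrow> ('v \<Rightarrow> 'f cubic) \<Rightarrow>
     ('v cplx \<Rightarrow> 'v cplx \<Rightarrow> 'v cplx) \<Rightarrow> (('v, 'f) free_alg set \<Rightarrow> ('v cplx \<Rightarrow> 'v cplx)) \<Rightarrow> bool"
where
  "trialitarian_map s Q star \<alpha> \<longleftrightarrow>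
     \<alpha> \<in> ring_hom (cliff0_alg s Q) (EK_alg s) \<and>
     (\<forall>c. \<forall>A \<in> carrier (cliff0_alg s Q).
        \<alpha> (c \<odot>\<^bsub>cliff0_alg s Q\<^esub> A) = c \<odot>\<^bsub>EK_alg s\<^esub> \<alpha> A) \<and>
     (\<forall>x y. \<alpha> (cliff_prod s Q x y) = (\<lambda>z. star (inc x) (star z (inc y))))"


section \<open>Gradings\<close>

text \<open>
  The grading group is an arbitrary abelian group, written additively.  A grading of a space is
  the family of its homogeneous components.
\<close>

definition space_grading ::
  "('f::comm_ring_1, 'a, 'm) module_scheme \<Rightarrow> ('g \<Rightarrow> 'a set) \<Rightarrow> bool" where
  "space_grading M \<Gamma> \<longleftrightarrow>
     (\<forall>g. submodule (\<Gamma> g) (ring_of_type_algebra :: 'f ring) M) \<and>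
     (\<forall>x \<in> carrier M. \<exists>!f. (\<forall>g. f g \<in> \<Gamma> g) \<and> finite {g. f g \<noteq> \<zero>\<^bsub>M\<^esub>} \<and>
        x = (\<Oplus>\<^bsub>M\<^esub>g \<in> {g. f g \<noteq> \<zero>\<^bsub>M\<^esub>}. f g))"

definition algebra_grading ::
  "('f::comm_ring_1, 'a, 'm) module_scheme \<Rightarrow> ('g::ab_group_add \<Rightarrow> 'a set) \<Rightarrow> bool" where
  "algebra_grading A \<Gamma> \<longleftrightarrow> space_grading A \<Gamma> \<and>
     (\<forall>g h. \<forall>x \<in> \<Gamma> g. \<forall>y \<in> \<Gamma> h. x \<otimes>\<^bsub>A\<^esub> y \<in> \<Gamma> (g + h))"

text \<open>The underlying \<open>F\<close>-space of \<open>V\<close>; the multiplicative fields of the record are not used.\<close>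

definition V_space ::
  "('f::comm_ring_1 cubic \<Rightarrow> 'v::ab_group_add \<Rightarrow> 'v) \<Rightarrow> ('f, 'v) module" where
  "V_space s = \<lparr>carrier = UNIV, monoid.mult = undefined, one = undefined,
                ring.zero = 0, add = (+), module.smult = F_scale s\<rparr>"

definition twisted_composition_grading ::
  "('f::comm_ring_1 cubic \<Rightarrow> 'v::ab_group_add \<Rightarrow> 'v) \<Rightarrow> ('v \<Rightarrow> 'v) \<Rightarrow> ('v \<Rightarrow> 'f cubic) \<Rightarrow>
     ('g::ab_group_add \<Rightarrow> 'f cubic set) \<Rightarrow> ('g \<Rightarrow> 'v set) \<Rightarrow> bool"
where
  "twisted_composition_grading s \<beta> Q \<Lambda> W \<longleftrightarrow>
     algebra_grading L_alg \<Lambda> \<and> space_grading (V_space s) W \<and>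
     (\<forall>g h. \<forall>l \<in> \<Lambda> g. \<forall>v \<in> W h. s l v \<in> W (g + h)) \<and>
     (\<forall>g h. \<forall>v \<in> W g. \<forall>w \<in> W h. polar \<beta> v w \<in> W (g + h)) \<and>
     (\<forall>g h. \<forall>v \<in> W g. \<forall>w \<in> W h. polar Q v w \<in> \<Lambda> (g + h))"

definition induced_grading ::
  "('f::comm_ring_1 cubic \<Rightarrow> 'v::ab_group_add \<Rightarrow> 'v) \<Rightarrow> ('g::ab_group_add \<Rightarrow> 'v set) \<Rightarrow>
     'g \<Rightarrow> ('v \<Rightarrow> 'v) set"
where
  "induced_grading s W g = {f \<in> carrier (E_alg s). \<forall>h. f ` W h \<subseteq> W (g + h)}"

text \<open>
  The grading on \<open>E \<otimes> K\<close> in which \<open>K\<close> has trivial degree; \<open>ext_bilin (\<lambda>f v. f v)\<close> is the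
  action of \<open>E \<otimes> K\<close> on \<open>V \<otimes> K\<close>.
\<close>

definition grading_EK :: "('g \<Rightarrow> ('v::ab_group_add \<Rightarrow> 'v) set) \<Rightarrow> 'g \<Rightarrow> ('v cplx \<Rightarrow> 'v cplx) set"
where
  "grading_EK \<Gamma> g = {ext_bilin (\<lambda>f v. f v) (Cplx f f') | f f'. f \<in> \<Gamma> g \<and> f' \<in> \<Gamma> g}"

definition add_subgroup :: "'g::ab_group_add set \<Rightarrow> bool" where
  "add_subgroup H \<longleftrightarrow> 0 \<in> H \<and> (\<forall>x \<in> H. \<forall>y \<in> H. x - y \<in> H)"

text \<open>The centre of \<open>E\<close> consists of the multiplications by elements of \<open>L\<close>.\<close>

definition type_III ::
  "('f::comm_ring_1 cubic \<Rightarrow> 'v::ab_group_add \<Rightarrow> 'v) \<Rightarrow> ('g::ab_group_add \<Rightarrow> ('v \<Rightarrow> 'v) set) \<Rightarrow> bool"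
where
  "type_III s \<Gamma> \<longleftrightarrow> card (add_subgroup hull {g. \<exists>l. l \<noteq> 0 \<and> s l \<in> \<Gamma> g}) = 3"

text \<open>
  Type III gradings on the trialitarian algebra \<open>E\<close>.  The product \<open>star\<close>, the maps \<open>\<kappa>\<close> and
  \<open>\<alpha>\<close>, and the grading \<open>C\<close> of the even Clifford algebra are the unique ones with their
  respective properties.
\<close>

definition trialitarian_grading_III ::
  "('f::comm_ring_1 cubic \<Rightarrow> 'v::ab_group_add \<Rightarrow> 'v) \<Rightarrow> ('v \<Rightarrow> 'v) \<Rightarrow> ('v \<Rightarrow> 'f cubic) \<Rightarrow>
     ('g::ab_group_add \<Rightarrow> ('v \<Rightarrow> 'v) set) \<Rightarrow> bool"
where
  "trialitarian_grading_III s \<beta> Q \<Gamma> \<longleftrightarrow>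
     algebra_grading (E_alg s) \<Gamma> \<and> type_III s \<Gamma> \<and>
     (\<forall>g. adjoint_inv s Q ` \<Gamma> g \<subseteq> \<Gamma> g) \<and>
     (\<exists>star \<kappa> \<alpha> C.
        triality_product s \<beta> Q star \<and> canonical_map s Q \<kappa> \<and> trialitarian_map s Q star \<alpha> \<and>
        algebra_grading (cliff0_alg s Q) C \<and> (\<forall>g. \<kappa> ` \<Gamma> g \<subseteq> C g) \<and>
        (\<forall>g. \<alpha> ` C g \<subseteq> grading_EK \<Gamma> g))"

definition inducing_gradings ::
  "('f::comm_ring_1 cubic \<Rightarrow> 'v::ab_group_add \<Rightarrow> 'v) \<Rightarrow> ('v \<Rightarrow> 'v) \<Rightarrow> ('v \<Rightarrow> 'f cubic) \<Rightarrow>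
     ('g::ab_group_add \<Rightarrow> ('v \<Rightarrow> 'v) set) \<Rightarrow> (('g \<Rightarrow> 'f cubic set) \<times> ('g \<Rightarrow> 'v set)) set"
where
  "inducing_gradings s \<beta> Q \<Gamma> =
     {(\<Lambda>, W). twisted_composition_grading s \<beta> Q \<Lambda> W \<and> induced_grading s W = \<Gamma>}"

end

theory Submission
  imports Defs "HOL-Library.Function_Algebras"
begin

text \<open>
  \<^bold>\<open>The idea of the proof.\<close>  Along \<open>L = F \<times> K\<close> the module \<open>V\<close> splits into \<open>V\<^sub>1\<close> over \<open>F\<close> and \<open>V\<^sub>2\<close> over
  \<open>K\<close>, and \<open>E\<close> into \<open>End\<^sub>F(V\<^sub>1)\<close> and \<open>End\<^sub>K(V\<^sub>2)\<close>.  The map \<open>\<beta>\<close> amounts to conjugate-linear operators \<open>J x\<close>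
  on \<open>V\<^sub>2\<close>, for \<open>x \<in> V\<^sub>1\<close>, with \<open>J x J y + J y J x = b(x, y)\<close>: thus \<open>V\<^sub>2\<close> is a module over the Clifford
  algebra of \<open>V\<^sub>1\<close>, and the products \<open>J x J y\<close> generate all of \<open>End\<^sub>K(V\<^sub>2)\<close> (\<open>even_clifford_density\<close>).  The
  latter fact also yields the centre of the spin group.

  \<^bold>\<open>A character.\<close>  The centre \<open>L\<close> of \<open>E\<close> is graded by \<open>H = {0, h, 2h}\<close>, with \<open>u = (1, \<omega>)\<close> of degree \<open>h\<close>
  for a primitive third root of unity \<open>\<omega>\<close>.  The unit circle of \<open>K\<close> is divisible because \<open>F\<close> is real closed,
  so some character \<open>\<chi>\<close> of \<open>G\<close> with values in it has \<open>\<chi>(h) = \<omega>\<close>.  Then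
  \<open>\<Psi>(f) = \<Sum> \<chi>(- g) f\<^sub>g\<close> on \<open>V\<^sub>2\<close> does not see the second component of the scalars and identifies
  \<open>End\<^sub>F(V\<^sub>1) \<otimes> K\<close> with \<open>End\<^sub>K(V\<^sub>2)\<close>.  By an argument of Skolem--Noether type it comes from an isometry
  \<open>\<tau>: V\<^sub>1 \<rightarrow> V\<^sub>2\<close>, and \<open>f (\<tau> x) = \<chi>(g) \<tau>(f x)\<close> for \<open>f\<close> of degree \<open>g\<close>.  So the homogeneous vectors of
  degree \<open>g\<close> that one is looking for should have the form \<open>x + \<chi>(g) \<tau> x\<close>.

  \<^bold>\<open>A grading modulo \<open>H\<close>.\<close>  It remains to grade \<open>V\<^sub>1\<close> by \<open>G/H\<close>.  A graded matrix algebra need not come from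
  a graded vector space; here it does because of \<open>\<alpha>\<close>.  Every \<open>w \<in> V\<^sub>2\<close> gives a map \<open>R w: \<tau> x \<mapsto> J x w\<close> in
  \<open>End\<^sub>K(V\<^sub>2)\<close>.  These maps are the contractions of elements of \<open>E\<close> with the Casimir element, in whose first
  factor \<open>\<alpha>\<close> has been applied.  As \<open>\<alpha>\<close> preserves degrees and the Casimir element has degree zero, the
  maps \<open>R w\<close> form a graded subspace, and \<open>V\<^sub>2\<close> inherits a grading by \<open>G/H\<close> (\<open>R_contract_EH\<close>).  It is
  compatible with \<open>E\<close>, with \<open>b\<close> and with the real structure given by \<open>\<tau>\<close>, whence it restricts to \<open>V\<^sub>1\<close>.

  \<^bold>\<open>The cyclic symmetry.\<close>  For \<open>\<beta>\<close> to preserve the degrees in \<open>G\<close> the trilinear form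
  \<open>T(c; y, z) = b(\<tau> c, J y (\<tau> z))\<close> must satisfy \<open>T(y; z, c) = \<chi>(k)\<^sup>3 T(c; y, z)\<close> for \<open>c\<close> of degree \<open>k\<close>
  (\<open>trilinear_cyclic\<close>).  The three components of the homomorphism \<open>\<alpha>\<close> involve the same operators, and
  comparing them gives two identities for \<open>J\<close>.  They say that the isometry \<open>U\<close> of \<open>V\<^sub>2\<close> which moves \<open>J y (\<tau> z)\<close> to
  the conjugate of \<open>J z (\<tau> y)\<close> normalizes the even Clifford algebra, acting on it by \<open>\<chi>\<^sup>-\<^sup>3\<close>.  Hence \<open>U\<close> followed
  by multiplication by \<open>\<chi>\<^sup>3\<close> commutes with all \<open>J x J y\<close> and is a scalar.  Its square is 1 as both maps are
  isometries, and its cube is 1 as \<open>T\<close> returns to itself after three cyclic shifts; so it is 1.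

  \<^bold>\<open>Uniqueness.\<close>  Rank one operators built from homogeneous vectors are homogeneous in \<open>E\<close>.  Applying
  them to the components of a vector \<open>v\<^sub>0\<close> in another inducing grading shows that the other grading is
  \<open>l V\<^sub>g\<close>, shifted by some \<open>d\<close>, for a unit \<open>l\<close> of \<open>L\<close>.  Compatibility with \<open>\<beta>\<close> puts \<open>d\<close> into \<open>H\<close>, so that a
  homogeneous unit of \<open>L\<close> can undo the shift; then compatibility with \<open>b\<^sub>Q\<close> gives \<open>l\<^sup>2 \<in> F\<close>, which leaves
  \<open>l = 1\<close> and \<open>l = (1, -1)\<close> up to scalars in \<open>F\<close>.
\<close>

section \<open>The scalars \<open>F\<close>, \<open>K\<close> and \<open>L\<close>\<close>

lemma cplx_eq_iff: "x = y \<longleftrightarrow> re x = re y \<and> im x = im y"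
  by (cases x; cases y) auto

lemma re_im_simps [simp]:
  "re (0 :: 'a::ab_group_add cplx) = 0" "im (0 :: 'a::ab_group_add cplx) = 0"
  "re (x + y) = re x + re (y :: 'a::ab_group_add cplx)" "im (x + y) = im x + im y"
  "re (x - y) = re x - re (y :: 'a::ab_group_add cplx)" "im (x - y) = im x - im y"
  "re (- x) = - re (x :: 'a::ab_group_add cplx)" "im (- x) = - im x"
  by (simp_all add: zero_cplx_def plus_cplx_def minus_cplx_def uminus_cplx_def)

lemma re_im_ring_simps [simp]:
  "re (1 :: 'a::comm_ring_1 cplx) = 1" "im (1 :: 'a::comm_ring_1 cplx) = 0"
  "re (a * b) = re a * re b - im a * im (b :: 'a::comm_ring_1 cplx)"
  "im (a * b) = re a * im b + im a * re b"
  by (simp_all add: one_cplx_def times_cplx_def)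

lemma re_im_inc [simp]: "re (inc x) = x" "im (inc x) = 0"
  by (simp_all add: inc_def)

lemma re_im_conj [simp]: "re (conj z) = re z" "im (conj z) = - im z"
  by (simp_all add: conj_def)

lemma re_im_imag_unit [simp]: "re imag_unit = 0" "im imag_unit = 1"
  by (simp_all add: imag_unit_def)

lemma inc_simps [simp]:
  "inc (0 :: 'a::ab_group_add) = 0" "inc (1 :: 'b::comm_ring_1) = 1"
  by (simp_all add: cplx_eq_iff)

lemma inc_add: "inc (x + y) = inc x + inc (y :: 'a::ab_group_add)"
  and inc_diff: "inc (x - y) = inc x - inc (y :: 'a::ab_group_add)"
  and inc_minus: "inc (- x) = - inc (x :: 'a::ab_group_add)"
  and inc_mult: "inc (a * b) = inc a * inc (b :: 'b::comm_ring_1)"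
  by (simp_all add: cplx_eq_iff)

lemma inc_numeral [simp]: "inc (numeral n :: 'f::comm_ring_1) = numeral n"
proof -
  have "inc (of_nat k :: 'f) = of_nat k" for k by (induction k) (simp_all add: inc_add)
  from this[of "numeral n"] show ?thesis by simp
qed

lemma inc_eq_iff [simp]: "inc x = inc y \<longleftrightarrow> x = y"
  by (simp add: cplx_eq_iff)

lemma inc_eq_0_iff [simp]: "inc x = 0 \<longleftrightarrow> x = (0 :: 'a::ab_group_add)"
  by (simp add: cplx_eq_iff)

lemma inc_inverse: "inc (inverse x) = inverse (inc (x :: 'f::linordered_field))"
  by (cases "x = 0") (simp_all add: cplx_eq_iff inverse_cplx_def field_simps)

lemma inc_divide: "inc (x / y) = inc x / inc (y :: 'f::linordered_field)"
  by (simp add: divide_inverse inc_mult inc_inverse)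

instance cplx :: (linordered_field) field_char_0
proof
  have "inc (of_nat k :: 'a) = of_nat k" for k by (induction k) (simp_all add: inc_add)
  then show "inj (of_nat :: nat \<Rightarrow> 'a cplx)"
    by (metis injI inc_eq_iff of_nat_eq_iff)
qed

lemma conj_simps [simp]:
  "conj (0 :: 'a::ab_group_add cplx) = 0" "conj (1 :: 'b::comm_ring_1 cplx) = 1"
  "conj (conj z) = (z :: 'a::ab_group_add cplx)" "conj (inc x) = inc (x :: 'a::ab_group_add)"
  "conj imag_unit = - (imag_unit :: 'b::comm_ring_1 cplx)"
  by (simp_all add: cplx_eq_iff)

lemma conj_add: "conj (x + y) = conj x + conj (y :: 'a::ab_group_add cplx)"
  and conj_diff: "conj (x - y) = conj x - conj (y :: 'a::ab_group_add cplx)"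
  and conj_minus: "conj (- x) = - conj (x :: 'a::ab_group_add cplx)"
  and conj_mult: "conj (a * b) = conj a * conj (b :: 'b::comm_ring_1 cplx)"
  by (simp_all add: cplx_eq_iff)

lemma conj_sum: "conj (sum f A) = (\<Sum>i\<in>A. conj (f i :: 'a::ab_group_add cplx))"
  by (induction A rule: infinite_finite_induct) (simp_all add: conj_add)

lemma conj_power: "conj (a ^ n) = conj (a :: 'b::comm_ring_1 cplx) ^ n"
  by (induction n) (simp_all add: conj_mult)

lemma conj_inverse: "conj (inverse z) = inverse (conj (z :: 'f::linordered_field cplx))"
  by (simp add: cplx_eq_iff inverse_cplx_def)

lemma conj_divide: "conj (z / w) = conj z / conj (w :: 'f::linordered_field cplx)"
  by (simp add: divide_inverse conj_mult conj_inverse)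

lemma conj_eq_0_iff [simp]: "conj z = 0 \<longleftrightarrow> z = (0 :: 'a::ab_group_add cplx)"
  by (metis conj_simps(1,3))

lemma imag_unit_squared [simp]: "imag_unit * imag_unit = (- 1 :: 'b::comm_ring_1 cplx)"
  by (simp add: cplx_eq_iff)

lemma imag_unit_nonzero [simp]: "imag_unit \<noteq> (0 :: 'f::linordered_field cplx)"
  by (simp add: cplx_eq_iff)

lemma cplx_decomp: "(z :: 'b::comm_ring_1 cplx) = inc (re z) + imag_unit * inc (im z)"
  by (simp add: cplx_eq_iff)

lemma conj_fixed_real: "conj z = z \<Longrightarrow> z = inc (re (z :: 'f::linordered_field cplx))"
  by (simp add: cplx_eq_iff)

lemma add_conj: "z + conj z = inc (2 * re (z :: 'f::linordered_field cplx))"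
  by (simp add: cplx_eq_iff)

lemma cubic_simps [simp]:
  "fst_part (0 :: 'f::comm_ring_1 cubic) = 0" "snd_part (0 :: 'f cubic) = 0"
  "fst_part (1 :: 'f cubic) = 1" "snd_part (1 :: 'f cubic) = 1"
  "fst_part (l + m) = fst_part l + fst_part (m :: 'f cubic)"
  "snd_part (l + m) = snd_part l + snd_part m"
  "fst_part (l - m) = fst_part l - fst_part m" "snd_part (l - m) = snd_part l - snd_part m"
  "fst_part (- l) = - fst_part l" "snd_part (- l) = - snd_part l"
  "fst_part (l * m) = fst_part l * fst_part m" "snd_part (l * m) = snd_part l * snd_part m"
  by (simp_all add: zero_cubic_def one_cubic_def plus_cubic_def minus_cubic_def uminus_cubic_def
      times_cubic_def)

lemma cubic_eq_iff: "l = m \<longleftrightarrow> fst_part l = fst_part m \<and> snd_part l = snd_part m"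
  by (cases l; cases m) auto

lemma of_F_parts [simp]: "fst_part (of_F c) = c" "snd_part (of_F c) = inc c"
  by (simp_all add: of_F_def)

lemma sharp_parts [simp]:
  "fst_part (sharp l) = re (snd_part l * conj (snd_part l))"
  "snd_part (sharp l) = inc (fst_part l) * conj (snd_part l)"
  by (simp_all add: sharp_def)

lemma fst_part_sum: "fst_part (sum f A) = (\<Sum>i\<in>A. fst_part (f i :: 'f::comm_ring_1 cubic))"
  by (induction A rule: infinite_finite_induct) simp_all

lemma re_sum: "re (sum f A) = (\<Sum>i\<in>A. re (f i :: 'a::ab_group_add cplx))"
  by (induction A rule: infinite_finite_induct) simp_all

lemma im_sum: "im (sum f A) = (\<Sum>i\<in>A. im (f i :: 'a::ab_group_add cplx))"
  by (induction A rule: infinite_finite_induct) simp_all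

section \<open>Roots in \<open>K\<close> and characters with values in the unit circle\<close>

lemma sqrt_nonneg:
  assumes "0 \<le> (a :: 'f::real_closed_field)" shows "\<exists>b\<ge>0. b * b = a"
proof -
  obtain b where "b ^ 2 = a" using ex_sqrt[OF assms] by blast
  then show ?thesis
    by (intro exI[of _ "\<bar>b\<bar>"]) (simp add: power2_eq_square)
qed

text \<open>
  The usual formula for the square root of \<open>r + s i\<close>, in which only nonnegative elements of
  \<open>F\<close> need a root.
\<close>

lemma cplx_sqrt: "\<exists>w. w * w = (z :: 'f::real_closed_field cplx)"
proof -
  define a b where "a = re z" and "b = im z"
  obtain r where r: "r \<ge> 0" "r * r = a * a + b * b"
    using sqrt_nonneg[of "a * a + b * b"] by auto
  have ra: "\<bar>a\<bar> \<le> r"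
    using r abs_le_square_iff[of a r] by (simp add: power2_eq_square)
  then have "0 \<le> (r + a) / 2" "0 \<le> (r - a) / 2" by (simp_all add: abs_le_iff)
  then obtain x y where x: "x \<ge> 0" "x * x = (r + a) / 2" and y: "y \<ge> 0" "y * y = (r - a) / 2"
    using sqrt_nonneg[of "(r + a) / 2"] sqrt_nonneg[of "(r - a) / 2"] by blast
  have "(2 * (x * y)) * (2 * (x * y)) = 4 * ((x * x) * (y * y))" by (simp add: algebra_simps)
  also have "\<dots> = r * r - a * a" unfolding x y by (simp add: field_simps)
  also have "\<dots> = b * b" using r by simp
  finally have "2 * (x * y) = \<bar>b\<bar>"
    using x(1) y(1) power2_eq_iff_nonneg[of "2 * (x * y)" "\<bar>b\<bar>"] by (simp add: power2_eq_square)
  then have "Cplx x (if b \<ge> 0 then y else - y) * Cplx x (if b \<ge> 0 then y else - y) = z"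
    using x y by (auto simp: cplx_eq_iff a_def b_def field_simps)
  then show ?thesis by blast
qed

abbreviation unitary :: "'f::comm_ring_1 cplx \<Rightarrow> bool" where
  "unitary z \<equiv> z * conj z = 1"

lemma unitary_sqrt:
  assumes "unitary (z :: 'f::real_closed_field cplx)" shows "\<exists>w. unitary w \<and> w ^ 2 = z"
proof -
  obtain w where w: "w * w = z" using cplx_sqrt by blast
  define r where "r = re (w * conj w)"
  have r: "w * conj w = inc r" "r \<ge> 0"
    by (auto simp: r_def cplx_eq_iff intro: add_nonneg_nonneg)
  have "inc (r * r) = (w * w) * conj (w * w)"
    using r(1) by (simp add: inc_mult conj_mult mult_ac flip: r(1))
  then have "r * r = 1" using assms w by (metis inc_eq_iff inc_simps(2))
  then have "r = 1" using r(2) power2_eq_iff_nonneg[of r 1] by (simp add: power2_eq_square)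
  then show ?thesis using r w by (auto simp: power2_eq_square)
qed

text \<open>
  A point \<open>z \<noteq> - 1\<close> of the circle is \<open>c / conj c\<close>, so \<open>(x + i) / (x - i)\<close> is an \<open>n\<close>-th root of it
  as soon as \<open>(x + i) ^ n * conj c\<close> is real; that is a polynomial equation of degree \<open>n\<close> in \<open>x\<close>.
\<close>

lemma unitary_odd_root:
  assumes z: "unitary (z :: 'f::real_closed_field cplx)" and n: "odd n"
  shows "\<exists>w. unitary w \<and> w ^ n = z"
proof (cases "z = - 1 \<or> z = 1")
  case True
  then show ?thesis
    using n by (auto intro: exI[of _ "- 1"] exI[of _ 1] simp: conj_minus)
next
  case False
  define c where "c = 1 + z"
  have c0: "c \<noteq> 0" using False by (simp add: c_def eq_neg_iff_add_eq_0 add.commute)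
  have zc: "z * conj c = c" using z by (simp add: c_def conj_add algebra_simps)
  have imc: "im c \<noteq> 0"
  proof
    assume "im c = 0"
    then have "conj c = c" by (simp add: cplx_eq_iff)
    then show False using zc c0 False by simp
  qed
  define f where "f k = im (of_nat (n choose k) * imag_unit ^ (n - k) * conj c)" for k
  have "f n \<noteq> 0" using imc by (simp add: f_def)
  then obtain x where x: "(\<Sum>k\<le>n. f k * x ^ k) = 0" using odd_degree_root[OF n] by blast
  have inc_power: "inc (x ^ k) = inc x ^ k" for k by (induction k) (simp_all add: inc_mult)
  define u where "u = inc x + imag_unit"
  have "u ^ n * conj c = (\<Sum>k\<le>n. inc (x ^ k) * (of_nat (n choose k) * imag_unit ^ (n - k) * conj c))"
    unfolding u_def binomial_ring
    by (simp add: sum_distrib_left sum_distrib_right mult_ac inc_power)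
  then have "im (u ^ n * conj c) = (\<Sum>k\<le>n. x ^ k * f k)"
    by (simp add: im_sum f_def del: re_im_ring_simps(3))
  then have im0: "im (u ^ n * conj c) = 0" using x by (simp add: mult.commute)
  define r where "r = re (u ^ n * conj c)"
  have r: "u ^ n * conj c = inc r" using im0 by (simp add: cplx_eq_iff r_def)
  have r': "conj u ^ n * c = inc r"
    using arg_cong[OF r, of conj] by (simp add: conj_mult conj_power)
  have u0: "u \<noteq> 0" by (simp add: u_def cplx_eq_iff)
  have "r \<noteq> 0" using r u0 c0 by auto
  define w where "w = u / conj u"
  have "unitary w" using u0 by (simp add: w_def conj_divide)
  moreover have "w ^ n = z"
  proof -
    have "conj u ^ n \<noteq> 0" using u0 by simp
    moreover have "(z * conj u ^ n) * c = u ^ n * c"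
    proof -
      have "(z * conj u ^ n) * c = z * inc r" using r' by (simp add: mult.assoc)
      also have "\<dots> = u ^ n * (z * conj c)" using r by (simp add: mult_ac)
      finally show ?thesis using zc by simp
    qed
    ultimately show ?thesis using c0 by (simp add: w_def power_divide field_simps)
  qed
  ultimately show ?thesis by blast
qed

text \<open>Even roots are iterated square roots; real closedness is used through the odd case.\<close>

lemma unitary_root:
  assumes "unitary (z :: 'f::real_closed_field cplx)" and "0 < n"
  shows "\<exists>w. unitary w \<and> w ^ n = z"
  using assms
proof (induction n arbitrary: z rule: less_induct)
  case (less n)
  show ?case
  proof (cases "odd n")
    case True
    then show ?thesis using unitary_odd_root less.prems by blast
  next
    case False
    then obtain m where m: "n = 2 * m" by blast
    obtain v where v: "unitary v" "v ^ 2 = z" using unitary_sqrt less.prems by blast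
    obtain w where "unitary w" "w ^ m = v" using less.IH[of m v] v m less.prems by auto
    then show ?thesis using v m by (auto simp: power_mult mult.commute[of 2])
  qed
qed

text \<open>
  Divisibility of the circle makes it an injective abelian group.  A partial character is
  represented by its graph, so that Zorn's lemma for inclusion applies.
\<close>

definition char_graph :: "('g::ab_group_add \<times> 'f::real_closed_field cplx) set \<Rightarrow> bool" where
  "char_graph R \<longleftrightarrow> (0, 1) \<in> R \<and> (\<forall>a u b v. (a, u) \<in> R \<longrightarrow> (b, v) \<in> R \<longrightarrow> (a - b, u * conj v) \<in> R)
     \<and> (\<forall>a u. (a, u) \<in> R \<longrightarrow> unitary u) \<and> (\<forall>u. (0, u) \<in> R \<longrightarrow> u = 1)"

primrec nmul :: "nat \<Rightarrow> 'g::ab_group_add \<Rightarrow> 'g" where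
  "nmul 0 g = 0"
| "nmul (Suc n) g = nmul n g + g"

lemma nmul_add: "nmul (m + n) g = nmul m g + nmul n g"
  by (induction n) (simp_all add: add_ac)

context
  fixes R :: "('g::ab_group_add \<times> 'f::real_closed_field cplx) set"
  assumes R: "char_graph R"
begin

lemma char_graph_diff: "(a, u) \<in> R \<Longrightarrow> (b, v) \<in> R \<Longrightarrow> (a - b, u * conj v) \<in> R"
  using R unfolding char_graph_def by blast

lemma char_graph_zero: "(0, 1) \<in> R"
  using R unfolding char_graph_def by blast

lemma char_graph_minus: "(b, v) \<in> R \<Longrightarrow> (- b, conj v) \<in> R"
  using char_graph_diff[OF char_graph_zero] by fastforce

lemma char_graph_add: "(a, u) \<in> R \<Longrightarrow> (b, v) \<in> R \<Longrightarrow> (a + b, u * v) \<in> R"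
  using char_graph_diff[OF _ char_graph_minus] by fastforce

lemma char_graph_unitary: "(a, u) \<in> R \<Longrightarrow> unitary u"
  using R unfolding char_graph_def by blast

lemma char_graph_unique: assumes "(a, u) \<in> R" "(a, v) \<in> R" shows "u = v"
proof -
  have "u * conj v = 1"
    using char_graph_diff[OF assms] R unfolding char_graph_def by simp
  moreover have "unitary v" using char_graph_unitary assms by blast
  ultimately show ?thesis by (metis mult.commute mult.left_commute mult.right_neutral)
qed

lemma char_graph_nmul: "(a, u) \<in> R \<Longrightarrow> (nmul n a, u ^ n) \<in> R"
proof (induction n)
  case (Suc n)
  then show ?case using char_graph_add[of "nmul n a" "u ^ n" a u] by (simp add: mult.commute)
qed (use char_graph_zero in simp)

text \<open>The possible values at a new element \<open>g\<close> are the \<open>n\<close>-th roots of the value at \<open>n g\<close>, where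
  \<open>n\<close> is the order of \<open>g\<close> modulo the domain.\<close>

lemma char_graph_value:
  fixes g :: 'g
  obtains w where "unitary w" and "\<And>n z. (nmul n g, z) \<in> R \<Longrightarrow> z = w ^ n"
proof (cases "\<exists>n>0. \<exists>z. (nmul n g, z) \<in> R")
  case False
  have zero: "\<And>n z. (nmul n g, z) \<in> R \<Longrightarrow> n = 0" using False by (metis gr0I)
  show ?thesis
  proof (rule that[of 1])
    fix n z assume "(nmul n g, z) \<in> R"
    then have "n = 0" by (rule zero)
    with \<open>(nmul n g, z) \<in> R\<close> have "(0, z) \<in> R" by simp
    then show "z = 1 ^ n" using char_graph_unique[OF _ char_graph_zero, of z] by simp
  qed simp
next
  case True
  define n where "n = (LEAST n. n > 0 \<and> (\<exists>z. (nmul n g, z) \<in> R))"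
  have n: "n > 0" "\<exists>z. (nmul n g, z) \<in> R"
    using LeastI_ex[OF True] unfolding n_def by blast+
  have min: "m < n \<Longrightarrow> m > 0 \<Longrightarrow> (nmul m g, z) \<notin> R" for m z
    using not_less_Least[of m "\<lambda>n. n > 0 \<and> (\<exists>z. (nmul n g, z) \<in> R)"] unfolding n_def by blast
  obtain z0 where z0: "(nmul n g, z0) \<in> R" using n by blast
  obtain w where w: "unitary w" "w ^ n = z0"
    using unitary_root[OF char_graph_unitary[OF z0] n(1)] by blast
  have nmul_mult: "nmul (a * b) g = nmul a (nmul b g)" for a b
  proof (induction a)
    case (Suc a)
    have "nmul (Suc a * b) g = nmul (a * b + b) g" by (simp only: mult_Suc add.commute)
    then show ?case by (simp only: nmul_add Suc nmul.simps)
  qed simp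
  have "z = w ^ m" if m: "(nmul m g, z) \<in> R" for m z
  proof -
    define q r where "q = m div n" and "r = m mod n"
    have mqr: "m = q * n + r" by (simp add: q_def r_def)
    have q: "(nmul (q * n) g, z0 ^ q) \<in> R"
      unfolding nmul_mult by (rule char_graph_nmul[OF z0])
    have "(nmul r g, z * conj (z0 ^ q)) \<in> R"
      using char_graph_diff[OF m q] by (subst (asm) mqr) (simp only: nmul_add add_diff_cancel_left')
    moreover have "r < n" using n(1) by (simp add: r_def)
    ultimately have "r = 0" using min[of r] by blast
    then have "(nmul m g, z0 ^ q) \<in> R" using q by (subst mqr) simp
    then have "z = z0 ^ q" using char_graph_unique[OF m] by blast
    also have "\<dots> = w ^ (n * q)" using w by (simp only: power_mult)
    also have "n * q = m" using mqr \<open>r = 0\<close> by (simp only: mult.commute add_0_right)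
    finally show ?thesis .
  qed
  then show ?thesis by (rule that[OF w(1)])
qed

text \<open>
  On the subgroup generated by the domain and \<open>g\<close>, the value \<open>w\<close> at \<open>g\<close>
  determines the extension. Its elements are written with differences of multiples of \<open>g\<close> with
  coefficients in \<open>nat\<close>.
\<close>

lemma char_graph_extend: "\<exists>R'. char_graph R' \<and> R \<subseteq> R' \<and> (\<exists>w. (g, w) \<in> R')"
proof -
  obtain w where w: "unitary w" and val: "\<And>n z. (nmul n g, z) \<in> R \<Longrightarrow> z = w ^ n"
    using char_graph_value[of g] by metis
  have w': "w ^ n * conj w ^ n = 1" for n
    using w by (simp flip: power_mult_distrib)
  define R' where "R' = {(a + nmul m g - nmul k g, u * w ^ m * conj w ^ k) | a u m k. (a, u) \<in> R}"
  have unit1: "u = 1" if "(a, v) \<in> R" "a + nmul m g - nmul k g = 0" "u = v * w ^ m * conj w ^ k"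
    for a u v m k
  proof (cases "m \<ge> k")
    case True
    then obtain j where j: "m = k + j" by (auto simp: le_iff_add)
    have "a + nmul j g = 0" using that(2) by (simp add: j nmul_add algebra_simps)
    then have "- a = nmul j g" by (simp add: neg_eq_iff_add_eq_0)
    then have "conj v = w ^ j" using val char_graph_minus[OF that(1)] by metis
    then have "v * w ^ j = 1" using char_graph_unitary[OF that(1)] by metis
    moreover have "u = (v * w ^ j) * (w ^ k * conj w ^ k)"
      using that(3) by (simp add: j power_add mult_ac)
    ultimately show ?thesis using w'[of k] by simp
  next
    case False
    then obtain j where j: "k = m + j" by (metis le_iff_add nat_le_linear)
    have "a = nmul j g" using that(2) by (simp add: j nmul_add algebra_simps)
    then have "v = w ^ j" using val that(1) by metis
    then have "v * conj w ^ j = 1" using w' by simp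
    moreover have "u = (v * conj w ^ j) * (w ^ m * conj w ^ m)"
      using that(3) by (simp add: j power_add mult_ac)
    ultimately show ?thesis using w'[of m] by simp
  qed
  have "char_graph R'"
    unfolding char_graph_def
  proof (intro conjI allI impI)
    show "(0, 1) \<in> R'"
    proof -
      have "(0, 1) = (0 + nmul 0 g - nmul 0 g, 1 * w ^ 0 * conj w ^ 0)" by simp
      then show ?thesis unfolding R'_def using char_graph_zero by blast
    qed
  next
    fix a u b v assume "(a, u) \<in> R'" "(b, v) \<in> R'"
    then obtain a' u' m k b' v' m' k' where
      1: "(a', u') \<in> R" "a = a' + nmul m g - nmul k g" "u = u' * w ^ m * conj w ^ k" and
      2: "(b', v') \<in> R" "b = b' + nmul m' g - nmul k' g" "v = v' * w ^ m' * conj w ^ k'"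
      unfolding R'_def by blast
    have "(a' - b', u' * conj v') \<in> R" using char_graph_diff 1 2 by blast
    moreover have "a - b = a' - b' + nmul (m + k') g - nmul (k + m') g"
      by (simp add: 1 2 nmul_add algebra_simps)
    moreover have "u * conj v = u' * conj v' * w ^ (m + k') * conj w ^ (k + m')"
      by (simp add: 1 2 power_add conj_mult conj_power mult_ac)
    ultimately show "(a - b, u * conj v) \<in> R'" unfolding R'_def by blast
  next
    fix a u assume "(a, u) \<in> R'"
    then obtain a' u' m k where 1: "(a', u') \<in> R" "u = u' * w ^ m * conj w ^ k"
      unfolding R'_def by blast
    have "u * conj u = (u' * conj u') * (w ^ m * conj w ^ m) * (w ^ k * conj w ^ k)"
      by (simp add: 1 conj_mult conj_power mult_ac)
    then show "unitary u" using w' char_graph_unitary[OF 1(1)] by simp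
  next
    fix u assume "(0, u) \<in> R'"
    then obtain a v m k where "(a, v) \<in> R" "0 = a + nmul m g - nmul k g" "u = v * w ^ m * conj w ^ k"
      by (auto simp: R'_def)
    then show "u = 1" using unit1[of a v m k u] by simp
  qed
  moreover have "R \<subseteq> R'"
  proof
    fix p assume "p \<in> R"
    then have "\<exists>a u m k. p = (a + nmul m g - nmul k g, u * w ^ m * conj w ^ k) \<and> (a, u) \<in> R"
      by (intro exI[of _ "fst p"] exI[of _ "snd p"] exI[of _ 0]) simp
    then show "p \<in> R'" unfolding R'_def by simp
  qed
  moreover have "(g, w) \<in> R'"
  proof -
    have "(g, w) = (0 + nmul (Suc 0) g - nmul 0 g, 1 * w ^ Suc 0 * conj w ^ 0)" by simp
    then show ?thesis unfolding R'_def using char_graph_zero by blast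
  qed
  ultimately show ?thesis by blast
qed

end

text \<open>A maximal graph has every group element in its domain, by the previous lemma.\<close>

lemma unitary_character_extension:
  fixes R0 :: "('g::ab_group_add \<times> 'f::real_closed_field cplx) set"
  assumes R0: "char_graph R0"
  obtains \<chi> where "\<And>g. unitary (\<chi> g)" and "\<And>g k. \<chi> (g + k) = \<chi> g * \<chi> k"
    and "\<And>g u. (g, u) \<in> R0 \<Longrightarrow> \<chi> g = u"
proof -
  let ?S = "{R. char_graph R \<and> R0 \<subseteq> R}"
  have "\<exists>M\<in>?S. \<forall>Y\<in>?S. M \<subseteq> Y \<longrightarrow> Y = M"
  proof (rule subset_Zorn_nonempty)
    show "{R. char_graph R \<and> R0 \<subseteq> R} \<noteq> {}" using R0 by blast
    fix \<C> assume \<C>: "\<C> \<noteq> {}" "subset.chain {R. char_graph R \<and> R0 \<subseteq> R} \<C>"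
    have ch: "char_graph R" "R0 \<subseteq> R" if "R \<in> \<C>" for R
      using \<C> that by (auto simp: subset.chain_def)
    have tot: "R \<subseteq> R' \<or> R' \<subseteq> R" if "R \<in> \<C>" "R' \<in> \<C>" for R R'
      using \<C>(2) that unfolding subset.chain_def by blast
    have "char_graph (\<Union>\<C>)"
      unfolding char_graph_def
    proof (intro conjI allI impI)
      show "(0, 1) \<in> \<Union>\<C>" using \<C>(1) ch char_graph_zero by blast
      fix a u b v assume "(a, u) \<in> \<Union>\<C>" "(b, v) \<in> \<Union>\<C>"
      then obtain R where "R \<in> \<C>" "(a, u) \<in> R" "(b, v) \<in> R" using tot by blast
      then show "(a - b, u * conj v) \<in> \<Union>\<C>" using ch char_graph_diff by blast
    next
      fix a u assume "(a, u) \<in> \<Union>\<C>"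
      then show "unitary u" using ch char_graph_unitary by blast
    next
      fix u assume "(0, u) \<in> \<Union>\<C>"
      then obtain R where "R \<in> \<C>" "(0, u) \<in> R" by blast
      then show "u = 1" using ch char_graph_unique char_graph_zero by blast
    qed
    moreover have "R0 \<subseteq> \<Union>\<C>" using \<C>(1) ch by blast
    ultimately show "\<Union>\<C> \<in> {R. char_graph R \<and> R0 \<subseteq> R}" by blast
  qed
  then obtain M where M: "char_graph M" "R0 \<subseteq> M"
    and max: "\<And>R. char_graph R \<Longrightarrow> M \<subseteq> R \<Longrightarrow> R = M"
    by (smt (verit) dual_order.trans mem_Collect_eq)
  have "\<exists>u. (g, u) \<in> M" for g
    using char_graph_extend[OF M(1), of g] max by blast
  then obtain \<chi> where \<chi>: "\<And>g. (g, \<chi> g) \<in> M" by metis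
  show ?thesis
  proof (rule that[of \<chi>])
    show "unitary (\<chi> g)" for g using char_graph_unitary[OF M(1) \<chi>] .
    show "\<chi> (g + k) = \<chi> g * \<chi> k" for g k
      using char_graph_unique[OF M(1) \<chi> char_graph_add[OF M(1) \<chi> \<chi>]] by blast
    show "\<chi> g = u" if "(g, u) \<in> R0" for g u
      using char_graph_unique[OF M(1) \<chi>] M(2) that by blast
  qed
qed

lemma unitary_character_order3:
  fixes h :: "'g::ab_group_add" and \<omega> :: "'f::real_closed_field cplx"
  assumes h: "h + h + h = 0" "h \<noteq> 0" and \<omega>: "unitary \<omega>" "\<omega> * \<omega> * \<omega> = 1"
  obtains \<chi> :: "'g \<Rightarrow> 'f cplx" where "\<And>g. unitary (\<chi> g)"
    and "\<And>g k. \<chi> (g + k) = \<chi> g * \<chi> k" and "\<chi> h = \<omega>"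
proof -
  have h2: "h + h = - h" using h by (simp add: eq_neg_iff_add_eq_0)
  have hh: "h + h \<noteq> 0" using h2 h by simp
  have hm: "- h \<noteq> h" using hh h2 by (metis add.left_inverse)
  have c2: "\<omega> * \<omega> = conj \<omega>" using \<omega> by (metis mult.left_commute mult.right_neutral mult.commute)
  have c2': "conj \<omega> * conj \<omega> = \<omega>" using c2 by (metis conj_mult conj_simps(3))
  let ?R = "{(0, 1), (h, \<omega>), (- h, conj \<omega>)}"
  have "(a - b, u * conj v) \<in> ?R" if "(a, u) \<in> ?R" "(b, v) \<in> ?R" for a b u v
  proof -
    have 1: "- h - h = h" using h2 by (metis add.inverse_inverse diff_conv_add_uminus minus_add)
    have 2: "h - - h = - h" using h2 by simp
    show ?thesis
      using that \<omega>(1) c2 c2' 1 2 by (elim insertE emptyE) (simp_all add: mult.commute[of "conj \<omega>" \<omega>])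
  qed
  moreover have "unitary u" if "(a, u) \<in> ?R" for a u
    using that \<omega>(1) by (elim insertE emptyE) (simp_all add: mult.commute[of "conj \<omega>" \<omega>])
  moreover have "u = 1" if "(0, u) \<in> ?R" for u
    using that h(2) by (elim insertE emptyE) simp_all
  ultimately have "char_graph ?R"
    unfolding char_graph_def by (intro conjI allI impI insertI1)
  then show ?thesis
    by (rule unitary_character_extension) (use that in blast)
qed

section \<open>The two components of a twisted composition\<close>

locale twisted_composition =
  fixes s :: "'f::real_closed_field cubic \<Rightarrow> 'v::ab_group_add \<Rightarrow> 'v"
    and \<beta> :: "'v \<Rightarrow> 'v" and Q :: "'v \<Rightarrow> 'f cubic"
  assumes tc: "twisted_composition8 s \<beta> Q"
begin

lemma s_module: "Modules.module s"
  using tc unfolding twisted_composition8_def free_of_rank_def by blast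

sublocale S: Modules.module s
  by (rule s_module)

sublocale F: vector_space "F_scale s"
  by unfold_locales
    (simp_all add: F_scale_def S.scale_right_distrib of_F_def plus_cubic_def times_cubic_def
      inc_add inc_mult one_cubic_def [symmetric] flip: S.scale_left_distrib)

text \<open>
  Multiplication by \<open>(r, 0)\<close> and by \<open>(0, c)\<close>. Both are operators on all of \<open>V\<close>:
  the components \<open>V\<^sub>1\<close> and \<open>V\<^sub>2\<close> are the images of \<open>ff 1\<close> and
  \<open>kk 1\<close>, and functions of \<open>V\<^sub>1\<close> or \<open>V\<^sub>2\<close> are extended to
  \<open>V\<close> through these projections.
\<close>

definition ff :: "'f \<Rightarrow> 'v \<Rightarrow> 'v" where "ff r v = s (Cubic r 0) v"
definition kk :: "'f cplx \<Rightarrow> 'v \<Rightarrow> 'v" where "kk c v = s (Cubic 0 c) v"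

lemma ff_kk_zero [simp]: "ff r 0 = 0" "kk c 0 = 0" "ff 0 v = 0" "kk 0 v = 0"
  using S.scale_zero_left by (simp_all add: ff_def kk_def flip: zero_cubic_def)

lemma ff_kk_add: "ff r (x + y) = ff r x + ff r y" "kk c (x + y) = kk c x + kk c y"
  and ff_kk_diff: "ff r (x - y) = ff r x - ff r y" "kk c (x - y) = kk c x - kk c y"
  and ff_kk_minus: "ff r (- x) = - ff r x" "kk c (- x) = - kk c x"
  by (simp_all add: ff_def kk_def S.scale_right_distrib S.scale_right_diff_distrib)

lemma ff_add_left: "ff (r + t) v = ff r v + ff t v"
  and kk_add_left: "kk (c + d) v = kk c v + kk d v"
  by (simp_all add: ff_def kk_def plus_cubic_def flip: S.scale_left_distrib)

lemma kk_minus_left: "kk (- c) v = - kk c v"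
  using kk_add_left[of c "- c" v] by (simp add: eq_neg_iff_add_eq_0 add.commute)

lemma ff_minus_left: "ff (- c) v = - ff c v"
  using ff_add_left[of c "- c" v] by (simp add: eq_neg_iff_add_eq_0 add.commute)

lemma kk_diff_left: "kk (c - d) v = kk c v - kk d v"
  using kk_add_left[of c "- d" v] by (simp add: kk_minus_left)

lemma ff_kk_comp [simp]:
  "ff r (ff t v) = ff (r * t) v" "kk c (kk d v) = kk (c * d) v" "ff r (kk c v) = 0" "kk c (ff r v) = 0"
  using S.scale_zero_left
  by (simp_all add: ff_def kk_def times_cubic_def flip: zero_cubic_def)

lemma ff_kk_sum: "ff r (sum g A) = (\<Sum>i\<in>A. ff r (g i))" "kk c (sum g A) = (\<Sum>i\<in>A. kk c (g i))"
  by (simp_all add: ff_def kk_def S.scale_sum_right)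

lemma kk_sum_left: "kk (sum g A) v = (\<Sum>i\<in>A. kk (g i) v)"
  by (induction A rule: infinite_finite_induct) (simp_all add: kk_add_left)

lemma s_split: "s l v = ff (fst_part l) v + kk (snd_part l) v"
  by (cases l) (simp add: ff_def kk_def plus_cubic_def flip: S.scale_left_distrib)

lemma ff_kk_split: "ff 1 v + kk 1 v = v"
  using s_split[of 1 v] by simp

lemma F_scale_split: "F_scale s r v = ff r v + kk (inc r) v"
  unfolding F_scale_def by (subst s_split) simp

lemma ff_kk_s [simp]: "ff r (s l v) = ff (r * fst_part l) v" "kk c (s l v) = kk (c * snd_part l) v"
  by (simp_all add: s_split[of l v] ff_kk_add)

lemma s_ff_kk [simp]: "s l (ff r v) = ff (fst_part l * r) v" "s l (kk c v) = kk (snd_part l * c) v"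
  by (simp_all add: s_split[of l "ff r v"] s_split[of l "kk c v"])

lemma ff_fixed_F_scale: "ff 1 x = x \<Longrightarrow> F_scale s r x = ff r x"
  using ff_kk_comp(4)[of "inc r" 1 x] by (simp add: F_scale_split)

lemma kk_cancel: assumes "c \<noteq> 0" "kk c v = kk c w" shows "kk 1 v = kk 1 w"
  using arg_cong[OF assms(2), of "kk (inverse c)"] assms(1) by simp

subsection \<open>The bilinear forms\<close>

definition b1 :: "'v \<Rightarrow> 'v \<Rightarrow> 'f" where "b1 x y = fst_part (polar Q x y)"
definition b2 :: "'v \<Rightarrow> 'v \<Rightarrow> 'f cplx" where "b2 x y = snd_part (polar Q x y)"

lemmas tc_unfolded = tc[unfolded twisted_composition8_def]

lemmas tc_parts = tc_unfolded[THEN conjunct1]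
  tc_unfolded[THEN conjunct2, THEN conjunct1]
  tc_unfolded[THEN conjunct2, THEN conjunct2, THEN conjunct1]
  tc_unfolded[THEN conjunct2, THEN conjunct2, THEN conjunct2, THEN conjunct1]
  tc_unfolded[THEN conjunct2, THEN conjunct2, THEN conjunct2, THEN conjunct2, THEN conjunct1]
  tc_unfolded[THEN conjunct2, THEN conjunct2, THEN conjunct2, THEN conjunct2, THEN conjunct2, THEN conjunct1]
  tc_unfolded[THEN conjunct2, THEN conjunct2, THEN conjunct2, THEN conjunct2, THEN conjunct2, THEN conjunct2]

lemmas polar_Q_hom = tc_parts(2)[unfolded quadratic_map_def, THEN conjunct2, THEN conjunct1, THEN spec]
  tc_parts(2)[unfolded quadratic_map_def, THEN conjunct2, THEN conjunct2, THEN spec]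

lemma polar_Q_add: "polar Q x (y + z) = polar Q x y + polar Q x z"
    "polar Q (x + y) z = polar Q x z + polar Q y z"
  and polar_Q_scale: "polar Q x (s l y) = l * polar Q x y" "polar Q (s l x) y = l * polar Q x y"
  using module_hom.add[OF polar_Q_hom(1)] module_hom.add[OF polar_Q_hom(2)]
    module_hom.scale[OF polar_Q_hom(1)] module_hom.scale[OF polar_Q_hom(2)] by blast+

lemma polar_sym: "polar q x y = polar (q :: 'a::ab_group_add \<Rightarrow> 'b::ab_group_add) y x"
  by (simp add: polar_def algebra_simps)

lemma polar_Q: "polar Q x y = Cubic (b1 x y) (b2 x y)"
  by (simp add: b1_def b2_def)

lemma b_sym: "b1 x y = b1 y x" "b2 x y = b2 y x"
  using polar_sym[of Q x y] by (simp_all add: b1_def b2_def)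

lemma b_add: "b1 x (y + z) = b1 x y + b1 x z" "b1 (x + y) z = b1 x z + b1 y z"
  "b2 x (y + z) = b2 x y + b2 x z" "b2 (x + y) z = b2 x z + b2 y z"
  by (simp_all add: b1_def b2_def polar_Q_add)

lemma b_s [simp]: "b1 x (s l y) = fst_part l * b1 x y" "b1 (s l x) y = fst_part l * b1 x y"
  "b2 x (s l y) = snd_part l * b2 x y" "b2 (s l x) y = snd_part l * b2 x y"
  by (simp_all add: b1_def b2_def polar_Q_scale)

lemma b_ff_kk [simp]: "b1 x (ff r y) = r * b1 x y" "b1 (ff r x) y = r * b1 x y"
  "b1 x (kk c y) = 0" "b1 (kk c x) y = 0"
  "b2 x (kk c y) = c * b2 x y" "b2 (kk c x) y = c * b2 x y"
  "b2 x (ff r y) = 0" "b2 (ff r x) y = 0"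
  by (simp_all add: ff_def kk_def)

lemma b_zero [simp]: "b1 x 0 = 0" "b1 0 x = 0" "b2 x 0 = 0" "b2 0 x = 0"
  using b_ff_kk(1)[of x 0 0] b_ff_kk(2)[of 0 0 x] b_ff_kk(5)[of x 0 0] b_ff_kk(6)[of 0 0 x] by simp_all

lemma b_minus: "b1 x (- y) = - b1 x y" "b1 (- x) y = - b1 x y"
  "b2 x (- y) = - b2 x y" "b2 (- x) y = - b2 x y"
  using b_add(1)[of x y "- y"] b_add(2)[of x "- x" y] b_add(3)[of x y "- y"] b_add(4)[of x "- x" y]
  by (simp_all add: eq_neg_iff_add_eq_0 add.commute)

lemma b_diff: "b1 x (y - z) = b1 x y - b1 x z" "b1 (x - y) z = b1 x z - b1 y z"
  "b2 x (y - z) = b2 x y - b2 x z" "b2 (x - y) z = b2 x z - b2 y z"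
  by (simp_all only: diff_conv_add_uminus b_add b_minus)

lemma b_sum: "b1 x (sum g A) = (\<Sum>i\<in>A. b1 x (g i))" "b1 (sum g A) x = (\<Sum>i\<in>A. b1 (g i) x)"
  "b2 x (sum g A) = (\<Sum>i\<in>A. b2 x (g i))" "b2 (sum g A) x = (\<Sum>i\<in>A. b2 (g i) x)"
  by (induction A rule: infinite_finite_induct; simp add: b_add)+

lemma polar_Q_nondegenerate: assumes "\<And>y. polar Q x y = 0" shows "x = 0"
proof -
  have "\<exists>!x. \<forall>y. 0 = polar Q x y"
  proof -
    have "Modules.module_hom s (*) (\<lambda>_. 0)"
    proof -
      have "polar Q 0 = (\<lambda>_. 0)" using polar_Q_scale(2)[of 0 0] by (simp add: fun_eq_iff)
      then show ?thesis using polar_Q_hom(1)[of 0] by simp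
    qed
    then show ?thesis
      using tc_parts(3) unfolding nonsingular_def by (elim allE impE)
  qed
  moreover have "\<forall>y. 0 = polar Q 0 y" using polar_Q_scale(2)[of 0 0] by simp
  ultimately show ?thesis using assms by metis
qed

lemma b1_nondegenerate: assumes "\<And>y. b1 x y = 0" shows "ff 1 x = 0"
  by (rule polar_Q_nondegenerate) (simp add: polar_Q assms zero_cubic_def)

lemma b2_nondegenerate: assumes "\<And>y. b2 x y = 0" shows "kk 1 x = 0"
  by (rule polar_Q_nondegenerate) (simp add: polar_Q assms zero_cubic_def)

lemma b1_eqI: assumes "\<And>y. b1 x y = b1 z y" shows "ff 1 x = ff 1 z"
  using b1_nondegenerate[of "x - z"] assms by (simp add: b_diff ff_kk_diff)

lemma b2_eqI: assumes "\<And>y. b2 y x = b2 y z" shows "kk 1 x = kk 1 z"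
proof -
  have "b2 (x - z) y = 0" for y
    using assms[of y] by (simp only: b_diff b_sym(2)[of x y] b_sym(2)[of z y] diff_self)
  then show ?thesis using b2_nondegenerate[of "x - z"] by (simp add: ff_kk_diff)
qed

lemma Q_scale: "Q (s l x) = l ^ 2 * Q x"
  by (rule tc_parts(2)[unfolded quadratic_map_def, THEN conjunct1, THEN spec, THEN spec])

lemma polar_Q_self: "polar Q x x = 2 * Q x"
proof -
  have "s (1 + 1) x = x + x" by (simp only: S.scale_left_distrib S.scale_one)
  then have "Q (x + x) = 4 * Q x" using Q_scale[of "1 + 1" x] by simp
  then show ?thesis by (simp add: polar_def)
qed

lemma cubic_two: "fst_part (2 :: 'f cubic) = 2" "snd_part (2 :: 'f cubic) = 2"
  by (simp_all only: one_add_one [symmetric] cubic_simps)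

lemma b1_self: "b1 x x = 2 * fst_part (Q x)" and b2_self: "b2 x x = 2 * snd_part (Q x)"
  by (simp_all only: b1_def b2_def polar_Q_self cubic_simps cubic_two)

subsection \<open>The operators \<open>J x\<close>\<close>

text \<open>
  Since \<open>\<beta>\<close> vanishes on the real component and maps the complex one into it, \<open>\<beta>\<close> consists of the
  products \<open>J x w\<close> of a real with a complex vector and of the values \<open>hh v w\<close> on complex vectors;
  \<open>b\<^sub>Q(v, \<beta> v) \<in> F\<close> says that these determine each other.
\<close>

definition J :: "'v \<Rightarrow> 'v \<Rightarrow> 'v" where "J x w = polar \<beta> (ff 1 x) (kk 1 w)"
definition hh :: "'v \<Rightarrow> 'v \<Rightarrow> 'v" where "hh v w = polar \<beta> (kk 1 v) (kk 1 w)"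

lemmas polar_beta_hom =
  tc_parts(4)[unfolded quadratic_map_def, THEN conjunct2, THEN conjunct1, THEN spec]
  tc_parts(4)[unfolded quadratic_map_def, THEN conjunct2, THEN conjunct2, THEN spec]

lemma polar_beta_add: "polar \<beta> x (y + z) = polar \<beta> x y + polar \<beta> x z"
    "polar \<beta> (x + y) z = polar \<beta> x z + polar \<beta> y z"
  and polar_beta_scale: "polar \<beta> x (F_scale s r y) = F_scale s r (polar \<beta> x y)"
    "polar \<beta> (F_scale s r x) y = F_scale s r (polar \<beta> x y)"
  using module_hom.add[OF polar_beta_hom(1)] module_hom.add[OF polar_beta_hom(2)]
    module_hom.scale[OF polar_beta_hom(1)] module_hom.scale[OF polar_beta_hom(2)] by blast+

lemmas beta_s = tc_parts(5)[rule_format]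
lemmas Q_beta = tc_parts(6)[rule_format]
lemmas polar_Q_beta = tc_parts(7)[rule_format]

lemma beta_ff [simp]: "\<beta> (ff r v) = 0"
  unfolding ff_def beta_s by (simp add: sharp_def flip: zero_cubic_def)

lemma beta_kk: "\<beta> (kk c v) = ff (re (c * conj c)) (\<beta> v)"
  by (simp add: kk_def ff_def beta_s sharp_def)

lemma J_self: "J v v = kk 1 (\<beta> v)"
proof -
  have "J v v = \<beta> v - ff 1 (\<beta> v)"
    using beta_kk[of 1 v] by (simp add: J_def polar_def ff_kk_split)
  also have "\<dots> = kk 1 (\<beta> v)"
    by (subst (1) ff_kk_split[of "\<beta> v", symmetric]) simp
  finally show ?thesis .
qed

lemma J_ff_kk [simp]: "J (ff 1 x) w = J x w" "J x (kk 1 w) = J x w"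
  by (simp_all add: J_def)

lemma J_eq_beta: "J x w = kk 1 (\<beta> (ff 1 x + kk 1 w))"
proof -
  let ?v = "ff 1 x + kk 1 w"
  have "J x w = J ?v ?v" by (simp add: J_def ff_kk_add)
  then show ?thesis by (simp add: J_self)
qed

lemma kk_J [simp]: "kk 1 (J x w) = J x w" "ff r (J x w) = 0"
  by (simp_all add: J_eq_beta)

lemma J_kk [simp]: "J x (kk c w) = kk (conj c) (J x w)"
proof -
  have "J x (kk c w) = kk 1 (\<beta> (s (Cubic 1 c) (ff 1 x + kk 1 w)))"
    by (simp add: J_eq_beta S.scale_right_distrib)
  then show ?thesis unfolding beta_s by (simp add: J_eq_beta)
qed

lemma J_add: "J (x + y) w = J x w + J y w" "J x (v + w) = J x v + J x w"
  by (simp_all add: J_def ff_kk_add polar_beta_add)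

lemma J_ff [simp]: "J (ff r x) w = kk (inc r) (J x w)"
proof -
  have "J (ff r x) w = polar \<beta> (F_scale s r (ff 1 x)) (kk 1 w)"
    by (simp add: J_def F_scale_split)
  also have "\<dots> = F_scale s r (J x w)"
    by (simp add: polar_beta_scale J_def)
  finally show ?thesis by (simp add: F_scale_split)
qed

lemma J_zero [simp]: "J 0 w = 0" "J x 0 = 0" "J (kk c x) w = 0" "J x (ff r w) = 0"
  using J_ff[of 0 x w] J_kk[of x 0 w] J_kk[of x 0 0] J_ff[of 0 0 w]
  by (simp_all add: J_def polar_def beta_ff[of 0 0, simplified])

lemma J_minus: "J (- x) w = - J x w" "J x (- w) = - J x w"
  using J_add(1)[of x "- x" w] J_add(2)[of x w "- w"] by (simp_all add: eq_neg_iff_add_eq_0 add.commute)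

lemma J_diff: "J (x - y) w = J x w - J y w" "J x (v - w) = J x v - J x w"
  by (simp_all only: diff_conv_add_uminus J_add J_minus)

lemma J_sum: "J (sum g A) w = (\<Sum>i\<in>A. J (g i) w)" "J x (sum g A) = (\<Sum>i\<in>A. J x (g i))"
  by (induction A rule: infinite_finite_induct; simp add: J_add)+

lemma J_s [simp]: "J (s l x) w = kk (inc (fst_part l)) (J x w)" "J x (s l w) = kk (conj (snd_part l)) (J x w)"
  by (simp_all add: s_split[of l x] s_split[of l w] J_add)

lemma hh_add: "hh (u + v) w = hh u w + hh v w" "hh v (u + w) = hh v u + hh v w"
  by (simp_all add: hh_def ff_kk_add polar_beta_add)

lemma polar_beta: "polar \<beta> v w = J v w + J w v + hh v w"
proof -
  have "polar \<beta> (ff 1 v) (ff 1 w) = 0" by (simp add: polar_def flip: ff_kk_add)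
  moreover have "polar \<beta> v w = polar \<beta> (ff 1 v + kk 1 v) (ff 1 w + kk 1 w)" by (simp add: ff_kk_split)
  ultimately show ?thesis
    by (simp add: polar_beta_add J_def hh_def polar_sym[of \<beta> "kk 1 v" "ff 1 w"])
qed

lemma hh_eq_beta: "hh v w = ff 1 (polar \<beta> (kk 1 v) (kk 1 w))"
  by (simp add: hh_def polar_def ff_kk_diff beta_kk flip: ff_kk_add)

lemma ff_hh [simp]: "ff 1 (hh v w) = hh v w" "kk c (hh v w) = 0"
  by (simp_all add: hh_eq_beta)

text \<open>
  The value \<open>b\<^sub>Q(v, \<beta> v)\<close> for \<open>v = x + w\<close>, whose two components agree as it lies
  in \<open>F\<close>. All relations between \<open>J\<close> and \<open>hh\<close> are polarizations of this one.
\<close>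

lemma b2_J_self: "b2 w (J x w) = inc (b1 x (\<beta> (kk 1 w)))"
proof -
  let ?v = "ff 1 x + kk 1 w"
  obtain r where r: "polar Q ?v (\<beta> ?v) = of_F r" using polar_Q_beta by blast
  have "b1 ?v (\<beta> ?v) = r" "b2 ?v (\<beta> ?v) = inc r"
    using r by (simp_all add: b1_def b2_def)
  moreover have "b1 ?v (\<beta> ?v) = b1 x (ff 1 (\<beta> ?v))" by (simp add: b_add)
  moreover have "ff 1 (\<beta> ?v) = \<beta> (kk 1 w)"
    using beta_kk[of 1 ?v] by (simp add: ff_kk_add)
  moreover have "b2 ?v (\<beta> ?v) = b2 w (J x w)" by (simp add: b_add J_eq_beta)
  ultimately show ?thesis by metis
qed

lemma b1_hh: "inc (b1 x (hh v w)) = b2 v (J x w) + b2 w (J x v)"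
proof -
  have "inc (b1 x (\<beta> (kk 1 (v + w)))) = b2 (v + w) (J x (v + w))" by (simp only: b2_J_self)
  then show ?thesis
    by (simp add: hh_def polar_def b_diff b_add J_add ff_kk_add inc_diff b2_J_self)
qed

lemma b2_J_hermitian: "b2 w (J x v) = conj (b2 v (J x w))"
proof -
  have "re (b2 v (J x w)) = re (b2 w (J x v))"
    using arg_cong[OF b1_hh[of x v "kk imag_unit w"], of im] by simp
  moreover have "im (b2 w (J x v)) = - im (b2 v (J x w))"
    using arg_cong[OF b1_hh[of x v w], of im] by (simp add: eq_neg_iff_add_eq_0 add.commute)
  ultimately show ?thesis by (simp add: cplx_eq_iff)
qed

lemma b1_hh_re: "b1 x (hh v w) = 2 * re (b2 v (J x w))"
  using arg_cong[OF b1_hh[of x v w], of re] b2_J_hermitian[of w x v] by simp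

text \<open>
  This is the second component of \<open>Q(\<beta> v) = Q(v)\<^sup>\<sharp>\<close> for \<open>v = x + w\<close>: each
  \<open>J x\<close> is a conjugate-linear similitude.
\<close>

lemma q2_J: "snd_part (Q (J x w)) = inc (fst_part (Q x)) * conj (snd_part (Q w))"
proof -
  have q: "snd_part (Q (kk 1 u)) = snd_part (Q u)" "fst_part (Q (ff 1 u)) = fst_part (Q u)" for u
    by (simp_all add: kk_def ff_def Q_scale power2_eq_square)
  let ?v = "ff 1 x + kk 1 w"
  have "snd_part (Q ?v) = snd_part (Q (kk 1 ?v))" "fst_part (Q ?v) = fst_part (Q (ff 1 ?v))"
    by (simp_all only: q)
  then show ?thesis
    using arg_cong[OF Q_beta[of ?v], of snd_part] by (simp add: J_eq_beta q ff_kk_add)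
qed

lemma b2_J_J: "b2 (J x v) (J x w) = inc (fst_part (Q x)) * conj (b2 v w)"
  by (simp add: b2_def polar_def q2_J conj_diff conj_add algebra_simps flip: J_add)

lemma J_J_self: "J x (J x w) = kk (inc (fst_part (Q x))) w"
proof -
  have "kk 1 (J x (J x w)) = kk 1 (kk (inc (fst_part (Q x))) w)"
    by (rule b2_eqI) (simp add: b2_J_hermitian[of _ x "J x w"] b2_J_J conj_mult b_sym)
  then show ?thesis by simp
qed

text \<open>
  Since \<open>J x\<close> is a similitude and Hermitian, it squares to its multiplier; polarization gives the
  relations of the Clifford algebra of \<open>V\<^sub>1\<close>.
\<close>

lemma J_clifford: "J x (J y w) + J y (J x w) = kk (inc (b1 x y)) w"
proof -
  have "J (x + y) (J (x + y) w) = kk (inc (fst_part (Q (x + y)))) w" by (rule J_J_self)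
  then have "J x (J y w) + J y (J x w)
      = kk (inc (fst_part (Q (x + y)))) w - kk (inc (fst_part (Q x))) w - kk (inc (fst_part (Q y))) w"
    by (simp add: J_add J_J_self algebra_simps)
  then show ?thesis by (simp add: b1_def polar_def inc_diff kk_diff_left)
qed

lemma b2_J_J_polar: "b2 (J x v) (J y w) + b2 (J y v) (J x w) = inc (b1 x y) * conj (b2 v w)"
proof -
  have "b2 (J x v) (J y w) = conj (b2 w (J y (J x v)))" for x y
    by (rule b2_J_hermitian)
  then have "b2 (J x v) (J y w) + b2 (J y v) (J x w) = conj (b2 w (J y (J x v) + J x (J y v)))"
    by (simp add: b_add conj_add)
  then show ?thesis by (simp add: J_clifford conj_mult b_sym)
qed

subsection \<open>Linear maps\<close>

abbreviation lin :: "('v \<Rightarrow> 'v) \<Rightarrow> bool" where "lin f \<equiv> Modules.module_hom s s f"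

lemma linI: "(\<And>x y. f (x + y) = f x + f y) \<Longrightarrow> (\<And>l x. f (s l x) = s l (f x)) \<Longrightarrow> lin f"
  by unfold_locales simp_all

lemma linI': assumes "\<And>x y. f (x + y) = f x + f y" "\<And>r x. f (ff r x) = ff r (f x)"
  "\<And>c x. f (kk c x) = kk c (f x)" shows "lin f"
proof (rule linI)
  show "f (s l x) = s l (f x)" for l x by (simp add: s_split[of l x] s_split[of l "f x"] assms)
qed (rule assms)

lemma lin_simps: assumes "lin f"
  shows "f (x + y) = f x + f y" "f (s l x) = s l (f x)" "f (ff r x) = ff r (f x)"
    "f (kk c x) = kk c (f x)" "f 0 = 0" "f (- x) = - f x" "f (x - y) = f x - f y"
    "f (sum g A) = (\<Sum>i\<in>A. f (g i))"
proof -
  interpret module_hom s s f by (rule assms)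
  show "f (x + y) = f x + f y" "f (s l x) = s l (f x)" "f (ff r x) = ff r (f x)"
    "f (kk c x) = kk c (f x)" "f 0 = 0" "f (- x) = - f x" "f (x - y) = f x - f y"
    "f (sum g A) = (\<Sum>i\<in>A. f (g i))"
    by (simp_all add: ff_def kk_def add scale zero neg diff sum)
qed

lemma lin_s: "lin (s l)" by (rule linI) (simp_all add: S.scale_right_distrib mult.commute)
lemma lin_kk: "lin (kk c)" by (rule linI) (simp_all add: ff_kk_add mult.commute)
lemma lin_ff: "lin (ff c)" by (rule linI) (simp_all add: ff_kk_add mult.commute)
lemma lin_comp: "lin f \<Longrightarrow> lin g \<Longrightarrow> lin (f \<circ> g)"
  by (rule linI) (simp_all add: lin_simps)
lemma lin_add: "lin f \<Longrightarrow> lin g \<Longrightarrow> lin (f + g)"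
  by (rule linI) (simp_all add: lin_simps S.scale_right_distrib algebra_simps)
lemma lin_zero: "lin 0" by (rule linI) simp_all
lemma lin_id: "lin id" by (rule linI) simp_all
lemma lin_minus: "lin f \<Longrightarrow> lin (- f)"
  by (rule linI) (simp_all add: lin_simps)
lemma lin_sum: "(\<And>i. i \<in> A \<Longrightarrow> lin (g i)) \<Longrightarrow> lin (sum g A)"
  by (induction A rule: infinite_finite_induct) (simp_all add: lin_zero lin_add)
lemma fun_sum_apply: "(sum g A) x = (\<Sum>i\<in>A. g i x)"
  by (induction A rule: infinite_finite_induct) simp_all

text \<open>
  The operators of rank one that span \<open>E\<close>; \<open>rk x y\<close> is mapped to \<open>x \<cdot> y\<close>
  by the canonical map.
\<close>

definition rk :: "'v \<Rightarrow> 'v \<Rightarrow> 'v \<Rightarrow> 'v" where "rk x y z = s (polar Q y z) x"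

lemma rk_eq: "rk x y z = ff (b1 y z) x + kk (b2 y z) x"
  by (simp add: rk_def s_split[of _ x] b1_def b2_def)

lemma lin_rk: "lin (rk x y)"
  by (rule linI) (simp_all add: rk_def polar_Q_add polar_Q_scale S.scale_left_distrib)

section \<open>Bases of the two components\<close>

lemma L_basis: obtains B where "finite B" "card B = 8"
  "\<And>c b. (\<Sum>b\<in>B. s (c b) b) = 0 \<Longrightarrow> b \<in> B \<Longrightarrow> c b = 0" "\<And>x. \<exists>c. x = (\<Sum>b\<in>B. s (c b) b)"
proof -
  obtain B where B: "finite B" "card B = 8" "\<not> S.dependent B" "S.span B = UNIV"
    using tc_parts(1) unfolding free_of_rank_def by auto
  show ?thesis
  proof (rule that[OF B(1,2)])
    show "c b = 0" if "(\<Sum>b\<in>B. s (c b) b) = 0" "b \<in> B" for c b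
      using S.independentD[OF B(3,1) order_refl that(1,2)] .
    show "\<exists>c. x = (\<Sum>b\<in>B. s (c b) b)" for x
    proof -
      have "x \<in> S.span B" using B(4) by simp
      then show ?thesis unfolding S.span_finite[OF B(1)] by blast
    qed
  qed
qed

lemma F_independent_family:
  assumes fin: "finite A" and ind: "\<And>c a. (\<Sum>a\<in>A. F_scale s (c a) (g a)) = 0 \<Longrightarrow> a \<in> A \<Longrightarrow> c a = (0 :: 'f)"
  shows "inj_on g A" "F.independent (g ` A)"
proof -
  show inj: "inj_on g A"
  proof (rule inj_onI, rule ccontr)
    fix a a' assume a: "a \<in> A" "a' \<in> A" "g a = g a'" "a \<noteq> a'"
    let ?c = "\<lambda>x. if x = a then 1 else if x = a' then - 1 else (0 :: 'f)"
    have "(\<Sum>x\<in>A. F_scale s (?c x) (g x)) = (\<Sum>x\<in>{a, a'}. F_scale s (?c x) (g x))"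
      by (rule sum.mono_neutral_right) (use fin a in auto)
    also have "\<dots> = 0" using a by simp
    finally show False using ind[of ?c a] a by simp
  qed
  show "F.independent (g ` A)"
  proof (rule F.independent_if_scalars_zero)
    fix f x assume f: "(\<Sum>x\<in>g ` A. F_scale s (f x) x) = 0" and x: "x \<in> g ` A"
    obtain a where a: "a \<in> A" "x = g a" using x by blast
    have "(\<Sum>a\<in>A. F_scale s (f (g a)) (g a)) = 0"
      using f by (simp add: sum.reindex[OF inj])
    from ind[OF this a(1)] show "f x = 0" using a by simp
  qed (use fin in simp)
qed

subsection \<open>An orthogonal basis of the real component\<close>

definition orth_family :: "nat \<Rightarrow> (nat \<Rightarrow> 'v) \<Rightarrow> bool" where
  "orth_family k e \<longleftrightarrow> (\<forall>i<k. ff 1 (e i) = e i \<and> b1 (e i) (e i) \<noteq> 0)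
     \<and> (\<forall>i<k. \<forall>j<k. i \<noteq> j \<longrightarrow> b1 (e i) (e j) = 0)"

definition orth_proj :: "nat \<Rightarrow> (nat \<Rightarrow> 'v) \<Rightarrow> 'v \<Rightarrow> 'v" where
  "orth_proj k e x = (\<Sum>i<k. ff (b1 x (e i) / b1 (e i) (e i)) (e i))"

lemma orth_family_independent:
  assumes "orth_family k e"
  shows "inj_on e {..<k}" "F.independent (e ` {..<k})"
proof -
  have "c i = 0" if c: "(\<Sum>j<k. F_scale s (c j) (e j)) = 0" and i: "i < k" for c i
  proof -
    have "0 = b1 (e i) (\<Sum>j<k. F_scale s (c j) (e j))" by (simp add: c)
    also have "\<dots> = (\<Sum>j<k. if j = i then c i * b1 (e i) (e i) else 0)"
      unfolding b_sum
      by (rule sum.cong) (use assms i in \<open>auto simp: orth_family_def F_scale_def\<close>)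
    finally show ?thesis using assms i by (simp add: orth_family_def)
  qed
  then show "inj_on e {..<k}" "F.independent (e ` {..<k})"
    using F_independent_family[of "{..<k}" e] by simp_all
qed

lemma b1_orth_proj:
  assumes "orth_family k e" "i < k" shows "b1 (orth_proj k e x) (e i) = b1 x (e i)"
proof -
  have "b1 (orth_proj k e x) (e i) = (\<Sum>j<k. if j = i then b1 x (e i) else 0)"
    unfolding orth_proj_def b_sum
    by (rule sum.cong) (use assms in \<open>auto simp: orth_family_def\<close>)
  then show ?thesis using assms(2) by simp
qed

text \<open>
  A nonzero space with nondegenerate form contains an anisotropic vector, as otherwise polarization would make the
  form vanish. This is applied to the orthogonal complement of the family.
\<close>

lemma orth_family_extend:
  assumes e: "orth_family k e" and x: "ff 1 x \<noteq> orth_proj k e x"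
  shows "\<exists>y. orth_family (Suc k) (e(k := y))"
proof -
  define perp where "perp y = ff 1 y - orth_proj k e y" for y
  have proj_ff: "ff 1 (orth_proj k e y) = orth_proj k e y" for y
    by (simp add: orth_proj_def ff_kk_sum)
  have ff_perp: "ff 1 (perp y) = perp y" for y by (simp add: perp_def ff_kk_diff proj_ff)
  have perp_e: "b1 (perp y) (e i) = 0" if "i < k" for y i
    using that b1_orth_proj[OF e] by (simp add: perp_def b_diff)
  have perp_proj: "b1 (perp y) (orth_proj k e z) = 0" for y z
    by (simp add: orth_proj_def b_sum perp_e)
  have "\<exists>y. b1 (perp y) (perp y) \<noteq> 0"
  proof (rule ccontr)
    assume "\<not> ?thesis"
    then have iso: "b1 (perp y) (perp y) = 0" for y by blast
    have perp_add: "perp (y + z) = perp y + perp z" for y z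
      by (simp add: perp_def orth_proj_def ff_kk_add b_add add_divide_distrib ff_add_left sum.distrib)
    have perp0: "b1 (perp y) (perp z) = 0" for y z
    proof -
      have "b1 (perp (y + z)) (perp (y + z)) = b1 (perp y) (perp z) + b1 (perp z) (perp y)"
        unfolding perp_add by (simp add: b_add iso)
      then show ?thesis by (simp add: iso b_sym(1)[of "perp z" "perp y"])
    qed
    have "b1 (perp x) z = 0" for z
    proof -
      have "b1 (perp x) z = b1 (perp x) (ff 1 z)" by simp
      also have "ff 1 z = perp z + orth_proj k e z" by (simp add: perp_def)
      finally show ?thesis by (simp add: b_add perp0 perp_proj)
    qed
    then have "ff 1 (perp x) = 0" by (rule b1_nondegenerate)
    then show False using x by (simp add: ff_perp) (simp add: perp_def)
  qed
  then obtain y where y: "b1 (perp y) (perp y) \<noteq> 0" by blast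
  have "orth_family (Suc k) (e(k := perp y))"
    unfolding orth_family_def
  proof (intro conjI allI impI)
    fix i assume "i < Suc k"
    then show "ff 1 ((e(k := perp y)) i) = (e(k := perp y)) i"
      and "b1 ((e(k := perp y)) i) ((e(k := perp y)) i) \<noteq> 0"
      using e y ff_perp by (cases "i = k"; simp add: orth_family_def)+
  next
    fix i j assume ij: "i < Suc k" "j < Suc k" "i \<noteq> j"
    consider "i = k" "j < k" | "j = k" "i < k" | "i < k" "j < k" using ij by linarith
    then show "b1 ((e(k := perp y)) i) ((e(k := perp y)) j) = 0"
    proof cases
      case 1 then show ?thesis using perp_e by simp
    next
      case 2 then show ?thesis using perp_e b_sym(1)[of "e i" "perp y"] by simp
    next
      case 3 then show ?thesis using e ij by (simp add: orth_family_def)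
    qed
  qed
  then show ?thesis by blast
qed

text \<open>
  A maximal orthogonal family: its size is bounded as its members are independent over \<open>F\<close>, and a family
  to which no vector can be added spans \<open>V\<^sub>1\<close>.
\<close>

lemma orth_basis_exists:
  "\<exists>e. orth_family 8 e \<and> (\<forall>x. ff 1 x = orth_proj 8 e x)"
proof -
  obtain B where B: "finite B" "card B = 8"
    and indep: "\<And>c b. (\<Sum>b\<in>B. s (c b) b) = 0 \<Longrightarrow> b \<in> B \<Longrightarrow> c b = 0"
    and gen: "\<And>x. \<exists>c. x = (\<Sum>b\<in>B. s (c b) b)" by (rule L_basis) blast
  have ind1: "c b = 0" if c: "(\<Sum>b\<in>B. F_scale s (c b) (ff 1 b)) = 0" and b: "b \<in> B" for c b
  proof -
    have "(\<Sum>b\<in>B. s (Cubic (c b) 0) b) = 0"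
      using c by (simp add: F_scale_split flip: ff_def)
    from indep[OF this b] show ?thesis by (simp add: zero_cubic_def)
  qed
  have T: "inj_on (ff 1) B" "F.independent (ff 1 ` B)"
    by (rule F_independent_family[of B "ff 1"]; (rule B ind1; assumption?))+
  have cardT: "card (ff 1 ` B) = 8" using card_image[OF T(1)] B by simp
  have spanT: "ff 1 x \<in> F.span (ff 1 ` B)" for x
  proof -
    obtain c where "x = (\<Sum>b\<in>B. s (c b) b)" using gen by blast
    then have "ff 1 x = (\<Sum>b\<in>B. F_scale s (fst_part (c b)) (ff 1 b))"
      by (simp add: ff_kk_sum F_scale_split)
    then show ?thesis by (auto intro!: F.span_sum F.span_scale intro: F.span_base)
  qed
  have bound: "k \<le> 8" if e: "orth_family k e" for k e
  proof -
    have "e ` {..<k} \<subseteq> F.span (ff 1 ` B)"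
    proof
      fix y assume "y \<in> e ` {..<k}"
      then have "ff 1 y = y" using e by (auto simp: orth_family_def)
      then show "y \<in> F.span (ff 1 ` B)" using spanT[of y] by simp
    qed
    then have "card (e ` {..<k}) \<le> card (ff 1 ` B)"
      using F.independent_span_bound[of "ff 1 ` B" "e ` {..<k}"] B orth_family_independent(2)[OF e]
      by simp
    then show ?thesis using cardT card_image[OF orth_family_independent(1)[OF e]] by simp
  qed
  have "\<exists>k e. orth_family k e \<and> (\<forall>x. ff 1 x = orth_proj k e x)"
  proof (rule ccontr)
    assume no: "\<not> ?thesis"
    have "\<exists>e. orth_family k e" for k
    proof (induction k)
      case (Suc k)
      then show ?case using no orth_family_extend by metis
    qed (simp add: orth_family_def)
    then show False using bound[of 9] by auto
  qed
  then obtain k e where e: "orth_family k e" "\<And>x. ff 1 x = orth_proj k e x" by blast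
  have "ff 1 ` B \<subseteq> F.span (e ` {..<k})"
  proof
    fix y assume "y \<in> ff 1 ` B"
    then obtain b where "y = ff 1 b" by blast
    then have "y = (\<Sum>i<k. F_scale s (b1 b (e i) / b1 (e i) (e i)) (e i))"
      unfolding e(2) orth_proj_def
      by simp (rule sum.cong, use e(1) in \<open>auto simp: orth_family_def intro!: ff_fixed_F_scale[symmetric]\<close>)
    then show "y \<in> F.span (e ` {..<k})" by (auto intro!: F.span_sum F.span_scale intro: F.span_base)
  qed
  then have "card (ff 1 ` B) \<le> card (e ` {..<k})"
    using F.independent_span_bound[OF _ T(2)] by simp
  then have "8 \<le> k" using cardT card_image[OF orth_family_independent(1)[OF e(1)]] by simp
  then have "k = 8" using bound[OF e(1)] by simp
  then show ?thesis using e by blast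
qed

subsection \<open>Dimension of the complex component\<close>

definition kindep :: "(nat \<Rightarrow> 'v) \<Rightarrow> bool" where
  "kindep v \<longleftrightarrow> (\<forall>j<8. kk 1 (v j) = v j) \<and>
     (\<forall>c. (\<Sum>j<8. kk (c j) (v j)) = 0 \<longrightarrow> (\<forall>j<8. c j = 0))"

text \<open>
  The complex component has dimension 16 over \<open>F\<close>, so the vectors \<open>v j\<close>, their multiples by
  \<open>i\<close> and a further vector are dependent over \<open>F\<close>.
\<close>

lemma kindep_spans:
  assumes v: "kindep v"
  shows "\<exists>c. kk 1 w = (\<Sum>j<8. kk (c j) (v j))"
proof -
  obtain B where B: "finite B" "card B = 8"
    and gen: "\<And>x. \<exists>c. x = (\<Sum>b\<in>B. s (c b) b)" by (rule L_basis) blast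
  let ?T = "kk 1 ` B \<union> kk imag_unit ` B"
  have cardT: "card ?T \<le> 16"
    using card_Un_le[of "kk 1 ` B" "kk imag_unit ` B"] card_image_le[OF B(1), of "kk 1"]
      card_image_le[OF B(1), of "kk imag_unit"] B by linarith
  have spanT: "kk 1 x \<in> F.span ?T" for x
  proof -
    obtain c where c: "x = (\<Sum>b\<in>B. s (c b) b)" using gen by blast
    have "kk 1 x = (\<Sum>b\<in>B. F_scale s (re (snd_part (c b))) (kk 1 b)
        + F_scale s (im (snd_part (c b))) (kk imag_unit b))"
      unfolding c ff_kk_sum
      by (rule sum.cong) (simp_all add: F_scale_split mult.commute flip: kk_add_left cplx_decomp)
    then show ?thesis by (auto intro!: F.span_sum F.span_add F.span_scale intro: F.span_base)
  qed
  \<comment> \<open>the family \<open>v, i v\<close>, indexed by \<open>{..<16}\<close>, extended by \<open>w\<close> at index 16\<close>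
  define g where "g j = (if j < 8 then v j else if j < 16 then kk imag_unit (v (j - 8)) else kk 1 w)"
    for j :: nat
  have sum16: "(\<Sum>j<16. F_scale s (c j) (g j)) = (\<Sum>j<8. kk (inc (c j) + imag_unit * inc (c (j + 8))) (v j))"
    for c :: "nat \<Rightarrow> 'f"
  proof -
    have "(\<Sum>j<16. F_scale s (c j) (g j)) = (\<Sum>j<8. F_scale s (c j) (g j)) + (\<Sum>j=8..<16. F_scale s (c j) (g j))"
      by (simp add: lessThan_atLeast0 sum.atLeastLessThan_concat)
    also have "(\<Sum>j=8..<16. F_scale s (c j) (g j)) = (\<Sum>j<8. F_scale s (c (j + 8)) (g (j + 8)))"
      using sum.shift_bounds_nat_ivl[of "\<lambda>j. F_scale s (c j) (g j)" 0 8 8] by (simp add: lessThan_atLeast0)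
    also have "(\<Sum>j<8. F_scale s (c j) (g j)) + \<dots> =
        (\<Sum>j<8. kk (inc (c j) + imag_unit * inc (c (j + 8))) (v j))"
      unfolding sum.distrib [symmetric]
    proof (rule sum.cong[OF refl])
      fix j :: nat assume "j \<in> {..<8}"
      then have "kk 1 (v j) = v j" "g j = v j" "g (j + 8) = kk imag_unit (v j)"
        using v by (simp_all add: kindep_def g_def)
      moreover have "ff r (v j) = 0" for r using \<open>kk 1 (v j) = v j\<close> ff_kk_comp(3)[of r 1 "v j"] by simp
      ultimately show "F_scale s (c j) (g j) + F_scale s (c (j + 8)) (g (j + 8))
          = kk (inc (c j) + imag_unit * inc (c (j + 8))) (v j)"
        by (simp add: F_scale_split kk_add_left mult.commute)
    qed
    finally show ?thesis .
  qed
  have coeff: "c j = 0" if "(\<Sum>j<16. F_scale s (c j) (g j)) = 0" "j < 16" for c j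
  proof -
    have z: "inc (c j) + imag_unit * inc (c (j + 8)) = 0" if "j < 8" for j
      using v[unfolded kindep_def, THEN conjunct2, THEN spec[of _ "\<lambda>j. inc (c j) + imag_unit * inc (c (j + 8))"]]
        that \<open>(\<Sum>j<16. F_scale s (c j) (g j)) = 0\<close> unfolding sum16 by simp
    have re0: "c j = 0" "c (j + 8) = 0" if "j < 8" for j
      using arg_cong[OF z[OF that], of re] arg_cong[OF z[OF that], of im] by simp_all
    show ?thesis
    proof (cases "j < 8")
      case False
      then show ?thesis using re0(2)[of "j - 8"] that by simp
    qed (use re0 in simp)
  qed
  have "\<exists>c. (\<Sum>j<17. F_scale s (c j) (g j)) = 0 \<and> (\<exists>j<17. c j \<noteq> 0)"
  proof (rule ccontr)
    assume "\<not> ?thesis"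
    then have 0: "c a = 0" if "(\<Sum>j<17. F_scale s (c j) (g j)) = 0" "a \<in> {..<17}" for c a
      using that by blast
    have 1: "inj_on g {..<17}" "F.independent (g ` {..<17})"
      by (rule F_independent_family[of "{..<17}" g]; (rule finite_lessThan 0; assumption?))+
    have "kk 1 (g j) = g j" if "j < 17" for j
      using that v by (auto simp: g_def kindep_def)
    then have "g ` {..<17} \<subseteq> F.span ?T" using spanT by (metis image_subsetI lessThan_iff)
    then have "card (g ` {..<17}) \<le> card ?T"
      using F.independent_span_bound[OF _ 1(2), of ?T] B by blast
    then show False using cardT card_image[OF 1(1)] by simp
  qed
  then obtain c where c: "(\<Sum>j<17. F_scale s (c j) (g j)) = 0" and nz: "\<exists>j<17. c j \<noteq> 0" by blast
  have split17: "(\<Sum>j<17. F_scale s (c j) (g j)) = (\<Sum>j<16. F_scale s (c j) (g j)) + kk (inc (c 16)) w"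
    using sum.lessThan_Suc[of "\<lambda>j. F_scale s (c j) (g j)" 16]
    by (simp add: g_def F_scale_split del: sum.lessThan_Suc)
  have c16: "c 16 \<noteq> 0"
  proof
    assume 0: "c 16 = 0"
    then have "(\<Sum>j<16. F_scale s (c j) (g j)) = 0" using c split17 by simp
    from coeff[OF this] have "c j = 0" if "j < 17" for j using that 0 by (cases "j = 16") auto
    then show False using nz by blast
  qed
  have "kk (inc (c 16)) w = - (\<Sum>j<8. kk (inc (c j) + imag_unit * inc (c (j + 8))) (v j))"
    using c unfolding split17 sum16 by (simp add: eq_neg_iff_add_eq_0 add.commute)
  then have "kk (inverse (inc (c 16))) (kk (inc (c 16)) w)
      = (\<Sum>j<8. kk (- inverse (inc (c 16)) * (inc (c j) + imag_unit * inc (c (j + 8)))) (v j))"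
    by (simp add: ff_kk_minus ff_kk_sum kk_minus_left flip: sum_negf)
  then have "kk 1 w = (\<Sum>j<8. kk (- inverse (inc (c 16)) * (inc (c j) + imag_unit * inc (c (j + 8)))) (v j))"
    using c16 by simp
  then show ?thesis
    by (rule exI[where x = "\<lambda>j. - inverse (inc (c 16)) * (inc (c j) + imag_unit * inc (c (j + 8)))"])
qed

lemma complex_component_nonzero: "\<exists>v w. b2 v w = 1"
proof -
  have "\<exists>v w. b2 v w \<noteq> 0"
  proof (rule ccontr)
    assume "\<not> ?thesis"
    then have 0: "kk 1 w = 0" for w by (intro b2_nondegenerate) blast
    obtain B where B: "finite B" "card B = 8"
      and ind: "\<And>c b. (\<Sum>b\<in>B. s (c b) b) = 0 \<Longrightarrow> b \<in> B \<Longrightarrow> c b = 0" by (rule L_basis) blast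
    then obtain b where "b \<in> B" by fastforce
    then show False using ind[of "\<lambda>_. Cubic 0 1" b] 0 by (simp add: zero_cubic_def flip: kk_def)
  qed
  then obtain v w where "b2 v w \<noteq> 0" by blast
  then have "b2 (kk (inverse (b2 v w)) v) w = 1" by simp
  then show ?thesis by blast
qed

end

section \<open>Density of the even Clifford algebra\<close>

locale twisted_composition_basis = twisted_composition s \<beta> Q
  for s :: "'f::real_closed_field cubic \<Rightarrow> 'v::ab_group_add \<Rightarrow> 'v" and \<beta> Q +
  fixes e :: "nat \<Rightarrow> 'v"
  assumes e_orth: "orth_family 8 e" and e_span: "\<And>x. ff 1 x = orth_proj 8 e x"
begin

definition n :: "nat \<Rightarrow> 'f" where "n k = b1 (e k) (e k)"

lemma ff_e [simp]: "k < 8 \<Longrightarrow> ff 1 (e k) = e k"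
  using e_orth by (simp add: orth_family_def)

lemma kk_e [simp]: "k < 8 \<Longrightarrow> kk c (e k) = 0"
  using ff_kk_comp(4)[of c 1 "e k"] by simp

lemma n_nonzero [simp]: "k < 8 \<Longrightarrow> n k \<noteq> 0"
  using e_orth by (simp add: orth_family_def n_def)

lemma b1_e: "j < 8 \<Longrightarrow> k < 8 \<Longrightarrow> b1 (e j) (e k) = (if j = k then n k else 0)"
  using e_orth by (simp add: orth_family_def n_def)

lemma e_expand: "ff 1 x = (\<Sum>k<8. ff (b1 x (e k) / n k) (e k))"
  by (simp add: e_span orth_proj_def n_def)

abbreviation JJ :: "nat \<Rightarrow> nat \<Rightarrow> 'v \<Rightarrow> 'v" where "JJ i j w \<equiv> J (e i) (J (e j) w)"

definition q :: "nat \<Rightarrow> 'f" where "q k = n k / 2"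

lemma q_nonzero [simp]: "k < 8 \<Longrightarrow> q k \<noteq> 0" by (simp add: q_def)

lemma JJ_self: "k < 8 \<Longrightarrow> J (e k) (J (e k) w) = kk (inc (q k)) w"
  using b1_self[of "e k"] by (simp add: J_J_self q_def n_def)

lemma J_anti: "i < 8 \<Longrightarrow> j < 8 \<Longrightarrow> i \<noteq> j \<Longrightarrow> J (e i) (J (e j) w) = - J (e j) (J (e i) w)"
  using J_clifford[of "e i" "e j" w] by (simp add: b1_e eq_neg_iff_add_eq_0)

lemma JJ_JJ_disjoint:
  assumes "i < 8" "j < 8" "k < 8" "l < 8" "i \<noteq> k" "i \<noteq> l" "j \<noteq> k" "j \<noteq> l"
  shows "JJ i j (JJ k l w) = JJ k l (JJ i j w)"
proof -
  have "JJ i j (JJ k l w) = J (e i) (- J (e k) (J (e j) (J (e l) w)))"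
    using assms J_anti[of j k] by simp
  also have "\<dots> = J (e i) (J (e k) (J (e l) (J (e j) w)))"
    using assms J_anti[of j l] by (simp add: J_minus)
  also have "\<dots> = - J (e k) (J (e i) (J (e l) (J (e j) w)))"
    using assms J_anti[of i k] by simp
  also have "\<dots> = JJ k l (JJ i j w)"
    using assms J_anti[of i l] by (simp add: J_minus)
  finally show ?thesis .
qed

lemma JJ_JJ_linked:
  assumes "i < 8" "j < 8" "k < 8" "i \<noteq> k" "i \<noteq> j" "j \<noteq> k"
  shows "JJ i j (JJ k i w) = - JJ k i (JJ i j w)"
proof -
  have "JJ i j (JJ k i w) = J (e i) (- J (e k) (J (e j) (J (e i) w)))"
    using assms J_anti[of j k] by simp
  also have "\<dots> = J (e i) (J (e k) (J (e i) (J (e j) w)))"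
    using assms J_anti[of j i] by (simp add: J_minus)
  also have "\<dots> = - JJ k i (JJ i j w)"
    using assms J_anti[of i k] by simp
  finally show ?thesis .
qed

lemma JJ_squared: "i < 8 \<Longrightarrow> j < 8 \<Longrightarrow> i \<noteq> j \<Longrightarrow> JJ i j (JJ i j w) = kk (- inc (q i * q j)) w"
  using J_anti[of j i "J (e j) w"]
  by (simp add: J_minus JJ_self kk_minus_left inc_mult mult.commute)

text \<open>
  Three commuting involutions \<open>A j\<close>, multiples of \<open>J (e (2 j)) J (e (2 j + 1))\<close>, and operators
  \<open>J (e 0) J (e (2 j))\<close> of which the \<open>j\<close>-th one flips the sign of \<open>A j\<close> alone.  A joint eigenvector
  is thereby moved through eight joint eigenspaces, which must be lines.  So the projections
  onto these lines and all matrix units belong to the algebra generated by the \<open>J x J y\<close>.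
\<close>

theorem even_clifford_density:
  assumes Y_add: "\<And>f g. f \<in> Y \<Longrightarrow> g \<in> Y \<Longrightarrow> f + g \<in> Y"
    and Y_comp: "\<And>f g. f \<in> Y \<Longrightarrow> g \<in> Y \<Longrightarrow> f \<circ> g \<in> Y"
    and Y_kk: "\<And>c. kk c \<in> Y" and Y_JJ: "\<And>x y. (\<lambda>w. J x (J y w)) \<in> Y"
    and f: "lin f" "\<And>v. kk 1 (f v) = f v"
  shows "f \<in> Y"
proof -
  have "\<exists>c. c * c = - inverse (inc (q (2 * j) * q (2 * j + 1)))" for j
    by (rule cplx_sqrt)
  then obtain c0 where c0: "\<And>j. c0 j * c0 j = - inverse (inc (q (2 * j) * q (2 * j + 1)))" by metis
  have c0_inv: "c0 j * c0 j * - inc (q (2 * j) * q (2 * j + 1)) = 1" if "j < 4" for j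
    using that by (simp add: c0)
  define a where "a c j w = kk c (JJ (2 * j) (2 * j + 1) w)" for c j w
  have a_invol: "a c j (a c j w) = kk 1 w" if "j < 4" "c = c0 j \<or> c = - c0 j" for c j w
  proof -
    have "a c j (a c j w) = kk (c * c * - inc (q (2 * j) * q (2 * j + 1))) w"
      using that by (simp add: a_def JJ_squared mult.assoc)
    also have "c * c = c0 j * c0 j" using that by auto
    finally show ?thesis using c0_inv that by simp
  qed
  have a_comm: "a c i (a d j w) = a d j (a c i w)" if "i < 4" "j < 4" for c d i j w
  proof (cases "i = j")
    case False
    then have "JJ (2 * i) (2 * i + 1) (JJ (2 * j) (2 * j + 1) w) = JJ (2 * j) (2 * j + 1) (JJ (2 * i) (2 * i + 1) w)"
      by (intro JJ_JJ_disjoint) (use that in presburger)+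
    then show ?thesis by (simp add: a_def mult.commute)
  qed (simp add: a_def mult.commute)
  have a_add: "a c j (v + w) = a c j v + a c j w" for c j v w by (simp add: a_def J_add ff_kk_add)
  have kk_a: "kk 1 (a c j w) = a c j w" for c j w by (simp add: a_def)
  have step: "\<exists>c u. (c = c0 j \<or> c = - c0 j) \<and> a c j u = u \<and> u \<noteq> 0 \<and> kk 1 u = u \<and>
      (\<forall>i d. i < 4 \<longrightarrow> a d i v = v \<longrightarrow> a d i u = u)" if "v \<noteq> 0" "kk 1 v = v" "j < 4" for v j
  proof (cases "v + a (c0 j) j v = 0")
    case True
    then have "a (- c0 j) j v = v"
      by (simp add: a_def kk_minus_left neg_eq_iff_add_eq_0 add.commute)
    then show ?thesis using that by blast
  next
    case False
    let ?u = "v + a (c0 j) j v"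
    have "a (c0 j) j ?u = ?u" using a_invol[of j "c0 j"] that by (simp add: a_add add.commute)
    moreover have "a d i ?u = ?u" if "i < 4" "a d i v = v" for i d
      using that a_comm[OF that(1) \<open>j < 4\<close>] by (simp add: a_add)
    moreover have "kk 1 ?u = ?u" using that by (simp add: ff_kk_add kk_a)
    ultimately show ?thesis using False by blast
  qed
  obtain u0 w0' where "b2 u0 w0' = 1" using complex_component_nonzero by blast
  then have "kk 1 w0' \<noteq> 0" by (metis b_ff_kk(5) b_zero(3) mult_1 zero_neq_one)
  then obtain w0 where w0: "kk 1 w0 \<noteq> 0" "kk 1 (kk 1 w0) = kk 1 w0" by auto
  obtain c1 v1 where v1: "c1 = c0 1 \<or> c1 = - c0 1" "a c1 1 v1 = v1" "v1 \<noteq> 0" "kk 1 v1 = v1"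
    using step[OF w0, of 1] by auto
  obtain c2 v2 where v2: "c2 = c0 2 \<or> c2 = - c0 2" "a c2 2 v2 = v2" "v2 \<noteq> 0" "kk 1 v2 = v2"
      and v2': "\<And>i d. i < 4 \<Longrightarrow> a d i v1 = v1 \<Longrightarrow> a d i v2 = v2"
    using step[OF v1(3,4), of 2] by auto
  obtain c3 v0 where v0: "c3 = c0 3 \<or> c3 = - c0 3" "a c3 3 v0 = v0" "v0 \<noteq> 0" "kk 1 v0 = v0"
      and v0': "\<And>i d. i < 4 \<Longrightarrow> a d i v2 = v2 \<Longrightarrow> a d i v0 = v0"
    using step[OF v2(3,4), of 3] by auto
  define A where "A j = a (if j = 1 then c1 else if j = 2 then c2 else c3) j" for j :: nat
  have A_v0: "A j v0 = v0" if "j \<in> {1, 2, 3}" for j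
    using that v0 v0'[of 2 c2] v0'[of 1 c1] v2'[of 1 c1] v1 v2 by (auto simp: A_def)
  have A_lin: "A j (kk c w) = kk c (A j w)" "A j (v + w) = A j v + A j w" for j c v w
    by (simp_all add: A_def a_def J_add ff_kk_add mult.commute)
  define sg :: "bool \<Rightarrow> 'f cplx" where "sg t = (if t then - 1 else 1)" for t
  have sg2: "sg t * sg t = 1" for t by (simp add: sg_def)
  define D where "D j t w = (if t then JJ 0 (2 * j) w else kk 1 w)" for j :: nat and t w
  define D' where "D' j t w = (if t then kk (- inverse (inc (q 0 * q (2 * j)))) (JJ 0 (2 * j) w) else kk 1 w)"
    for j :: nat and t w
  have D'_D: "D' j t (D j t w) = kk 1 w" if "j \<in> {1, 2, 3}" for j t w
    using that by (auto simp: D_def D'_def JJ_squared)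
  have A_D_same: "A j (D j t w) = kk (sg t) (D j t (A j w))" if "j \<in> {1, 2, 3}" for j t w
  proof (cases t)
    case True
    have "JJ (2 * j) (2 * j + 1) (JJ 0 (2 * j) w) = - JJ 0 (2 * j) (JJ (2 * j) (2 * j + 1) w)"
      by (rule JJ_JJ_linked) (use that in auto)
    then show ?thesis using True by (simp add: D_def A_def a_def sg_def ff_kk_minus kk_minus_left mult.commute)
  qed (simp add: D_def A_def a_def sg_def)
  have A_D: "A j (D i t w) = D i t (A j w)" if "i \<noteq> j" "i \<in> {1, 2, 3}" "j \<in> {1, 2, 3}" for i j t w
  proof (cases t)
    case True
    have "JJ (2 * j) (2 * j + 1) (JJ 0 (2 * i) w) = JJ 0 (2 * i) (JJ (2 * j) (2 * j + 1) w)"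
      by (rule JJ_JJ_disjoint) (use that in auto)
    then show ?thesis using True by (simp add: D_def A_def a_def mult.commute)
  qed (simp add: D_def A_def a_def)
  have kk_D: "kk 1 (D j t w) = D j t w" "D j t (kk c w) = kk c (D j t w)" for j t w c
    by (auto simp: D_def)
  define bit :: "nat \<Rightarrow> nat \<Rightarrow> bool" where "bit j k = odd (k div 2 ^ (j - 1))" for j k
  have bit_eq: "k = l" if "k < 8" "l < 8" "bit 1 k = bit 1 l" "bit 2 k = bit 2 l" "bit 3 k = bit 3 l" for k l
  proof -
    have "k \<in> {0, 1, 2, 3, 4, 5, 6, 7}" "l \<in> {0, 1, 2, 3, 4, 5, 6, 7}" using that by auto
    then show ?thesis using that(3-5) by (elim insertE emptyE) (simp_all add: bit_def)
  qed
  define T where "T k w = D 1 (bit 1 k) (D 2 (bit 2 k) (D 3 (bit 3 k) w))" for k w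
  define T' where "T' k w = D' 3 (bit 3 k) (D' 2 (bit 2 k) (D' 1 (bit 1 k) w))" for k w
  have D'_kk: "D' j t (kk c w) = kk c (D' j t w)" for j t c w by (simp add: D'_def mult_ac)
  have kk_D': "kk 1 (D' j t w) = D' j t w" for j t w by (simp add: D'_def)
  have T'_T: "T' k (T k w) = kk 1 w" for k w
    by (simp add: T_def T'_def D'_D D'_kk kk_D')
  define v where "v k = T k v0" for k
  have A_v: "A j (v k) = kk (sg (bit j k)) (v k)" if "j \<in> {1, 2, 3}" for j k
    using that by (auto simp: v_def T_def A_D_same A_D A_v0 kk_D A_lin)
  have T'_kk: "T' k (kk c w) = kk c (T' k w)" for k c w by (simp add: T'_def D'_kk)
  have T'_v: "T' k (v k) = v0" for k using T'_T[of k v0] v0(4) by (simp add: v_def)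
  have v_nz: "v k \<noteq> 0" for k
    using T'_v[of k] T'_kk[of k 0 0] v0(3) by auto
  have kk_v: "kk 1 (v k) = v k" for k by (simp add: v_def T_def kk_D)
  define h where "h j t w = kk (inverse 2) (w + kk (sg t) (A j w))" for j t w
  have h_v: "h j (bit j k) (v l) = (if bit j k = bit j l then v l else 0)" if "j \<in> {1, 2, 3}" for j k l
  proof -
    have "h j (bit j k) (v l) = kk (inverse 2) (kk 1 (v l) + kk (sg (bit j k) * sg (bit j l)) (v l))"
      using that by (simp add: h_def A_v kk_v)
    also have "\<dots> = kk (inverse 2 * (1 + sg (bit j k) * sg (bit j l))) (v l)"
      by (simp only: ff_kk_comp flip: kk_add_left)
    finally show ?thesis by (simp add: sg_def kk_v)
  qed
  have h_lin: "h j t (kk c w) = kk c (h j t w)" "h j t (x + w) = h j t x + h j t w" for j t c x w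
    by (simp_all add: h_def A_lin ff_kk_add mult_ac)
  define p where "p k w = h 1 (bit 1 k) (h 2 (bit 2 k) (h 3 (bit 3 k) w))" for k w
  have h0: "h j t 0 = 0" for j t using h_lin(1)[of j t 0 0] by simp
  have p_v: "p k (v l) = (if k = l then v l else 0)" if "k < 8" "l < 8" for k l
    using bit_eq[OF that] by (auto simp: p_def h_v h0)
  have p_lin: "p k (kk c w) = kk c (p k w)" "p k (x + w) = p k x + p k w" "p k 0 = 0" for k c x w
    by (simp_all add: p_def h_lin h0)
  have p_sum: "p k (sum g I) = (\<Sum>i\<in>I. p k (g i))" for k g and I :: "nat set"
    by (induction I rule: infinite_finite_induct) (simp_all add: p_lin)
  have p_comb: "p k (\<Sum>l<8. kk (c l) (v l)) = kk (c k) (v k)" if "k < 8" for k c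
  proof -
    have "p k (\<Sum>l<8. kk (c l) (v l)) = (\<Sum>l<8. if l = k then kk (c k) (v k) else 0)"
      unfolding p_sum by (rule sum.cong) (use that in \<open>auto simp: p_lin p_v\<close>)
    then show ?thesis using that by simp
  qed
  have "kindep v"
    unfolding kindep_def
  proof (intro conjI allI impI)
    fix c k assume "(\<Sum>l<8. kk (c l) (v l)) = 0" "(k :: nat) < 8"
    then have 0: "kk (c k) (v k) = 0" using p_comb[of k c] p_lin(3) by simp
    show "c k = 0"
    proof (rule ccontr)
      assume "c k \<noteq> 0"
      then have "kk 1 (v k) = kk 1 0" by (rule kk_cancel) (simp add: 0)
      then show False using v_nz kk_v by simp
    qed
  qed (rule kk_v)
  then have span: "\<exists>c. kk 1 w = (\<Sum>l<8. kk (c l) (v l))" for w by (rule kindep_spans)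
  have "\<exists>G. f (v k) = (\<Sum>l<8. kk (G l) (v l))" for k
    using span[of "f (v k)"] unfolding f(2) .
  then obtain F where F: "\<And>k. f (v k) = (\<Sum>l<8. kk (F k l) (v l))" by metis
  have Y_sum: "sum g I \<in> Y" if "\<And>i. i \<in> I \<Longrightarrow> g i \<in> Y" for g and I :: "nat set"
  proof -
    have "kk 0 = 0" by (rule ext) simp
    then have "0 \<in> Y" using Y_kk[of 0] by simp
    then show ?thesis using that by (induction I rule: infinite_finite_induct) (auto intro: Y_add)
  qed
  have JJ_Y: "(\<lambda>w. J x (J y (g w))) \<in> Y" if "g \<in> Y" for x y g
    using Y_comp[OF Y_JJ that] by (simp add: comp_def)
  have kk_Y: "(\<lambda>w. kk c (g w)) \<in> Y" if "g \<in> Y" for c g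
    using Y_comp[OF Y_kk that] by (simp add: comp_def)
  have add_Y: "(\<lambda>w. g w + g' w) \<in> Y" if "g \<in> Y" "g' \<in> Y" for g g'
    using Y_add[OF that] by (simp add: plus_fun_def)
  have D_Y: "(\<lambda>w. D j t (g w)) \<in> Y" "(\<lambda>w. D' j t (g w)) \<in> Y" if "g \<in> Y" for j t g
    using that by (cases t; simp add: D_def D'_def JJ_Y kk_Y)+
  have h_Y: "(\<lambda>w. h j t (g w)) \<in> Y" if "g \<in> Y" for j t g
    unfolding h_def A_def a_def using that by (intro kk_Y add_Y JJ_Y)
  have p_Y: "(\<lambda>w. p k (kk 1 w)) \<in> Y" for k
    unfolding p_def by (intro h_Y Y_kk)
  have f_eq: "f = (\<Sum>k<8. \<Sum>l<8. (\<lambda>w. kk (F k l) (T l (T' k (p k (kk 1 w))))))"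
  proof (rule ext)
    fix w
    obtain c where c: "kk 1 w = (\<Sum>k<8. kk (c k) (v k))" using span by blast
    have "f w = f (kk 1 w)" using f by (simp add: lin_simps)
    also have "\<dots> = (\<Sum>k<8. \<Sum>l<8. kk (c k * F k l) (v l))"
      unfolding c using f(1) by (simp add: lin_simps F ff_kk_sum)
    also have "\<dots> = (\<Sum>k<8. \<Sum>l<8. kk (F k l) (T l (T' k (p k (kk 1 w)))))"
    proof (intro sum.cong refl)
      fix k l :: nat assume "k \<in> {..<8}" "l \<in> {..<8}"
      then have "p k (kk 1 w) = kk (c k) (v k)" unfolding c using p_comb by simp
      then have "T' k (p k (kk 1 w)) = kk (c k) v0" by (simp add: T'_kk T'_v)
      then show "kk (c k * F k l) (v l) = kk (F k l) (T l (T' k (p k (kk 1 w))))"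
        by (simp add: T_def v_def kk_D mult.commute)
    qed
    finally show "f w = (\<Sum>k<8. \<Sum>l<8. (\<lambda>w. kk (F k l) (T l (T' k (p k (kk 1 w)))))) w"
      by (simp add: fun_sum_apply)
  qed
  have "(\<lambda>w. kk (F k l) (T l (T' k (p k (kk 1 w))))) \<in> Y" for k l
    unfolding T_def T'_def by (intro kk_Y D_Y p_Y)
  then show ?thesis by (subst f_eq) (intro Y_sum)
qed

text \<open>A commuting map commutes with operators of rank one by density, hence is scalar.\<close>

lemma even_clifford_commutant:
  assumes z: "lin z" and comm: "\<And>x y w. z (J x (J y w)) = J x (J y (z w))"
  shows "\<exists>c. \<forall>w. kk 1 (z w) = kk c w"
proof -
  obtain v0 w0 where vw: "b2 v0 w0 = 1" using complex_component_nonzero by blast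
  let ?Y = "{f. \<forall>w. z (f w) = f (z w)}"
  have "(\<lambda>w. kk (b2 v0 w) (kk 1 x)) \<in> ?Y" for x
  proof (rule even_clifford_density)
    show "lin (\<lambda>w. kk (b2 v0 w) (kk 1 x))"
      by (rule linI) (simp_all add: b_add kk_add_left)
  qed (use z comm in \<open>auto simp: lin_simps\<close>)
  then have "z (kk (b2 v0 w0) (kk 1 x)) = kk (b2 v0 (z w0)) (kk 1 x)" for x by blast
  then have "kk 1 (z x) = kk (b2 v0 (z w0)) x" for x
    using z vw by (simp add: lin_simps)
  then show ?thesis by blast
qed

section \<open>The centre of the spin group\<close>

text \<open>
  The negative of the reflection in \<open>x\<close>. With this sign it satisfies
  \<open>J (neg_reflection x v) = J x J v (J x)\<^sup>-\<^sup>1\<close>.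
\<close>

definition neg_reflection :: "'v \<Rightarrow> 'v \<Rightarrow> 'v" where
  "neg_reflection x v = ff (b1 x v / fst_part (Q x)) x - ff 1 v"

context
  fixes x assumes x: "fst_part (Q x) \<noteq> 0"
begin

lemma neg_reflection_add: "neg_reflection x (v + w) = neg_reflection x v + neg_reflection x w"
  by (simp add: neg_reflection_def b_add add_divide_distrib ff_add_left ff_kk_add)

lemma neg_reflection_scale: "neg_reflection x (ff r v) = ff r (neg_reflection x v)" "neg_reflection x (kk c v) = 0" "ff 1 (neg_reflection x v) = neg_reflection x v"
    "kk c (neg_reflection x v) = 0"
  by (simp_all add: neg_reflection_def ff_kk_diff mult.commute)

lemma b1_neg_reflection: "b1 (neg_reflection x v) w = b1 v (neg_reflection x w)"
  by (simp add: neg_reflection_def b_diff b_sym(1)[of v x] mult.commute)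

lemma neg_reflection_neg_reflection: "neg_reflection x (neg_reflection x v) = ff 1 v"
proof -
  have "b1 x (neg_reflection x v) = b1 x v"
    using x by (simp add: neg_reflection_def b_diff b1_self)
  then show ?thesis unfolding neg_reflection_def[of x "neg_reflection x v"] by (simp add: neg_reflection_scale) (simp add: neg_reflection_def)
qed

lemma J_neg_reflection: "kk (inc (fst_part (Q x))) (J (neg_reflection x v) w) = J x (J v (J x w))"
proof -
  have "J v (J x w) = kk (inc (b1 x v)) w - J x (J v w)"
    using J_clifford[of x v w] by (simp add: eq_diff_eq add.commute)
  then have "J x (J v (J x w)) = kk (inc (b1 x v)) (J x w) - kk (inc (fst_part (Q x))) (J v w)"
    by (simp add: J_diff J_J_self)
  then show ?thesis
    using x by (simp add: neg_reflection_def J_diff ff_kk_diff mult.commute flip: inc_mult)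
qed

lemma J_neg_reflection_J: "J (neg_reflection x v) (J x w) = J x (J v w)"
proof -
  have "kk (inc (fst_part (Q x))) (J (neg_reflection x v) (J x w)) = kk (inc (fst_part (Q x))) (J x (J v w))"
    by (simp add: J_neg_reflection J_J_self)
  then have "kk 1 (J (neg_reflection x v) (J x w)) = kk 1 (J x (J v w))"
    by (rule kk_cancel[rotated]) (use x in simp)
  then show ?thesis by simp
qed

lemma b2_J_J_neg_reflection: "b2 (J x v) (J c (J x w)) = inc (fst_part (Q x)) * conj (b2 v (J (neg_reflection x c) w))"
proof -
  have "b2 (J x v) (J c (J x w)) = conj (b2 v (J x (J c (J x w))))"
    using b2_J_hermitian[of "J c (J x w)" x v] by (simp add: b_sym(2)[of "J x v"])
  then show ?thesis by (simp add: conj_mult flip: J_neg_reflection)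
qed

end

text \<open>The spin group contains the products of two vectors of \<open>V\<^sub>1\<close> whose norms are inverse to each
  other: \<open>x y\<close> acts by reflections on \<open>V\<^sub>1\<close> and by \<open>J x J y\<close> on \<open>V\<^sub>2\<close>.\<close>

lemma spin_point_of_pair:
  assumes xy: "fst_part (Q x) * fst_part (Q y) = 1"
  shows "(\<lambda>v. neg_reflection x (neg_reflection y v) + J x (J y v)) \<in> spin_points s \<beta> Q" (is "?g x y \<in> _")
proof -
  have nz: "fst_part (Q x) \<noteq> 0" "fst_part (Q y) \<noteq> 0" using xy by auto
  note rs = neg_reflection_scale[OF nz(1)] neg_reflection_scale[OF nz(2)] neg_reflection_add[OF nz(1)] neg_reflection_add[OF nz(2)]
  have inv: "?g x y (?g y x v) = v" if "fst_part (Q x) \<noteq> 0" "fst_part (Q y) \<noteq> 0"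
      "fst_part (Q x) * fst_part (Q y) = 1" for x y v
  proof -
    note rs = neg_reflection_scale[OF that(1)] neg_reflection_scale[OF that(2)] neg_reflection_add[OF that(1)] neg_reflection_add[OF that(2)]
    have 1: "neg_reflection x (J u w) = 0" "neg_reflection y (J u w) = 0" "J u (neg_reflection x w) = 0" "J u (neg_reflection y w) = 0" for u w
    proof -
      show "neg_reflection x (J u w) = 0" using rs(2)[of 1 "J u w"] by simp
      show "neg_reflection y (J u w) = 0" using rs(6)[of 1 "J u w"] by simp
      show "J u (neg_reflection x w) = 0" using J_zero(4)[of u 1 "neg_reflection x w"] by (simp only: rs)
      show "J u (neg_reflection y w) = 0" using J_zero(4)[of u 1 "neg_reflection y w"] by (simp only: rs)
    qed
    have 2: "neg_reflection x 0 = 0" unfolding neg_reflection_def by simp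
    have "?g x y (?g y x v) = neg_reflection x (ff 1 (neg_reflection x v)) + kk (inc (fst_part (Q x) * fst_part (Q y))) v"
      by (simp add: rs J_add 1 2 neg_reflection_neg_reflection[OF that(2)] J_J_self mult.commute inc_mult)
    then show ?thesis using that(3) by (simp add: rs neg_reflection_neg_reflection[OF that(1)] ff_kk_split)
  qed
  have lin: "lin (?g x y)"
    by (rule linI') (simp_all add: rs J_add ff_kk_add neg_reflection_def[of x 0])
  have "bij (?g x y)"
  proof (rule o_bij[of "?g y x"])
    have yx: "fst_part (Q y) * fst_part (Q x) = 1" using xy by (simp only: mult.commute)
    show "?g y x \<circ> ?g x y = id" by (rule ext) (simp only: comp_def id_apply inv[OF nz(2,1) yx])
    show "?g x y \<circ> ?g y x = id" by (rule ext) (simp only: comp_def id_apply inv[OF nz xy])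
  qed
  moreover have "?g x y (\<beta> v) = \<beta> (?g x y v)" for v
  proof -
    have "kk 1 (?g x y (\<beta> v)) = J x (J y (J v v))"
      using J_self[of v] by (simp add: ff_kk_add rs)
    also have "\<dots> = J (neg_reflection x (neg_reflection y v)) (J x (J y v))"
      by (simp add: J_neg_reflection_J[OF nz(1)] J_neg_reflection_J[OF nz(2)])
    also have "\<dots> = J (?g x y v) (?g x y v)"
    proof -
      have "J (?g x y v) (?g x y v) = J (ff 1 (?g x y v)) (kk 1 (?g x y v))" by simp
      then show ?thesis by (simp only: ff_kk_add rs kk_J add_0 add_0_right)
    qed
    also have "\<dots> = kk 1 (\<beta> (?g x y v))" by (rule J_self)
    finally have kkp: "kk 1 (?g x y (\<beta> v)) = kk 1 (\<beta> (?g x y v))" .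
    have "b1 (?g x y (\<beta> v)) c = b1 (\<beta> (?g x y v)) c" for c
    proof -
      have b1_beta: "inc (b1 (\<beta> w) c) = b2 w (J c w)" for w c
        unfolding b2_J_self beta_kk by (simp add: b_sym(1)[of c])
      have "b1 (?g x y (\<beta> v)) c = b1 (\<beta> v) (neg_reflection y (neg_reflection x c))"
        using b_ff_kk(4)[of 1 "J x (J y (\<beta> v))" c] by (simp add: b_add b1_neg_reflection[OF nz(1)] b1_neg_reflection[OF nz(2)])
      then have "inc (b1 (?g x y (\<beta> v)) c) = b2 v (J (neg_reflection y (neg_reflection x c)) v)" by (simp add: b1_beta)
      also have "\<dots> = b2 (J x (J y v)) (J c (J x (J y v)))"
        using xy by (simp add: b2_J_J_neg_reflection[OF nz(1)] b2_J_J_neg_reflection[OF nz(2)] conj_mult flip: mult.assoc inc_mult)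
      also have "\<dots> = b2 (?g x y v) (J c (?g x y v))"
      proof -
        have "b2 (?g x y v) (J c (?g x y v)) = b2 (?g x y v) (kk 1 (J c (kk 1 (?g x y v))))" by simp
        also have "\<dots> = b2 (kk 1 (?g x y v)) (J c (kk 1 (?g x y v)))" by (simp only: b_ff_kk mult_1)
        finally show ?thesis by (simp only: ff_kk_add rs kk_J add_0)
      qed
      finally show ?thesis by (simp only: b1_beta[symmetric] inc_eq_iff)
    qed
    then have "ff 1 (?g x y (\<beta> v)) = ff 1 (\<beta> (?g x y v))" by (rule b1_eqI)
    with kkp show ?thesis using ff_kk_split by metis
  qed
  moreover have "Q (?g x y v) = Q v" for v
  proof -
    let ?w = "?g x y v"
    have "b1 ?w ?w = b1 (ff 1 ?w) (ff 1 ?w)" by simp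
    also have "\<dots> = b1 (neg_reflection x (neg_reflection y v)) (neg_reflection x (neg_reflection y v))" by (simp only: ff_kk_add rs kk_J add_0_right)
    also have "\<dots> = b1 v v" by (simp add: b1_neg_reflection[OF nz(1)] b1_neg_reflection[OF nz(2)] neg_reflection_neg_reflection[OF nz(1)] neg_reflection_neg_reflection[OF nz(2)] rs)
    finally have 1: "fst_part (Q ?w) = fst_part (Q v)" by (simp add: b1_self)
    have "b2 ?w ?w = b2 (kk 1 ?w) (kk 1 ?w)" by simp
    also have "\<dots> = b2 (J x (J y v)) (J x (J y v))" by (simp only: ff_kk_add rs kk_J add_0)
    also have "\<dots> = b2 v v"
      using xy by (simp add: b2_J_J conj_mult flip: mult.assoc inc_mult)
    finally have 2: "snd_part (Q ?w) = snd_part (Q v)" by (simp add: b2_self)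
    show ?thesis using 1 2 by (simp add: cubic_eq_iff)
  qed
  ultimately show ?thesis using lin by (simp add: spin_points_def)
qed

text \<open>
  An element of the centre commutes with the products \<open>J x J y\<close> for which \<open>x y\<close> lies in the
  spin group. These suffice to see that it commutes with all \<open>J x J y\<close>, so it is a scalar
  \<open>c\<close> on \<open>V\<^sub>2\<close>, where \<open>c = \<plusminus> 1\<close> because \<open>Q\<close> is
  preserved. Compatibility with \<open>\<beta>\<close> makes it the identity on \<open>V\<^sub>1\<close>.
\<close>

lemma spin_center_eq: "spin_center s \<beta> Q - {id} = {s (Cubic 1 (- 1))}"
proof -
  let ?a = "Cubic 1 (- 1) :: 'f cubic"
  have sharp_a: "sharp ?a = ?a" and a2: "?a * ?a = 1"
    by (simp_all add: cubic_eq_iff conj_minus)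
  have sa: "s ?a (s ?a v) = v" for v by (simp add: a2)
  have "s ?a \<in> spin_points s \<beta> Q"
    unfolding spin_points_def
  proof (intro CollectI conjI allI)
    show "bij (s ?a)" by (rule o_bij[of "s ?a"]) (simp_all add: fun_eq_iff a2)
    show "s ?a (\<beta> v) = \<beta> (s ?a v)" for v by (simp add: beta_s sharp_a)
    show "Q (s ?a v) = Q v" for v by (simp add: Q_scale power2_eq_square a2)
  qed (rule lin_s)
  then have a_center: "s ?a \<in> spin_center s \<beta> Q"
    unfolding spin_center_def spin_points_def by (auto simp: fun_eq_iff lin_simps)
  obtain v1 w1 where vw1: "b2 v1 w1 = 1" using complex_component_nonzero by blast
  then have kw: "kk 1 w1 \<noteq> 0" by (metis b_ff_kk(5) b_zero(3) mult_1 zero_neq_one)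
  have a_id: "s ?a \<noteq> id"
  proof
    assume "s ?a = id"
    then have "b2 v1 (s ?a w1) = b2 v1 w1" by simp
    then show False using vw1 by simp
  qed
  have main: "z = s ?a \<or> z = id" if z: "z \<in> spin_center s \<beta> Q" for z
  proof -
    have zl: "lin z" and z_beta: "\<And>v. z (\<beta> v) = \<beta> (z v)" and z_Q: "\<And>v. Q (z v) = Q v"
      and z_comm: "\<And>f. f \<in> spin_points s \<beta> Q \<Longrightarrow> z \<circ> f = f \<circ> z"
      using z unfolding spin_center_def spin_points_def by blast+
    have comm1: "z (J x (J y w)) = J x (J y (z w))" if xy: "fst_part (Q x) * fst_part (Q y) = 1" for x y w
    proof -
      have nz: "fst_part (Q x) \<noteq> 0" "fst_part (Q y) \<noteq> 0" using xy by auto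
      have "z (neg_reflection x (neg_reflection y w) + J x (J y w)) = neg_reflection x (neg_reflection y (z w)) + J x (J y (z w))"
        using z_comm[OF spin_point_of_pair[OF xy]] by (simp add: fun_eq_iff)
      from arg_cong[OF this, of "kk 1"] show ?thesis
        using lin_simps(4)[OF zl, of 1 "neg_reflection x (neg_reflection y w)"] lin_simps(4)[OF zl, of 1 "J x (J y w)"]
        by (simp add: ff_kk_add neg_reflection_scale[OF nz(1)] lin_simps[OF zl])
    qed
    \<comment> \<open>for orthogonal \<open>x, y\<close> the vector \<open>y\<close> is moved along \<open>x\<close> until its norm is inverse to that of \<open>x\<close>\<close>
    have comm2: "z (J x (J y w)) = J x (J y (z w))"
      if x: "fst_part (Q x) \<noteq> 0" and orth: "b1 x y = 0" and le: "fst_part (Q x) * fst_part (Q y) \<le> 1" for x y w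
    proof -
      obtain t where t: "t * t = (1 - fst_part (Q x) * fst_part (Q y)) / (fst_part (Q x) * fst_part (Q x))"
        using sqrt_nonneg[of "(1 - fst_part (Q x) * fst_part (Q y)) / (fst_part (Q x) * fst_part (Q x))"] le by auto
      have "b1 (y + ff t x) (y + ff t x) = b1 y y + t * t * b1 x x"
        using orth by (simp add: b_add b_sym(1)[of y x])
      then have "fst_part (Q (y + ff t x)) = fst_part (Q y) + t * t * fst_part (Q x)"
        by (simp add: b1_self)
      then have "fst_part (Q x) * fst_part (Q (y + ff t x)) = 1"
        using x by (simp add: t field_simps)
      from comm1[OF this] show ?thesis
        by (simp add: J_add J_J_self lin_simps[OF zl] mult.commute)
    qed
    have comm3: "z (JJ i j w) = JJ i j (z w)" if ij: "i < 8" "j < 8" for i j w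
    proof (cases "i = j")
      case True
      then show ?thesis using ij by (simp add: JJ_self lin_simps[OF zl])
    next
      case False
      have Qe: "fst_part (Q (e k)) = q k" if "k < 8" for k
        using b1_self[of "e k"] by (simp add: q_def n_def)
      define r where "r = (if q i * q j \<le> 1 then 1 else 1 / (q i * q j))"
      have r0: "r \<noteq> 0" using ij by (simp add: r_def)
      have "fst_part (Q (ff r (e j))) = r * r * q j"
        using ij by (simp add: ff_def Q_scale power2_eq_square Qe)
      moreover have "q i * (r * r * q j) \<le> 1"
      proof (cases "q i * q j \<le> 1")
        case False
        then have "q i * (r * r * q j) = 1 / (q i * q j)" using ij by (simp add: r_def)
        then show ?thesis using False by (simp add: field_simps)
      qed (simp add: r_def)
      ultimately have "z (J (e i) (J (ff r (e j)) w)) = J (e i) (J (ff r (e j)) (z w))"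
        using ij False by (intro comm2) (simp_all add: b1_e Qe)
      then have "kk (inc r) (z (JJ i j w)) = kk (inc r) (JJ i j (z w))"
        by (simp add: lin_simps[OF zl])
      then have "kk 1 (z (JJ i j w)) = kk 1 (JJ i j (z w))" by (rule kk_cancel[rotated]) (use r0 in simp)
      then show ?thesis using lin_simps(4)[OF zl, of 1 "JJ i j w"] by simp
    qed
    have J_exp: "J x w = (\<Sum>k<8. kk (inc (b1 x (e k) / n k)) (J (e k) w))" for x w
      using arg_cong[OF e_expand[of x], of "\<lambda>x. J x w"] by (simp add: J_sum)
    have "z (J x (J y w)) = J x (J y (z w))" for x y w
      unfolding J_exp[of x] J_exp[of y] J_sum lin_simps[OF zl] ff_kk_sum
      by (simp add: lin_simps[OF zl] comm3)
    from even_clifford_commutant[OF zl this] obtain c where c: "\<And>w. kk 1 (z w) = kk c w" by blast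
    have cJ: "kk c (J x w) = kk (conj c) (J (z x) w)" for x w
    proof -
      let ?v = "ff 1 x + kk 1 w"
      have "kk 1 (z (\<beta> ?v)) = J (z ?v) (z ?v)" by (simp only: z_beta J_self)
      also have "\<dots> = J (ff 1 (z ?v)) (kk 1 (z ?v))" by simp
      also have "\<dots> = kk (conj c) (J (z x) w)"
        unfolding c by (simp add: lin_simps[OF zl] ff_kk_add)
      finally show ?thesis unfolding c J_eq_beta by simp
    qed
    have "Q (z v1 + z w1) = Q (v1 + w1)" using z_Q[of "v1 + w1"] lin_simps(1)[OF zl, of v1 w1] by simp
    then have "b2 (z v1) (z w1) = b2 v1 w1" using z_Q by (simp add: b2_def polar_def)
    then have "b2 (kk 1 (z v1)) (kk 1 (z w1)) = b2 v1 w1" by simp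
    then have "c * c = 1" unfolding c using vw1 by simp
    then have c1: "c = 1 \<or> c = - 1" by (rule square_eq_1_iff[THEN iffD1])
    then have "J (z x - x) w = 0" for x w
      using cJ[of x w] by (auto simp: J_diff conj_minus kk_minus_left)
    then have "kk (inc (b1 (z x - x) y)) w1 = 0" for x y
      using J_clifford[of "z x - x" y w1] by simp
    then have "inc (b1 (z x - x) y) * b2 v1 w1 = 0" for x y using b_ff_kk(5) b_zero(3) by metis
    then have "b1 (z x - x) y = 0" for x y using vw1 by simp
    then have "ff 1 (z x - x) = 0" for x by (rule b1_nondegenerate)
    then have "ff 1 (z x) = ff 1 x" for x by (simp add: ff_kk_diff)
    then have zx: "z x = ff 1 x + kk c x" for x using ff_kk_split[of "z x"] c[of x] by simp
    from c1 show ?thesis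
    proof
      assume "c = 1"
      then have "z = id" by (intro ext) (simp add: zx ff_kk_split)
      then show ?thesis by simp
    next
      assume "c = - 1"
      then have "z x = s ?a x" for x by (simp add: zx s_split[of ?a x])
      then have "z = s ?a" by (rule ext)
      then show ?thesis by (rule disjI1)
    qed
  qed
  show ?thesis
  proof (intro equalityI subsetI)
    fix z assume "z \<in> spin_center s \<beta> Q - {id}"
    then show "z \<in> {s ?a}" using main[of z] by simp
  next
    fix z assume "z \<in> {s ?a}"
    then show "z \<in> spin_center s \<beta> Q - {id}" using a_center a_id by simp
  qed
qed

end

section \<open>Gradings as families of projections\<close>

text \<open>
  The part of a grading that concerns the additive group alone, with sums in the type class instead of the record.
\<close>

definition decomposes :: "'a::ab_group_add set \<Rightarrow> ('g \<Rightarrow> 'a set) \<Rightarrow> bool" where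
  "decomposes C \<Gamma> \<longleftrightarrow>
     (\<forall>g. \<Gamma> g \<subseteq> C \<and> 0 \<in> \<Gamma> g \<and> (\<forall>x\<in>\<Gamma> g. \<forall>y\<in>\<Gamma> g. x + y \<in> \<Gamma> g) \<and> (\<forall>x\<in>\<Gamma> g. - x \<in> \<Gamma> g)) \<and>
     (\<forall>x\<in>C. \<exists>!f. (\<forall>g. f g \<in> \<Gamma> g) \<and> finite {g. f g \<noteq> 0} \<and> x = (\<Sum>g | f g \<noteq> 0. f g))"

lemma space_grading_iff:
  fixes M :: "('f::comm_ring_1, 'a::ab_group_add, 'm) module_scheme"
  assumes add: "add M = (+)" and zero: "ring.zero M = 0"
    and C: "0 \<in> carrier M" "\<And>x y. x \<in> carrier M \<Longrightarrow> y \<in> carrier M \<Longrightarrow> x + y \<in> carrier M"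
      "\<And>x. x \<in> carrier M \<Longrightarrow> - x \<in> carrier M"
  shows "space_grading M \<Gamma> \<longleftrightarrow>
    decomposes (carrier M) \<Gamma> \<and> (\<forall>g c. \<forall>x\<in>\<Gamma> g. module.smult M c x \<in> \<Gamma> g)"
proof -
  interpret M: abelian_group M
  proof (rule abelian_groupI)
    fix x assume "x \<in> carrier M"
    then show "\<exists>y\<in>carrier M. y \<oplus>\<^bsub>M\<^esub> x = \<zero>\<^bsub>M\<^esub>"
      using C(3) by (intro bexI[of _ "- x"]) (simp_all add: add zero)
  qed (use C in \<open>simp_all add: add zero add_ac\<close>)
  have inv: "inv\<^bsub>add_monoid M\<^esub> x = - x" if "x \<in> carrier M" for x
    using M.minus_equality[of "- x" x] that C by (simp add: add zero a_inv_def)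
  have fs: "finsum M f A = sum f A" if "finite A" "f \<in> A \<rightarrow> carrier M" for f :: "'b \<Rightarrow> 'a" and A
    using that by (induction A rule: finite_induct) (simp_all add: zero add)
  have sub: "submodule K (ring_of_type_algebra :: 'f ring) M \<longleftrightarrow>
      K \<subseteq> carrier M \<and> 0 \<in> K \<and> (\<forall>x\<in>K. \<forall>y\<in>K. x + y \<in> K) \<and> (\<forall>x\<in>K. - x \<in> K) \<and>
      (\<forall>c. \<forall>x\<in>K. module.smult M c x \<in> K)" for K
  proof
    assume "submodule K (ring_of_type_algebra :: 'f ring) M"
    then interpret K: submodule K "ring_of_type_algebra :: 'f ring" M .
    have K: "K \<subseteq> carrier M" using K.subset by simp
    show "K \<subseteq> carrier M \<and> 0 \<in> K \<and> (\<forall>x\<in>K. \<forall>y\<in>K. x + y \<in> K) \<and> (\<forall>x\<in>K. - x \<in> K) \<and>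
      (\<forall>c. \<forall>x\<in>K. module.smult M c x \<in> K)"
    proof (intro conjI ballI allI)
      show "0 \<in> K" using K.one_closed by (simp add: zero)
      show "x + y \<in> K" if "x \<in> K" "y \<in> K" for x y using K.m_closed[OF that] by (simp add: add)
      show "- x \<in> K" if "x \<in> K" for x using K.m_inv_closed[OF that] inv[of x] K that by (metis subsetD)
      show "module.smult M c x \<in> K" if "x \<in> K" for c x
        using K.smult_closed[of c x] that by (simp add: ring_of_type_algebra_def)
    qed (rule K)
  next
    assume K: "K \<subseteq> carrier M \<and> 0 \<in> K \<and> (\<forall>x\<in>K. \<forall>y\<in>K. x + y \<in> K) \<and> (\<forall>x\<in>K. - x \<in> K) \<and>
      (\<forall>c. \<forall>x\<in>K. module.smult M c x \<in> K)"
    show "submodule K (ring_of_type_algebra :: 'f ring) M"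
    proof (intro submodule.intro subgroup.intro submodule_axioms.intro)
      show "inv\<^bsub>add_monoid M\<^esub> x \<in> K" if "x \<in> K" for x
        using K that by (simp add: inv subset_iff)
    qed (use K in \<open>simp_all add: add zero\<close>)
  qed
  have eq: "((\<forall>g. f g \<in> \<Gamma> g) \<and> finite {g. f g \<noteq> \<zero>\<^bsub>M\<^esub>} \<and> x = (\<Oplus>\<^bsub>M\<^esub>g \<in> {g. f g \<noteq> \<zero>\<^bsub>M\<^esub>}. f g)) \<longleftrightarrow>
      ((\<forall>g. f g \<in> \<Gamma> g) \<and> finite {g. f g \<noteq> 0} \<and> x = (\<Sum>g | f g \<noteq> 0. f g))"
    if "\<forall>g. \<Gamma> g \<subseteq> carrier M" for f x
    unfolding zero
  proof (intro conj_cong refl)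
    assume f: "\<forall>g. f g \<in> \<Gamma> g" "finite {g. f g \<noteq> 0}"
    have "finsum M f {g. f g \<noteq> 0} = (\<Sum>g | f g \<noteq> 0. f g)" by (rule fs) (use f that in auto)
    then show "(x = (\<Oplus>\<^bsub>M\<^esub>g \<in> {g. f g \<noteq> 0}. f g)) = (x = (\<Sum>g | f g \<noteq> 0. f g))" by (simp only:)
  qed
  show ?thesis
  proof (cases "\<forall>g. \<Gamma> g \<subseteq> carrier M")
    case True
    then show ?thesis
      unfolding space_grading_def decomposes_def sub eq[OF True] by blast
  next
    case False
    then show ?thesis
      unfolding space_grading_def decomposes_def sub by blast
  qed
qed

definition component :: "('g \<Rightarrow> 'a::ab_group_add set) \<Rightarrow> 'g \<Rightarrow> 'a \<Rightarrow> 'a" where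
  "component \<Gamma> g x = (THE f. (\<forall>g. f g \<in> \<Gamma> g) \<and> finite {g. f g \<noteq> 0} \<and> x = (\<Sum>g | f g \<noteq> 0. f g)) g"

context
  fixes C :: "'a::ab_group_add set" and \<Gamma> :: "'g \<Rightarrow> 'a set"
  assumes dec: "decomposes C \<Gamma>"
begin

lemma decomposes_closed: "x \<in> \<Gamma> g \<Longrightarrow> x \<in> C" "0 \<in> \<Gamma> g" "x \<in> \<Gamma> g \<Longrightarrow> y \<in> \<Gamma> g \<Longrightarrow> x + y \<in> \<Gamma> g"
    "x \<in> \<Gamma> g \<Longrightarrow> - x \<in> \<Gamma> g"
  using dec unfolding decomposes_def by auto

lemma component_spec:
  assumes "x \<in> C"
  shows "component \<Gamma> g x \<in> \<Gamma> g" "finite {g. component \<Gamma> g x \<noteq> 0}"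
    "x = (\<Sum>g | component \<Gamma> g x \<noteq> 0. component \<Gamma> g x)"
proof -
  have ex: "\<exists>!f. (\<forall>g. f g \<in> \<Gamma> g) \<and> finite {g. f g \<noteq> 0} \<and> x = (\<Sum>g | f g \<noteq> 0. f g)"
    using dec assms unfolding decomposes_def by simp
  let ?P = "\<lambda>f. (\<forall>g. f g \<in> \<Gamma> g) \<and> finite {g. f g \<noteq> 0} \<and> x = (\<Sum>g | f g \<noteq> 0. f g)"
  have "?P (\<lambda>g. component \<Gamma> g x)" unfolding component_def by (rule theI'[OF ex])
  then show "component \<Gamma> g x \<in> \<Gamma> g" "finite {g. component \<Gamma> g x \<noteq> 0}"
    "x = (\<Sum>g | component \<Gamma> g x \<noteq> 0. component \<Gamma> g x)" by blast+
qed

text \<open>The components are determined by any expression as a finite sum of homogeneous elements.\<close>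

lemma component_eqI:
  assumes "x \<in> C" "finite A" "\<And>g. g \<in> A \<Longrightarrow> f g \<in> \<Gamma> g" "x = (\<Sum>g\<in>A. f g)"
  shows "component \<Gamma> g x = (if g \<in> A then f g else 0)"
proof -
  let ?f = "\<lambda>g. if g \<in> A then f g else 0"
  have ex: "\<exists>!f. (\<forall>g. f g \<in> \<Gamma> g) \<and> finite {g. f g \<noteq> 0} \<and> x = (\<Sum>g | f g \<noteq> 0. f g)"
    using dec assms unfolding decomposes_def by simp
  have fin: "finite {g. ?f g \<noteq> 0}" by (rule finite_subset[OF _ assms(2)]) auto
  have "(\<Sum>g | ?f g \<noteq> 0. ?f g) = (\<Sum>g\<in>A. f g)"
    by (rule sum.mono_neutral_cong_left) (use assms(2) in auto)
  then have 1: "(\<forall>g. ?f g \<in> \<Gamma> g) \<and> finite {g. ?f g \<noteq> 0} \<and> x = (\<Sum>g | ?f g \<noteq> 0. ?f g)"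
    using assms fin decomposes_closed(2) by simp
  have "(THE f. (\<forall>g. f g \<in> \<Gamma> g) \<and> finite {g. f g \<noteq> 0} \<and> x = (\<Sum>g | f g \<noteq> 0. f g)) = ?f"
    by (rule the1_equality) (rule ex, rule 1)
  then show ?thesis unfolding component_def by (rule fun_cong)
qed

lemma component_homogeneous: "x \<in> \<Gamma> g \<Longrightarrow> component \<Gamma> k x = (if k = g then x else 0)"
  using component_eqI[of x "{g}" "\<lambda>_. x" k] decomposes_closed(1) by simp

lemma component_sum_superset:
  assumes "x \<in> C" "finite A" "\<And>g. g \<notin> A \<Longrightarrow> component \<Gamma> g x = 0"
  shows "x = (\<Sum>g\<in>A. component \<Gamma> g x)"
proof -
  have "(\<Sum>g | component \<Gamma> g x \<noteq> 0. component \<Gamma> g x) = (\<Sum>g\<in>A. component \<Gamma> g x)"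
    by (rule sum.mono_neutral_left) (use assms in auto)
  then show ?thesis using component_spec(3)[OF assms(1)] by simp
qed

lemma component_add:
  assumes "x \<in> C" "y \<in> C" "x + y \<in> C"
  shows "component \<Gamma> g (x + y) = component \<Gamma> g x + component \<Gamma> g y"
proof -
  define A where "A = {g. component \<Gamma> g x \<noteq> 0} \<union> {g. component \<Gamma> g y \<noteq> 0}"
  have A: "finite A" using component_spec(2) assms by (simp add: A_def)
  have "x = (\<Sum>g\<in>A. component \<Gamma> g x)" "y = (\<Sum>g\<in>A. component \<Gamma> g y)"
    by (rule component_sum_superset[OF assms(1) A], simp add: A_def)
      (rule component_sum_superset[OF assms(2) A], simp add: A_def)
  then have "x + y = (\<Sum>g\<in>A. component \<Gamma> g x + component \<Gamma> g y)" by (simp only: sum.distrib)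
  then have "component \<Gamma> g (x + y) = (if g \<in> A then component \<Gamma> g x + component \<Gamma> g y else 0)"
    using component_eqI[OF assms(3) A, of "\<lambda>g. component \<Gamma> g x + component \<Gamma> g y" g]
      component_spec(1) assms decomposes_closed(3) by blast
  then show ?thesis by (auto simp: A_def)
qed

end

text \<open>A grading from its projections, of which only finitely many are nonzero.\<close>

lemma decomposesI:
  fixes \<Gamma> :: "'g \<Rightarrow> 'a::ab_group_add set"
  assumes sub: "\<And>g. \<Gamma> g \<subseteq> C" "\<And>g. 0 \<in> \<Gamma> g" "\<And>g x y. x \<in> \<Gamma> g \<Longrightarrow> y \<in> \<Gamma> g \<Longrightarrow> x + y \<in> \<Gamma> g"
      "\<And>g x. x \<in> \<Gamma> g \<Longrightarrow> - x \<in> \<Gamma> g"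
    and add: "\<And>g x y. \<pi> g (x + y) = \<pi> g x + \<pi> g y"
    and \<pi>: "\<And>g x. x \<in> C \<Longrightarrow> \<pi> g x \<in> \<Gamma> g" "\<And>g x. x \<in> \<Gamma> g \<Longrightarrow> \<pi> g x = x"
      "\<And>g k x. x \<in> \<Gamma> g \<Longrightarrow> k \<noteq> g \<Longrightarrow> \<pi> k x = 0"
    and S: "finite S" "\<And>g x. g \<notin> S \<Longrightarrow> \<pi> g x = 0" "\<And>x. x \<in> C \<Longrightarrow> x = (\<Sum>g\<in>S. \<pi> g x)"
  shows "decomposes C \<Gamma>"
proof -
  have \<pi>0: "\<pi> g 0 = 0" for g using add[of g 0 0] by simp
  have \<pi>_sum: "\<pi> g (sum f A) = (\<Sum>i\<in>A. \<pi> g (f i))" for g f and A :: "'g set"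
    by (induction A rule: infinite_finite_induct) (simp_all add: \<pi>0 add)
  have "\<exists>!f. (\<forall>g. f g \<in> \<Gamma> g) \<and> finite {g. f g \<noteq> 0} \<and> x = (\<Sum>g | f g \<noteq> 0. f g)" if x: "x \<in> C" for x
  proof (rule ex1I[of _ "\<lambda>g. \<pi> g x"])
    have "finite {g. \<pi> g x \<noteq> 0}" by (rule finite_subset[OF _ S(1)]) (use S(2) in blast)
    moreover have "(\<Sum>g | \<pi> g x \<noteq> 0. \<pi> g x) = (\<Sum>g\<in>S. \<pi> g x)"
      by (rule sum.mono_neutral_left) (use S in auto)
    ultimately show "(\<forall>g. \<pi> g x \<in> \<Gamma> g) \<and> finite {g. \<pi> g x \<noteq> 0} \<and> x = (\<Sum>g | \<pi> g x \<noteq> 0. \<pi> g x)"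
      using S(3)[OF x] \<pi>(1)[OF x] by simp
  next
    fix f assume f: "(\<forall>g. f g \<in> \<Gamma> g) \<and> finite {g. f g \<noteq> 0} \<and> x = (\<Sum>g | f g \<noteq> 0. f g)"
    show "f = (\<lambda>g. \<pi> g x)"
    proof
      fix g
      have "\<pi> g x = (\<Sum>k | f k \<noteq> 0. \<pi> g (f k))" using f \<pi>_sum by metis
      also have "\<dots> = (\<Sum>k | f k \<noteq> 0. if k = g then f g else 0)"
      proof (rule sum.cong[OF refl])
        fix k show "\<pi> g (f k) = (if k = g then f g else 0)"
          using f \<pi>(2)[of "f k" k] \<pi>(3)[of "f k" k g] by auto
      qed
      also have "\<dots> = f g" using f by auto
      finally show "f g = \<pi> g x" by simp
    qed
  qed
  then show ?thesis unfolding decomposes_def using sub by blast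
qed

section \<open>Gradings on the trialitarian algebra\<close>

context twisted_composition
begin

lemma E_alg_parts [simp]: "carrier (E_alg s) = {f. lin f}" "add (E_alg s) = (+)" "ring.zero (E_alg s) = 0"
  "module.smult (E_alg s) c f = (\<lambda>x. s (of_F c) (f x))" "monoid.mult (E_alg s) = (\<circ>)"
  by (simp_all add: End_alg_def fun_eq_iff plus_fun_def zero_fun_def)

lemma E_grading_iff: "algebra_grading (E_alg s) \<Gamma> \<longleftrightarrow> decomposes {f. lin f} \<Gamma> \<and>
    (\<forall>g c. \<forall>f\<in>\<Gamma> g. (\<lambda>x. s (of_F c) (f x)) \<in> \<Gamma> g) \<and> (\<forall>g h. \<forall>f\<in>\<Gamma> g. \<forall>f'\<in>\<Gamma> h. f \<circ> f' \<in> \<Gamma> (g + h))"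
  unfolding algebra_grading_def
  by (subst space_grading_iff) (auto simp: lin_zero lin_add lin_minus)

lemma V_grading_iff: "space_grading (V_space s) W \<longleftrightarrow> decomposes UNIV W \<and>
    (\<forall>g c. \<forall>x\<in>W g. s (of_F c) x \<in> W g)"
  by (subst space_grading_iff) (auto simp: V_space_def F_scale_def)

lemma L_grading_iff: "algebra_grading (L_alg :: ('f, 'f cubic) module) \<Lambda> \<longleftrightarrow> decomposes UNIV \<Lambda> \<and>
    (\<forall>g c. \<forall>l\<in>\<Lambda> g. of_F c * l \<in> \<Lambda> g) \<and> (\<forall>g h. \<forall>l\<in>\<Lambda> g. \<forall>m\<in>\<Lambda> h. l * m \<in> \<Lambda> (g + h))"
  unfolding algebra_grading_def
  by (subst space_grading_iff) (auto simp: L_alg_def)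

subsection \<open>Adjoint operators\<close>

definition adj :: "('v \<Rightarrow> 'v) \<Rightarrow> 'v \<Rightarrow> 'v" where "adj = adjoint_inv s Q"

lemma polar_Q_cancel: assumes "\<And>x. polar Q x y = polar Q x z" shows "y = z"
proof -
  have "polar Q (y - z) x = 0" for x
    using assms[of x] polar_sym[of Q] polar_Q_add(2)[of "y - z" z x] by simp
  then have "y - z = 0" by (rule polar_Q_nondegenerate)
  then show ?thesis by simp
qed

lemma adj_spec:
  assumes f: "lin f" shows "lin (adj f)" "polar Q (f x) y = polar Q x (adj f y)"
proof -
  have "\<exists>z. \<forall>x. polar Q (f x) y = polar Q x z" for y
  proof -
    have "Modules.module_hom s (*) (\<lambda>x. polar Q (f x) y)"
    proof -
      interpret h: Modules.module_hom s s f by (rule f)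
      interpret p: Modules.module_hom s "(*)" "\<lambda>x. polar Q x y" by (rule polar_Q_hom(2))
      show ?thesis by unfold_locales (simp_all add: h.add h.scale p.add p.scale)
    qed
    then have "\<exists>!z. \<forall>x. polar Q (f x) y = polar Q z x"
      using tc_parts(3) unfolding nonsingular_def by (elim allE impE)
    then show ?thesis using polar_sym[of Q] by metis
  qed
  then obtain f' where f': "\<And>x y. polar Q (f x) y = polar Q x (f' y)" by metis
  have "lin f'"
  proof (rule linI)
    show "f' (y + z) = f' y + f' z" for y z
      by (rule polar_Q_cancel) (simp add: polar_Q_add flip: f')
    show "f' (s l y) = s l (f' y)" for l y
      by (rule polar_Q_cancel) (simp add: polar_Q_scale flip: f')
  qed
  have "adj f = f'"
    unfolding adj_def adjoint_inv_def
  proof (rule the_equality)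
    show "f' \<in> carrier (E_alg s) \<and> (\<forall>x y. polar Q (f x) y = polar Q x (f' y))"
      using \<open>lin f'\<close> f' by simp
    fix f'' assume f'': "f'' \<in> carrier (E_alg s) \<and> (\<forall>x y. polar Q (f x) y = polar Q x (f'' y))"
    show "f'' = f'"
    proof
      fix y show "f'' y = f' y"
        by (rule polar_Q_cancel) (use f' f'' in metis)
    qed
  qed
  then show "lin (adj f)" "polar Q (f x) y = polar Q x (adj f y)" using \<open>lin f'\<close> f' by simp_all
qed

lemma b_adj: assumes "lin f" shows "b1 (f x) y = b1 x (adj f y)" "b2 (f x) y = b2 x (adj f y)"
  using adj_spec(2)[OF assms] by (simp_all add: b1_def b2_def)

lemma adj_unique: assumes "lin f" "\<And>x y. polar Q (f x) y = polar Q x (f' y)" shows "adj f = f'"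
proof
  fix y show "adj f y = f' y"
    by (rule polar_Q_cancel) (use adj_spec(2)[OF assms(1)] assms(2) in metis)
qed

lemma adj_rk: "adj (rk x y) = rk y x"
  by (rule adj_unique[OF lin_rk]) (simp add: rk_def polar_Q_scale polar_sym[of Q _ x] polar_sym[of Q _ y] mult.commute)

lemma adj_add: "lin f \<Longrightarrow> lin g \<Longrightarrow> adj (f + g) = adj f + adj g"
  by (rule adj_unique) (simp_all add: lin_add polar_Q_add adj_spec(2))

lemma comp_rk: "lin f \<Longrightarrow> f \<circ> rk x y = rk (f x) y"
  by (rule ext) (simp add: rk_def lin_simps)

lemma rk_add: "rk (x + x') y = rk x y + rk x' y" "rk x (y + y') = rk x y + rk x y'"
  by (rule ext; simp add: rk_def S.scale_right_distrib polar_Q_add S.scale_left_distrib)+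

lemma dual_basis: obtains B B' where "finite B" "\<And>x. x = (\<Sum>b\<in>B. s (polar Q (B' b) x) (b :: 'v))"
proof -
  obtain B where B: "finite B" "card B = 8"
    and ind: "\<And>c b. (\<Sum>b\<in>B. s (c b) b) = 0 \<Longrightarrow> b \<in> B \<Longrightarrow> c b = 0"
    and gen: "\<And>x. \<exists>c. x = (\<Sum>b\<in>B. s (c b) b)" by (rule L_basis) blast
  obtain c where c: "\<And>x. x = (\<Sum>b\<in>B. s (c x b) b)" using gen by metis
  have uniq: "d b = c x b" if "x = (\<Sum>b\<in>B. s (d b) b)" "b \<in> B" for x d b
  proof -
    have "(\<Sum>b\<in>B. s (d b - c x b) b) = 0"
      using that(1) c[of x] by (simp add: S.scale_left_diff_distrib sum_subtractf)
    from ind[OF this that(2)] show ?thesis by simp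
  qed
  have "\<exists>y. \<forall>x. c x b = polar Q y x" if b: "b \<in> B" for b
  proof -
    have "Modules.module_hom s (*) (\<lambda>x. c x b)"
    proof unfold_locales
      fix x y l
      have "x + y = (\<Sum>b\<in>B. s (c x b + c y b) b)"
        using c[of x] c[of y] by (simp add: S.scale_left_distrib sum.distrib)
      from uniq[OF this b] show "c (x + y) b = c x b + c y b" by simp
      have "s l x = (\<Sum>b\<in>B. s (l * c x b) b)"
        by (subst c[of x]) (simp add: S.scale_sum_right)
      from uniq[OF this b] show "c (s l x) b = l * c x b" by simp
    qed (simp_all add: algebra_simps)
    then show ?thesis using tc_parts(3) unfolding nonsingular_def by metis
  qed
  then obtain B' where "\<And>b x. b \<in> B \<Longrightarrow> c x b = polar Q (B' b) x" by metis
  then have "x = (\<Sum>b\<in>B. s (polar Q (B' b) x) b)" for x using c[of x] by simp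
  then show ?thesis by (rule that[OF B(1)])
qed

text \<open>
  \<open>E\<close> is spanned by the operators of rank one, because nonsingularity of \<open>Q\<close> provides dual
  bases.
\<close>

lemma lin_expand_rk:
  obtains B B' where "finite B" "\<And>f. lin f \<Longrightarrow> f = (\<Sum>b\<in>B. rk (f b) (B' b))"
proof -
  obtain B and B' :: "'v \<Rightarrow> 'v" where B: "finite B" and x: "\<And>x. x = (\<Sum>b\<in>B. s (polar Q (B' b) x) b)"
    by (rule dual_basis) blast
  have "f = (\<Sum>b\<in>B. rk (f b) (B' b))" if "lin f" for f
  proof
    fix z
    show "f z = (\<Sum>b\<in>B. rk (f b) (B' b)) z"
      by (subst x[of z]) (simp add: fun_sum_apply rk_def lin_simps[OF that])
  qed
  then show ?thesis by (rule that[OF B])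
qed

text \<open>A grading of \<open>E\<close> has only finitely many nonzero components, as \<open>E\<close> has finite dimension over \<open>F\<close>.\<close>

lemma E_grading_finite:
  assumes dec: "decomposes {f. lin f} \<Gamma>" and F: "\<And>g c f. f \<in> \<Gamma> g \<Longrightarrow> (\<lambda>x. s (of_F c) (f x)) \<in> \<Gamma> g"
  shows "\<exists>S. finite S \<and> (\<forall>f g. lin f \<longrightarrow> g \<notin> S \<longrightarrow> component \<Gamma> g f = 0)"
proof -
  obtain B B' where B: "finite B" and ex: "\<And>f. lin f \<Longrightarrow> f = (\<Sum>b\<in>B. rk (f b) (B' b))"
    by (rule lin_expand_rk) blast
  obtain B2 and B2' :: "'v \<Rightarrow> 'v" where B2: "finite B2"
    and ex2: "\<And>x. x = (\<Sum>b\<in>B2. s (polar Q (B2' b) x) b)" by (rule dual_basis) blast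
  define T where "T = {Cubic 1 0, Cubic 0 1, Cubic (0 :: 'f) imag_unit}"
  define G where "G = (\<lambda>(l, a, b). s l \<circ> rk a (B' b)) ` (T \<times> B2 \<times> B)"
  have G: "finite G" "\<And>f. f \<in> G \<Longrightarrow> lin f"
    using B B2 by (auto simp: G_def T_def intro: lin_comp lin_s lin_rk)
  define S where "S = (\<Union>f\<in>G. {g. component \<Gamma> g f \<noteq> 0})"
  have S: "finite S" using G component_spec(2)[OF dec] by (auto simp: S_def)
  define N where "N = {f. lin f \<and> (\<forall>g. g \<notin> S \<longrightarrow> component \<Gamma> g f = 0)}"
  have N_add: "f + f' \<in> N" if "f \<in> N" "f' \<in> N" for f f'
    using that component_add[OF dec, of f f'] by (simp add: N_def lin_add)
  have N0: "0 \<in> N"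
  proof -
    have "component \<Gamma> g 0 = 0" for g
      using component_homogeneous[OF dec decomposes_closed(2)[OF dec, of g], of g] by (simp only: refl if_True)
    then show ?thesis by (simp add: N_def lin_zero)
  qed
  have N_sum: "sum h I \<in> N" if "\<And>i. i \<in> I \<Longrightarrow> h i \<in> N" for h and I :: "'v set"
    using that by (induction I rule: infinite_finite_induct) (auto simp: N0 N_add)
  have N_F: "(\<lambda>x. s (of_F c) (f x)) \<in> N" if f: "f \<in> N" for c f
  proof -
    have lf: "lin f" and cf: "\<And>g. g \<notin> S \<Longrightarrow> component \<Gamma> g f = 0" using f by (simp_all add: N_def)
    have l: "lin (\<lambda>x. s (of_F c) (f x))"
      using lin_comp[OF lin_s lf] by (simp add: comp_def)
    have f_eq: "f = (\<Sum>g\<in>S. component \<Gamma> g f)"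
      by (rule component_sum_superset[OF dec _ S]) (use lf cf in auto)
    have "(\<lambda>x. s (of_F c) (f x)) = (\<Sum>g\<in>S. (\<lambda>x. s (of_F c) (component \<Gamma> g f x)))"
      by (subst (1) f_eq) (simp add: fun_eq_iff fun_sum_apply S.scale_sum_right)
    then have "component \<Gamma> g (\<lambda>x. s (of_F c) (f x)) = 0" if "g \<notin> S" for g
      using component_eqI[OF dec _ S, of "\<lambda>x. s (of_F c) (f x)" "\<lambda>g x. s (of_F c) (component \<Gamma> g f x)" g]
        that l F component_spec(1)[OF dec] lf by simp
    then show ?thesis using l by (simp add: N_def)
  qed
  have G_N: "f \<in> N" if "f \<in> G" for f using that G by (auto simp: N_def S_def)
  have N_L: "(\<lambda>x. s l (rk a (B' b) x)) \<in> N" if "a \<in> B2" "b \<in> B" for l a b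
  proof -
    have g: "(\<lambda>x. s t (rk a (B' b) x)) \<in> N" if t: "t \<in> T" for t
    proof (rule G_N)
      have "(\<lambda>x. s t (rk a (B' b) x)) = (\<lambda>(l, a, b). s l \<circ> rk a (B' b)) (t, a, b)" by (simp add: comp_def)
      then show "(\<lambda>x. s t (rk a (B' b) x)) \<in> G"
        unfolding G_def using t \<open>a \<in> B2\<close> \<open>b \<in> B\<close> by (intro image_eqI) auto
    qed
    have l: "l = of_F (fst_part l) * Cubic 1 0 + (of_F (re (snd_part l)) * Cubic 0 1 + of_F (im (snd_part l)) * Cubic 0 imag_unit)"
      by (simp add: cubic_eq_iff mult.commute flip: cplx_decomp)
    have eq: "(\<lambda>x. s l (rk a (B' b) x)) = (\<lambda>x. s (of_F (fst_part l)) (s (Cubic 1 0) (rk a (B' b) x)))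
        + ((\<lambda>x. s (of_F (re (snd_part l))) (s (Cubic 0 1) (rk a (B' b) x)))
        + (\<lambda>x. s (of_F (im (snd_part l))) (s (Cubic 0 imag_unit) (rk a (B' b) x))))"
      by (subst (1) l) (simp add: fun_eq_iff S.scale_left_distrib)
    show ?thesis unfolding eq
      by (intro N_add N_F g) (simp_all add: T_def)
  qed
  have "f \<in> N" if f: "lin f" for f
  proof -
    have "rk x (B' b) \<in> N" if "b \<in> B" for x b
    proof -
      have "rk x (B' b) = (\<Sum>a\<in>B2. (\<lambda>z. s (polar Q (B2' a) x) (rk a (B' b) z)))"
      proof
        fix z
        have "rk x (B' b) z = s (polar Q (B' b) z) (\<Sum>a\<in>B2. s (polar Q (B2' a) x) a)"
          unfolding rk_def by (subst ex2[of x]) simp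
        then show "rk x (B' b) z = (\<Sum>a\<in>B2. (\<lambda>z. s (polar Q (B2' a) x) (rk a (B' b) z))) z"
          by (simp add: fun_sum_apply rk_def S.scale_sum_right mult.commute)
      qed
      from this [symmetric] show ?thesis by (rule subst) (intro N_sum N_L that)
    qed
    then show ?thesis by (subst ex[OF f]) (intro N_sum)
  qed
  then have "\<forall>f g. lin f \<longrightarrow> g \<notin> S \<longrightarrow> component \<Gamma> g f = 0" by (simp add: N_def)
  then show ?thesis using S by blast
qed

end

section \<open>The degrees of the centre\<close>

locale trialitarian_graded = twisted_composition_basis s \<beta> Q e
  for s :: "'f::real_closed_field cubic \<Rightarrow> 'v::ab_group_add \<Rightarrow> 'v" and \<beta> Q and e :: "nat \<Rightarrow> 'v" +
  fixes \<Gamma> :: "'g::ab_group_add \<Rightarrow> ('v \<Rightarrow> 'v) set"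
  assumes tg: "trialitarian_grading_III s \<beta> Q \<Gamma>"
begin

lemma E_grading: "algebra_grading (E_alg s) \<Gamma>" and typeIII: "type_III s \<Gamma>"
  and adj_image: "\<And>g. adjoint_inv s Q ` \<Gamma> g \<subseteq> \<Gamma> g"
  using tg unfolding trialitarian_grading_III_def by simp_all

lemma dec: "decomposes {f. lin f} \<Gamma>"
  using E_grading unfolding E_grading_iff by simp

lemma \<Gamma>_scale: "f \<in> \<Gamma> g \<Longrightarrow> (\<lambda>x. s (of_F c) (f x)) \<in> \<Gamma> g"
  using E_grading unfolding E_grading_iff by simp

lemma \<Gamma>_comp: "f \<in> \<Gamma> g \<Longrightarrow> f' \<in> \<Gamma> k \<Longrightarrow> f \<circ> f' \<in> \<Gamma> (g + k)"
  using E_grading unfolding E_grading_iff by simp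

lemma \<Gamma>_lin: "f \<in> \<Gamma> g \<Longrightarrow> lin f"
  using decomposes_closed(1)[OF dec] by auto

lemmas \<Gamma>_zero = decomposes_closed(2)[OF dec]
lemmas \<Gamma>_add = decomposes_closed(3)[OF dec]

lemma \<Gamma>_adj: "f \<in> \<Gamma> g \<Longrightarrow> adj f \<in> \<Gamma> g"
  using adj_image by (auto simp: adj_def)

abbreviation pr :: "'g \<Rightarrow> ('v \<Rightarrow> 'v) \<Rightarrow> 'v \<Rightarrow> 'v" where "pr \<equiv> component \<Gamma>"

lemma pr_in: "lin f \<Longrightarrow> pr g f \<in> \<Gamma> g"
  using component_spec(1)[OF dec] by simp

lemma pr_hom: "f \<in> \<Gamma> g \<Longrightarrow> pr k f = (if k = g then f else 0)"
  by (rule component_homogeneous[OF dec])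

lemma pr_add: "lin f \<Longrightarrow> lin f' \<Longrightarrow> pr g (f + f') = pr g f + pr g f'"
  by (rule component_add[OF dec]) (simp_all add: lin_add)

lemma pr_lin: "lin f \<Longrightarrow> lin (pr g f)"
  using pr_in \<Gamma>_lin by blast

lemma E_induct [consumes 1, case_names homogeneous add]:
  assumes "lin f" and hom: "\<And>g f. f \<in> \<Gamma> g \<Longrightarrow> P f"
    and add: "\<And>f f'. lin f \<Longrightarrow> lin f' \<Longrightarrow> P f \<Longrightarrow> P f' \<Longrightarrow> P (f + f')"
  shows "P f"
proof -
  let ?A = "{g. pr g f \<noteq> 0}"
  have P0: "P 0" by (rule hom[OF \<Gamma>_zero])
  have "P (\<Sum>g\<in>A. pr g f)" for A :: "'g set"
  proof (induction A rule: infinite_finite_induct)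
    case (infinite A)
    show ?case by (subst sum.infinite[OF infinite]) (rule P0)
  next
    case empty
    show ?case by (subst sum.empty) (rule P0)
  next
    case (insert g A)
    have "P (pr g f + (\<Sum>g\<in>A. pr g f))"
      by (rule add[OF pr_lin lin_sum hom[OF pr_in] insert.IH]) (rule assms(1) pr_lin)+
    then show ?case by (subst sum.insert[OF insert(1,2)])
  qed
  from this[of ?A] show ?thesis
    using component_spec(3)[OF dec, of f] assms(1) by (simp only: mem_Collect_eq)
qed

lemma id_degree: "id \<in> \<Gamma> 0"
proof -
  have "pr 0 id \<circ> f = f" if "lin f" for f
    using that
  proof (induction f rule: E_induct)
    case (homogeneous g f)
    have "f = (\<Sum>k | pr k id \<noteq> 0. pr k id \<circ> f)"
    proof
      fix x
      have "f x = (\<Sum>k | pr k id \<noteq> 0. pr k id) (f x)"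
        using component_spec(3)[OF dec, of id] lin_id by (simp add: fun_eq_iff)
      then show "f x = (\<Sum>k | pr k id \<noteq> 0. pr k id \<circ> f) x" by (simp add: fun_sum_apply)
    qed
    also have "\<dots> = (\<Sum>k\<in>(\<lambda>k. k + g) ` {k. pr k id \<noteq> 0}. pr (k - g) id \<circ> f)"
      by (subst sum.reindex) (simp_all add: inj_on_def)
    finally have f_eq: "f = (\<Sum>k\<in>(\<lambda>k. k + g) ` {k. pr k id \<noteq> 0}. pr (k - g) id \<circ> f)" .
    have "pr g f = (if g \<in> (\<lambda>k. k + g) ` {k. pr k id \<noteq> 0} then pr (g - g) id \<circ> f else 0)"
    proof (rule component_eqI[OF dec, where f = "\<lambda>k. pr (k - g) id \<circ> f"])
      show "f \<in> {f. lin f}" using homogeneous \<Gamma>_lin by simp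
      show "finite ((\<lambda>k. k + g) ` {k. pr k id \<noteq> 0})"
        using component_spec(2)[OF dec, of id] lin_id by simp
      show "f = (\<Sum>k\<in>(\<lambda>k. k + g) ` {k. pr k id \<noteq> 0}. pr (k - g) id \<circ> f)" by (rule f_eq)
      show "pr (k - g) id \<circ> f \<in> \<Gamma> k" for k
        using \<Gamma>_comp[OF pr_in[OF lin_id] homogeneous, of "k - g"] by simp
    qed
    moreover have "pr g f = f" using pr_hom[OF homogeneous, of g] by simp
    ultimately have "f = (if g \<in> (\<lambda>k. k + g) ` {k. pr k id \<noteq> 0} then pr 0 id \<circ> f else 0)"
      by (simp only: diff_self)
    moreover have "pr 0 id \<circ> f = 0" if "g \<notin> (\<lambda>k. k + g) ` {k. pr k id \<noteq> 0}"
    proof -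
      have "pr 0 id = 0" using that by (force simp: image_iff)
      then show ?thesis by (simp add: fun_eq_iff)
    qed
    ultimately show ?case by metis
  next
    case (add f f')
    have "pr 0 id (f x) = f x" "pr 0 id (f' x) = f' x" for x
      using add(3,4)[THEN fun_cong, of x] by (simp_all only: comp_apply)
    then show ?case
      by (intro ext) (simp only: comp_apply plus_fun_apply lin_simps(1)[OF pr_lin[OF lin_id]])
  qed
  from this[OF lin_id] have "pr 0 id = id" by simp
  then show ?thesis using pr_in[OF lin_id] by metis
qed

lemma b2_e [simp]: "k < 8 \<Longrightarrow> b2 (e k) w = 0" "k < 8 \<Longrightarrow> b2 w (e k) = 0"
  using b_ff_kk(7)[of w 1 "e k"] b_ff_kk(8)[of 1 "e k" w] by simp_all

lemma polar_one: obtains y z where "polar Q y z = 1"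
proof -
  obtain v w where vw: "b2 v w = 1" using complex_component_nonzero by blast
  have "polar Q (ff 1 (e 0) + kk 1 v) (ff (1 / n 0) (e 0) + kk 1 w) = 1"
    using vw by (simp add: polar_Q b_add b1_e cubic_eq_iff)
  then show ?thesis by (rule that)
qed

lemma s_eq_0_iff: "(\<forall>v. s l v = 0) \<longleftrightarrow> l = 0"
proof
  assume 0: "\<forall>v. s l v = 0"
  obtain y z where "polar Q y z = 1" by (rule polar_one)
  then show "l = 0" using 0 polar_Q_scale(1)[of y l z] polar_Q_scale(1)[of y 0 0] by simp
qed simp

lemma s_inj: "s l = s m \<longleftrightarrow> l = m"
  using s_eq_0_iff[of "l - m"] by (auto simp: fun_eq_iff S.scale_left_diff_distrib)

text \<open>
  A central operator commutes with \<open>rk x y\<close>; this is evaluated at a vector \<open>z\<close> with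
  \<open>b\<^sub>Q(y, z) = 1\<close>.
\<close>

lemma center_E:
  assumes f: "lin f" and comm: "\<And>f'. lin f' \<Longrightarrow> f \<circ> f' = f' \<circ> f"
  shows "\<exists>l. f = s l"
proof -
  obtain y z where yz: "polar Q y z = 1" by (rule polar_one)
  have "f x = s (polar Q y (f z)) x" for x
    using fun_cong[OF comm[OF lin_rk[of x y]], of z] yz by (simp add: rk_def lin_simps[OF f])
  then show ?thesis by blast
qed

definition \<Lambda> :: "'g \<Rightarrow> 'f cubic set" where "\<Lambda> g = {l. s l \<in> \<Gamma> g}"

text \<open>
  The components of a central element commute with homogeneous elements, by uniqueness of components, and so are
  central. Hence the grading restricts to \<open>L\<close>.
\<close>

lemma pr_s: "\<exists>m. pr g (s l) = s m"
proof (rule center_E)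
  show "pr g (s l) \<circ> f = f \<circ> pr g (s l)" if "lin f" for f
    using that
  proof (induction f rule: E_induct)
    case (homogeneous k f)
    have lf: "lin f" by (rule \<Gamma>_lin[OF homogeneous])
    let ?A = "{g. pr g (s l) \<noteq> 0}"
    have A: "finite ?A" using component_spec(2)[OF dec, of "s l"] lin_s by simp
    have sl: "s l v = (\<Sum>g\<in>?A. pr g (s l) v)" for v
      using fun_cong[OF component_spec(3)[OF dec, of "s l"], of v] lin_s by (simp add: fun_sum_apply)
    have 0: "0 = (\<Sum>g\<in>(\<lambda>g. g + k) ` ?A. (pr (g - k) (s l) \<circ> f) - (f \<circ> pr (g - k) (s l)))"
    proof
      fix v
      have "(\<Sum>g\<in>?A. pr g (s l) (f v) - f (pr g (s l) v)) = s l (f v) - f (s l v)"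
        unfolding sl[of "f v"] sl[of v] by (simp add: sum_subtractf lin_simps[OF lf])
      also have "\<dots> = 0" by (simp add: lin_simps[OF lf])
      finally show "0 v = (\<Sum>g\<in>(\<lambda>g. g + k) ` ?A. (pr (g - k) (s l) \<circ> f) - (f \<circ> pr (g - k) (s l))) v"
        by (simp add: sum.reindex inj_on_def fun_sum_apply fun_diff_def)
    qed
    have hom: "(pr (g - k) (s l) \<circ> f) - (f \<circ> pr (g - k) (s l)) \<in> \<Gamma> g" for g
    proof -
      have 1: "pr (g - k) (s l) \<circ> f \<in> \<Gamma> g"
        using \<Gamma>_comp[OF pr_in[OF lin_s] homogeneous, of "g - k" l] by simp
      have 2: "f \<circ> pr (g - k) (s l) \<in> \<Gamma> g"
        using \<Gamma>_comp[OF homogeneous pr_in[OF lin_s], of "g - k" l] by simp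
      have "(pr (g - k) (s l) \<circ> f) + - (f \<circ> pr (g - k) (s l)) \<in> \<Gamma> g"
        by (rule \<Gamma>_add[OF 1 decomposes_closed(4)[OF dec 2]])
      then show ?thesis by (simp only: add_uminus_conv_diff)
    qed
    have "pr (g + k) 0 = (if g + k \<in> (\<lambda>g. g + k) ` ?A
        then (pr (g + k - k) (s l) \<circ> f) - (f \<circ> pr (g + k - k) (s l)) else 0)"
      by (rule component_eqI[OF dec, where f = "\<lambda>g. (pr (g - k) (s l) \<circ> f) - (f \<circ> pr (g - k) (s l))"])
        (use A lin_zero hom 0 in simp_all)
    moreover have "pr (g + k) 0 = 0" using pr_hom[OF \<Gamma>_zero, of "g + k" "g + k"] by simp
    ultimately have eq: "g + k \<in> (\<lambda>g. g + k) ` ?A \<Longrightarrow>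
        0 = (pr (g + k - k) (s l) \<circ> f) - (f \<circ> pr (g + k - k) (s l))" by metis
    show ?case
    proof (cases "pr g (s l) = 0")
      case True
      then show ?thesis by (intro ext) (simp add: lin_simps[OF lf])
    next
      case False
      then have "0 = (pr g (s l) \<circ> f) - (f \<circ> pr g (s l))" using eq by simp
      then show ?thesis by (metis eq_iff_diff_eq_0)
    qed
  next
    case (add f f')
    then show ?case using pr_lin[OF lin_s, of g l] by (simp add: fun_eq_iff lin_simps)
  qed
qed (rule pr_lin[OF lin_s])

lemma \<Lambda>_closed: "l \<in> \<Lambda> g \<Longrightarrow> m \<in> \<Lambda> g \<Longrightarrow> l + m \<in> \<Lambda> g" "l \<in> \<Lambda> g \<Longrightarrow> of_F c * l \<in> \<Lambda> g"
    "l \<in> \<Lambda> g \<Longrightarrow> m \<in> \<Lambda> k \<Longrightarrow> l * m \<in> \<Lambda> (g + k)" "1 \<in> \<Lambda> 0"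
proof -
  show "l + m \<in> \<Lambda> g" if "l \<in> \<Lambda> g" "m \<in> \<Lambda> g"
  proof -
    have "s l + s m \<in> \<Gamma> g" using that \<Gamma>_add by (simp add: \<Lambda>_def)
    moreover have "s l + s m = s (l + m)" by (simp add: fun_eq_iff S.scale_left_distrib)
    ultimately show ?thesis by (simp add: \<Lambda>_def)
  qed
  show "of_F c * l \<in> \<Lambda> g" if "l \<in> \<Lambda> g"
  proof -
    have "(\<lambda>x. s (of_F c) (s l x)) = s (of_F c * l)" by (simp add: fun_eq_iff)
    then show ?thesis using \<Gamma>_scale[of "s l" g c] that by (simp add: \<Lambda>_def)
  qed
  show "l * m \<in> \<Lambda> (g + k)" if "l \<in> \<Lambda> g" "m \<in> \<Lambda> k"
  proof -
    have "s l \<circ> s m = s (l * m)" by (simp add: fun_eq_iff)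
    then show ?thesis using \<Gamma>_comp[of "s l" g "s m" k] that by (simp add: \<Lambda>_def)
  qed
  have "id = s 1" by (simp add: fun_eq_iff)
  then show "1 \<in> \<Lambda> 0" using id_degree by (simp add: \<Lambda>_def)
qed

lemma \<Lambda>_independent:
  assumes "finite A" "\<And>g. g \<in> A \<Longrightarrow> l g \<in> \<Lambda> g" "(\<Sum>g\<in>A. l g) = 0" "g \<in> A" shows "l g = 0"
proof -
  have "0 = (\<Sum>g\<in>A. s (l g))"
    using assms(3) by (simp add: fun_eq_iff fun_sum_apply flip: S.scale_sum_left)
  then have "pr g 0 = (if g \<in> A then s (l g) else 0)"
  proof (intro component_eqI[OF dec, where f = "\<lambda>g. s (l g)"])
    show "0 \<in> {f. lin f}" by (simp only: mem_Collect_eq lin_zero)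
    show "s (l k) \<in> \<Gamma> k" if "k \<in> A" for k using assms(2)[OF that] by (simp only: \<Lambda>_def mem_Collect_eq)
  qed (use assms in simp_all)
  moreover have "pr g 0 = 0" using pr_hom[OF \<Gamma>_zero, of g g] by simp
  ultimately have "s (l g) = 0" using assms(4) by simp
  then show ?thesis using s_eq_0_iff[of "l g"] by (simp add: fun_eq_iff)
qed

end

text \<open>A three-element subgroup is cyclic, so it is \<open>{0, h, h + h}\<close> with \<open>h\<close> of order 3.\<close>

lemma add_subgroup_card_3:
  fixes H :: "'g::ab_group_add set"
  assumes "add_subgroup H" "card H = 3" "h \<in> H" "h \<noteq> 0"
  shows "h + h + h = 0" "h + h \<noteq> 0" "h + h \<noteq> h" "H = {0, h, h + h}"
proof -
  have H: "0 \<in> H" "\<And>x y. x \<in> H \<Longrightarrow> y \<in> H \<Longrightarrow> x - y \<in> H"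
    using assms(1) unfolding add_subgroup_def by blast+
  have m: "- h \<in> H" using H(2)[OF H(1) assms(3)] by simp
  have fin: "finite H" using assms(2) card.infinite by fastforce
  have "card (H - {0, h}) = 1"
    using fin H(1) assms by (subst card_Diff_subset) auto
  then obtain k where k: "H - {0, h} = {k}" by (rule card_1_singletonE)
  have "k \<in> H - {0, h}" unfolding k by simp
  then have Hk: "k \<noteq> 0" "k \<noteq> h" by simp_all
  have "H = insert 0 (insert h (H - {0, h}))" using H(1) assms(3) by blast
  then have Hk: "H = {0, h, k}" "k \<noteq> 0" "k \<noteq> h" using Hk unfolding k by simp_all
  have hh: "h + h \<noteq> 0"
  proof
    assume "h + h = 0"
    have "k - h \<in> {0, h, k}" using H(2) Hk by blast
    then show False using Hk(2,3) assms(4) \<open>h + h = 0\<close> by (auto simp: diff_eq_eq)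
  qed
  have mk: "- h = k" using m Hk hh assms(4) by (metis add.right_inverse insertE neg_equal_0_iff_equal singletonD)
  have "h - k \<in> {0, h, k}" using H(2) Hk by blast
  then have "h + h \<in> {0, h, k}" using mk by (metis diff_minus_eq_add)
  then have hk: "h + h = k" using hh assms(4) by simp
  show "h + h + h = 0" using hk mk by (metis add.left_inverse)
  show "h + h \<noteq> 0" by (rule hh)
  show "h + h \<noteq> h" using assms(4) by simp
  show "H = {0, h, h + h}" using Hk hk by simp
qed

context trialitarian_graded
begin

text \<open>
  A homogeneous element of \<open>L\<close> of degree \<open>h\<close> and its square are linearly independent, which
  excludes zero divisors; scaled to \<open>(1, c)\<close>, its cube lies in the one-dimensional space \<open>\<Lambda> 0\<close>.
\<close>

lemma type_III_center:
  obtains h \<omega> where "h + h + h = 0" "h \<noteq> 0" "h + h \<noteq> 0" "h + h \<noteq> h"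
    and "\<omega> * \<omega> + \<omega> + 1 = 0" and "Cubic 1 \<omega> \<in> \<Lambda> h"
proof -
  define P where "P = {g. \<exists>l. l \<noteq> 0 \<and> s l \<in> \<Gamma> g}"
  have card: "card (add_subgroup hull P) = 3"
    using typeIII unfolding type_III_def P_def .
  have inter: "add_subgroup (\<Inter>T)" if "\<forall>K\<in>T. add_subgroup K" for T :: "'g set set"
    using that unfolding add_subgroup_def by blast
  have H: "add_subgroup (add_subgroup hull P)" by (rule hull_in[of add_subgroup P, OF inter])
  have "\<not> P \<subseteq> {0}"
  proof
    assume "P \<subseteq> {0}"
    moreover have "add_subgroup {0 :: 'g}" by (simp add: add_subgroup_def)
    ultimately have "add_subgroup hull P \<subseteq> {0}" by (intro hull_minimal)
    then have "card (add_subgroup hull P) \<le> card {0 :: 'g}" by (rule card_mono[rotated]) simp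
    then show False using card by simp
  qed
  then obtain h l where h: "h \<noteq> 0" "l \<noteq> 0" "l \<in> \<Lambda> h" by (auto simp: P_def \<Lambda>_def)
  have "h \<in> add_subgroup hull P" by (rule hull_inc) (use h in \<open>auto simp: P_def \<Lambda>_def\<close>)
  note h3 = add_subgroup_card_3[OF H card this h(1)]
  have ind: "x = 0 \<and> y = 0 \<and> z = 0"
    if "x \<in> \<Lambda> 0" "y \<in> \<Lambda> h" "z \<in> \<Lambda> (h + h)" "x + y + z = 0" for x y z
  proof -
    define f where "f g = (if g = 0 then x else if g = h then y else z)" for g
    have "(\<Sum>g\<in>{0, h, h + h}. f g) = 0"
      using that(4) h(1) h3(2,3) by (simp add: f_def add_ac)
    moreover have "f g \<in> \<Lambda> g" if "g \<in> {0, h, h + h}" for g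
      using that \<open>x \<in> \<Lambda> 0\<close> \<open>y \<in> \<Lambda> h\<close> \<open>z \<in> \<Lambda> (h + h)\<close> h(1) h3(2,3)
      by (elim insertE emptyE) (simp_all add: f_def)
    ultimately have "f g = 0" if "g \<in> {0, h, h + h}" for g
      using \<Lambda>_independent[of "{0, h, h + h}" f g] that by simp
    from this[of 0] this[of h] this[of "h + h"] show ?thesis using h(1) h3(2,3) by (simp add: f_def)
  qed
  define r c0 where "r = fst_part l" and "c0 = snd_part l"
  have l2: "l * l \<in> \<Lambda> (h + h)" and l3: "l * l * l \<in> \<Lambda> 0"
    using \<Lambda>_closed(3)[OF h(3,3)] \<Lambda>_closed(3)[OF \<Lambda>_closed(3)[OF h(3,3)] h(3)] h3(1) by simp_all
  have 0: "0 \<in> \<Lambda> g" for g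
  proof -
    have "s 0 = 0" by (simp add: fun_eq_iff)
    then show ?thesis using \<Gamma>_zero by (simp add: \<Lambda>_def)
  qed
  have r0: "r \<noteq> 0"
  proof
    assume "r = 0"
    then have c0: "c0 \<noteq> 0" using h(2) by (auto simp: r_def c0_def cubic_eq_iff)
    \<comment> \<open>on \<open>0 \<times> K\<close> the relation \<open>c\<^sup>3 = 2 Re c \<cdot> c\<^sup>2 - |c|\<^sup>2 c\<close> is homogeneous only if \<open>c\<^sup>3 = 0\<close>\<close>
    have "l * l * l + of_F (re (c0 * conj c0)) * l + of_F (- 2 * re c0) * (l * l) = 0"
      using \<open>r = 0\<close> by (simp add: cubic_eq_iff r_def c0_def) (simp add: cplx_eq_iff algebra_simps)
    then have "l * l * l = 0" using ind[OF l3 \<Lambda>_closed(2)[OF h(3)] \<Lambda>_closed(2)[OF l2]] by blast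
    then show False using c0 by (simp add: cubic_eq_iff c0_def)
  qed
  define c where "c = c0 * inc (1 / r)"
  define u where "u = Cubic 1 c"
  have "u = of_F (1 / r) * l" using r0 by (simp add: u_def c_def cubic_eq_iff r_def c0_def mult.commute)
  then have u: "u \<in> \<Lambda> h" using \<Lambda>_closed(2)[OF h(3)] by simp
  have u2: "u * u \<in> \<Lambda> (h + h)" and u3: "u * u * u \<in> \<Lambda> 0"
    using \<Lambda>_closed(3)[OF u u] \<Lambda>_closed(3)[OF \<Lambda>_closed(3)[OF u u] u] h3(1) by simp_all
  have u0: "u \<noteq> 0" "u * u \<noteq> 0" by (simp_all add: u_def cubic_eq_iff)
  have imc: "im c \<noteq> 0"
  proof
    assume "im c = 0"
    then have c: "c = inc (re c)" by (simp add: cplx_eq_iff)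
    have "of_F (re c) * 1 + of_F (- 1 - re c) * u + u * u = 0"
      by (simp add: cubic_eq_iff u_def) (subst (2 3 4 5) c, simp add: cplx_eq_iff algebra_simps)
    then have "u * u = 0"
      using ind[OF \<Lambda>_closed(2)[OF \<Lambda>_closed(4)] \<Lambda>_closed(2)[OF u] u2] by blast
    then show False using u0 by simp
  qed
  have \<Lambda>0: "snd_part m = inc (fst_part m)" if m: "m \<in> \<Lambda> 0" for m
  proof -
    define x y0 y1 a N where "x = fst_part m" and "y0 = re (snd_part m) - im (snd_part m) / im c * re c"
      and "y1 = im (snd_part m) / im c" and "a = re c" and "N = re c * re c + im c * im c"
    have "N - 2 * a + 1 = (re c - 1) * (re c - 1) + im c * im c"
      by (simp add: N_def a_def algebra_simps)
    then have D: "N - 2 * a + 1 \<noteq> 0" using imc by (simp add: sum_squares_eq_zero_iff)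
    define t where "t = (x - y0 - y1) / (N - 2 * a + 1)"
    have t: "t * (N - 2 * a + 1) = x - y0 - y1" using D by (simp add: t_def)
    \<comment> \<open>the coordinates of \<open>m\<close> with respect to \<open>1, u, u\<^sup>2\<close>\<close>
    have "m = of_F (y0 + t * N) * 1 + of_F (y1 - 2 * a * t) * u + of_F t * (u * u)"
    proof -
      have "fst_part m = (y0 + t * N) + (y1 - 2 * a * t) + t"
        using t by (simp add: x_def algebra_simps)
      moreover have "snd_part m = inc (y0 + t * N) + inc (y1 - 2 * a * t) * c + inc t * (c * c)"
        using imc by (simp add: cplx_eq_iff y0_def y1_def N_def a_def field_simps)
      ultimately show ?thesis by (simp add: cubic_eq_iff u_def)
    qed
    then have "(of_F (y0 + t * N) * 1 - m) + of_F (y1 - 2 * a * t) * u + of_F t * (u * u) = 0"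
      by (simp add: algebra_simps)
    moreover have "of_F (y0 + t * N) * 1 - m \<in> \<Lambda> 0"
    proof -
      have "of_F (- 1) * m = - m" by (simp add: cubic_eq_iff inc_minus)
      then have "- m \<in> \<Lambda> 0" using \<Lambda>_closed(2)[OF m, of "- 1"] by simp
      then show ?thesis using \<Lambda>_closed(1)[OF \<Lambda>_closed(2)[OF \<Lambda>_closed(4)]] by fastforce
    qed
    ultimately have "of_F (y0 + t * N) * 1 - m = 0"
      using ind[OF _ \<Lambda>_closed(2)[OF u] \<Lambda>_closed(2)[OF u2]] by blast
    then have "m = of_F (y0 + t * N)" by simp
    then show ?thesis by simp
  qed
  have c3: "c * c * c = 1" using \<Lambda>0[OF u3] by (simp add: u_def)
  then have "(c - 1) * (c * c + c + 1) = 0" by (simp add: algebra_simps)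
  moreover have "c - 1 \<noteq> 0" using imc by (auto simp: cplx_eq_iff)
  ultimately have "c * c + c + 1 = 0" by simp
  then show ?thesis using that[OF h3(1) h(1) h3(2,3)] u by (simp add: u_def)
qed

text \<open>
  The data fixed for the rest of the proof: a generator \<open>h\<close> of the degrees of \<open>L\<close>, the
  homogeneous element \<open>(1, \<omega>)\<close>, a finite set \<open>S\<close> of degrees that is stable under
  \<open>h\<close> and contains the support, and a character \<open>\<chi>\<close> that takes the value
  \<open>\<omega>\<close> at \<open>h\<close>.
\<close>

lemma degree_character:
  obtains h \<omega> S \<chi> where "h + h + h = 0" "h + h \<noteq> 0" "h + h \<noteq> h"
    and "\<omega> * \<omega> + \<omega> + 1 = 0" "unitary \<omega>" and "Cubic 1 \<omega> \<in> \<Lambda> h"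
    and "finite S" "\<And>f g. lin f \<Longrightarrow> g \<notin> S \<Longrightarrow> pr g f = 0" "\<And>g. g \<in> S \<Longrightarrow> g + h \<in> S"
    and "\<And>g. unitary (\<chi> g)" "\<And>g k. \<chi> (g + k) = \<chi> g * \<chi> k" "\<chi> h = \<omega>"
proof -
  obtain h \<omega> where h: "h + h + h = 0" "h \<noteq> 0" "h + h \<noteq> 0" "h + h \<noteq> h"
    and \<omega>: "\<omega> * \<omega> + \<omega> + 1 = 0" "Cubic 1 \<omega> \<in> \<Lambda> h" by (rule type_III_center)
  have "(\<omega> - 1) * (\<omega> * \<omega> + \<omega> + 1) = 0" using \<omega> by simp
  then have \<omega>3: "\<omega> * \<omega> * \<omega> = 1" by (simp add: algebra_simps)
  have unit: "unitary \<omega>"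
  proof -
    define r where "r = re (\<omega> * conj \<omega>)"
    have r: "\<omega> * conj \<omega> = inc r" "r \<ge> 0" by (auto simp: r_def cplx_eq_iff)
    have "inc (r * r * r) = (\<omega> * \<omega> * \<omega>) * conj (\<omega> * \<omega> * \<omega>)"
      using r(1) by (simp add: inc_mult conj_mult mult_ac flip: r(1))
    then have "inc (r * r * r) = inc 1" unfolding \<omega>3 by simp
    then have "r * r * r = 1" by (simp only: inc_eq_iff)
    then have "r ^ 3 = 1 ^ 3" by (simp add: power3_eq_cube)
    then have "r = 1" using r(2) power_eq_iff_eq_base[of 3 r 1] by simp
    then show ?thesis using r by simp
  qed
  obtain S0 where S0: "finite S0" "\<And>f g. lin f \<Longrightarrow> g \<notin> S0 \<Longrightarrow> pr g f = 0"
    using E_grading_finite[OF dec \<Gamma>_scale] by blast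
  define S where "S = S0 \<union> (\<lambda>g. g + h) ` S0 \<union> (\<lambda>g. g + h + h) ` S0"
  have S: "g + h \<in> S" if "g \<in> S" for g
    using that h(1) by (auto simp: S_def add.assoc)
  obtain \<chi> :: "'g \<Rightarrow> 'f cplx" where \<chi>: "\<And>g. unitary (\<chi> g)" "\<And>g k. \<chi> (g + k) = \<chi> g * \<chi> k" "\<chi> h = \<omega>"
    using unitary_character_order3[OF h(1,2) unit \<omega>3] by blast
  show ?thesis
    by (rule that[OF h(1,3,4) \<omega>(1) unit \<omega>(2) _ _ S \<chi>]) (use S0 in \<open>auto simp: S_def\<close>)
qed

end

section \<open>The grading modulo the degrees of the centre\<close>

(* These rules also match the functions on their own, which they turn into abstractions. *)
declare comp_apply [simp del] plus_fun_apply [simp del] zero_fun_apply [simp del]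

lemmas pointwise = comp_apply plus_fun_apply zero_fun_apply

locale trialitarian_character = trialitarian_graded s \<beta> Q e \<Gamma>
  for s :: "'f::real_closed_field cubic \<Rightarrow> 'v::ab_group_add \<Rightarrow> 'v" and \<beta> Q and e :: "nat \<Rightarrow> 'v"
    and \<Gamma> :: "'g::ab_group_add \<Rightarrow> ('v \<Rightarrow> 'v) set" +
  fixes h :: 'g and \<omega> :: "'f cplx" and S :: "'g set" and \<chi> :: "'g \<Rightarrow> 'f cplx"
  assumes h3: "h + h + h = 0" and hh: "h + h \<noteq> 0" "h + h \<noteq> h"
    and \<omega>: "\<omega> * \<omega> + \<omega> + 1 = 0" "unitary \<omega>" and \<Lambda>_h: "Cubic 1 \<omega> \<in> \<Lambda> h"
    and S: "finite S" "\<And>f g. lin f \<Longrightarrow> g \<notin> S \<Longrightarrow> pr g f = 0" "\<And>g. g \<in> S \<Longrightarrow> g + h \<in> S"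
    and \<chi>: "\<And>g. unitary (\<chi> g)" "\<And>g k. \<chi> (g + k) = \<chi> g * \<chi> k" "\<chi> h = \<omega>"
begin

definition u :: "'f cubic" where "u = Cubic 1 \<omega>"

lemma u_parts [simp]: "fst_part u = 1" "snd_part u = \<omega>" by (simp_all add: u_def)

lemma conj_\<omega>: "conj \<omega> = \<omega> * \<omega>"
proof -
  have "(\<omega> * \<omega> + \<omega> + 1) * (\<omega> - 1) = 0" using \<omega> by simp
  then have "\<omega> * \<omega> * \<omega> = 1" by (simp add: algebra_simps)
  then have "\<omega> * (\<omega> * \<omega>) * conj \<omega> = conj \<omega>" by (simp add: mult_ac)
  then show ?thesis using \<omega>(2) by (metis mult.assoc mult.commute mult.right_neutral)
qed

lemma \<omega>3: "\<omega> * \<omega> * \<omega> = 1" using \<omega>(2) conj_\<omega> by (simp add: mult.assoc)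

lemma \<chi>_0 [simp]: "\<chi> 0 = 1"
proof -
  have "\<chi> 0 * \<chi> 0 = \<chi> 0" using \<chi>(2)[of 0 0] by simp
  moreover have "\<chi> 0 \<noteq> 0" using \<chi>(1)[of 0] by auto
  ultimately show ?thesis by simp
qed

lemma \<chi>_nonzero [simp]: "\<chi> g \<noteq> 0" using \<chi>(1)[of g] by auto

lemma \<chi>_cancel [simp]: "\<chi> g * \<chi> (- g) = 1" "\<chi> (- g) * \<chi> g = 1"
  using \<chi>(2)[of g "- g"] \<chi>(2)[of "- g" g] by simp_all

text \<open>
  The discrete Fourier transform of length three, applied to the images \<open>b, c, conj c\<close> of
  \<open>(b, c)\<close> under the three homomorphisms from \<open>L\<close> to \<open>K\<close>.
\<close>

lemma L_coordinates: "l = of_F ((fst_part l + 2 * re (snd_part l)) / 3)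
    + of_F ((fst_part l + 2 * re (snd_part l * conj \<omega>)) / 3) * u
    + of_F ((fst_part l + 2 * re (snd_part l * \<omega>)) / 3) * (u * u)"
proof -
  have sum0: "1 + \<omega> + \<omega> * \<omega> = 0" using \<omega>(1) by (simp add: add_ac)
  have re3: "re (1 + \<omega> + \<omega> * \<omega>) = 0" "im (1 + \<omega> + \<omega> * \<omega>) = 0" by (simp_all only: sum0 re_im_simps)
  have cw: "re \<omega> = re (\<omega> * \<omega>)" "- im \<omega> = im (\<omega> * \<omega>)"
    using arg_cong[OF conj_\<omega>, of re] arg_cong[OF conj_\<omega>, of im] by simp_all
  have rw: "re \<omega> = - 1 / 2" using re3(1) cw(1) by (simp del: re_im_ring_simps(3) add: field_simps)
  define y where "y = snd_part l"
  have c: "inc (2 * re z) = z + conj z" for z :: "'f cplx" by (simp add: add_conj)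
  have "inc ((fst_part l + 2 * re y) / 3) + inc ((fst_part l + 2 * re (y * conj \<omega>)) / 3) * \<omega>
      + inc ((fst_part l + 2 * re (y * \<omega>)) / 3) * (\<omega> * \<omega>)
    = (inc (fst_part l) * (1 + \<omega> + \<omega> * \<omega>) + (y + conj y)
       + (y * conj \<omega> + conj y * \<omega>) * \<omega> + (y * \<omega> + conj y * conj \<omega>) * (\<omega> * \<omega>)) / 3"
    by (simp only: inc_divide inc_add c conj_mult conj_simps inc_numeral) (simp add: field_simps)
  also have "\<dots> = (conj y * (1 + \<omega> * \<omega> + \<omega> * \<omega> * \<omega> * \<omega>) + y * (1 + \<omega> * \<omega> * \<omega> + \<omega> * \<omega> * \<omega>)) / 3"
    unfolding sum0 conj_\<omega> by (simp add: algebra_simps)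
  also have "\<dots> = y" unfolding \<omega>3 using sum0 by (simp add: add_ac)
  finally have "snd_part l = inc ((fst_part l + 2 * re y) / 3) + inc ((fst_part l + 2 * re (y * conj \<omega>)) / 3) * \<omega>
      + inc ((fst_part l + 2 * re (y * \<omega>)) / 3) * (\<omega> * \<omega>)" by (simp only: y_def)
  moreover have "fst_part l = (fst_part l + 2 * re y) / 3 + (fst_part l + 2 * re (y * conj \<omega>)) / 3
      + (fst_part l + 2 * re (y * \<omega>)) / 3"
  proof -
    have "re (y * conj \<omega>) + re (y * \<omega>) = 2 * re \<omega> * re y" by (simp add: algebra_simps)
    then have "re (y * conj \<omega>) = - re y - re (y * \<omega>)" unfolding rw by simp
    then show ?thesis by (simp add: field_simps del: re_im_ring_simps)
  qed
  ultimately show ?thesis by (simp add: cubic_eq_iff y_def del: re_im_ring_simps)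
qed

lemma L_induct: assumes "P 1" and "\<And>l. P l \<Longrightarrow> P (u * l)" and "\<And>c l. P l \<Longrightarrow> P (of_F c * l)"
    and "\<And>l m. P l \<Longrightarrow> P m \<Longrightarrow> P (l + m)" shows "P (l :: 'f cubic)"
proof -
  have P: "P (of_F c * l)" if "P l" for c l using assms(3) that .
  have u: "P u" using assms(2)[OF assms(1)] by simp
  have "P (of_F p * 1 + of_F q * u + of_F r * (u * u))" for p q r
    by (intro assms(4) P assms(1) u assms(2)[OF u])
  then show ?thesis by (subst L_coordinates) simp
qed

lemma h_add: "g + h + h + h = g" "g + (h + h) + h = g" "g + h + (h + h) = g"
  using h3 by (simp_all add: add.assoc)

lemma su_\<Gamma>: "f \<in> \<Gamma> g \<Longrightarrow> s u \<circ> f \<in> \<Gamma> (g + h)"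
  using \<Gamma>_comp[of "s u" h f g] \<Lambda>_h by (simp add: u_def \<Lambda>_def add.commute)

lemma comp_add: "lin f \<Longrightarrow> f \<circ> (a + b) = (f \<circ> a) + (f \<circ> b)" "(a + b) \<circ> f' = (a \<circ> f') + (b \<circ> f')"
  by (rule ext; simp add: pointwise lin_simps)+

lemma comp_zero: "lin f \<Longrightarrow> f \<circ> 0 = 0" "0 \<circ> f' = 0"
  by (rule ext; simp add: pointwise lin_simps)+

lemma pr_u: "lin f \<Longrightarrow> pr (g + h) (s u \<circ> f) = s u \<circ> pr g f"
proof (induction f rule: E_induct)
  case (homogeneous k f)
  show ?case
    using pr_hom[OF su_\<Gamma>[OF homogeneous], of "g + h"] pr_hom[OF homogeneous, of g]
    by (cases "g = k") (simp_all only: if_True if_False add_right_cancel comp_zero(1)[OF lin_s] refl)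
next
  case (add f f')
  then show ?case
    by (simp only: comp_add(1)[OF lin_s] pr_add lin_comp lin_s)
qed

lemma pr_F: "lin f \<Longrightarrow> pr g (s (of_F c) \<circ> f) = s (of_F c) \<circ> pr g f"
proof (induction f rule: E_induct)
  case (homogeneous k f)
  have "s (of_F c) \<circ> f \<in> \<Gamma> k" using \<Gamma>_scale[OF homogeneous, of c] by (simp add: comp_def)
  from pr_hom[OF this, of g] pr_hom[OF homogeneous, of g] show ?case
    by (cases "g = k") (simp_all only: if_True if_False comp_zero(1)[OF lin_s] refl)
next
  case (add f f')
  then show ?case by (simp only: comp_add(1)[OF lin_s] pr_add lin_comp lin_s)
qed

text \<open>Congruence modulo \<open>{0, h, h + h}\<close>.\<close>

definition cong :: "'g \<Rightarrow> 'g \<Rightarrow> bool" where "cong g k \<longleftrightarrow> k = g \<or> k = g + h \<or> k = g + h + h"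

lemma cong_refl [simp]: "cong g g" by (simp add: cong_def)

lemma cong_sym: "cong g k \<Longrightarrow> cong k g"
  unfolding cong_def by (auto simp: h_add h3)

lemma cong_trans: "cong g k \<Longrightarrow> cong k l \<Longrightarrow> cong g l"
  unfolding cong_def by (auto simp: h_add h3)

lemma cong_right: "cong k k' \<Longrightarrow> cong g k \<longleftrightarrow> cong g k'"
  using cong_trans cong_sym by blast

lemma cong_add: "cong g k \<Longrightarrow> cong g' k' \<Longrightarrow> cong (g + g') (k + k')"
proof -
  have *: "h + (h + h) = 0" "h + (h + (h + x)) = x" for x using h3 by (simp_all flip: add.assoc)
  show "cong g k \<Longrightarrow> cong g' k' \<Longrightarrow> cong (g + g') (k + k')"
    unfolding cong_def by (auto simp: ac_simps *)
qed

lemma cong_minus: "cong g k \<Longrightarrow> cong (- g) (- k)"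
proof -
  have *: "- h = h + h" using h3 by (metis minus_unique add.commute)
  show "cong g k \<Longrightarrow> cong (- g) (- k)"
    unfolding cong_def by (auto simp: * h_add h3)
qed

lemma cong_h [simp]: "cong g (g + h)" "cong (g + h) g" "cong g (g + h + h)"
  using h3 by (auto simp: cong_def)

lemma \<chi>_cong: "cong g k \<Longrightarrow> \<chi> g * \<chi> g * \<chi> g = \<chi> k * \<chi> k * \<chi> k"
proof -
  have *: "\<chi> (g + h) * \<chi> (g + h) * \<chi> (g + h) = \<chi> g * \<chi> g * \<chi> g" for g
  proof -
    have "\<chi> (g + h) * \<chi> (g + h) * \<chi> (g + h) = \<chi> g * \<chi> g * \<chi> g * (\<omega> * \<omega> * \<omega>)"
      by (simp only: \<chi>(2,3) mult_ac)
    then show ?thesis by (simp only: \<omega>3 mult_1_right)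
  qed
  assume "cong g k"
  then show "\<chi> g * \<chi> g * \<chi> g = \<chi> k * \<chi> k * \<chi> k"
    unfolding cong_def using *[of g] *[of "g + h"] by (elim disjE) (simp_all only:)
qed

text \<open>
  The projections for the coarser grading by the quotient group. Multiplication by \<open>u\<close> only permutes the
  three summands, so in contrast to \<open>pr g\<close> they are linear over \<open>L\<close>.
\<close>

definition qp :: "'g \<Rightarrow> ('v \<Rightarrow> 'v) \<Rightarrow> 'v \<Rightarrow> 'v" where
  "qp g f = pr g f + pr (g + h) f + pr (g + h + h) f"

lemma lin_qp: "lin f \<Longrightarrow> lin (qp g f)"
  by (simp add: qp_def lin_add pr_lin)

lemma qp_add: "lin f \<Longrightarrow> lin f' \<Longrightarrow> qp g (f + f') = qp g f + qp g f'"
  by (simp only: qp_def pr_add) (simp only: ac_simps)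

lemma qp_hom: "f \<in> \<Gamma> k \<Longrightarrow> qp g f = (if cong g k then f else 0)"
proof -
  have ne: "g \<noteq> g + h" "g + h \<noteq> g + h + h" "g \<noteq> g + h + h"
    using hh by (auto simp: add.assoc)
  assume f: "f \<in> \<Gamma> k"
  show "qp g f = (if cong g k then f else 0)"
    unfolding qp_def pr_hom[OF f] cong_def using ne
    by (cases "k = g"; cases "k = g + h"; cases "k = g + h + h") simp_all
qed

lemma qp_s: "lin f \<Longrightarrow> qp g (s l \<circ> f) = s l \<circ> qp g f"
proof (induction l rule: L_induct)
  case 1
  have "s 1 \<circ> f = f" for f :: "'v \<Rightarrow> 'v" by (simp add: pointwise fun_eq_iff)
  then show ?case by (simp only:)
next
  case (2 l)
  have lf: "lin (s l \<circ> f)" by (intro lin_comp lin_s 2)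
  have "s (u * l) \<circ> f = s u \<circ> (s l \<circ> f)" for f :: "'v \<Rightarrow> 'v" by (simp add: pointwise fun_eq_iff)
  moreover have "qp g (s u \<circ> (s l \<circ> f)) = s u \<circ> qp g (s l \<circ> f)"
    unfolding qp_def using pr_u[OF lf, of g] pr_u[OF lf, of "g + h"] pr_u[OF lf, of "g + h + h"]
    by (simp only: h_add comp_add(1)[OF lin_s]) (simp only: ac_simps)
  ultimately show ?case using 2(1)[OF 2(2)] by (simp only:)
next
  case (3 c l)
  have lf: "lin (s l \<circ> f)" by (intro lin_comp lin_s 3)
  have "s (of_F c * l) \<circ> f = s (of_F c) \<circ> (s l \<circ> f)" for f :: "'v \<Rightarrow> 'v" by (simp add: pointwise fun_eq_iff)
  moreover have "qp g (s (of_F c) \<circ> (s l \<circ> f)) = s (of_F c) \<circ> qp g (s l \<circ> f)"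
    unfolding qp_def pr_F[OF lf] comp_add(1)[OF lin_s] by (rule refl)
  ultimately show ?case using 3(1)[OF 3(2)] by (simp only:)
next
  case (4 l m)
  have "s (l + m) \<circ> f = (s l \<circ> f) + (s m \<circ> f)" for f :: "'v \<Rightarrow> 'v" by (simp add: pointwise fun_eq_iff S.scale_left_distrib)
  then show ?case using 4(1)[OF 4(3)] 4(2)[OF 4(3)] qp_add[OF lin_comp[OF lin_s 4(3)] lin_comp[OF lin_s 4(3)], of g l m]
    by (simp only:)
qed

lemma qp_kk: assumes "lin f" shows "qp g (kk c \<circ> f) = kk c \<circ> qp g f"
proof -
  have "kk c \<circ> f = s (Cubic 0 c) \<circ> f" for f :: "'v \<Rightarrow> 'v" by (simp add: pointwise fun_eq_iff kk_def)
  then show ?thesis using qp_s[OF assms, of g "Cubic 0 c"] by (simp only:)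
qed

text \<open>The operators of degree \<open>g\<close> modulo \<open>{0, h, h + h}\<close>.\<close>

definition EH :: "'g \<Rightarrow> ('v \<Rightarrow> 'v) set" where "EH g = {f. lin f \<and> qp g f = f}"

lemma EH_lin: "f \<in> EH g \<Longrightarrow> lin f" by (simp add: EH_def)

lemma EH_add: "f \<in> EH g \<Longrightarrow> f' \<in> EH g \<Longrightarrow> f + f' \<in> EH g"
  unfolding EH_def by (simp only: mem_Collect_eq lin_add qp_add simp_thms)

lemma EH_zero: "0 \<in> EH g"
  using qp_hom[OF \<Gamma>_zero, of g g] by (simp only: EH_def mem_Collect_eq lin_zero simp_thms cong_refl if_True)

lemma EH_sum: "(\<And>i. i \<in> I \<Longrightarrow> f i \<in> EH g) \<Longrightarrow> sum f I \<in> EH g"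
proof (induction I rule: infinite_finite_induct)
  case (insert i I)
  have "f i + sum f I \<in> EH g" by (intro EH_add insert.IH insert.prems) simp_all
  then show ?case using insert by simp
qed (simp_all add: EH_zero)

lemma EH_kk: "f \<in> EH g \<Longrightarrow> kk c \<circ> f \<in> EH g"
  unfolding EH_def by (simp only: mem_Collect_eq lin_comp lin_kk qp_kk simp_thms)

lemma \<Gamma>_EH: "f \<in> \<Gamma> k \<Longrightarrow> cong g k \<Longrightarrow> f \<in> EH g"
  unfolding EH_def using qp_hom \<Gamma>_lin by simp

lemma qp_EH: "lin f \<Longrightarrow> qp g f \<in> EH g"
  unfolding qp_def by (intro EH_add \<Gamma>_EH[OF pr_in]) simp_all

lemma EH_qp: "f \<in> EH k \<Longrightarrow> qp g f = (if cong g k then f else 0)"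
proof -
  assume f: "f \<in> EH k"
  have l: "lin (pr k f)" "lin (pr (k + h) f)" "lin (pr (k + h + h) f)" using EH_lin[OF f] pr_lin by blast+
  have c: "cong g (k + h) \<longleftrightarrow> cong g k" "cong g (k + h + h) \<longleftrightarrow> cong g k"
    using cong_right[of k "k + h" g] cong_right[of k "k + h + h" g] by simp_all
  have p: "pr i f \<in> \<Gamma> i" for i by (rule pr_in[OF EH_lin[OF f]])
  have "qp g f = qp g (qp k f)" using f by (simp add: EH_def)
  also have "\<dots> = (if cong g k then qp k f else 0)"
    unfolding qp_def[of k f] using l p
    by (simp only: qp_add lin_add qp_hom[OF p] c) (cases "cong g k"; simp only: if_True if_False add_0)
  finally show "qp g f = (if cong g k then f else 0)" using f by (simp add: EH_def)
qed

lemma EH_cong: assumes "f \<in> EH g" "cong g k" shows "f \<in> EH k"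
proof -
  have "qp k f = f" using EH_qp[OF assms(1), of k] cong_sym[OF assms(2)] by simp
  then show ?thesis using EH_lin[OF assms(1)] by (simp only: EH_def mem_Collect_eq simp_thms)
qed

lemma EH_comp: "f \<in> EH g \<Longrightarrow> f' \<in> EH k \<Longrightarrow> f \<circ> f' \<in> EH (g + k)"
proof -
  assume f: "f \<in> EH g" and f': "f' \<in> EH k"
  have hom: "a \<circ> b \<in> EH (g + k)" if "a \<in> \<Gamma> i" "b \<in> \<Gamma> j" "cong g i" "cong k j" for a b i j
    using \<Gamma>_EH[OF \<Gamma>_comp[OF that(1,2)] cong_add[OF that(3,4)]] .
  have pf: "pr i f \<in> \<Gamma> i" and pf': "pr i f' \<in> \<Gamma> i" for i
    by (rule pr_in[OF EH_lin[OF f]], rule pr_in[OF EH_lin[OF f']])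
  have "qp g f \<circ> qp k f' \<in> EH (g + k)"
    unfolding qp_def comp_add(2) comp_add(1)[OF \<Gamma>_lin[OF pf]]
    by (intro EH_add hom[OF pf pf']) simp_all
  then show ?thesis using f f' by (simp add: EH_def)
qed

lemma adj_EH: "f \<in> EH g \<Longrightarrow> adj f \<in> EH g"
proof -
  assume f: "f \<in> EH g"
  have pf: "adj (pr i f) \<in> \<Gamma> i" "lin (pr i f)" for i
    using \<Gamma>_adj pr_in EH_lin[OF f] \<Gamma>_lin by blast+
  have "adj (qp g f) \<in> EH g"
    unfolding qp_def using pf(2) by (simp only: adj_add lin_add) (intro EH_add \<Gamma>_EH[OF pf(1)]; simp)
  then show ?thesis using f by (simp add: EH_def)
qed

lemma S_shift: "g \<in> S \<longleftrightarrow> g + h \<in> S"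
  using S(3)[of g] S(3)[of "g + h"] S(3)[of "g + h + h"] by (auto simp: h_add)

lemma sum_pr: "lin f \<Longrightarrow> (\<Sum>g\<in>S. pr g f) = f"
  using component_sum_superset[OF dec, of f S] S by simp

lemma sum_S_shift: "(\<Sum>g\<in>S. F (g + h)) = (\<Sum>g\<in>S. F g :: 'a::comm_monoid_add)"
proof -
  have "(\<lambda>g. g + h) ` S = S"
  proof
    show "S \<subseteq> (\<lambda>g. g + h) ` S"
    proof
      fix g assume "g \<in> S"
      then have "g + h + h \<in> S" using S(3) by blast
      then show "g \<in> (\<lambda>g. g + h) ` S" using h_add(1)[of g] by (metis image_eqI)
    qed
  qed (use S(3) in blast)
  then show ?thesis using sum.reindex[of "\<lambda>g. g + h" S F] by (simp add: inj_on_def comp_def)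
qed

lemma sum_qp: "lin f \<Longrightarrow> (\<Sum>g\<in>S. qp g f) = f + f + f"
  unfolding qp_def sum.distrib
  using sum_S_shift[of "\<lambda>g. pr g f"] sum_S_shift[of "\<lambda>g. pr (g + h) f"] sum_pr[of f] by (simp only:)

lemma qp_outside: "lin f \<Longrightarrow> g \<notin> S \<Longrightarrow> qp g f = 0"
  unfolding qp_def using S(2)[of f g] S(2)[of f "g + h"] S(2)[of f "g + h + h"]
    S_shift[of g] S_shift[of "g + h"] by simp

subsection \<open>Identifying the two components of \<open>E\<close>\<close>

text \<open>
  The factor \<open>\<chi>(- g)\<close> compensates the factor \<open>\<omega>\<close> that multiplication by
  \<open>u\<close> has on the complex component. So \<open>\<Psi> f\<close> depends on the restriction of
  \<open>f\<close> to \<open>V\<^sub>1\<close> only, and \<open>\<Psi>\<close> embeds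
  \<open>End\<^sub>F(V\<^sub>1)\<close> into \<open>End\<^sub>K(V\<^sub>2)\<close>.
\<close>

definition \<Psi> :: "('v \<Rightarrow> 'v) \<Rightarrow> 'v \<Rightarrow> 'v" where "\<Psi> f v = (\<Sum>g\<in>S. kk (\<chi> (- g)) (pr g f v))"

lemma \<Psi>_hom: assumes f: "f \<in> \<Gamma> g" shows "\<Psi> f v = kk (\<chi> (- g)) (f v)"
proof -
  have "\<Psi> f v = (\<Sum>k\<in>S. if k = g then kk (\<chi> (- g)) (f v) else 0)"
    unfolding \<Psi>_def pr_hom[OF f] by (rule sum.cong) (auto simp: zero_fun_apply)
  also have "\<dots> = kk (\<chi> (- g)) (f v)"
  proof (cases "g \<in> S")
    case False
    then have "f = 0" using S(2)[OF \<Gamma>_lin[OF f], of g] pr_hom[OF f, of g] by simp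
    then show ?thesis using False by (auto simp: zero_fun_apply intro!: sum.neutral)
  qed (use S(1) in simp)
  finally show ?thesis .
qed

lemma \<Psi>_add: "lin f \<Longrightarrow> lin f' \<Longrightarrow> \<Psi> (f + f') v = \<Psi> f v + \<Psi> f' v"
  by (simp add: \<Psi>_def pr_add ff_kk_add sum.distrib pointwise)

lemma kk_\<Psi> [simp]: "kk 1 (\<Psi> f v) = \<Psi> f v" by (simp add: \<Psi>_def ff_kk_sum)

lemma lin_\<Psi>: "lin f \<Longrightarrow> lin (\<Psi> f)"
  by (rule linI) (simp_all add: \<Psi>_def lin_simps[OF pr_lin] ff_kk_add sum.distrib S.scale_sum_right mult.commute)

lemma \<Psi>_kk [simp]: "lin f \<Longrightarrow> \<Psi> f (kk 1 v) = \<Psi> f v"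
  using lin_simps(4)[OF lin_\<Psi>, of f 1 v] by simp

lemma \<Psi>_comp: "lin f \<Longrightarrow> lin f' \<Longrightarrow> \<Psi> (f \<circ> f') v = \<Psi> f (\<Psi> f' v)"
proof (induction f arbitrary: v rule: E_induct)
  case (homogeneous g f)
  note f = homogeneous(1)
  from homogeneous(2) show ?case
  proof (induction f' arbitrary: v rule: E_induct)
    case (homogeneous k f')
    show ?case
    proof -
      have "\<Psi> (f \<circ> f') v = kk (\<chi> (- (g + k))) (f (f' v))"
        using \<Psi>_hom[OF \<Gamma>_comp[OF f homogeneous], of v] by (simp only: comp_apply[of f f' v])
      then show ?thesis
      by (simp add: \<Psi>_hom[OF f] \<Psi>_hom[OF homogeneous] lin_simps[OF \<Gamma>_lin[OF f]] mult.commute flip: \<chi>(2))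
    qed
  next
    case (add a b)
    note l = \<Gamma>_lin[OF f]
    show ?case
      using add by (simp add: comp_add(1)[OF l] \<Psi>_add lin_comp l lin_simps[OF lin_\<Psi>[OF l]])
  qed
next
  case (add a b)
  then show ?case by (simp add: comp_add(2) \<Psi>_add lin_comp)
qed

lemma \<Psi>_s: "lin f \<Longrightarrow> \<Psi> (s l \<circ> f) v = kk (inc (fst_part l)) (\<Psi> f v)"
proof (induction l arbitrary: f v rule: L_induct)
  case 1
  have "s 1 \<circ> f = f" by (simp add: pointwise fun_eq_iff)
  then show ?case by (simp only: u_parts cubic_simps inc_simps kk_\<Psi>)
next
  case (2 l)
  have "\<Psi> (s u \<circ> f) v = \<Psi> f v" if "lin f" for f v
    using that
  proof (induction f arbitrary: v rule: E_induct)
    case (homogeneous g f)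
    have "\<chi> (- (g + h)) * \<omega> = \<chi> (- g) * (\<chi> (- h) * \<chi> h)"
      by (simp add: \<chi>(2,3) mult_ac flip: \<chi>(2))
    then show ?case
      using \<Psi>_hom[OF su_\<Gamma>[OF homogeneous], of v]
      by (simp only: comp_apply[of "s u" f v]) (simp add: \<Psi>_hom[OF homogeneous])
  next
    case (add a b)
    then show ?case by (simp add: comp_add(1)[OF lin_s] \<Psi>_add lin_comp lin_s)
  qed
  moreover have "s (u * l) \<circ> f = s u \<circ> (s l \<circ> f)" by (simp add: pointwise fun_eq_iff)
  ultimately show ?case using 2 by (simp add: lin_comp lin_s)
next
  case (3 c l)
  have "\<Psi> (s (of_F c) \<circ> f) v = kk (inc c) (\<Psi> f v)" if "lin f" for f v
    using that by (simp add: \<Psi>_def pr_F ff_kk_sum mult.commute comp_apply)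
  moreover have "s (of_F c * l) \<circ> f = s (of_F c) \<circ> (s l \<circ> f)" by (simp add: pointwise fun_eq_iff)
  ultimately show ?case using 3 by (simp add: lin_comp lin_s inc_mult)
next
  case (4 l m)
  have "s (l + m) \<circ> f = (s l \<circ> f) + (s m \<circ> f)" by (simp add: pointwise fun_eq_iff S.scale_left_distrib)
  then show ?case using 4 by (simp add: \<Psi>_add lin_comp lin_s inc_add kk_add_left)
qed

lemma \<Psi>_id: "\<Psi> id v = kk 1 v"
  using \<Psi>_hom[OF id_degree, of v] by simp

lemma \<Psi>_ff: "\<Psi> (ff r) v = kk (inc r) v"
proof -
  have "ff r = s (Cubic r 0) \<circ> id" by (simp add: pointwise fun_eq_iff ff_def)
  then show ?thesis using \<Psi>_s[OF lin_id, of "Cubic r 0" v] by (simp add: \<Psi>_id)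
qed

lemma \<Psi>_EH: "f \<in> EH g \<Longrightarrow> \<Psi> f \<in> EH g"
proof -
  assume f: "f \<in> EH g"
  have "\<Psi> f = (\<Sum>k\<in>S. kk (\<chi> (- k)) \<circ> pr k f)" by (rule ext) (simp add: pointwise \<Psi>_def fun_sum_apply)
  moreover have "kk (\<chi> (- k)) \<circ> pr k f \<in> EH g" for k
  proof (cases "cong g k")
    case True
    then show ?thesis by (intro EH_kk \<Gamma>_EH[OF pr_in[OF EH_lin[OF f]]])
  next
    case False
    have "pr k f = pr k (qp g f)" using f by (simp add: EH_def)
    also have "\<dots> = 0"
      unfolding qp_def using False EH_lin[OF f]
      by (simp only: pr_add lin_add pr_lin pr_hom[OF pr_in] cong_def de_Morgan_disj if_False add_0)
    finally have "kk (\<chi> (- k)) \<circ> pr k f = 0" by (simp only: comp_zero(1)[OF lin_kk])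
    then show ?thesis by (simp only: EH_zero)
  qed
  ultimately show ?thesis by (simp only:) (intro EH_sum)
qed

lemma b2_\<Psi>: "lin f \<Longrightarrow> b2 (\<Psi> f v) w = b2 v (\<Psi> (adj f) w)"
proof (induction f rule: E_induct)
  case (homogeneous g f)
  then show ?case
    by (simp add: \<Psi>_hom[OF homogeneous] \<Psi>_hom[OF \<Gamma>_adj[OF homogeneous]] b_adj \<Gamma>_lin)
next
  case (add a b)
  then show ?case by (simp add: \<Psi>_add adj_add adj_spec(1) b_add)
qed

lemma rk_e_e: "j < 8 \<Longrightarrow> k < 8 \<Longrightarrow> rk x (e j) (e k) = (if j = k then ff (n j) x else 0)"
  by (simp add: rk_eq b1_e)

lemma rk_s: "rk (s l x) y = s l \<circ> rk x y" by (rule ext) (simp add: comp_apply rk_def mult.commute)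

text \<open>
  \<open>\<Psi>\<close> restricts to a homomorphism from \<open>End\<^sub>F(V\<^sub>1)\<close> to \<open>End\<^sub>K(V\<^sub>2)\<close>.  As in the Skolem--Noether
  theorem, applying it to operators of rank one yields an equivariant map \<open>V\<^sub>1 \<rightarrow> V\<^sub>2\<close>.
\<close>

lemma equivariant_isometry_exists:
  "\<exists>\<tau>. (\<forall>x y. \<tau> (x + y) = \<tau> x + \<tau> y) \<and> (\<forall>x. kk 1 (\<tau> x) = \<tau> x)
     \<and> (\<forall>f x. lin f \<longrightarrow> \<tau> (f x) = \<Psi> f (\<tau> x)) \<and> (\<forall>x y. b2 (\<tau> x) (\<tau> y) = inc (b1 x y))"
proof -
  have "\<exists>w. \<Psi> (rk (e 0) (e 0)) w \<noteq> 0"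
  proof (rule ccontr)
    assume "\<not> ?thesis"
    then have 0: "\<Psi> (rk (e 0) (e 0)) w = 0" for w by blast
    have zk: "\<Psi> (rk (e k) (e k)) w = 0" if k: "k < 8" for k w
    proof -
      have "rk (e k) (e 0) \<circ> (rk (e 0) (e 0) \<circ> rk (e 0) (e k)) = rk (ff (n 0 * n 0) (e k)) (e k)"
        using k by (simp add: comp_rk[OF lin_rk] rk_e_e lin_simps[OF lin_rk])
      also have "\<dots> = s (Cubic (n 0 * n 0) 0) \<circ> rk (e k) (e k)" by (simp only: ff_def rk_s)
      finally have eq: "rk (e k) (e 0) \<circ> (rk (e 0) (e 0) \<circ> rk (e 0) (e k)) = s (Cubic (n 0 * n 0) 0) \<circ> rk (e k) (e k)" .
      have "\<Psi> (rk (e k) (e 0) \<circ> (rk (e 0) (e 0) \<circ> rk (e 0) (e k))) w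
          = \<Psi> (rk (e k) (e 0)) (\<Psi> (rk (e 0) (e 0)) (\<Psi> (rk (e 0) (e k)) w))"
        by (simp add: \<Psi>_comp lin_comp lin_rk)
      then have "kk (inc (n 0 * n 0)) (\<Psi> (rk (e k) (e k)) w)
          = \<Psi> (rk (e k) (e 0)) (\<Psi> (rk (e 0) (e 0)) (\<Psi> (rk (e 0) (e k)) w))"
        unfolding eq by (simp add: \<Psi>_s[OF lin_rk])
      also have "\<dots> = 0" using lin_simps(5)[OF lin_\<Psi>[OF lin_rk]] by (simp add: 0)
      finally have "kk 1 (\<Psi> (rk (e k) (e k)) w) = kk 1 0"
        by (intro kk_cancel[of "inc (n 0 * n 0)"]) simp_all
      then show ?thesis by simp
    qed
    have "ff 1 = (\<Sum>k<8. s (Cubic (1 / n k) 0) \<circ> rk (e k) (e k))"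
    proof
      fix x
      show "ff 1 x = (\<Sum>k<8. s (Cubic (1 / n k) 0) \<circ> rk (e k) (e k)) x"
        by (subst e_expand) (simp add: comp_apply fun_sum_apply rk_eq b_sym(1)[of x] S.scale_right_distrib)
    qed
    moreover have "\<Psi> (\<Sum>k\<in>I. s (Cubic (1 / n k) 0) \<circ> rk (e k) (e k)) w = 0" if "I \<subseteq> {..<8}" for I w
    proof -
      have "finite I" using that finite_subset by blast
      then show ?thesis
        using that
      proof (induction I rule: finite_induct)
        case empty
        have "\<Psi> 0 w = kk (\<chi> (- 0)) ((0 :: 'v \<Rightarrow> 'v) w)" by (rule \<Psi>_hom[OF \<Gamma>_zero])
        moreover have "(0 :: 'v \<Rightarrow> 'v) w = 0" by (simp add: zero_fun_apply)
        ultimately show ?case by (simp only: ff_kk_zero sum.empty)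
      next
        case (insert k I)
        have "lin (s (Cubic (1 / n k) 0) \<circ> rk (e k) (e k))" "lin (\<Sum>k\<in>I. s (Cubic (1 / n k) 0) \<circ> rk (e k) (e k))"
          by (intro lin_sum lin_comp lin_s lin_rk)+
        from \<Psi>_add[OF this] show ?case
          using insert by (simp add: \<Psi>_s[OF lin_rk] zk)
      qed
    qed
    ultimately have "\<Psi> (ff 1) w = 0" for w by simp
    then have "kk 1 w = 0" for w by (simp add: \<Psi>_ff)
    then show False using complex_component_nonzero by (metis b_ff_kk(5) b_zero(3) mult_1 zero_neq_one)
  qed
  then obtain w where w: "\<Psi> (rk (e 0) (e 0)) w \<noteq> 0" by blast
  define v0 where "v0 = \<Psi> (rk (e 0) (e 0)) w"
  define t where "t x = \<Psi> (rk (ff 1 x) (e 0)) v0" for x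
  have t_add: "t (x + y) = t x + t y" for x y
    by (simp add: t_def ff_kk_add rk_add \<Psi>_add lin_rk)
  have kk_t: "kk 1 (t x) = t x" for x by (simp add: t_def)
  have t_eq: "t (f x) = \<Psi> f (t x)" if "lin f" for f x
    using that by (simp add: t_def lin_rk flip: \<Psi>_comp comp_rk lin_simps(3))
  have t_ff: "t (ff r x) = kk (inc r) (t x)" for r x
    using t_eq[OF lin_ff] by (simp add: \<Psi>_ff)
  have t0: "t (e 0) = kk (inc (n 0)) v0"
  proof -
    have "t (e 0) = \<Psi> (rk (e 0) (e 0) \<circ> rk (e 0) (e 0)) w"
      by (simp add: t_def v0_def \<Psi>_comp lin_rk)
    also have "rk (e 0) (e 0) \<circ> rk (e 0) (e 0) = s (Cubic (n 0) 0) \<circ> rk (e 0) (e 0)"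
      by (simp add: comp_rk[OF lin_rk] rk_e_e ff_def rk_s)
    finally show ?thesis by (simp add: \<Psi>_s lin_rk v0_def)
  qed
  have kk_v0: "kk 1 v0 = v0" by (simp add: v0_def)
  have t0_nz: "t (e 0) \<noteq> 0"
  proof
    assume "t (e 0) = 0"
    then have "kk 1 v0 = kk 1 0" unfolding t0 by (intro kk_cancel[of "inc (n 0)"]) simp_all
    then show False using w kk_v0 by (simp add: v0_def)
  qed
  define C where "C = b2 (t (e 0)) (t (e 0))"
  have b2_t: "inc (n 0) * b2 (t x) (t y) = inc (b1 x y) * C" for x y
  proof -
    have "kk (inc (n 0)) (t x) = t (rk (ff 1 x) (e 0) (e 0))"
      by (simp add: rk_e_e t_ff)
    then have "inc (n 0) * b2 (t x) (t y) = b2 (t (rk (ff 1 x) (e 0) (e 0))) (t y)" by (metis b_ff_kk(6))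
    also have "\<dots> = b2 (t (e 0)) (t (rk (e 0) (ff 1 x) y))"
      by (simp add: t_eq[OF lin_rk] b2_\<Psi>[OF lin_rk] adj_rk)
    also have "rk (e 0) (ff 1 x) y = ff (b1 x y) (e 0)" by (simp add: rk_eq)
    finally show ?thesis by (simp add: t_ff C_def)
  qed
  have C: "C \<noteq> 0"
  proof
    assume C0: "C = 0"
    then have b0: "b2 (t x) (t y) = 0" for x y using b2_t[of x y] by simp
    have "kindep (\<lambda>k. t (e k))"
      unfolding kindep_def
    proof (intro conjI allI impI)
      fix c j assume sum0: "(\<Sum>k<8. kk (c k) (t (e k))) = 0" and j: "(j :: nat) < 8"
      have "0 = \<Psi> (rk (e 0) (e j)) (\<Sum>k<8. kk (c k) (t (e k)))"
        unfolding sum0 by (simp add: lin_simps[OF lin_\<Psi>[OF lin_rk]])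
      also have "\<dots> = (\<Sum>k<8. kk (c k) (t (rk (e 0) (e j) (e k))))"
        by (simp add: lin_simps[OF lin_\<Psi>[OF lin_rk]] t_eq[OF lin_rk])
      also have "\<dots> = (\<Sum>k<8. if k = j then kk (c j * inc (n j)) (t (e 0)) else 0)"
        by (rule sum.cong) (use j t_ff[of 0 0] in \<open>auto simp: rk_e_e t_ff\<close>)
      finally have "kk (c j * inc (n j)) (t (e 0)) = 0" using j by simp
      then have "c j * inc (n j) = 0"
        using kk_cancel[of "c j * inc (n j)" "t (e 0)" 0] t0_nz kk_t by auto
      then show "c j = 0" using j by simp
    qed (rule kk_t)
    then have "b2 (t (e 0)) z = 0" for z
    proof -
      obtain c where c: "kk 1 z = (\<Sum>k<8. kk (c k) (t (e k)))"
        using kindep_spans[OF \<open>kindep _\<close>] by blast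
      have "b2 (t (e 0)) (kk 1 z) = 0" unfolding c by (simp add: b_sum b0)
      then show ?thesis by simp
    qed
    then have "kk 1 (t (e 0)) = 0" by (intro b2_nondegenerate) simp
    then show False using t0_nz kk_t by simp
  qed
  obtain d where d: "d * d = inc (n 0) / C" using cplx_sqrt by blast
  define \<tau> where "\<tau> x = kk d (t x)" for x
  have "b2 (\<tau> x) (\<tau> y) = inc (b1 x y)" for x y
  proof -
    have "b2 (\<tau> x) (\<tau> y) = (d * d) * b2 (t x) (t y)" by (simp add: \<tau>_def mult.assoc)
    also have "\<dots> = (inc (n 0) * b2 (t x) (t y)) / C" by (simp add: d)
    finally show ?thesis using C by (simp add: b2_t)
  qed
  moreover have "\<tau> (f x) = \<Psi> f (\<tau> x)" if "lin f" for f x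
    by (simp add: \<tau>_def t_eq[OF that] lin_simps[OF lin_\<Psi>[OF that]])
  moreover have "\<tau> (x + y) = \<tau> x + \<tau> y" "kk 1 (\<tau> x) = \<tau> x" for x y
    by (simp_all add: \<tau>_def t_add ff_kk_add)
  ultimately show ?thesis by blast
qed

end

section \<open>The trialitarian structure in terms of \<open>J\<close>\<close>

locale trialitarian_isometry = trialitarian_character s \<beta> Q e \<Gamma> h \<omega> S \<chi>
  for s :: "'f::real_closed_field cubic \<Rightarrow> 'v::ab_group_add \<Rightarrow> 'v" and \<beta> Q and e :: "nat \<Rightarrow> 'v"
    and \<Gamma> :: "'g::ab_group_add \<Rightarrow> ('v \<Rightarrow> 'v) set" and h \<omega> S \<chi> +
  fixes \<tau> :: "'v \<Rightarrow> 'v"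
  assumes \<tau>_add: "\<And>x y. \<tau> (x + y) = \<tau> x + \<tau> y" and kk_\<tau> [simp]: "\<And>x. kk 1 (\<tau> x) = \<tau> x"
    and \<tau>_lin: "\<And>f x. lin f \<Longrightarrow> \<tau> (f x) = \<Psi> f (\<tau> x)"
    and b2_\<tau>: "\<And>x y. b2 (\<tau> x) (\<tau> y) = inc (b1 x y)"
begin

lemma \<tau>_ff [simp]: "\<tau> (ff r x) = kk (inc r) (\<tau> x)"
  by (simp add: \<tau>_lin[OF lin_ff] \<Psi>_ff)

lemma \<tau>_kk [simp]: "\<tau> (kk c x) = 0"
proof -
  have "\<tau> (kk c x) = \<tau> (ff 1 (kk c x) + kk c x) - \<tau> (ff 1 (kk c x))" by (simp only: \<tau>_add add_diff_cancel_left')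
  have "kk c = s (Cubic 0 c) \<circ> id" by (rule ext) (simp add: kk_def comp_apply)
  then have "\<Psi> (kk c) v = 0" for v using \<Psi>_s[OF lin_id, of "Cubic 0 c" v] by simp
  then show ?thesis by (simp add: \<tau>_lin[OF lin_kk])
qed

lemma \<tau>_zero [simp]: "\<tau> 0 = 0" using \<tau>_ff[of 0 0] by simp

lemma \<tau>_sum: "\<tau> (sum g A) = (\<Sum>i\<in>A. \<tau> (g i))"
  by (induction A rule: infinite_finite_induct) (simp_all add: \<tau>_add)

lemma J_\<tau> [simp]: "J (\<tau> x) w = 0"
  using J_zero(3)[of 1 "\<tau> x" w] by simp

lemma b1_\<tau> [simp]: "b1 (\<tau> x) y = 0" "b1 y (\<tau> x) = 0"
  using b_ff_kk(4)[of 1 "\<tau> x" y] b_ff_kk(3)[of y 1 "\<tau> x"] by simp_all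

lemma ff_\<tau> [simp]: "ff r (\<tau> x) = 0"
  using ff_kk_comp(3)[of r 1 "\<tau> x"] by simp

lemma \<tau>_expand: "\<tau> x = (\<Sum>k<8. kk (inc (b1 x (e k) / n k)) (\<tau> (e k)))"
proof -
  have "\<tau> x = \<tau> (ff 1 x)" by simp
  then show ?thesis by (subst (asm) e_expand) (simp add: \<tau>_sum)
qed

lemma J_expand: "J x w = (\<Sum>k<8. kk (inc (b1 x (e k) / n k)) (J (e k) w))"
  using arg_cong[OF e_expand[of x], of "\<lambda>x. J x w"] by (simp add: J_sum)

lemma kindep_\<tau>: "kindep (\<lambda>k. \<tau> (e k))"
  unfolding kindep_def
proof (intro conjI allI impI)
  fix c j assume sum0: "(\<Sum>k<8. kk (c k) (\<tau> (e k))) = 0" and j: "(j :: nat) < 8"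
  have "0 = b2 (\<Sum>k<8. kk (c k) (\<tau> (e k))) (\<tau> (e j))" by (simp add: sum0)
  also have "\<dots> = (\<Sum>k<8. if k = j then c j * inc (n j) else 0)"
    unfolding b_sum by (rule sum.cong) (use j in \<open>auto simp: b2_\<tau> b1_e\<close>)
  finally show "c j = 0" using j by simp
qed simp

lemma b2_expand: "kk 1 w = (\<Sum>k<8. kk (b2 w (\<tau> (e k)) / inc (n k)) (\<tau> (e k)))"
proof -
  obtain c where c: "kk 1 w = (\<Sum>k<8. kk (c k) (\<tau> (e k)))" using kindep_spans[OF kindep_\<tau>] by blast
  have "b2 w (\<tau> (e j)) = c j * inc (n j)" if j: "j < 8" for j
  proof -
    have "b2 w (\<tau> (e j)) = b2 (kk 1 w) (\<tau> (e j))" by simp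
    also have "\<dots> = (\<Sum>k<8. if k = j then c j * inc (n j) else 0)"
      unfolding c b_sum by (rule sum.cong) (use j in \<open>auto simp: b2_\<tau> b1_e\<close>)
    finally show ?thesis using j by simp
  qed
  then show ?thesis unfolding c by (intro sum.cong) simp_all
qed

lemma b2_expand_right: "b2 v w = (\<Sum>k<8. b2 v (\<tau> (e k)) * b2 w (\<tau> (e k)) / inc (n k))"
proof -
  have "b2 v w = b2 v (kk 1 w)" by simp
  then show ?thesis by (subst (asm) b2_expand) (simp add: b_sum mult.commute)
qed

lemma \<tau>_basis_eqI:
  assumes "lin f" "lin g" "\<And>k. k < 8 \<Longrightarrow> f (\<tau> (e k)) = g (\<tau> (e k))"
  shows "f (kk 1 w) = g (kk 1 w)"
  unfolding b2_expand[of w] using assms by (simp add: lin_simps)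

lemma b2_\<tau>_eqI: assumes "\<And>c. b2 (\<tau> c) v = b2 (\<tau> c) w" shows "kk 1 v = kk 1 w"
  unfolding b2_expand[of v] b2_expand[of w] using assms by (simp add: b_sym(2)[of v] b_sym(2)[of w])

subsection \<open>The product on \<open>V \<otimes> K\<close>\<close>

text \<open>
  \<open>V \<otimes> K\<close> is the sum of the three components \<open>\<epsilon> (V \<otimes> K)\<close> for the idempotents \<open>\<epsilon>\<close> of
  \<open>L \<otimes> K = K \<times> K \<times> K\<close>.  Semilinearity of \<open>*\<close> leaves only the products of each component with the
  next one, and these are given by the polarization of \<open>\<beta>\<close>.
\<close>

abbreviation sK :: "'f cubic cplx \<Rightarrow> 'v cplx \<Rightarrow> 'v cplx" where "sK \<equiv> ext_bilin s"

lemma sK_simps: "re (sK t x) = s (re t) (re x) - s (im t) (im x)"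
  "im (sK t x) = s (re t) (im x) + s (im t) (re x)"
  by (simp_all add: ext_bilin_def)

lemma sK_mult: "sK t (sK t' x) = sK (t * t') x"
  by (simp add: cplx_eq_iff sK_simps S.scale_right_distrib S.scale_right_diff_distrib
      S.scale_left_distrib S.scale_left_diff_distrib algebra_simps)

definition eps1 :: "'f cubic cplx" where "eps1 = Cplx (Cubic 1 0) 0"
definition eps2 :: "'f cubic cplx" where "eps2 = Cplx (Cubic 0 (1 / 2)) (Cubic 0 (- imag_unit / 2))"
definition eps3 :: "'f cubic cplx" where "eps3 = Cplx (Cubic 0 (1 / 2)) (Cubic 0 (imag_unit / 2))"

lemmas eps_defs = eps1_def eps2_def eps3_def

lemma half_conj: "conj (1 / 2 :: 'f cplx) = 1 / 2" "conj (imag_unit / 2 :: 'f cplx) = - imag_unit / 2"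
proof -
  have "conj (2 :: 'f cplx) = 2" using conj_simps(4)[of "2 :: 'f"] by simp
  then show "conj (1 / 2 :: 'f cplx) = 1 / 2" "conj (imag_unit / 2 :: 'f cplx) = - imag_unit / 2"
    by (simp_all add: conj_divide)
qed

lemma to_K3_eps: "to_K3 eps1 = (1, 0, 0)" "to_K3 eps2 = (0, 1, 0)" "to_K3 eps3 = (0, 0, 1)"
  "to_K3 (Cplx 0 1 :: 'f cubic cplx) = (imag_unit, imag_unit, imag_unit)"
proof -
  have I: "imag_unit * imag_unit / 2 = (- 1 / 2 :: 'f cplx)" by simp
  show "to_K3 eps1 = (1, 0, 0)" "to_K3 eps2 = (0, 1, 0)" "to_K3 eps3 = (0, 0, 1)"
    "to_K3 (Cplx 0 1 :: 'f cubic cplx) = (imag_unit, imag_unit, imag_unit)"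
    by (simp_all add: to_K3_def Let_def eps_defs half_conj conj_minus I)
qed

lemma to_K3_rho: "to_K3 (rho (t :: 'f cubic cplx)) = (case to_K3 t of (x, y, z) \<Rightarrow> (y, z, x))"
  unfolding rho_def by (rule surj_f_inv_f) (rule bij_is_surj[OF bij_to_K3])

lemma to_K3_inject: "to_K3 t = to_K3 t' \<Longrightarrow> t = (t' :: 'f cubic cplx)"
  using bij_is_inj[OF bij_to_K3] by (rule injD)

lemma rho_eps: "rho eps1 = eps3" "rho eps2 = eps1" "rho eps3 = eps2"
  "rho (Cplx 0 1) = (Cplx 0 1 :: 'f cubic cplx)"
  by (rule to_K3_inject; simp add: to_K3_rho to_K3_eps)+

lemma eps_mult: "eps1 * eps2 = 0" "eps1 * eps3 = 0" "eps2 * eps1 = 0" "eps2 * eps3 = 0" "eps3 * eps1 = 0"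
    "eps3 * eps2 = 0"
  by (simp_all add: eps_defs cplx_eq_iff cubic_eq_iff)

definition E1 :: "'v \<Rightarrow> 'v cplx" where "E1 x = Cplx (ff 1 x) 0"
definition E2 :: "'v \<Rightarrow> 'v cplx" where "E2 w = Cplx (kk (1 / 2) w) (kk (- imag_unit / 2) w)"
definition E3 :: "'v \<Rightarrow> 'v cplx" where "E3 w = Cplx (kk (1 / 2) w) (kk (imag_unit / 2) w)"

lemma re_im_E [simp]: "re (E1 x) = ff 1 x" "im (E1 x) = 0" "re (E2 x) = kk (1 / 2) x"
  "im (E2 x) = kk (- imag_unit / 2) x" "re (E3 x) = kk (1 / 2) x" "im (E3 x) = kk (imag_unit / 2) x"
  by (simp_all add: E1_def E2_def E3_def)

lemma re_im_eps [simp]: "re eps1 = Cubic 1 0" "im eps1 = 0" "re eps2 = Cubic 0 (1 / 2)"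
  "im eps2 = Cubic 0 (- imag_unit / 2)" "re eps3 = Cubic 0 (1 / 2)" "im eps3 = Cubic 0 (imag_unit / 2)"
  by (simp_all add: eps_defs)

lemma sK_E: "sK eps1 (E1 x) = E1 x" "sK eps2 (E2 x) = E2 x" "sK eps3 (E3 x) = E3 x"
proof -
  have I: "imag_unit * imag_unit / 4 = (- 1 / 4 :: 'f cplx)" by simp
  have q: "kk (1 / 4) x + kk (1 / 4) x = kk (1 / 2) x" "kk (imag_unit / 4) x + kk (imag_unit / 4) x = kk (imag_unit / 2) x"
    "- kk (imag_unit / 4) x - kk (imag_unit / 4) x = - kk (imag_unit / 2) x"
    by (simp_all flip: kk_add_left kk_minus_left kk_diff_left)
  show "sK eps1 (E1 x) = E1 x" "sK eps2 (E2 x) = E2 x" "sK eps3 (E3 x) = E3 x"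
    by (simp_all add: cplx_eq_iff sK_simps I kk_minus_left q)
qed

lemma inc_E: "inc x = E1 x + E2 x + E3 x"
proof -
  have "kk (1 / 2) x + kk (1 / 2) x = kk 1 x" by (simp flip: kk_add_left)
  then show ?thesis by (simp add: cplx_eq_iff add.assoc ff_kk_split kk_minus_left)
qed

lemma E_sum: "E3 (sum g A) = (\<Sum>i\<in>A. E3 (g i))"
  by (simp add: cplx_eq_iff ff_kk_sum re_sum im_sum)

lemma polar_ext_quad: "polar (ext_quad \<beta>) x y = ext_bilin (polar \<beta>) x y"
  by (simp add: cplx_eq_iff polar_def[of "ext_quad \<beta>"] ext_quad_def ext_bilin_def polar_beta_add)
    (simp add: polar_def algebra_simps)

lemma beta_E1_E2: "ext_bilin (polar \<beta>) (E1 x) (E2 w) = E3 (J x w)"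
proof -
  have p: "polar \<beta> (ff 1 x) (kk c w) = kk (conj c) (J x w)" for c
    using J_kk[of x c w] by (simp add: J_def)
  have z: "polar \<beta> 0 y = 0" for y using polar_beta_add(2)[of 0 0 y] by simp
  show ?thesis by (simp add: cplx_eq_iff ext_bilin_def p z half_conj conj_minus del: J_kk)
qed

lemma beta_E3_E1: "ext_bilin (polar \<beta>) (E3 w) (E1 x) = E2 (J x w)"
proof -
  have p: "polar \<beta> (kk c w) (ff 1 x) = kk (conj c) (J x w)" for c
    using J_kk[of x c w] polar_sym[of \<beta> "kk c w"] by (simp add: J_def)
  have z: "polar \<beta> y 0 = 0" for y using polar_beta_add(1)[of y 0 0] by simp
  show ?thesis by (simp add: cplx_eq_iff ext_bilin_def p z half_conj)
qed

text \<open>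
  The product of the second and the third component, which lies in the first one. Only its pairing with
  \<open>V\<^sub>1\<close> matters.
\<close>

definition HK :: "'v \<Rightarrow> 'v \<Rightarrow> 'v cplx" where "HK v w = ext_bilin (polar \<beta>) (E2 v) (E3 w)"

lemma HK_parts: "ff 1 (re (HK v w)) = re (HK v w)" "ff 1 (im (HK v w)) = im (HK v w)"
  "b1 c (re (HK v w)) = re (b2 v (J c w))" "b1 c (im (HK v w)) = im (b2 v (J c w))"
proof -
  have p: "polar \<beta> (kk a v) (kk b w) = hh (kk a v) (kk b w)" for a b by (simp add: hh_def)
  have I4: "imag_unit / 2 * (imag_unit / 2 * x) = - x / 4" "imag_unit / 2 * (x / 2) = imag_unit * x / 4" for x :: "'f cplx"
    by (simp_all add: field_simps flip: mult.assoc)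
  show "ff 1 (re (HK v w)) = re (HK v w)" "ff 1 (im (HK v w)) = im (HK v w)"
    by (simp_all add: HK_def ext_bilin_def p ff_kk_diff ff_kk_add)
  have quarter: "re (x / 4) = re x / 4" "im (x / 4) = im x / 4" for x :: "'f cplx"
  proof -
    have i4: "inc (1 / 4) = (1 / 4 :: 'f cplx)" unfolding inc_divide by simp
    have "x / 4 = inc (1 / 4) * x" unfolding i4 by simp
    from arg_cong[OF this, of re] arg_cong[OF this, of im]
    show "re (x / 4) = re x / 4" "im (x / 4) = im x / 4"
      by (simp_all only: re_im_ring_simps re_im_inc)
  qed
  have r1: "b2 (kk (1 / 2) v) (J c (kk (1 / 2) w)) = b2 v (J c w) / 4"
    "b2 (kk (- imag_unit / 2) v) (J c (kk (imag_unit / 2) w)) = - (b2 v (J c w) / 4)"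
    "b2 (kk (1 / 2) v) (J c (kk (imag_unit / 2) w)) = - imag_unit * b2 v (J c w) / 4"
    "b2 (kk (- imag_unit / 2) v) (J c (kk (1 / 2) w)) = - imag_unit * b2 v (J c w) / 4"
    by (simp_all add: half_conj field_simps flip: mult.assoc)
  show "b1 c (re (HK v w)) = re (b2 v (J c w))"
    unfolding HK_def ext_bilin_def p cplx.sel re_im_E b_diff b1_hh_re r1 re_im_simps quarter by simp
  show "b1 c (im (HK v w)) = im (b2 v (J c w))"
    unfolding HK_def ext_bilin_def p cplx.sel re_im_E b_add b1_hh_re r1 re_im_simps quarter by simp
qed

context
  fixes star assumes star: "triality_product s \<beta> Q star"
begin

lemmas star_unfolded = star[unfolded triality_product_def Let_def]

lemmas star_add = star_unfolded[THEN conjunct1, rule_format]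
  star_unfolded[THEN conjunct2, THEN conjunct1, rule_format]
lemmas star_sK = star_unfolded[THEN conjunct2, THEN conjunct2, THEN conjunct1, rule_format]
  star_unfolded[THEN conjunct2, THEN conjunct2, THEN conjunct2, THEN conjunct1, rule_format]
lemmas star_self = star_unfolded[THEN conjunct2, THEN conjunct2, THEN conjunct2, THEN conjunct2,
    THEN conjunct1, rule_format]

lemma sK_zero: "sK 0 x = 0" by (simp add: cplx_eq_iff sK_simps)

lemma star_zero:
  assumes "sK t x = x" "sK t' y = y" "rho t * rho (rho t') = 0" shows "star x y = 0"
proof -
  have "star x y = star (sK t x) (sK t' y)" using assms by simp
  also have "\<dots> = sK (rho t * rho (rho t')) (star x y)"
    by (simp only: star_sK sK_mult mult.commute)
  finally show ?thesis using assms(3) by (simp add: sK_zero)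
qed

lemma star_polar: "star x y + star y x = ext_bilin (polar \<beta>) x y"
proof -
  have "star (x + y) (x + y) = ext_quad \<beta> (x + y)" by (rule star_self)
  then show ?thesis
    unfolding polar_ext_quad [symmetric] polar_def star_add by (simp add: star_self algebra_simps)
qed

lemma star_E: "star (E1 x) (E1 y) = 0" "star (E1 x) (E3 y) = 0" "star (E2 x) (E1 y) = 0"
  "star (E2 x) (E2 y) = 0" "star (E3 x) (E2 y) = 0" "star (E3 x) (E3 y) = 0"
  "star (E1 x) (E2 w) = E3 (J x w)" "star (E3 w) (E1 x) = E2 (J x w)" "star (E2 v) (E3 w) = HK v w"
proof -
  show 0: "star (E1 x) (E1 y) = 0" "star (E1 x) (E3 y) = 0" "star (E2 x) (E1 y) = 0"
    "star (E2 x) (E2 y) = 0" "star (E3 x) (E2 y) = 0" "star (E3 x) (E3 y) = 0" for x y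
    by (rule star_zero, rule sK_E, rule sK_E, simp add: rho_eps eps_mult)+
  show "star (E1 x) (E2 w) = E3 (J x w)"
    using star_polar[of "E1 x" "E2 w"] by (simp add: 0 beta_E1_E2)
  show "star (E3 w) (E1 x) = E2 (J x w)"
    using star_polar[of "E3 w" "E1 x"] by (simp add: 0 beta_E3_E1)
  show "star (E2 v) (E3 w) = HK v w"
    using star_polar[of "E2 v" "E3 w"] by (simp add: 0 HK_def)
qed

lemma star_inc: "star (E3 v) (inc y) = E2 (J y v)" "star (inc x) (E2 w) = E3 (J x w)"
  "star (E1 x) (inc y) = E3 (J x y)" "star (inc v) (E3 w) = HK v w" "star (E2 v) (inc w) = HK v w"
  "star (inc v) (E1 x) = E2 (J x v)"
  by (simp_all add: inc_E star_add star_E)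

end

text \<open>
  A basis of \<open>V\<close> over \<open>L\<close> and its dual with respect to \<open>b\<^sub>Q\<close>.
\<close>

definition basis :: "nat \<Rightarrow> 'v" where "basis k = e k + \<tau> (e k)"
definition cobasis :: "nat \<Rightarrow> 'v" where "cobasis k = s (of_F (1 / n k)) (basis k)"

lemma expand_rk: assumes "lin f" shows "f = (\<Sum>k<8. rk (f (basis k)) (cobasis k))"
proof
  fix z
  have "z = ff 1 z + kk 1 z" by (simp add: ff_kk_split)
  also have "\<dots> = (\<Sum>k<8. ff (b1 z (e k) / n k) (e k) + kk (b2 z (\<tau> (e k)) / inc (n k)) (\<tau> (e k)))"
    unfolding e_expand[of z] b2_expand[of z] sum.distrib ..
  also have "\<dots> = (\<Sum>k<8. rk (basis k) (cobasis k) z)"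
    by (rule sum.cong) (simp_all add: rk_eq basis_def cobasis_def b_add ff_kk_add b_sym(1)[of z] b_sym(2)[of z] inc_divide)
  finally have z: "z = (\<Sum>k<8. rk (basis k) (cobasis k) z)" .
  have "f z = (\<Sum>k<8. f (rk (basis k) (cobasis k) z))" by (subst z) (simp only: lin_simps(8)[OF assms])
  then show "f z = (\<Sum>k<8. rk (f (basis k)) (cobasis k)) z"
    by (simp add: fun_sum_apply rk_def lin_simps[OF assms])
qed

text \<open>
  The action of \<open>\<alpha> (\<kappa> f)\<close> on the third component of \<open>V \<otimes> K\<close>; it
  extends \<open>rk x y \<mapsto> J x J y\<close>.
\<close>

definition A :: "('v \<Rightarrow> 'v) \<Rightarrow> 'v \<Rightarrow> 'v" where
  "A f w = (\<Sum>k<8. kk (inc (1 / n k)) (J (f (e k)) (J (e k) w)))"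

text \<open>
  The three components of the condition that \<open>\<alpha> \<circ> \<kappa>\<close> maps \<open>\<Gamma> g\<close> to \<open>\<Gamma> g \<otimes> K\<close>.  They involve the
  same two elements \<open>f', f''\<close>, and it is this coupling that determines the behaviour of \<open>\<chi>\<close>.
\<close>

lemma alpha_components:
  assumes f: "f \<in> \<Gamma> g"
  obtains f' f'' where "f' \<in> \<Gamma> g" "f'' \<in> \<Gamma> g"
    and "\<And>w. A f w = kk 1 (f' w) - kk imag_unit (f'' w)"
    and "\<And>c x. Cplx (b1 c (f' x)) (b1 c (f'' x)) = (\<Sum>k<8. b2 (f (\<tau> (e k))) (J c (J x (\<tau> (e k)))) / inc (n k))"
    and "\<And>v. kk 1 (f' v) + kk imag_unit (f'' v)
      = (\<Sum>k<8. \<Sum>l<8. kk (b2 v (J (e l) (\<tau> (e k))) / (inc (n k) * inc (n l))) (J (e l) (f (\<tau> (e k)))))"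
proof -
  obtain star \<kappa> \<alpha> C where star: "triality_product s \<beta> Q star" and \<kappa>: "canonical_map s Q \<kappa>"
    and \<alpha>: "trialitarian_map s Q star \<alpha>" and \<kappa>_deg: "\<forall>g. \<kappa> ` \<Gamma> g \<subseteq> C g"
    and \<alpha>_deg: "\<forall>g. \<alpha> ` C g \<subseteq> grading_EK \<Gamma> g"
    using tg[unfolded trialitarian_grading_III_def, THEN conjunct2, THEN conjunct2, THEN conjunct2]
    by (elim exE conjE) (rule that; assumption)
  note st = star_inc[OF star] star_add[OF star]
  have lf: "lin f" by (rule \<Gamma>_lin[OF f])
  have \<kappa>_carrier: "\<kappa> f \<in> carrier (cliff0_alg s Q)" if "lin f" for f
    using \<kappa> that unfolding canonical_map_def by (auto simp: hom_def Pi_def)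
  have \<kappa>_add: "\<kappa> (f + f') = \<kappa> f \<oplus>\<^bsub>cliff0_alg s Q\<^esub> \<kappa> f'" if "lin f" "lin f'" for f f'
    using \<kappa> that unfolding canonical_map_def by (auto simp: hom_def)
  have \<alpha>_add: "\<alpha> (a \<oplus>\<^bsub>cliff0_alg s Q\<^esub> b) z = \<alpha> a z + \<alpha> b z"
    if "a \<in> carrier (cliff0_alg s Q)" "b \<in> carrier (cliff0_alg s Q)" for a b z
  proof -
    have "\<alpha> \<in> ring_hom (cliff0_alg s Q) (EK_alg s)" using \<alpha> unfolding trialitarian_map_def by blast
    from ring_hom_add[OF this that] show ?thesis by (simp add: End_alg_def)
  qed
  have A0_add: "\<alpha> (\<kappa> (f + f')) z = \<alpha> (\<kappa> f) z + \<alpha> (\<kappa> f') z" if "lin f" "lin f'" for f f' z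
    using that by (simp only: \<kappa>_add \<alpha>_add \<kappa>_carrier)
  have A0_zero: "\<alpha> (\<kappa> 0) z = 0" for z
    using A0_add[OF lin_zero lin_zero, of z] by simp
  have A0_sum: "\<alpha> (\<kappa> (sum r I)) z = (\<Sum>k\<in>I. \<alpha> (\<kappa> (r k)) z)" if "\<And>k. lin (r k)" for r z and I :: "nat set"
    by (induction I rule: infinite_finite_induct) (simp_all add: A0_zero A0_add lin_sum that)
  have A0_rk: "\<alpha> (\<kappa> (rk x y)) z = star (inc x) (star z (inc y))" for x y z
  proof -
    have "rk x y = (\<lambda>z. s (polar Q y z) x)" by (rule ext) (simp add: rk_def)
    then have "\<kappa> (rk x y) = cliff_prod s Q x y" using \<kappa> unfolding canonical_map_def by metis
    then show ?thesis using \<alpha> unfolding trialitarian_map_def by simp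
  qed
  have A0: "\<alpha> (\<kappa> f) z = (\<Sum>k<8. star (inc (f (basis k))) (star z (inc (cobasis k))))" for z
    by (subst expand_rk[OF lf]) (simp only: A0_sum lin_rk A0_rk)
  have "\<alpha> (\<kappa> f) \<in> grading_EK \<Gamma> g" using f \<kappa>_deg \<alpha>_deg by blast
  then obtain f' f'' where f': "f' \<in> \<Gamma> g" "f'' \<in> \<Gamma> g"
    and ext: "\<alpha> (\<kappa> f) = ext_bilin (\<lambda>f v. f v) (Cplx f' f'')"
    unfolding grading_EK_def by blast
  have eval: "(\<Sum>k<8. star (inc (f (basis k))) (star z (inc (cobasis k))))
      = Cplx (f' (re z) - f'' (im z)) (f' (im z) + f'' (re z))" for z
    unfolding A0 [symmetric] ext by (simp add: ext_bilin_def)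
  have l': "lin f'" "lin f''" using f' \<Gamma>_lin by blast+
  have fe: "kk c (f (e k)) = 0" if "k < 8" for c k using that lin_simps(5)[OF lf] by (simp flip: lin_simps(4)[OF lf])
  have f\<tau>: "kk 1 (f (\<tau> x)) = f (\<tau> x)" "ff 1 (f (\<tau> x)) = 0" for x
    by (simp_all add: lin_simps(5)[OF lf] flip: lin_simps(3,4)[OF lf])
  have Jvbd: "J (cobasis k) v = kk (inc (1 / n k)) (J (e k) v)" "J x (cobasis k) = kk (inc (1 / n k)) (J x (\<tau> (e k)))"
    if "k < 8" for k x v
    using that J_zero(4)[of x 1 "e k"] by (simp_all add: cobasis_def basis_def J_add conj_divide inc_divide)
  have Jf: "J (f (basis k)) w = J (f (e k)) w" "J x (f (basis k)) = J x (f (\<tau> (e k)))" if "k < 8" for k w x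
    using that J_zero(3)[of 1 "f (\<tau> (e k))" w] J_zero(4)[of x 1 "f (e k)"]
    by (simp_all add: basis_def lin_simps[OF lf] J_add f\<tau> flip: lin_simps(3)[OF lf])
  have b2f: "b2 (f (basis k)) w = b2 (f (\<tau> (e k))) w" if "k < 8" for k w
    using that b_ff_kk(8)[of 1 "f (e k)" w]
    by (simp add: basis_def lin_simps[OF lf] b_add flip: lin_simps(3)[OF lf])
  have 1: "A f w = kk 1 (f' w) - kk imag_unit (f'' w)" for w
  proof -
    have "E3 (A f w) = (\<Sum>k<8. star (inc (f (basis k))) (star (E3 w) (inc (cobasis k))))"
      unfolding A_def E_sum by (rule sum.cong) (simp_all add: st Jf Jvbd)
    then have "kk (1 / 2) (A f w) = f' (kk (1 / 2) w) - f'' (kk (imag_unit / 2) w)"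
      unfolding eval by (simp add: cplx_eq_iff)
    then have "kk 2 (kk (1 / 2) (A f w)) = kk 2 (f' (kk (1 / 2) w) - f'' (kk (imag_unit / 2) w))" by simp
    moreover have "kk 1 (A f w) = A f w" by (simp add: A_def ff_kk_sum)
    ultimately show ?thesis by (simp add: ff_kk_diff lin_simps[OF l'(1)] lin_simps[OF l'(2)])
  qed
  have 2: "Cplx (b1 c (f' x)) (b1 c (f'' x)) = (\<Sum>k<8. b2 (f (\<tau> (e k))) (J c (J x (\<tau> (e k)))) / inc (n k))" for c x
  proof -
    have "(\<Sum>k<8. HK (f (basis k)) (J x (cobasis k))) = Cplx (f' (ff 1 x)) (f'' (ff 1 x))"
      using eval[of "E1 x"] by (simp add: st lin_simps(5)[OF l'(1)] lin_simps(5)[OF l'(2)])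
    then have sums: "f' (ff 1 x) = (\<Sum>k<8. re (HK (f (basis k)) (J x (cobasis k))))"
      "f'' (ff 1 x) = (\<Sum>k<8. im (HK (f (basis k)) (J x (cobasis k))))"
      by (simp_all add: cplx_eq_iff re_sum im_sum)
    have "b1 c (f' x) = b1 c (f' (ff 1 x))" "b1 c (f'' x) = b1 c (f'' (ff 1 x))"
      by (simp_all add: lin_simps(3)[OF l'(1)] lin_simps(3)[OF l'(2)])
    then have "Cplx (b1 c (f' x)) (b1 c (f'' x)) = (\<Sum>k<8. b2 (f (basis k)) (J c (J x (cobasis k))))"
      unfolding sums b_sum HK_parts by (simp add: cplx_eq_iff re_sum im_sum)
    also have "\<dots> = (\<Sum>k<8. b2 (f (\<tau> (e k))) (J c (J x (\<tau> (e k)))) / inc (n k))"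
      by (rule sum.cong) (simp_all add: b2f Jvbd inc_divide conj_divide)
    finally show ?thesis .
  qed
  have 3: "kk 1 (f' v) + kk imag_unit (f'' v)
      = (\<Sum>k<8. \<Sum>l<8. kk (b2 v (J (e l) (\<tau> (e k))) / (inc (n k) * inc (n l))) (J (e l) (f (\<tau> (e k)))))" for v
  proof -
    have HK_E1: "HK v w = E1 (re (HK v w)) + sK (Cplx 0 1) (E1 (im (HK v w)))" for w
      by (simp add: cplx_eq_iff sK_simps HK_parts)
    have "star (inc x) (HK v w) = E2 (J (re (HK v w)) x) + sK (Cplx 0 1) (E2 (J (im (HK v w)) x))" for x w
      by (subst HK_E1) (simp only: st star_sK[OF star] rho_eps)
    then have re_star: "re (star (inc x) (HK v w)) = kk (1 / 2) (J (re (HK v w)) x) + kk (imag_unit / 2) (J (im (HK v w)) x)" for x w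
      by (simp add: sK_simps kk_minus_left)
    have JHK: "J (re (HK v w)) x + kk imag_unit (J (im (HK v w)) x) = (\<Sum>l<8. kk (b2 v (J (e l) w) / inc (n l)) (J (e l) x))" for x w
    proof -
      have "J (re (HK v w)) x + kk imag_unit (J (im (HK v w)) x)
        = (\<Sum>l<8. kk (inc (re (b2 v (J (e l) w)) / n l) + imag_unit * inc (im (b2 v (J (e l) w)) / n l)) (J (e l) x))"
        unfolding J_expand[of "re (HK v w)"] J_expand[of "im (HK v w)"]
        by (simp add: b_sym(1)[of _ "e _"] HK_parts ff_kk_sum kk_add_left sum.distrib)
      also have "\<dots> = (\<Sum>l<8. kk (b2 v (J (e l) w) / inc (n l)) (J (e l) x))"
      proof (rule sum.cong[OF refl])
        fix l :: nat
        have "inc (re z / r) + imag_unit * inc (im z / r) = z / inc r" for z :: "'f cplx" and r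
          by (subst (3) cplx_decomp[of z]) (simp add: inc_divide add_divide_distrib)
        then show "kk (inc (re (b2 v (J (e l) w)) / n l) + imag_unit * inc (im (b2 v (J (e l) w)) / n l)) (J (e l) x)
            = kk (b2 v (J (e l) w) / inc (n l)) (J (e l) x)" by simp
      qed
      finally show ?thesis .
    qed
    have "(\<Sum>k<8. star (inc (f (basis k))) (HK v (cobasis k))) = Cplx (f' (re (E2 v)) - f'' (im (E2 v))) (f' (im (E2 v)) + f'' (re (E2 v)))"
      using eval[of "E2 v"] by (simp only: st)
    from arg_cong[OF this, of re]
    have "kk (1 / 2) (f' v) + kk (imag_unit / 2) (f'' v) =
        (\<Sum>k<8. kk (1 / 2) (J (re (HK v (cobasis k))) (f (basis k))) + kk (imag_unit / 2) (J (im (HK v (cobasis k))) (f (basis k))))"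
      by (simp add: re_sum re_star lin_simps[OF l'(1)] lin_simps[OF l'(2)] kk_minus_left)
    from arg_cong[OF this, of "kk 2"]
    have "kk 1 (f' v) + kk imag_unit (f'' v) =
        (\<Sum>k<8. J (re (HK v (cobasis k))) (f (basis k)) + kk imag_unit (J (im (HK v (cobasis k))) (f (basis k))))"
      by (simp add: ff_kk_add ff_kk_sum)
    also have "\<dots> = (\<Sum>k<8. \<Sum>l<8. kk (b2 v (J (e l) (cobasis k)) / inc (n l)) (J (e l) (f (basis k))))"
      by (simp only: JHK)
    also have "\<dots> = (\<Sum>k<8. \<Sum>l<8. kk (b2 v (J (e l) (\<tau> (e k))) / (inc (n k) * inc (n l))) (J (e l) (f (\<tau> (e k)))))"
      by (intro sum.cong refl) (simp add: Jf Jvbd inc_divide)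
    finally show ?thesis .
  qed
  show ?thesis by (rule that[OF f' 1 2 3])
qed

lemma A_add: "A (f + f') w = A f w + A f' w"
  by (simp add: A_def pointwise J_add ff_kk_add sum.distrib)

lemma A_zero: "A 0 = 0"
  by (rule ext) (simp add: A_def pointwise)

lemma A_s: "A (s l \<circ> f) w = kk (inc (fst_part l)) (A f w)"
  by (simp add: A_def comp_apply ff_kk_sum mult.commute)

lemma kk_A [simp]: "kk 1 (A f w) = A f w" by (simp add: A_def ff_kk_sum)

lemma lin_A: "lin (A f)"
  by (rule linI') (simp_all add: A_def J_add ff_kk_add ff_kk_sum sum.distrib mult.commute)

lemma A_rk: "A (rk x y) w = J x (J y w)"
proof -
  have "J x (J y w) = (\<Sum>k<8. kk (inc (b1 y (e k) / n k)) (J x (J (e k) w)))"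
    by (subst J_expand[of y]) (simp add: J_sum)
  also have "\<dots> = A (rk x y) w"
    unfolding A_def by (rule sum.cong) (simp_all add: rk_eq J_add flip: inc_mult)
  finally show ?thesis by simp
qed

text \<open>
  Here the hypothesis on \<open>\<alpha>\<close> enters: \<open>A f\<close> is a \<open>K\<close>-combination of two
  elements of \<open>\<Gamma> g\<close>. Multiplication by \<open>K\<close> on \<open>V\<^sub>2\<close> respects
  degrees only modulo \<open>{0, h, h + h}\<close>.
\<close>

lemma A_\<Gamma>_EH: assumes f: "f \<in> \<Gamma> g" shows "A f \<in> EH g"
proof -
  obtain f' f'' where f': "f' \<in> \<Gamma> g" "f'' \<in> \<Gamma> g"
    and A: "\<And>w. A f w = kk 1 (f' w) - kk imag_unit (f'' w)"
    by (rule alpha_components[OF f]) (rule that; assumption)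
  have "A f = (kk 1 \<circ> f') + (kk (- imag_unit) \<circ> f'')"
    by (rule ext) (simp add: pointwise A kk_minus_left)
  then show ?thesis by (simp only:) (intro EH_add EH_kk \<Gamma>_EH[OF f'(1)] \<Gamma>_EH[OF f'(2)] cong_refl)
qed

lemma A_add': "A (f + f') = A f + A f'" by (rule ext) (simp add: A_add pointwise)

lemma A_qp: "lin f \<Longrightarrow> A (qp g f) = qp g (A f)"
proof (induction f rule: E_induct)
  case (homogeneous k f)
  show ?case
    unfolding qp_hom[OF homogeneous] EH_qp[OF A_\<Gamma>_EH[OF homogeneous]] by (simp add: A_zero)
next
  case (add f f')
  then show ?case by (simp only: qp_add A_add' lin_A)
qed

lemma A_EH: "f \<in> EH g \<Longrightarrow> A f \<in> EH g"
  using A_qp[of f g] lin_A[of f] unfolding EH_def by simp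

lemma \<Gamma>_\<tau>: assumes f: "f \<in> \<Gamma> g" shows "f (\<tau> z) = kk (\<chi> g) (\<tau> (f z))"
  using lin_simps(4)[OF \<Gamma>_lin[OF f], of 1 "\<tau> z"]
  by (simp add: \<tau>_lin[OF \<Gamma>_lin[OF f]] \<Psi>_hom[OF f])

subsection \<open>Two identities for \<open>J\<close>\<close>

text \<open>
  By the behaviour of \<open>\<tau>\<close>, the operators \<open>f', f''\<close> act on \<open>\<tau> x\<close> as on
  \<open>x\<close>, up to \<open>\<chi> g\<close>. Thus the three components of \<open>\<alpha> (\<kappa> f)\<close>
  all express the numbers \<open>b1 c (f' x)\<close> and \<open>b1 c (f'' x)\<close>. The first identity compares the
  third component with the first one. The second one compares the first with the second, where conjugate-linearity of
  \<open>J\<close> accumulates the factors \<open>\<chi> g\<close>.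
\<close>

lemma A_\<Gamma>_identities:
  assumes f: "f \<in> \<Gamma> g"
  shows "b2 (\<tau> c) (A f (\<tau> z)) = conj (\<Sum>k<8. b2 (\<tau> (f (e k))) (J c (J z (\<tau> (e k)))) / inc (n k))"
    and "(\<Sum>k<8. \<Sum>l<8. b2 (\<tau> z) (J (e l) (\<tau> (e k))) / (inc (n k) * inc (n l)) * b2 (\<tau> c) (J (e l) (\<tau> (f (e k)))))
      = \<chi> g * \<chi> g * \<chi> g * conj (b2 (\<tau> c) (A f (\<tau> z)))"
proof -
  obtain f' f'' where f': "f' \<in> \<Gamma> g" "f'' \<in> \<Gamma> g"
    and 1: "\<And>w. A f w = kk 1 (f' w) - kk imag_unit (f'' w)"
    and 2: "\<And>c x. Cplx (b1 c (f' x)) (b1 c (f'' x)) = (\<Sum>k<8. b2 (f (\<tau> (e k))) (J c (J x (\<tau> (e k)))) / inc (n k))"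
    and 3: "\<And>v. kk 1 (f' v) + kk imag_unit (f'' v)
      = (\<Sum>k<8. \<Sum>l<8. kk (b2 v (J (e l) (\<tau> (e k))) / (inc (n k) * inc (n l))) (J (e l) (f (\<tau> (e k)))))"
    by (rule alpha_components[OF f]) (rule that; assumption)
  define T where "T = (\<Sum>k<8. b2 (\<tau> (f (e k))) (J c (J z (\<tau> (e k)))) / inc (n k))"
  have T: "Cplx (b1 c (f' z)) (b1 c (f'' z)) = \<chi> g * T"
    unfolding 2 T_def sum_distrib_left by (simp add: \<Gamma>_\<tau>[OF f])
  have Cp: "Cplx a b = inc a + imag_unit * inc b" "conj (Cplx a b) = inc a - imag_unit * inc b" for a b :: 'f
    by (simp_all add: cplx_eq_iff)
  have unit: "\<chi> g * (conj (\<chi> g) * y) = y" for y using \<chi>(1)[of g] by (simp flip: mult.assoc)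
  have "b2 (\<tau> c) (A f (\<tau> z)) = \<chi> g * conj (Cplx (b1 c (f' z)) (b1 c (f'' z)))"
    unfolding Cp(2) by (simp add: 1 b_diff \<Gamma>_\<tau>[OF f'(1)] \<Gamma>_\<tau>[OF f'(2)] b2_\<tau> algebra_simps)
  then show R1: "b2 (\<tau> c) (A f (\<tau> z)) = conj T" by (simp add: T conj_mult unit)
  define M where "M = (\<Sum>k<8. \<Sum>l<8. b2 (\<tau> z) (J (e l) (\<tau> (e k))) / (inc (n k) * inc (n l)) * b2 (\<tau> c) (J (e l) (\<tau> (f (e k)))))"
  have "b2 (\<tau> c) (kk 1 (f' (\<tau> z)) + kk imag_unit (f'' (\<tau> z))) = \<chi> g * Cplx (b1 c (f' z)) (b1 c (f'' z))"
    unfolding Cp by (simp add: b_add \<Gamma>_\<tau>[OF f'(1)] \<Gamma>_\<tau>[OF f'(2)] b2_\<tau> algebra_simps)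
  moreover have "b2 (\<tau> c) (kk 1 (f' (\<tau> z)) + kk imag_unit (f'' (\<tau> z))) = conj (\<chi> g) * M"
    unfolding 3 M_def sum_distrib_left by (simp add: b_sum \<Gamma>_\<tau>[OF f] mult_ac)
  ultimately have "conj (\<chi> g) * M = \<chi> g * (\<chi> g * T)" by (simp add: T)
  then have "\<chi> g * (conj (\<chi> g) * M) = \<chi> g * (\<chi> g * (\<chi> g * T))" by simp
  then show "M = \<chi> g * \<chi> g * \<chi> g * conj (b2 (\<tau> c) (A f (\<tau> z)))"
    unfolding unit R1 by (simp add: mult.assoc)
qed

text \<open>
  The factors \<open>\<chi> g\<close> have cancelled in the first identity, so it extends to all of \<open>E\<close>
  and in particular to operators of rank one.
\<close>

lemma J_J_symmetry: "b2 (\<tau> c) (J x (J y (\<tau> z))) = conj (b2 (\<tau> x) (J c (J z (\<tau> y))))"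
proof -
  have gen: "b2 (\<tau> c) (A f (\<tau> z)) = conj (\<Sum>k<8. b2 (\<tau> (f (e k))) (J c (J z (\<tau> (e k)))) / inc (n k))" if "lin f" for f
    using that
  proof (induction f rule: E_induct)
    case (homogeneous g f)
    then show ?case by (rule A_\<Gamma>_identities)
  next
    case (add f f')
    then show ?case unfolding A_add by (simp add: b_add pointwise \<tau>_add add_divide_distrib sum.distrib conj_add)
  qed
  have "b2 (\<tau> x) (J c (J z (\<tau> y))) = (\<Sum>k<8. inc (b1 y (e k) / n k) * b2 (\<tau> x) (J c (J z (\<tau> (e k)))))"
    by (subst \<tau>_expand[of y]) (simp add: J_sum b_sum)
  also have "\<dots> = (\<Sum>k<8. b2 (\<tau> (rk x y (e k))) (J c (J z (\<tau> (e k)))) / inc (n k))"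
    by (rule sum.cong) (simp_all add: rk_eq inc_divide)
  finally show ?thesis using gen[OF lin_rk, of x y] by (simp add: A_rk)
qed

text \<open>
  The factor in the second identity depends on the degree modulo \<open>{0, h, h + h}\<close> only, because
  \<open>\<omega>\<^sup>3 = 1\<close>.
\<close>

lemma J_J_twisted_symmetry:
  assumes xy: "rk x y \<in> EH g"
  shows "(\<Sum>l<8. b2 (\<tau> z) (J (e l) (\<tau> y)) * b2 (\<tau> c) (J (e l) (\<tau> x)) / inc (n l))
    = \<chi> g * \<chi> g * \<chi> g * conj (b2 (\<tau> c) (J x (J y (\<tau> z))))"
proof -
  define M where "M f = (\<Sum>k<8. \<Sum>l<8. b2 (\<tau> z) (J (e l) (\<tau> (e k))) / (inc (n k) * inc (n l)) * b2 (\<tau> c) (J (e l) (\<tau> (f (e k)))))" for f :: "'v \<Rightarrow> 'v"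
  have M_add: "M (f + f') = M f + M f'" for f f'
    by (simp add: M_def pointwise \<tau>_add J_add b_add distrib_left sum.distrib)
  define f where "f = rk x y"
  have f: "qp g f = f" "lin f" using xy by (simp_all add: f_def EH_def)
  define c3 where "c3 = \<chi> g * \<chi> g * \<chi> g"
  have M: "M (pr k f) = c3 * conj (b2 (\<tau> c) (A (pr k f) (\<tau> z)))" if "cong g k" for k
    unfolding M_def c3_def using A_\<Gamma>_identities(2)[OF pr_in[OF f(2)], where z = z and c = c] \<chi>_cong[OF that] by simp
  have "M (qp g f) = c3 * conj (b2 (\<tau> c) (A (qp g f) (\<tau> z)))"
    unfolding qp_def M_add A_add using M[of g] M[of "g + h"] M[of "g + h + h"]
    by (simp add: b_add conj_add distrib_left)
  then have "M (rk x y) = c3 * conj (b2 (\<tau> c) (J x (J y (\<tau> z))))" by (simp add: f(1)) (simp add: f_def A_rk)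
  moreover have "M (rk x y) = (\<Sum>l<8. b2 (\<tau> z) (J (e l) (\<tau> y)) * b2 (\<tau> c) (J (e l) (\<tau> x)) / inc (n l))"
  proof -
    have y: "b2 (\<tau> z) (J (e l) (\<tau> y)) = (\<Sum>k<8. inc (b1 y (e k) / n k) * b2 (\<tau> z) (J (e l) (\<tau> (e k))))" for l
      by (subst \<tau>_expand[of y]) (simp add: J_sum b_sum)
    have "M (rk x y) = (\<Sum>l<8. \<Sum>k<8. inc (b1 y (e k) / n k) * b2 (\<tau> z) (J (e l) (\<tau> (e k))) * b2 (\<tau> c) (J (e l) (\<tau> x)) / inc (n l))"
      unfolding M_def by (subst sum.swap) (intro sum.cong refl, simp add: rk_eq inc_divide)
    then show ?thesis unfolding y by (simp add: sum_distrib_right sum_divide_distrib)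
  qed
  ultimately show ?thesis unfolding c3_def by simp
qed

section \<open>The Casimir element and the grading of the complex component\<close>

definition tr1 :: "('v \<Rightarrow> 'v) \<Rightarrow> 'f" where "tr1 f = (\<Sum>k<8. b1 (e k) (f (e k)) / n k)"

lemma tr1_add: "tr1 (f + f') = tr1 f + tr1 f'"
  by (simp add: tr1_def pointwise b_add add_divide_distrib sum.distrib)

lemma tr1_zero: "tr1 0 = 0"
  by (simp add: tr1_def pointwise)

lemma tr1_s: "tr1 (s l \<circ> f) = fst_part l * tr1 f"
  by (simp add: tr1_def comp_apply sum_distrib_left)

lemma b1_expand: "b1 x y = (\<Sum>k<8. b1 x (e k) * b1 (e k) y / n k)"
proof -
  have "b1 x y = b1 (ff 1 x) y" by simp
  then show ?thesis by (subst (asm) e_expand) (simp add: b_sum)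
qed

lemma tr1_comp: assumes "lin f" "lin f'"
  shows "tr1 (f \<circ> f') = (\<Sum>k<8. \<Sum>j<8. b1 (e k) (f (e j)) * b1 (e j) (f' (e k)) / (n k * n j))"
proof -
  have "b1 (e k) (f (f' (e k))) = (\<Sum>j<8. b1 (e k) (f (e j)) * b1 (e j) (f' (e k)) / n j)" for k
    using b1_expand[of "adj f (e k)" "f' (e k)"]
    by (simp add: b_sym(1)[of "e k" "f _"] b_adj(1)[OF assms(1)]) (simp add: b_sym(1) mult.commute)
  then show ?thesis by (simp add: tr1_def comp_apply sum_divide_distrib mult.commute)
qed

lemma tr1_commute: assumes "lin f" "lin f'" shows "tr1 (f \<circ> f') = tr1 (f' \<circ> f)"
  unfolding tr1_comp[OF assms] tr1_comp[OF assms(2,1)]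
  by (subst sum.swap) (simp add: mult.commute)

lemma tr1_rk: "lin f \<Longrightarrow> tr1 (f \<circ> rk x y) = b1 y (f x)"
  unfolding comp_rk tr1_def by (subst b1_expand[of y]) (simp add: rk_eq b_add)

text \<open>
  Functions of \<open>E\<close> that are linear over \<open>L\<close> through its first factor. They are determined by
  the restriction of their argument to \<open>V\<^sub>1\<close>.
\<close>

definition lin1 :: "(('v \<Rightarrow> 'v) \<Rightarrow> 'v) \<Rightarrow> bool" where
  "lin1 F \<longleftrightarrow> (\<forall>f f'. lin f \<longrightarrow> lin f' \<longrightarrow> F (f + f') = F f + F f') \<and>
     (\<forall>l f. lin f \<longrightarrow> F (s l \<circ> f) = kk (inc (fst_part l)) (F f))"

lemma lin1_simps: assumes "lin1 F"
  shows "lin f \<Longrightarrow> lin f' \<Longrightarrow> F (f + f') = F f + F f'"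
    "lin f \<Longrightarrow> F (s l \<circ> f) = kk (inc (fst_part l)) (F f)" "F 0 = 0"
    "(\<And>i. lin (f'' i)) \<Longrightarrow> F (\<Sum>i\<in>(I :: nat set). f'' i) = (\<Sum>i\<in>I. F (f'' i))"
proof -
  show add: "F (f + f') = F f + F f'" if "lin f" "lin f'" for f f' using assms that unfolding lin1_def by blast
  show "lin f \<Longrightarrow> F (s l \<circ> f) = kk (inc (fst_part l)) (F f)" using assms unfolding lin1_def by blast
  show zero: "F 0 = 0" using add[OF lin_zero lin_zero] by simp
  show "F (\<Sum>i\<in>I. f'' i) = (\<Sum>i\<in>I. F (f'' i))" if "\<And>i. lin (f'' i)"
    by (induction I rule: infinite_finite_induct) (simp_all add: zero add lin_sum that)
qed

lemma ff_comp_expand: assumes "lin f"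
  shows "ff 1 \<circ> f = (\<Sum>i<8. \<Sum>j<8. s (Cubic (b1 (e i) (f (e j)) / (n i * n j)) 0) \<circ> rk (e i) (e j))"
proof
  fix z
  have "(ff 1 \<circ> f) z = f (ff 1 z)" by (simp add: comp_apply lin_simps[OF assms])
  also have "\<dots> = (\<Sum>j<8. ff (b1 z (e j) / n j) (ff 1 (f (e j))))"
    by (subst e_expand) (simp add: lin_simps[OF assms])
  also have "\<dots> = (\<Sum>j<8. \<Sum>i<8. ff (b1 (e i) (f (e j)) / (n i * n j)) (ff (b1 (e j) z) (e i)))"
    by (intro sum.cong refl, subst e_expand)
      (simp add: ff_kk_sum b_sym(1)[of z] b_sym(1)[of _ "e _"] mult_ac)
  finally show "(ff 1 \<circ> f) z = (\<Sum>i<8. \<Sum>j<8. s (Cubic (b1 (e i) (f (e j)) / (n i * n j)) 0) \<circ> rk (e i) (e j)) z"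
    by (subst sum.swap) (simp add: fun_sum_apply comp_apply rk_eq ff_def S.scale_right_distrib)
qed

lemma lin1_expand: assumes F: "lin1 F" and f: "lin f"
  shows "F f = (\<Sum>i<8. \<Sum>j<8. kk (inc (b1 (e i) (f (e j)) / (n i * n j))) (F (rk (e i) (e j))))"
proof -
  have split: "f = (ff 1 \<circ> f) + (s (Cubic 0 1) \<circ> f)"
    by (rule ext) (simp add: pointwise flip: kk_def, simp add: ff_kk_split)
  have "F f = F (ff 1 \<circ> f)"
    by (subst split) (simp add: lin1_simps(1,2)[OF F] lin_comp lin_ff lin_s f)
  then show ?thesis
    unfolding ff_comp_expand[OF f] by (simp add: lin1_simps(2,4)[OF F] lin_comp lin_s lin_rk lin_sum)
qed

lemma qp_zero: "qp g 0 = 0" using qp_hom[OF \<Gamma>_zero, of g g] by simp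

lemma kk_inc_\<tau>_eq_0: "kk (inc c) (\<tau> (e 0)) = 0 \<Longrightarrow> c = 0"
proof -
  assume "kk (inc c) (\<tau> (e 0)) = 0"
  then have "b2 (kk (inc c) (\<tau> (e 0))) (\<tau> (e 0)) = 0" by simp
  then show "c = 0" by (simp add: b2_\<tau> b1_e flip: inc_mult)
qed

text \<open>
  The composition of the trace with a projection of nonzero degree is again a trace form. On a matrix algebra it is a
  multiple of the trace, and it vanishes at the identity, which has degree zero.
\<close>

lemma tr1_qp: assumes a: "\<not> cong a 0" and f: "lin f" shows "tr1 (qp a f) = 0"
proof -
  define F where "F f = kk (inc (tr1 (qp a f))) (\<tau> (e 0))" for f
  have F: "lin1 F"
    unfolding lin1_def F_def by (simp add: qp_add tr1_add inc_add kk_add_left qp_s tr1_s inc_mult)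
  have trace: "tr1 (qp a (f \<circ> f')) = tr1 (qp a (f' \<circ> f))" if "lin f" "lin f'" for f f'
    using that(1)
  proof (induction f rule: E_induct)
    case (homogeneous i f)
    note f = homogeneous
    from that(2) show ?case
    proof (induction f' rule: E_induct)
      case (homogeneous j f')
      show ?case
        using qp_hom[OF \<Gamma>_comp[OF f homogeneous], of a] qp_hom[OF \<Gamma>_comp[OF homogeneous f], of a]
          tr1_commute[OF \<Gamma>_lin[OF f] \<Gamma>_lin[OF homogeneous]]
        by (simp add: add.commute)
    next
      case (add x y)
      then show ?case by (simp add: comp_add \<Gamma>_lin[OF f] qp_add lin_comp tr1_add)
    qed
  next
    case (add x y)
    then show ?case by (simp add: comp_add that(2) qp_add lin_comp tr1_add)
  qed
  have rk: "kk (inc (n 0)) (F (rk x y)) = kk (inc (b1 y x)) (F (rk (e 0) (e 0)))" for x y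
  proof -
    have 1: "rk x (e 0) \<circ> rk (e 0) y = s (Cubic (n 0) 0) \<circ> rk x y"
      by (simp add: comp_rk lin_rk) (simp add: rk_eq b1_e ff_def rk_s)
    have 2: "rk (e 0) y \<circ> rk x (e 0) = s (polar Q y x) \<circ> rk (e 0) (e 0)"
      by (simp add: comp_rk lin_rk) (simp add: rk_def[of "e 0" y x] rk_s)
    have "F (rk x (e 0) \<circ> rk (e 0) y) = F (rk (e 0) y \<circ> rk x (e 0))"
      unfolding F_def by (rule arg_cong[OF trace[OF lin_rk lin_rk]])
    then show ?thesis unfolding 1 2 by (simp add: lin1_simps(2)[OF F] lin_rk b1_def)
  qed
  have rk': "F (rk x y) = kk (inc (b1 y x / n 0)) (F (rk (e 0) (e 0)))" for x y
    using arg_cong[OF rk[of x y], of "kk (inc (1 / n 0))"] by (simp add: F_def flip: inc_mult)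
  have "0 = F id"
    unfolding F_def qp_hom[OF id_degree, of a] using a by (simp add: tr1_zero)
  also have "\<dots> = (\<Sum>i<8. \<Sum>j<8. kk (inc (b1 (e i) (e j) / (n i * n j))) (F (rk (e i) (e j))))"
    using lin1_expand[OF F lin_id] by simp
  also have "\<dots> = (\<Sum>i<8::nat. \<Sum>j<8. if j = i then kk (inc (1 / n 0)) (F (rk (e 0) (e 0))) else 0)"
    by (intro sum.cong refl, subst rk') (simp add: b1_e flip: inc_mult)
  also have "\<dots> = kk (8 * inc (1 / n 0)) (F (rk (e 0) (e 0)))"
    by (simp flip: kk_sum_left)
  also have "\<dots> = kk (inc (8 / n 0 * tr1 (qp a (rk (e 0) (e 0))))) (\<tau> (e 0))"
  proof -
    have "8 * inc (1 / n 0) = inc (8 / n 0)" by (simp add: inc_divide)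
    then show ?thesis by (simp only: F_def inc_mult ff_kk_comp)
  qed
  finally have "tr1 (qp a (rk (e 0) (e 0))) = 0"
    using kk_inc_\<tau>_eq_0 by fastforce
  then have "F (rk x y) = 0" for x y by (subst rk') (simp add: F_def)
  then have "F f = 0" using lin1_expand[OF F f] by simp
  then show ?thesis unfolding F_def by (rule kk_inc_\<tau>_eq_0)
qed

lemma cong_add_cancel: "cong (g + k) (g' + k) \<longleftrightarrow> cong g g'" "cong (k + g) (k + g') \<longleftrightarrow> cong g g'"
  unfolding cong_def by (auto simp: add.assoc add.commute add.left_commute)

lemma cong_uminus_left: "cong (- a) b \<longleftrightarrow> cong (a + b) 0"
  using cong_add_cancel(2)[of a "- a" b] cong_sym[of "0 :: 'g" "a + b"] cong_sym[of "a + b" 0] by auto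

lemma tr1_qp_adjoint: "lin f \<Longrightarrow> lin f' \<Longrightarrow> tr1 (qp a f \<circ> f') = tr1 (f \<circ> qp (- a) f')"
proof (induction f rule: E_induct)
  case (homogeneous i f)
  note f = homogeneous(1)
  from homogeneous(2) show ?case
  proof (induction f' rule: E_induct)
    case (homogeneous j f')
    have ff': "f \<circ> f' \<in> \<Gamma> (i + j)" by (rule \<Gamma>_comp[OF f homogeneous])
    have 0: "tr1 (f \<circ> f') = 0" if "\<not> cong (i + j) 0"
      using tr1_qp[OF that \<Gamma>_lin[OF ff']] qp_hom[OF ff', of "i + j"] by simp
    have z: "0 \<circ> f' = 0" "f \<circ> 0 = 0" by (rule comp_zero(2), rule comp_zero(1)[OF \<Gamma>_lin[OF f]])
    have c: "cong a i \<longleftrightarrow> cong (- a) j" if "cong (i + j) 0"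
    proof -
      have "cong (- i) j" using that cong_uminus_left by blast
      then have "cong (- a) j \<longleftrightarrow> cong (- a) (- i)" using cong_right by blast
      also have "\<dots> \<longleftrightarrow> cong a i" using cong_minus[of a i] cong_minus[of "- a" "- i"] by auto
      finally show ?thesis by simp
    qed
    show ?case
    proof (cases "cong (i + j) 0")
      case True
      show ?thesis unfolding qp_hom[OF f] qp_hom[OF homogeneous] c[OF True]
        by (cases "cong (- a) j") (simp_all only: if_True if_False z)
    next
      case False
      show ?thesis unfolding qp_hom[OF f] qp_hom[OF homogeneous] using 0[OF False]
        by (cases "cong a i"; cases "cong (- a) j") (simp_all only: if_True if_False z tr1_zero)
    qed
  next
    case (add x y)
    then show ?case using \<Gamma>_lin[OF f] by (simp add: comp_add lin_qp qp_add lin_comp tr1_add)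
  qed
next
  case (add x y)
  then show ?case by (simp add: comp_add lin_qp qp_add lin_comp tr1_add)
qed

text \<open>
  The Casimir element \<open>\<Sum> rk (e i) (e j) \<otimes> rk (e j) (e i) / (n i n j)\<close> corresponds to the
  trace form, for which \<open>qp a\<close> and \<open>qp (- a)\<close> are adjoint; that is, it has degree zero. A
  map \<open>\<phi>\<close> stands for a linear map on the tensor product.
\<close>

lemma casimir_qp:
  assumes l: "\<And>y. lin1 (\<lambda>x. \<phi> x y)" and r: "\<And>x. lin1 (\<phi> x)"
  shows "(\<Sum>i<8. \<Sum>j<8. kk (inc (1 / (n i * n j))) (\<phi> (qp a (rk (e i) (e j))) (rk (e j) (e i))))
    = (\<Sum>i<8. \<Sum>j<8. kk (inc (1 / (n i * n j))) (\<phi> (rk (e i) (e j)) (qp (- a) (rk (e j) (e i)))))"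
proof -
  define c where "c i j k l = inc (1 / (n i * n j)) * inc (b1 (e k) (qp a (rk (e i) (e j)) (e l)) / (n k * n l))" for i j k l
  have c: "c i j k l = inc (1 / (n k * n l)) * inc (b1 (e j) (qp (- a) (rk (e l) (e k)) (e i)) / (n j * n i))" for i j k l
  proof -
    have "b1 (e k) (qp a (rk (e i) (e j)) (e l)) = tr1 (qp a (rk (e i) (e j)) \<circ> rk (e l) (e k))"
      by (simp add: tr1_rk lin_qp lin_rk)
    also have "\<dots> = tr1 (qp (- a) (rk (e l) (e k)) \<circ> rk (e i) (e j))"
      by (subst tr1_qp_adjoint[OF lin_rk lin_rk]) (rule tr1_commute[OF lin_rk lin_qp[OF lin_rk]])
    also have "\<dots> = b1 (e j) (qp (- a) (rk (e l) (e k)) (e i))" by (simp add: tr1_rk lin_qp lin_rk)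
    finally show ?thesis by (simp add: c_def mult_ac flip: inc_mult)
  qed
  have "(\<Sum>i<8. \<Sum>j<8. kk (inc (1 / (n i * n j))) (\<phi> (qp a (rk (e i) (e j))) (rk (e j) (e i))))
    = (\<Sum>i<8. \<Sum>j<8. \<Sum>k<8. \<Sum>l<8. kk (c i j k l) (\<phi> (rk (e k) (e l)) (rk (e j) (e i))))"
    by (rule sum.cong[OF refl], rule sum.cong[OF refl], subst lin1_expand[OF l lin_qp[OF lin_rk]]) (simp add: ff_kk_sum c_def)
  also have "\<dots> = (\<Sum>i<8. \<Sum>k<8. \<Sum>j<8. \<Sum>l<8. kk (c i j k l) (\<phi> (rk (e k) (e l)) (rk (e j) (e i))))"
    by (rule sum.cong[OF refl], rule sum.swap)
  also have "\<dots> = (\<Sum>k<8. \<Sum>i<8. \<Sum>j<8. \<Sum>l<8. kk (c i j k l) (\<phi> (rk (e k) (e l)) (rk (e j) (e i))))"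
    by (rule sum.swap)
  also have "\<dots> = (\<Sum>k<8. \<Sum>i<8. \<Sum>l<8. \<Sum>j<8. kk (c i j k l) (\<phi> (rk (e k) (e l)) (rk (e j) (e i))))"
    by (rule sum.cong[OF refl], rule sum.cong[OF refl], rule sum.swap)
  also have "\<dots> = (\<Sum>k<8. \<Sum>l<8. \<Sum>i<8. \<Sum>j<8. kk (c i j k l) (\<phi> (rk (e k) (e l)) (rk (e j) (e i))))"
    by (rule sum.cong[OF refl], rule sum.swap)
  also have "\<dots> = (\<Sum>k<8. \<Sum>l<8. \<Sum>j<8. \<Sum>i<8. kk (c i j k l) (\<phi> (rk (e k) (e l)) (rk (e j) (e i))))"
    by (rule sum.cong[OF refl], rule sum.cong[OF refl], rule sum.swap)
  also have "\<dots> = (\<Sum>k<8. \<Sum>l<8. kk (inc (1 / (n k * n l))) (\<phi> (rk (e k) (e l)) (qp (- a) (rk (e l) (e k)))))"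
    by (rule sum.cong[OF refl], rule sum.cong[OF refl], subst lin1_expand[OF r lin_qp[OF lin_rk]]) (simp add: ff_kk_sum c)
  finally show ?thesis .
qed

text \<open>The \<open>K\<close>-linear map with \<open>\<tau> x \<mapsto> J x w\<close>.\<close>

definition R :: "'v \<Rightarrow> 'v \<Rightarrow> 'v" where
  "R w v = (\<Sum>k<8. kk (b2 v (\<tau> (e k)) / inc (n k)) (J (e k) w))"

lemma R_\<tau> [simp]: "R w (\<tau> x) = J x w"
  by (subst J_expand[of x]) (simp add: R_def b2_\<tau> inc_divide)

lemma lin_R: "lin (R w)"
  by (rule linI') (simp_all add: R_def b_add add_divide_distrib kk_add_left ff_kk_sum sum.distrib)

lemma kk_R [simp]: "kk 1 (R w v) = R w v" "R w (kk 1 v) = R w v" "R (kk 1 w) v = R w v"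
  by (simp_all add: R_def ff_kk_sum)

lemma R_add: "R (v + w) = R v + R w"
  by (rule ext) (simp add: R_def pointwise J_add ff_kk_add sum.distrib)

lemma R_kk: "R (kk c w) = kk (conj c) \<circ> R w"
  by (rule ext) (simp add: R_def comp_apply ff_kk_sum mult.commute)

lemma R_ff: "R (ff r w) = 0"
  by (rule ext) (simp add: R_def zero_fun_apply)

lemma R_eqI: assumes "lin f" "\<And>x. f (\<tau> x) = J x w" shows "f (kk 1 v) = R w v"
  using \<tau>_basis_eqI[OF assms(1) lin_R[of w], of v] assms(2) by simp

text \<open>
  \<open>w\<close> is recovered from \<open>R w\<close> because \<open>J (e 0)\<close> squares to the scalar
  \<open>n 0 / 2\<close>.
\<close>

lemma R_determines: "kk (inc (2 / n 0)) (J (e 0) (R w (\<tau> (e 0)))) = kk 1 w"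
  by (simp add: JJ_self q_def flip: inc_mult)

lemma R_inject: assumes "R v = R w" shows "kk 1 v = kk 1 w"
  using R_determines[of v] R_determines[of w] assms by simp

text \<open>
  Every \<open>w\<close> in the complex component is of the form \<open>contract f\<close>, and \<open>R (contract f)\<close> arises from \<open>f\<close> by
  contraction with the Casimir element, which has degree zero.  This is how the grading of \<open>E\<close>
  yields one of the complex component.
\<close>

definition contract :: "('v \<Rightarrow> 'v) \<Rightarrow> 'v" where
  "contract f = (\<Sum>l<8. kk (inc (1 / n l)) (J (e l) (f (\<tau> (e l)))))"

lemma contract_add: "contract (f + f') = contract f + contract f'"
  by (simp add: contract_def pointwise J_add ff_kk_add sum.distrib)

lemma contract_zero: "contract 0 = 0"
  by (simp add: contract_def pointwise)

lemma contract_surj: "\<exists>f. lin f \<and> contract f = kk 1 w"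
proof (intro exI conjI)
  define f where "f v = kk (b2 v (\<tau> (e 0)) / inc (n 0)) (kk 2 (J (e 0) w))" for v
  show "lin f" by (rule linI') (simp_all add: f_def b_add add_divide_distrib kk_add_left mult_ac)
  have "contract f = (\<Sum>l<8::nat. if l = 0 then kk 1 w else 0)"
    unfolding contract_def
  proof (rule sum.cong[OF refl])
    fix l :: nat assume l: "l \<in> {..<8}"
    have c2: "conj (2 :: 'f cplx) = 2" using conj_simps(4)[of "2 :: 'f"] by simp
    show "kk (inc (1 / n l)) (J (e l) (f (\<tau> (e l)))) = (if l = 0 then kk 1 w else 0)"
      using l by (simp add: f_def b2_\<tau> b1_e JJ_self q_def conj_divide conj_mult c2 inc_divide)
  qed
  then show "contract f = kk 1 w" by simp
qed

lemma R_contract: assumes f: "lin f"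
  shows "(\<Sum>i<8. \<Sum>j<8. kk (inc (1 / (n i * n j))) (A (rk (e i) (e j)) (f (\<Psi> (rk (e j) (e i)) v)))) = R (contract f) v"
proof -
  define g where "g v = (\<Sum>i<8. \<Sum>j<8. kk (inc (1 / (n i * n j))) (A (rk (e i) (e j)) (f (\<Psi> (rk (e j) (e i)) v))))" for v
  have "lin g"
    by (rule linI') (simp_all add: g_def lin_simps[OF lin_A] lin_simps[OF f] lin_simps[OF lin_\<Psi>[OF lin_rk]]
        ff_kk_add ff_kk_sum sum.distrib mult.commute)
  moreover have "g (\<tau> x) = J x (contract f)" for x
  proof -
    have "g (\<tau> x) = (\<Sum>i<8. \<Sum>j<8. kk (inc (b1 x (e i) / n i)) (J (e i) (kk (inc (1 / n j)) (J (e j) (f (\<tau> (e j)))))))"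
      unfolding g_def \<tau>_lin[OF lin_rk, symmetric]
      by (intro sum.cong refl)
        (simp add: rk_eq \<tau>_add b_sym(1)[of _ x] lin_simps[OF f] A_rk inc_divide inc_mult conj_divide conj_mult)
    also have "\<dots> = J x (contract f)"
      by (subst J_expand[of x]) (simp add: contract_def J_sum ff_kk_sum)
    finally show ?thesis .
  qed
  ultimately have "g (kk 1 v) = R (contract f) v" by (rule R_eqI)
  then show ?thesis by (simp add: g_def lin_rk)
qed

lemma lin1_contraction: assumes "lin f"
  shows "lin1 (\<lambda>x. A x (f (\<Psi> y v)))"
  unfolding lin1_def
  by (simp_all add: A_add A_s \<Psi>_add \<Psi>_s lin_simps[OF assms] lin_simps[OF lin_A])

text \<open>
  Replacing the two factors of the Casimir element by their components of degrees \<open>a\<close> and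
  \<open>- a\<close>, and summing over \<open>a\<close>, multiplies the contraction by 3, as \<open>S\<close> contains
  each degree modulo \<open>{0, h, h + h}\<close> three times. All terms of the new sum have the same degree as
  \<open>f\<close>.
\<close>

lemma R_contract_EH: assumes f: "f \<in> EH g" shows "R (contract f) \<in> EH g"
proof -
  note lf = EH_lin[OF f]
  define D where "D = (\<Sum>a\<in>S. \<Sum>i<8. \<Sum>j<8. kk (inc (1 / (n i * n j))) \<circ>
    ((A (qp a (rk (e i) (e j))) \<circ> f) \<circ> \<Psi> (qp (- a) (rk (e j) (e i)))))"
  have "A (qp a x) \<circ> f \<circ> \<Psi> (qp (- a) y) \<in> EH g" if "lin x" "lin y" for a x y
    using EH_comp[OF EH_comp[OF A_EH[OF qp_EH[OF that(1), of a]] f] \<Psi>_EH[OF qp_EH[OF that(2), of "- a"]]] by simp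
  then have "D \<in> EH g" unfolding D_def by (intro EH_sum EH_kk) (simp add: lin_rk)
  have "D v = kk 3 (R (contract f) v)" for v
  proof -
    have inner: "(\<Sum>i<8. \<Sum>j<8. kk (inc (1 / (n i * n j))) (A (qp a (rk (e i) (e j))) (f (\<Psi> (qp (- a) (rk (e j) (e i))) v))))
      = (\<Sum>i<8. \<Sum>j<8. kk (inc (1 / (n i * n j))) (A (qp a (rk (e i) (e j))) (f (\<Psi> (rk (e j) (e i)) v))))" for a
    proof -
      have idem: "qp a (qp a x) = qp a x" if "lin x" for x using qp_EH[OF that, of a] by (simp add: EH_def)
      define \<phi> where "\<phi> x y = A (qp a x) (f (\<Psi> y v))" for x y
      have "lin1 (\<lambda>x. \<phi> x y)" for y
        using lin1_contraction[OF lf, of y v] unfolding lin1_def \<phi>_def by (simp add: qp_add qp_s lin_qp)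
      moreover have "lin1 (\<phi> x)" for x
        unfolding lin1_def \<phi>_def by (simp add: \<Psi>_add \<Psi>_s lin_simps[OF lf] lin_simps[OF lin_A])
      ultimately show ?thesis
        using casimir_qp[of \<phi> a] by (simp add: \<phi>_def idem lin_rk)
    qed
    have A3: "(\<Sum>a\<in>S. A (qp a x) w) = kk 3 (A x w)" if "lin x" for x w
    proof -
      have "(\<Sum>a\<in>S. A (qp a x)) = A (\<Sum>a\<in>S. qp a x)"
        using S(1) by (induction S rule: finite_induct) (simp_all add: A_zero A_add')
      then have "(\<Sum>a\<in>S. A (qp a x) w) = A x w + A x w + A x w"
        using sum_qp[OF that] fun_sum_apply[of "\<lambda>a. A (qp a x)" S w] by (simp add: A_add' pointwise)
      also have "\<dots> = kk 1 (A x w) + kk 1 (A x w) + kk 1 (A x w)" by simp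
      finally show ?thesis by (simp flip: kk_add_left del: kk_A)
    qed
    have "D v = (\<Sum>a\<in>S. \<Sum>i<8. \<Sum>j<8. kk (inc (1 / (n i * n j))) (A (qp a (rk (e i) (e j))) (f (\<Psi> (qp (- a) (rk (e j) (e i))) v))))"
      by (simp add: D_def fun_sum_apply comp_apply)
    also have "\<dots> = (\<Sum>i<8. \<Sum>j<8. \<Sum>a\<in>S. kk (inc (1 / (n i * n j))) (A (qp a (rk (e i) (e j))) (f (\<Psi> (rk (e j) (e i)) v))))"
      unfolding inner by (subst sum.swap, rule sum.cong[OF refl], subst sum.swap, rule refl)
    also have "\<dots> = (\<Sum>i<8. \<Sum>j<8. kk (inc (1 / (n i * n j))) (kk 3 (A (rk (e i) (e j)) (f (\<Psi> (rk (e j) (e i)) v)))))"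
      by (simp only: A3[OF lin_rk] flip: ff_kk_sum(2))
    also have "\<dots> = kk 3 (R (contract f) v)"
      unfolding R_contract[OF lf, symmetric] by (simp only: ff_kk_sum ff_kk_comp mult.commute)
    finally show ?thesis .
  qed
  then have "R (contract f) = kk (1 / 3) \<circ> D" by (intro ext) (simp add: comp_apply)
  then show ?thesis using EH_kk[OF \<open>D \<in> EH g\<close>] by simp
qed

lemma qp_R_contract: "lin f \<Longrightarrow> qp g (R (contract f)) = R (contract (qp g f))"
proof (induction f rule: E_induct)
  case (homogeneous k f)
  have R0: "R 0 = 0" using R_ff[of 0 0] by simp
  show ?case
    unfolding qp_hom[OF homogeneous] EH_qp[OF R_contract_EH[OF \<Gamma>_EH[OF homogeneous cong_refl]]]
    by (simp add: contract_zero R0)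
next
  case (add f f')
  then show ?case by (simp add: contract_add R_add qp_add lin_R)
qed

text \<open>
  The vector \<open>v\<close> with \<open>R v = qp g (R w)\<close>, recovered as in \<open>R_determines\<close>.
\<close>

definition pr2 :: "'g \<Rightarrow> 'v \<Rightarrow> 'v" where
  "pr2 g w = kk (inc (2 / n 0)) (J (e 0) (qp g (R w) (\<tau> (e 0))))"

lemma R_pr2: "R (pr2 g w) = qp g (R w)"
proof -
  obtain f where f: "lin f" "contract f = kk 1 w" using contract_surj by blast
  have w: "R w = R (contract f)" unfolding f(2) by (rule ext) simp
  have "pr2 g w = kk 1 (contract (qp g f))"
    unfolding pr2_def w qp_R_contract[OF f(1)] by (rule R_determines)
  then have "R (pr2 g w) = R (contract (qp g f))" by (simp add: fun_eq_iff)
  then show ?thesis unfolding w qp_R_contract[OF f(1)] .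
qed

lemma kk_pr2 [simp]: "kk 1 (pr2 g w) = pr2 g w" by (simp add: pr2_def)

lemma pr2_add: "pr2 g (v + w) = pr2 g v + pr2 g w"
  by (simp add: pr2_def R_add qp_add lin_R pointwise J_add ff_kk_add)

lemma pr2_kk [simp]: "pr2 g (kk c w) = kk c (pr2 g w)"
  unfolding pr2_def R_kk qp_kk[OF lin_R] by (simp add: comp_apply mult.commute)

lemma lin_pr2: "lin (pr2 g)"
proof (rule linI')
  show "pr2 g (ff r w) = ff r (pr2 g w)" for r w
    by (simp add: pr2_def R_ff qp_zero zero_fun_apply)
qed (simp_all add: pr2_add)

lemma R_inject': "R v = R w \<Longrightarrow> kk 1 v = v \<Longrightarrow> kk 1 w = w \<Longrightarrow> v = w"
  using R_inject by metis

lemma pr2_fixed_iff: "pr2 g w = w \<longleftrightarrow> kk 1 w = w \<and> R w \<in> EH g"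
proof
  assume w: "pr2 g w = w"
  have "qp g (R w) = R w" using R_pr2[of g w] w by simp
  then show "kk 1 w = w \<and> R w \<in> EH g" using kk_pr2[of g w] w lin_R by (simp add: EH_def)
next
  assume w: "kk 1 w = w \<and> R w \<in> EH g"
  then have "R (pr2 g w) = R w" by (simp add: R_pr2 EH_def)
  then show "pr2 g w = w" by (rule R_inject') (use w in simp_all)
qed

definition V2 :: "'g \<Rightarrow> 'v set" where "V2 g = {w. pr2 g w = w}"

lemma V2_iff: "w \<in> V2 g \<longleftrightarrow> kk 1 w = w \<and> R w \<in> EH g" by (simp add: V2_def pr2_fixed_iff)

lemma pr2_V2: "pr2 g w \<in> V2 g" by (simp add: V2_iff R_pr2 qp_EH lin_R)

lemma V2_pr2: assumes "w \<in> V2 k" shows "pr2 g w = (if cong g k then w else 0)"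
proof -
  have w: "kk 1 w = w" "R w \<in> EH k" using assms by (simp_all add: V2_iff)
  have R0: "R 0 = 0" using R_ff[of 0 0] by simp
  have "R (pr2 g w) = R (if cong g k then w else 0)"
    unfolding R_pr2 EH_qp[OF w(2)] by (simp add: R0)
  then show ?thesis by (rule R_inject') (simp_all add: w)
qed

lemma V2_cong: "w \<in> V2 g \<Longrightarrow> cong g k \<Longrightarrow> w \<in> V2 k" by (auto simp: V2_iff intro: EH_cong)

lemma V2_add: "v \<in> V2 g \<Longrightarrow> w \<in> V2 g \<Longrightarrow> v + w \<in> V2 g" by (simp add: V2_def pr2_add)

lemma V2_kk: "w \<in> V2 g \<Longrightarrow> kk c w \<in> V2 g" by (simp add: V2_def)

lemma V2_zero: "0 \<in> V2 g" by (simp add: V2_def lin_simps[OF lin_pr2])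

lemma V2_sum: "(\<And>i. i \<in> I \<Longrightarrow> f i \<in> V2 g) \<Longrightarrow> sum f I \<in> V2 g"
  by (induction I rule: infinite_finite_induct) (simp_all add: V2_zero V2_add)

lemma sum_pr2: "(\<Sum>g\<in>S. pr2 g w) = kk 3 w"
proof -
  have "(\<Sum>g\<in>S. pr2 g w) = kk (inc (2 / n 0)) (J (e 0) ((\<Sum>g\<in>S. qp g (R w)) (\<tau> (e 0))))"
    by (simp add: pr2_def fun_sum_apply J_sum ff_kk_sum)
  also have "\<dots> = kk 1 w + kk 1 w + kk 1 w"
    unfolding sum_qp[OF lin_R] pointwise J_add ff_kk_add R_determines ..
  finally show ?thesis by (simp flip: kk_add_left)
qed

lemma pr2_outside: "g \<notin> S \<Longrightarrow> pr2 g w = 0"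
  by (simp add: pr2_def qp_outside lin_R zero_fun_apply)

lemma V2_induct: assumes "\<And>g w. w \<in> V2 g \<Longrightarrow> P w" "\<And>v w. P v \<Longrightarrow> P w \<Longrightarrow> P (v + w)" shows "P (kk 1 w)"
proof -
  have "P 0" using assms(1) V2_zero by blast
  then have "P (\<Sum>g\<in>S. pr2 g (kk (1 / 3) w))"
    by - (induction S rule: infinite_finite_induct, simp_all add: assms(2) assms(1)[OF pr2_V2] del: pr2_kk)
  then show ?thesis unfolding sum_pr2 by simp
qed

text \<open>
  The Clifford relations: moving \<open>J z\<close> past \<open>J x J y\<close> produces the action of
  \<open>x \<wedge> y\<close>, as an element of the orthogonal Lie algebra, on \<open>z\<close>.
\<close>

lemma R_A: assumes f: "lin f"
  shows "R (A f w) = (R w \<circ> \<Psi> (adj f)) + (kk (- 1) \<circ> (R w \<circ> \<Psi> f)) + (A f \<circ> R w)"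
proof
  fix v
  define g where "g = (R w \<circ> \<Psi> (adj f)) + (kk (- 1) \<circ> (R w \<circ> \<Psi> f)) + (A f \<circ> R w)"
  have "lin g" unfolding g_def by (intro lin_add lin_comp lin_R lin_\<Psi> lin_kk lin_A adj_spec(1) f)
  moreover have "g (\<tau> z) = J z (A f w)" for z
  proof -
    have lf': "lin (adj f)" by (rule adj_spec(1)[OF f])
    have "J z (A f w) = (\<Sum>k<8. kk (inc (1 / n k)) (J z (J (f (e k)) (J (e k) w))))"
      by (simp add: A_def J_sum)
    also have "\<dots> = (\<Sum>k<8. kk (inc (b1 (adj f z) (e k) / n k)) (J (e k) w) - kk (inc (b1 z (e k) / n k)) (J (f (e k)) w)
        + kk (inc (1 / n k)) (J (f (e k)) (J (e k) (J z w))))"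
    proof (rule sum.cong[OF refl])
      fix k :: nat
      have "J z (J (f (e k)) (J (e k) w)) = kk (inc (b1 z (f (e k)))) (J (e k) w) - J (f (e k)) (J z (J (e k) w))"
        using J_clifford[of z "f (e k)" "J (e k) w"] by (simp add: algebra_simps)
      moreover have "J z (J (e k) w) = kk (inc (b1 z (e k))) w - J (e k) (J z w)"
        using J_clifford[of z "e k" w] by (simp add: algebra_simps)
      moreover have "b1 z (f (e k)) = b1 (adj f z) (e k)"
        using b_adj(1)[OF f, of "e k" z] by (simp add: b_sym(1))
      ultimately show "kk (inc (1 / n k)) (J z (J (f (e k)) (J (e k) w)))
        = kk (inc (b1 (adj f z) (e k) / n k)) (J (e k) w) - kk (inc (b1 z (e k) / n k)) (J (f (e k)) w)
        + kk (inc (1 / n k)) (J (f (e k)) (J (e k) (J z w)))"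
        by (simp add: J_diff ff_kk_diff inc_divide)
    qed
    also have "\<dots> = J (adj f z) w - J (f z) w + A f (J z w)"
    proof -
      have "J (f z) w = J (f (ff 1 z)) w" by (simp add: lin_simps[OF f])
      also have "\<dots> = (\<Sum>k<8. kk (inc (b1 z (e k) / n k)) (J (f (e k)) w))"
        by (subst e_expand) (simp add: lin_simps[OF f] J_sum)
      finally show ?thesis
        unfolding J_expand[of "adj f z"] A_def sum.distrib sum_subtractf by simp
    qed
    finally show ?thesis
      by (simp add: g_def pointwise kk_minus_left flip: \<tau>_lin[OF f] \<tau>_lin[OF lf'])
  qed
  ultimately have "g (kk 1 v) = R (A f w) v" by (rule R_eqI)
  moreover have "g (kk 1 v) = g v"
    using f by (simp add: g_def pointwise lin_simps(4)[OF lin_A, of _ 1, simplified] adj_spec(1))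
  ultimately show "R (A f w) v = ((R w \<circ> \<Psi> (adj f)) + (kk (- 1) \<circ> (R w \<circ> \<Psi> f)) + (A f \<circ> R w)) v"
    unfolding g_def [symmetric] by simp
qed

lemma A_V2: assumes f: "f \<in> EH a" and w: "w \<in> V2 k" shows "A f w \<in> V2 (a + k)"
proof -
  have w': "R w \<in> EH k" using w by (simp add: V2_iff)
  have "R (A f w) \<in> EH (a + k)"
    unfolding R_A[OF EH_lin[OF f]]
    by (intro EH_add EH_kk EH_comp[OF A_EH[OF f] w'];
        subst add.commute, intro EH_comp[OF w'] \<Psi>_EH adj_EH f)
  then show ?thesis by (simp add: V2_iff)
qed

lemma qp_comp: "lin f \<Longrightarrow> lin f' \<Longrightarrow> (\<Sum>b\<in>S. qp b f \<circ> qp (a - b) f') = qp a (f \<circ> f') + qp a (f \<circ> f') + qp a (f \<circ> f')"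
proof (induction f rule: E_induct)
  case (homogeneous i f)
  note f = homogeneous(1)
  from homogeneous(2) show ?case
  proof (induction f' rule: E_induct)
    case (homogeneous j f')
    have z: "0 \<circ> x = 0" "f \<circ> 0 = 0" for x by (rule comp_zero(2), rule comp_zero(1)[OF \<Gamma>_lin[OF f]])
    have "qp b f \<circ> qp (a - b) f' = (if cong a (i + j) then qp b f \<circ> f' else 0)" for b
    proof (cases "cong b i")
      case True
      have "cong (a - b) j \<longleftrightarrow> cong a (b + j)"
        using cong_add_cancel(2)[of b "a - b" j] by simp
      also have "\<dots> \<longleftrightarrow> cong a (i + j)" using cong_add[OF True cong_refl[of j]] by (rule cong_right)
      finally show ?thesis unfolding qp_hom[OF homogeneous] qp_hom[OF f]
        using True by (cases "cong a (i + j)") (simp_all only: if_True if_False z)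
    qed (simp only: qp_hom[OF f] if_False z, simp)
    then have "(\<Sum>b\<in>S. qp b f \<circ> qp (a - b) f') = (if cong a (i + j) then (\<Sum>b\<in>S. qp b f \<circ> f') else 0)" by simp
    also have "(\<Sum>b\<in>S. qp b f \<circ> f') = (\<Sum>b\<in>S. qp b f) \<circ> f'"
      by (rule ext) (simp add: fun_sum_apply comp_apply)
    finally show ?case
      unfolding qp_hom[OF \<Gamma>_comp[OF f homogeneous]] sum_qp[OF \<Gamma>_lin[OF f]] comp_add(2) by simp
  next
    case (add x y)
    then show ?case using \<Gamma>_lin[OF f] by (simp add: comp_add lin_qp qp_add lin_comp sum.distrib ac_simps)
  qed
next
  case (add x y)
  then show ?case by (simp add: comp_add lin_qp qp_add lin_comp sum.distrib ac_simps)
qed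

lemma kk_3: "kk 3 w = kk 1 w + kk 1 w + kk 1 w" by (simp flip: kk_add_left)

lemma kk_third: "kk 3 w \<in> V2 g \<Longrightarrow> kk 1 w \<in> V2 g"
  using V2_kk[of "kk 3 w" g "1 / 3"] by simp

text \<open>The operators \<open>J x \<circ> J y\<close> generate \<open>End\<^sub>K(V\<^sub>2)\<close>, so the module property spreads to all of \<open>E\<close>.\<close>

lemma EH_V2: assumes f: "f \<in> EH a" and w: "w \<in> V2 k" shows "kk 1 (f w) \<in> V2 (a + k)"
proof -
  define Y where "Y = {f. lin f \<and> (\<forall>a k w. w \<in> V2 k \<longrightarrow> kk 1 (qp a f w) \<in> V2 (a + k))}"
  have YD: "kk 1 (qp a f w) \<in> V2 (a + k)" "lin f" if "f \<in> Y" "w \<in> V2 k" for f a k w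
    using that unfolding Y_def by blast+
  have "kk 1 \<circ> f \<in> Y"
  proof (rule even_clifford_density)
    show "f + f' \<in> Y" if "f \<in> Y" "f' \<in> Y" for f f'
      using that unfolding Y_def by (simp add: lin_add qp_add pointwise ff_kk_add V2_add)
    show "f \<circ> f' \<in> Y" if fY: "f \<in> Y" "f' \<in> Y" for f f'
    proof -
      have l: "lin f" "lin f'" using fY unfolding Y_def by simp_all
      have "kk 1 (qp a (f \<circ> f') w) \<in> V2 (a + k)" if w: "w \<in> V2 k" for a k w
      proof (rule kk_third)
        have "kk 3 (qp a (f \<circ> f') w) = kk 1 ((\<Sum>b\<in>S. qp b f \<circ> qp (a - b) f') w)"
          unfolding qp_comp[OF l] kk_3 pointwise ff_kk_add ..
        also have "\<dots> = (\<Sum>b\<in>S. kk 1 (qp b f (kk 1 (qp (a - b) f' w))))"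
          using l by (simp add: fun_sum_apply comp_apply ff_kk_sum lin_simps(4)[OF lin_qp])
        also have "\<dots> \<in> V2 (a + k)"
        proof (rule V2_sum)
          fix b
          show "kk 1 (qp b f (kk 1 (qp (a - b) f' w))) \<in> V2 (a + k)"
            using YD(1)[OF fY(1) YD(1)[OF fY(2) w], of b "a - b"] by (simp add: algebra_simps)
        qed
        finally show "kk 3 (qp a (f \<circ> f') w) \<in> V2 (a + k)" .
      qed
      then show ?thesis using l unfolding Y_def by (simp add: lin_comp)
    qed
    show "kk c \<in> Y" for c
    proof -
      have kk_id: "kk c = kk c \<circ> id" by (simp add: fun_eq_iff comp_apply)
      have "qp a (kk c) = kk c \<circ> qp a id" for a by (subst kk_id) (rule qp_kk[OF lin_id])
      then have "qp a (kk c) w = (if cong a 0 then kk c w else 0)" for a w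
        unfolding qp_hom[OF id_degree] by (simp add: comp_apply zero_fun_apply)
      moreover have "kk c w \<in> V2 (a + k)" if "w \<in> V2 k" "cong a 0" for a k w
        using V2_cong[OF V2_kk[OF that(1)], of "a + k" c] cong_sym[OF cong_add[OF that(2) cong_refl[of k]]] by simp
      ultimately show ?thesis unfolding Y_def by (simp add: lin_kk V2_zero)
    qed
    show "(\<lambda>w. J x (J y w)) \<in> Y" for x y
    proof -
      have "(\<lambda>w. J x (J y w)) = A (rk x y)" by (rule ext) (simp add: A_rk)
      moreover have "kk 1 (qp a (A (rk x y)) w) \<in> V2 (a + k)" if "w \<in> V2 k" for a k w
        unfolding A_qp[OF lin_rk, symmetric] using A_V2[OF qp_EH[OF lin_rk] that] by simp
      ultimately show ?thesis unfolding Y_def by (simp add: lin_A)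
    qed
  qed (use f in \<open>simp_all add: comp_apply lin_comp lin_kk EH_lin\<close>)
  from YD(1)[OF this w, of a] show ?thesis
    using EH_kk[OF f, of 1] by (simp add: EH_def comp_apply)
qed

lemma EH_pr2: assumes f: "f \<in> EH i" shows "kk 1 (f (pr2 l w)) = pr2 (i + l) (f w)"
proof -
  note lf = EH_lin[OF f]
  have "kk 1 (f (pr2 l (kk 1 w))) = pr2 (i + l) (f (kk 1 w))"
  proof (rule V2_induct)
    fix g w assume w: "w \<in> V2 g"
    show "kk 1 (f (pr2 l w)) = pr2 (i + l) (f w)"
      using V2_pr2[OF w, of l] V2_pr2[OF EH_V2[OF f w], of "i + l"]
      by (simp add: cong_add_cancel lin_simps(5)[OF lf])
  qed (simp add: pr2_add lin_simps[OF lf] ff_kk_add)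
  then show ?thesis by (simp add: lin_simps(4)[OF lf])
qed

lemma V2I: assumes w: "kk 1 w = w" and 0: "\<And>l. \<not> cong l k \<Longrightarrow> pr2 l w = 0" shows "w \<in> V2 k"
proof -
  have "pr2 k (pr2 l w) = pr2 l w" for l
    using V2_pr2[OF pr2_V2[of l w], of k] 0[of l] cong_sym[of l k] by auto
  then have "pr2 k (\<Sum>l\<in>S. pr2 l w) = (\<Sum>l\<in>S. pr2 l w)" by (simp add: lin_simps(8)[OF lin_pr2])
  then have "kk (1 / 3) (kk 3 (pr2 k w)) = kk (1 / 3) (kk 3 w)" unfolding sum_pr2 by simp
  then show ?thesis using w by (simp add: V2_def)
qed

subsection \<open>Compatibility of the form and the real structure with the grading\<close>

definition Klin :: "('v \<Rightarrow> 'f cplx) \<Rightarrow> bool" where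
  "Klin F \<longleftrightarrow> (\<forall>x y. F (x + y) = F x + F y) \<and> (\<forall>c x. F (kk c x) = c * F x)"

lemma Klin_eqI: assumes F: "Klin F" and G: "Klin G" and eq: "\<And>x. F (\<tau> x) = G (\<tau> x)" shows "F w = G w"
proof -
  have sum: "F (\<Sum>k<8::nat. kk (c k) (g k)) = (\<Sum>k<8. c k * F (g k))" if "Klin F" for F c g
  proof -
    have "F 0 = 0" using that[unfolded Klin_def, THEN conjunct2, rule_format, of 0 0] by simp
    then have "F (\<Sum>k\<in>I. kk (c k) (g k)) = (\<Sum>k\<in>I. c k * F (g k))" for I :: "nat set"
      using that unfolding Klin_def by (induction I rule: infinite_finite_induct) simp_all
    then show ?thesis .
  qed
  have "F (kk 1 w) = G (kk 1 w)" unfolding b2_expand[of w] sum[OF F] sum[OF G] eq ..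
  then show ?thesis using F G by (simp add: Klin_def)
qed

text \<open>
  The maps \<open>R v\<close> and their adjoints satisfy relations of Clifford type as well, now with the form on
  \<open>V\<^sub>2\<close>.
\<close>

lemma R_polar: "b2 (R v x) (R w y) + b2 (R w x) (R v y) = conj (b2 v w) * b2 x y"
proof -
  have 1: "b2 (R v (\<tau> a)) (R w (\<tau> b)) + b2 (R w (\<tau> a)) (R v (\<tau> b)) = conj (b2 v w) * b2 (\<tau> a) (\<tau> b)" for a b
    using b2_J_J_polar[of a v b w] by (simp add: b2_\<tau> b_sym(2)[of "J a w"] mult.commute)
  have 2: "b2 (R v (\<tau> a)) (R w y) + b2 (R w (\<tau> a)) (R v y) = conj (b2 v w) * b2 (\<tau> a) y" for a y
    by (rule Klin_eqI[of "\<lambda>y. b2 (R v (\<tau> a)) (R w y) + b2 (R w (\<tau> a)) (R v y)"])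
      (simp_all only: 1, simp_all add: Klin_def lin_simps[OF lin_R] b_add algebra_simps)
  show ?thesis
    by (rule Klin_eqI[of "\<lambda>x. b2 (R v x) (R w y) + b2 (R w x) (R v y)"])
      (simp_all only: 2, simp_all add: Klin_def lin_simps[OF lin_R] b_add algebra_simps)
qed

text \<open>
  By \<open>R_polar\<close>, the scalar \<open>conj (b2 v w)\<close> is an operator of degree \<open>g + k\<close>;
  but scalars have degree zero.
\<close>

lemma b2_V2: assumes v: "v \<in> V2 g" and w: "w \<in> V2 k" and ne: "\<not> cong (g + k) 0" shows "b2 v w = 0"
proof -
  define c where "c = conj (b2 v w)"
  define D where "D = (adj (R v) \<circ> R w) + (adj (R w) \<circ> R v)"
  have v': "R v \<in> EH g" and w': "R w \<in> EH k" using v w by (simp_all add: V2_iff)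
  have "D \<in> EH (g + k)"
    unfolding D_def using EH_comp[OF adj_EH[OF v'] w'] EH_comp[OF adj_EH[OF w'] v']
    by (intro EH_add) (simp_all add: add.commute)
  moreover have "kk 1 \<circ> D = kk c"
  proof
    fix x
    have "kk 1 (D x) = kk 1 (kk c x)"
    proof (rule b2_eqI)
      fix y
      show "b2 y (D x) = b2 y (kk c x)"
        using R_polar[of v y w x] b_adj(2)[OF lin_R, of v y "R w x"] b_adj(2)[OF lin_R, of w y "R v x"]
        by (simp add: D_def pointwise b_add c_def)
    qed
    then show "(kk 1 \<circ> D) x = kk c x" by (simp add: comp_apply)
  qed
  ultimately have "kk c \<in> EH (g + k)" using EH_kk[of D "g + k" 1] by simp
  from EH_qp[OF this, of 0] have q: "qp 0 (kk c) = 0" using ne cong_sym[of 0 "g + k"] by auto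
  have kk_id: "kk c = kk c \<circ> id" by (simp add: fun_eq_iff comp_apply)
  have "qp 0 (kk c) = kk c \<circ> qp 0 id" by (subst kk_id) (rule qp_kk[OF lin_id])
  then have "qp 0 (kk c) = kk c" unfolding qp_hom[OF id_degree] using kk_id by simp
  then have 0: "kk c x = 0" for x using q by (simp add: zero_fun_apply fun_eq_iff)
  obtain y z where "b2 y z = 1" using complex_component_nonzero by blast
  then have "b2 (kk c y) z = c" by simp
  then have "c = 0" unfolding 0 by simp
  then show ?thesis by (simp add: c_def)
qed

lemma b2_pr2: "b2 (pr2 l v) w = b2 v (pr2 (- l) w)"
proof -
  have "b2 (pr2 l (kk 1 v)) (kk 1 w) = b2 (kk 1 v) (pr2 (- l) (kk 1 w))"
  proof (rule V2_induct[where P = "\<lambda>v. b2 (pr2 l v) (kk 1 w) = b2 v (pr2 (- l) (kk 1 w))"])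
    fix g v assume v: "v \<in> V2 g"
    show "b2 (pr2 l v) (kk 1 w) = b2 v (pr2 (- l) (kk 1 w))"
    proof (rule V2_induct[where P = "\<lambda>w. b2 (pr2 l v) w = b2 v (pr2 (- l) w)"])
      fix k w assume w: "w \<in> V2 k"
      have "cong l g \<longleftrightarrow> cong (- l) k" if "cong (g + k) 0"
      proof -
        have "cong (- g) k" using that cong_uminus_left by blast
        then have "cong (- l) k \<longleftrightarrow> cong (- l) (- g)" using cong_right by blast
        also have "\<dots> \<longleftrightarrow> cong l g" using cong_minus[of l g] cong_minus[of "- l" "- g"] by auto
        finally show ?thesis by simp
      qed
      then show "b2 (pr2 l v) w = b2 v (pr2 (- l) w)"
        unfolding V2_pr2[OF v] V2_pr2[OF w] using b2_V2[OF v w] by auto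
    qed (simp add: b_add pr2_add)
  qed (simp add: b_add pr2_add)
  then show ?thesis by simp
qed

lemma R_nondegenerate: assumes "\<And>u. R u v = 0" shows "kk 1 v = 0"
proof (rule b2_nondegenerate)
  fix y
  obtain u w where uw: "b2 u w = 1" using complex_component_nonzero by blast
  show "b2 v y = 0" using R_polar[of u v w y] by (simp add: assms uw)
qed

text \<open>The conjugation of \<open>V\<^sub>2 = K \<otimes> \<tau>(V\<^sub>1)\<close>.\<close>

definition conj2 :: "'v \<Rightarrow> 'v" where
  "conj2 w = (\<Sum>k<8. kk (conj (b2 w (\<tau> (e k))) / inc (n k)) (\<tau> (e k)))"

lemma conj2_add: "conj2 (v + w) = conj2 v + conj2 w"
  by (simp add: conj2_def b_add conj_add add_divide_distrib kk_add_left sum.distrib)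

lemma conj2_kk [simp]: "conj2 (kk c w) = kk (conj c) (conj2 w)"
  by (simp add: conj2_def conj_mult ff_kk_sum)

lemma kk_conj2 [simp]: "kk 1 (conj2 w) = conj2 w"
  by (simp add: conj2_def ff_kk_sum)

lemma conj2_\<tau> [simp]: "conj2 (\<tau> x) = \<tau> x"
  by (subst \<tau>_expand[of x]) (simp add: conj2_def b2_\<tau> inc_divide)

lemma b2_conj2: "b2 (conj2 v) w = conj (b2 v (conj2 w))"
proof (rule Klin_eqI[of "b2 (conj2 v)" "\<lambda>w. conj (b2 v (conj2 w))"])
  fix x
  have "conj (b2 v (\<tau> x)) = (\<Sum>k<8. inc (b1 x (e k) / n k) * conj (b2 v (\<tau> (e k))))"
    by (subst \<tau>_expand) (simp add: b_sum conj_sum conj_mult)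
  then show "b2 (conj2 v) (\<tau> x) = conj (b2 v (conj2 (\<tau> x)))"
    by (simp add: conj2_def[of v] b_sum b2_\<tau> b_sym(1)[of x] inc_divide mult.commute)
qed (simp_all add: Klin_def b_add conj2_add conj_add conj_mult)

text \<open>
  Hermiticity of \<open>J x\<close>, extended from \<open>\<tau> x\<close> to all vectors by means of the conjugation.
\<close>

lemma b2_R: "b2 x (R w y) = conj (b2 w (R x (conj2 y)))"
proof (rule Klin_eqI[of "\<lambda>y. b2 x (R w y)" "\<lambda>y. conj (b2 w (R x (conj2 y)))"])
  show "b2 x (R w (\<tau> z)) = conj (b2 w (R x (conj2 (\<tau> z))))" for z
    by simp (rule b2_J_hermitian)
qed (simp_all add: Klin_def b_add conj2_add conj_add conj_mult lin_simps[OF lin_R])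

text \<open>
  By the homogeneity of the form and \<open>b2_R\<close>, the map \<open>z \<mapsto> R z (conj2 y)\<close> raises
  degrees by the degree of \<open>y\<close>. As the component of \<open>conj2 y\<close> of degree \<open>l\<close>
  contributes a map that raises them by \<open>l\<close>, only \<open>l = k\<close> occurs.
\<close>

lemma conj2_V2: assumes y: "y \<in> V2 k" shows "conj2 y \<in> V2 k"
proof (rule V2I)
  fix l assume l: "\<not> cong l k"
  have hom: "R z (pr2 l (conj2 y)) = 0" if z: "z \<in> V2 i" for z i
  proof -
    have "kk 1 (pr2 (i + l) (R z (conj2 y))) = kk 1 0"
    proof (rule b2_eqI)
      fix w
      define w' where "w' = pr2 (- (i + l)) w"
      have w': "w' \<in> V2 (- (i + l))" unfolding w'_def by (rule pr2_V2)
      have "\<not> cong (i + (- (i + l) + k)) 0"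
        using l cong_uminus_left[of l k] cong_uminus_left[of l "- k"] cong_minus[of l k]
          cong_add_cancel(2)[of "- l" l k] cong_sym[of "- l + k" 0] cong_sym by auto
      moreover have "R w' y \<in> V2 (- (i + l) + k)"
        using EH_V2[OF _ y, of "R w'"] w' by (simp add: V2_iff)
      ultimately have "b2 z (R w' y) = 0" using b2_V2[OF z] by blast
      then have "b2 w' (R z (conj2 y)) = 0" using b2_R[of z w' y] by simp
      then show "b2 w (pr2 (i + l) (R z (conj2 y))) = b2 w 0"
        using b2_pr2[of "i + l" "R z (conj2 y)" w] by (simp add: w'_def b_sym(2))
    qed
    then show ?thesis using EH_pr2[of "R z" i l "conj2 y"] z by (simp add: V2_iff)
  qed
  have "R (kk 1 z) (pr2 l (conj2 y)) = 0" for z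
    by (rule V2_induct) (simp_all add: hom R_add pointwise)
  then show "pr2 l (conj2 y) = 0" using R_nondegenerate[of "pr2 l (conj2 y)"] by simp
qed simp

lemma pr2_conj2: "pr2 g (conj2 w) = conj2 (pr2 g w)"
proof -
  have "pr2 g (conj2 (kk 1 w)) = conj2 (pr2 g (kk 1 w))"
  proof (rule V2_induct)
    fix k w assume w: "w \<in> V2 k"
    have "conj2 0 = 0" using conj2_kk[of 0 0] by simp
    then show "pr2 g (conj2 w) = conj2 (pr2 g w)" unfolding V2_pr2[OF w] V2_pr2[OF conj2_V2[OF w]] by simp
  qed (simp add: conj2_add pr2_add)
  then show ?thesis by simp
qed

subsection \<open>The grading of the real component\<close>

definition V1 :: "'g \<Rightarrow> 'v set" where "V1 g = {x. ff 1 x = x \<and> \<tau> x \<in> V2 g}"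

text \<open>
  The coefficients of \<open>pr2 g (\<tau> x)\<close> in the basis \<open>\<tau> (e k)\<close> are real, as
  \<open>pr2 g\<close> commutes with the conjugation.
\<close>

definition pr1 :: "'g \<Rightarrow> 'v \<Rightarrow> 'v" where
  "pr1 g x = (\<Sum>k<8. ff (re (b2 (pr2 g (\<tau> x)) (\<tau> (e k))) / n k) (e k))"

lemma \<tau>_inject: assumes "\<tau> x = \<tau> y" shows "ff 1 x = ff 1 y"
proof (rule b1_eqI)
  fix z
  have "inc (b1 x z) = inc (b1 y z)" using assms by (simp flip: b2_\<tau>)
  then show "b1 x z = b1 y z" by simp
qed

lemma \<tau>_inject': "\<tau> x = \<tau> y \<Longrightarrow> ff 1 x = x \<Longrightarrow> ff 1 y = y \<Longrightarrow> x = y"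
  using \<tau>_inject by metis

lemma ff_pr1 [simp]: "ff 1 (pr1 g x) = pr1 g x"
  by (simp add: pr1_def ff_kk_sum)

lemma \<tau>_pr1: "\<tau> (pr1 g x) = pr2 g (\<tau> x)"
proof -
  have "inc (re (b2 (pr2 g (\<tau> x)) (\<tau> z))) = b2 (pr2 g (\<tau> x)) (\<tau> z)" for z
  proof -
    have "conj (b2 (pr2 g (\<tau> x)) (\<tau> z)) = b2 (pr2 g (\<tau> x)) (\<tau> z)"
      using b2_conj2[of "pr2 g (\<tau> x)" "\<tau> z"] by (simp flip: pr2_conj2)
    then show ?thesis by (rule conj_fixed_real[symmetric])
  qed
  then have "\<tau> (pr1 g x) = kk 1 (pr2 g (\<tau> x))"
    unfolding b2_expand[of "pr2 g (\<tau> x)"] by (simp add: pr1_def \<tau>_sum inc_divide)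
  then show ?thesis by simp
qed

lemma pr1_V1: "pr1 g x \<in> V1 g" by (simp add: V1_def \<tau>_pr1 pr2_V2)

lemma \<tau>_V1: "x \<in> V1 g \<Longrightarrow> \<tau> x \<in> V2 g" "x \<in> V1 g \<Longrightarrow> ff 1 x = x" by (simp_all add: V1_def)

lemma V1_kk: "x \<in> V1 g \<Longrightarrow> kk c x = 0" using ff_kk_comp(4)[of c 1 x] by (simp add: V1_def)

lemma V1_pr1: "x \<in> V1 k \<Longrightarrow> pr1 g x = (if cong g k then x else 0)"
  by (rule \<tau>_inject') (auto simp: \<tau>_pr1 V2_pr2 dest: \<tau>_V1)

lemma pr1_add: "pr1 g (x + y) = pr1 g x + pr1 g y"
  by (simp add: pr1_def \<tau>_add pr2_add b_add add_divide_distrib ff_add_left sum.distrib)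

lemma V1_add: "x \<in> V1 g \<Longrightarrow> y \<in> V1 g \<Longrightarrow> x + y \<in> V1 g"
  by (simp add: V1_def ff_kk_add \<tau>_add V2_add)

lemma V1_ff: "x \<in> V1 g \<Longrightarrow> ff r x \<in> V1 g" by (simp add: V1_def V2_kk)

lemma V1_zero: "0 \<in> V1 g" by (simp add: V1_def V2_zero)

lemma V1_cong: "x \<in> V1 g \<Longrightarrow> cong g k \<Longrightarrow> x \<in> V1 k" unfolding V1_def by (blast intro: V2_cong)

lemma sum_pr1: "(\<Sum>g\<in>S. pr1 g x) = ff 3 x"
proof (rule \<tau>_inject')
  show "\<tau> (\<Sum>g\<in>S. pr1 g x) = \<tau> (ff 3 x)" by (simp add: \<tau>_sum \<tau>_pr1 sum_pr2)
qed (simp_all add: ff_kk_sum)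

lemma pr1_outside: "g \<notin> S \<Longrightarrow> pr1 g x = 0" by (simp add: pr1_def pr2_outside)

lemma V1_induct: assumes "\<And>g x. x \<in> V1 g \<Longrightarrow> P x" "\<And>x y. P x \<Longrightarrow> P y \<Longrightarrow> P (x + y)" shows "P (ff 1 x)"
proof -
  have "P 0" using assms(1) V1_zero by blast
  then have "P (\<Sum>g\<in>S. pr1 g (ff (1 / 3) x))"
    by - (induction S rule: infinite_finite_induct, simp_all add: assms(2) assms(1)[OF pr1_V1])
  then show ?thesis unfolding sum_pr1 by simp
qed

lemma b1_V1: "x \<in> V1 g \<Longrightarrow> y \<in> V1 k \<Longrightarrow> \<not> cong (g + k) 0 \<Longrightarrow> b1 x y = 0"
  using b2_V2[of "\<tau> x" g "\<tau> y" k] by (simp add: b2_\<tau> \<tau>_V1)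

lemma J_V2: assumes "x \<in> V1 g" "w \<in> V2 k" shows "J x w \<in> V2 (g + k)"
proof -
  have "R w \<in> EH k" using assms(2) unfolding V2_iff ..
  from EH_V2[OF this \<tau>_V1(1)[OF assms(1)]] show ?thesis by (simp add: add.commute)
qed

lemma pr2_\<Psi>: assumes "lin f" "w \<in> V2 k" shows "pr2 (c + k) (\<Psi> f w) = \<Psi> (qp c f) w"
  using assms(1)
proof (induction f rule: E_induct)
  case (homogeneous i f)
  have "\<Psi> f w \<in> V2 (i + k)" using EH_V2[OF \<Psi>_EH[OF \<Gamma>_EH[OF homogeneous cong_refl]] assms(2)] by simp
  moreover have "\<Psi> 0 w = 0" using \<Psi>_hom[OF \<Gamma>_zero, where v = w] by (simp add: zero_fun_apply)
  ultimately show ?case unfolding qp_hom[OF homogeneous] by (simp add: V2_pr2 cong_add_cancel)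
next
  case (add x y)
  then show ?case by (simp add: \<Psi>_add qp_add lin_qp pr2_add)
qed

text \<open>
  The map \<open>rk x y\<close> raises degrees in \<open>V\<^sub>1\<close> by \<open>a + b\<close>, since
  \<open>b1\<close> is homogeneous; and \<open>\<tau>\<close> translates this into a statement on
  \<open>\<Psi>\<close>, hence on the projections \<open>qp c\<close>.
\<close>

lemma rk_EH: assumes x: "x \<in> V1 a" and y: "y \<in> V1 b" shows "rk x y \<in> EH (a + b)"
proof -
  define E where "E = rk x y"
  have E: "lin E" unfolding E_def by (rule lin_rk)
  have xz: "kk c x = 0" "ff 1 x = x" for c using x by (simp_all add: V1_kk \<tau>_V1)
  have zero: "qp c E = 0" if c: "\<not> cong c (a + b)" for c
  proof
    fix z
    have "E = s (Cubic 1 0) \<circ> E" by (rule ext) (simp add: E_def comp_apply rk_eq xz S.scale_right_distrib)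
    then have "qp c E = s (Cubic 1 0) \<circ> qp c E" using qp_s[OF E] by metis
    then have ff: "ff 1 (qp c E z) = qp c E z" for z by (metis comp_apply ff_def)
    have "ff 1 (qp c E (ff 1 z)) = 0"
    proof (rule V1_induct[where P = "\<lambda>z. ff 1 (qp c E z) = 0"])
      fix k z assume z: "z \<in> V1 k"
      have "\<tau> (qp c E z) = pr2 (c + k) (\<tau> (E z))"
        by (simp add: \<tau>_lin lin_qp E pr2_\<Psi> \<tau>_V1(1)[OF z])
      also have "\<dots> = kk (inc (b1 y z)) (pr2 (c + k) (\<tau> x))"
        by (simp add: E_def rk_eq xz \<tau>_add)
      also have "\<dots> = 0"
      proof (cases "cong (b + k) 0")
        case True
        have "cong (a + b + k) a" using cong_add[OF cong_refl[of a] True] by (simp add: add.assoc)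
        then have "\<not> cong (c + k) a" using c cong_add_cancel(1)[of c k "a + b"] cong_trans cong_sym by blast
        then show ?thesis by (simp add: V2_pr2[OF \<tau>_V1(1)[OF x]])
      qed (simp add: b1_V1[OF y z])
      finally have "\<tau> (qp c E z) = \<tau> 0" by simp
      from \<tau>_inject[OF this] show "ff 1 (qp c E z) = 0" by simp
    qed (simp add: lin_simps[OF lin_qp[OF E]] ff_kk_add)
    then have "ff 1 (qp c E z) = 0" by (simp add: lin_simps(3)[OF lin_qp[OF E]])
    then have "qp c E z = 0" unfolding ff .
    then show "qp c E z = 0 z" unfolding zero_fun_apply[of z] .
  qed
  have "qp (a + b) (qp c E) = qp c E" for c
  proof (cases "cong c (a + b)")
    case True
    then show ?thesis using EH_qp[OF qp_EH[OF E], of "a + b" c] cong_sym[OF True] by simp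
  next
    case False
    show ?thesis unfolding zero[OF False] by (rule qp_zero)
  qed
  moreover have "qp (a + b) (\<Sum>c\<in>I. qp c E) = (\<Sum>c\<in>I. qp (a + b) (qp c E))" for I
    by (induction I rule: infinite_finite_induct) (simp_all add: qp_zero qp_add lin_qp lin_sum E)
  ultimately have three: "qp (a + b) (E + E + E) = E + E + E" by (simp only: flip: sum_qp[OF E])
  have t: "E = s (of_F (1 / 3)) \<circ> (E + E + E)"
  proof
    fix z
    have "s (of_F 3) y = y + y + y" for y
    proof -
      have "of_F 3 = (1 + 1 + 1 :: 'f cubic)"
        by (simp only: cubic_eq_iff of_F_parts cubic_simps inc_numeral) simp
      then show ?thesis by (simp only: S.scale_left_distrib S.scale_one)
    qed
    then have "s (of_F (1 / 3)) (E z + E z + E z) = s (of_F (1 / 3) * of_F 3) (E z)" by (simp flip: S.scale_scale)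
    moreover have "of_F (1 / 3) * of_F 3 = (1 :: 'f cubic)"
      by (simp add: cubic_eq_iff inc_divide)
    ultimately show "E z = (s (of_F (1 / 3)) \<circ> (E + E + E)) z" by (simp add: pointwise)
  qed
  have "qp (a + b) E = s (of_F (1 / 3)) \<circ> qp (a + b) (E + E + E)"
    by (subst t) (intro qp_s lin_add E)
  then have "qp (a + b) E = E" unfolding three using t by simp
  then show ?thesis using E unfolding E_def EH_def by simp
qed

section \<open>The cyclic symmetry of the trilinear form\<close>

lemma conj2_conj2 [simp]: "conj2 (conj2 w) = kk 1 w"
proof -
  have sum: "conj2 (\<Sum>k\<in>I. g k) = (\<Sum>k\<in>I. conj2 (g k))" for g and I :: "nat set"
  proof -
    have "conj2 0 = 0" using conj2_kk[of 0 0] by simp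
    then show ?thesis by (induction I rule: infinite_finite_induct) (simp_all add: conj2_add)
  qed
  have "conj2 (conj2 w) = (\<Sum>k<8. kk (b2 w (\<tau> (e k)) / inc (n k)) (\<tau> (e k)))"
    by (subst (2) conj2_def) (simp add: sum conj_divide)
  then show ?thesis unfolding b2_expand[of w] .
qed

lemma b2_J_\<tau>0: assumes "j < 8" "k < 8"
  shows "b2 (J (e j) (\<tau> (e 0))) (J (e k) (\<tau> (e 0))) = (if j = k then inc (n k) * inc (n 0) / 2 else 0)"
proof -
  have "2 * b2 (J (e j) (\<tau> (e 0))) (J (e k) (\<tau> (e 0))) = inc (b1 (e j) (e k)) * inc (n 0)"
    using b2_J_J_polar[of "e j" "\<tau> (e 0)" "e k" "\<tau> (e 0)"]
    by (simp add: b_sym(2)[of "J (e k) _"] b2_\<tau> b1_e flip: mult_2)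
  then show ?thesis using assms by (auto simp: b1_e field_simps)
qed

lemma J_\<tau>0_expand:
  "(\<Sum>k<8. kk (b2 (J y w) (J (e k) (\<tau> (e 0))) / inc (n k)) (J (e k) (\<tau> (e 0)))) = kk (inc (n 0 / 2)) (J y w)"
proof -
  define v where "v k = J (e k) (\<tau> (e 0))" for k
  have b: "b2 (\<Sum>k<8. kk (c k) (v k)) (v j) = c j * (inc (n j) * inc (n 0) / 2)" if j: "j < 8" for c j
  proof -
    have "b2 (\<Sum>k<8. kk (c k) (v k)) (v j) = (\<Sum>k<8. if k = j then c j * (inc (n j) * inc (n 0) / 2) else 0)"
      unfolding b_sum by (rule sum.cong) (use j in \<open>auto simp: v_def b2_J_\<tau>0\<close>)
    then show ?thesis using j by simp
  qed
  have "kindep v"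
    unfolding kindep_def
  proof (intro conjI allI impI)
    fix c j assume "(\<Sum>k<8. kk (c k) (v k)) = 0" "(j :: nat) < 8"
    then show "c j = 0" using b[of j c] by simp
  qed (simp add: v_def)
  then obtain c where c: "kk 1 (J y w) = (\<Sum>k<8. kk (c k) (v k))" using kindep_spans by blast
  have "(\<Sum>k<8. kk (b2 (J y w) (v k) / inc (n k)) (v k)) = (\<Sum>k<8. kk (c k * inc (n 0) / 2) (v k))"
  proof (rule sum.cong[OF refl])
    fix k :: nat assume "k \<in> {..<8}"
    then have "b2 (J y w) (v k) = c k * (inc (n k) * inc (n 0) / 2)" using b[of k c] by (simp flip: c)
    moreover have "c k * (inc (n k) * inc (n 0) / 2) / inc (n k) = c k * inc (n 0) / 2"
      using \<open>k \<in> _\<close> by simp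
    ultimately show "kk (b2 (J y w) (v k) / inc (n k)) (v k) = kk (c k * inc (n 0) / 2) (v k)"
      by (simp only:)
  qed
  also have "\<dots> = kk (inc (n 0 / 2)) (kk 1 (J y w))"
    unfolding c by (simp add: ff_kk_sum inc_divide mult.commute)
  finally show ?thesis by (simp add: v_def)
qed

text \<open>
  The isometry with \<open>U (J y (\<tau> z)) = conj2 (J z (\<tau> y))\<close>. It exists by
  \<open>J_J_symmetry\<close>, and is given by this formula because \<open>J (e 0)\<close> maps the basis
  \<open>\<tau> (e k)\<close> to a basis.
\<close>

definition U :: "'v \<Rightarrow> 'v" where "U w = kk (inc (2 / n 0)) (conj2 (R (\<tau> (e 0)) (J (e 0) w)))"

lemma lin_U: "lin U"
  by (rule linI')
    (simp_all add: U_def J_add lin_simps[OF lin_R] conj2_add ff_kk_add mult.commute, insert conj2_kk[of 0 0], simp)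

lemma kk_U [simp]: "kk 1 (U w) = U w" "U (kk 1 w) = U w"
  by (simp_all add: U_def)

lemma ff_U [simp]: "ff r (U w) = 0"
  using ff_kk_comp(3)[of r 1 "U w"] by simp

lemma U_J: "U (J y (\<tau> z)) = conj2 (J z (\<tau> y))"
proof -
  define D where "D = J z (\<tau> y)"
  have "b2 (J (e 0) (J y (\<tau> z))) (\<tau> (e k)) = b2 D (J (e k) (\<tau> (e 0)))" for k
    using J_J_symmetry[of "e k" "e 0" y z] b2_J_hermitian[of "\<tau> (e 0)" "e k" D]
    by (simp add: D_def b_sym(2)[of "J (e 0) _"])
  then have "R (\<tau> (e 0)) (J (e 0) (J y (\<tau> z))) = kk (inc (n 0 / 2)) D"
    unfolding R_def using J_\<tau>0_expand[of z "\<tau> y"] by (simp add: D_def)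
  then show ?thesis by (simp add: U_def D_def flip: inc_mult)
qed

lemma b2_U: "b2 (U v) (U w) = b2 v w"
proof -
  have g: "b2 (conj2 v) (conj2 w) = conj (b2 v w)" for v w by (simp add: b2_conj2)
  have r: "b2 (R (\<tau> (e 0)) v) (R (\<tau> (e 0)) w) = inc (n 0 / 2) * b2 v w" for v w
  proof -
    have "2 * b2 (R (\<tau> (e 0)) v) (R (\<tau> (e 0)) w) = inc (n 0) * b2 v w"
      using R_polar[of "\<tau> (e 0)" v "\<tau> (e 0)" w] by (simp add: b2_\<tau> b1_e flip: mult_2)
    then show ?thesis by (simp add: inc_divide field_simps)
  qed
  have "fst_part (Q (e 0)) = n 0 / 2" using b1_self[of "e 0"] by (simp add: n_def)
  then have j: "b2 (J (e 0) v) (J (e 0) w) = inc (n 0 / 2) * conj (b2 v w)" using b2_J_J by simp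
  have "b2 (U v) (U w) = inc (2 / n 0 * (2 / n 0) * (n 0 / 2) * (n 0 / 2)) * b2 v w"
    by (simp only: U_def b_ff_kk g r j conj_mult conj_simps inc_mult mult_ac)
  also have "2 / n 0 * (2 / n 0) * (n 0 / 2) * (n 0 / 2) = 1" by simp
  finally show ?thesis by simp
qed

abbreviation chi3 :: "'g \<Rightarrow> 'f cplx" where "chi3 g \<equiv> \<chi> g * \<chi> g * \<chi> g"

lemma chi3_add: "chi3 (g + k) = chi3 g * chi3 k" by (simp add: \<chi>(2) mult_ac)

lemma unitary_chi3: "chi3 g * conj (chi3 g) = 1"
proof -
  have "chi3 g * conj (chi3 g) = (\<chi> g * conj (\<chi> g)) * (\<chi> g * conj (\<chi> g)) * (\<chi> g * conj (\<chi> g))"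
    by (simp only: conj_mult mult_ac)
  then show ?thesis by (simp only: \<chi>(1) mult_1)
qed

text \<open>
  This is \<open>J_J_twisted_symmetry\<close>, in which \<open>J (e l) (\<tau> y)\<close> is rewritten as
  \<open>conj2 (U (J y (\<tau> (e l))))\<close>; the sum over \<open>l\<close> then is an expansion of
  \<open>b2\<close>.
\<close>

lemma U_J_J: assumes x: "x \<in> V1 a" and y: "y \<in> V1 b"
  shows "U (J y (J x w)) = kk (conj (chi3 (a + b))) (J y (J x (U w)))"
proof -
  define Ut where "Ut = adj U"
  have Ut: "b2 (U v) w = b2 v (Ut w)" "lin Ut" for v w
    unfolding Ut_def by (rule b_adj(2)[OF lin_U], rule adj_spec(1)[OF lin_U])
  have on_\<tau>: "U (J y (J x (Ut (\<tau> c)))) = kk (conj (chi3 (a + b))) (J y (J x (\<tau> c)))" for c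
  proof -
    have "b2 (\<tau> z) (U (J y (J x (Ut (\<tau> c))))) = b2 (\<tau> z) (kk (conj (chi3 (a + b))) (J y (J x (\<tau> c))))" for z
    proof -
      have flip: "b2 (\<tau> z) (J (e l) (\<tau> y)) = b2 (J y (Ut (\<tau> z))) (\<tau> (e l))" for l z y
      proof -
        have "J (e l) (\<tau> y) = conj2 (U (J y (\<tau> (e l))))" by (simp add: U_J)
        then have "b2 (\<tau> z) (J (e l) (\<tau> y)) = conj (b2 (\<tau> z) (U (J y (\<tau> (e l)))))"
          using b2_conj2[of "U (J y (\<tau> (e l)))" "\<tau> z"] by (simp add: b_sym(2))
        also have "b2 (\<tau> z) (U (J y (\<tau> (e l)))) = b2 (Ut (\<tau> z)) (J y (\<tau> (e l)))"
          using Ut(1)[of "J y (\<tau> (e l))" "\<tau> z"] by (simp add: b_sym(2))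
        also have "conj (b2 (Ut (\<tau> z)) (J y (\<tau> (e l)))) = b2 (\<tau> (e l)) (J y (Ut (\<tau> z)))"
          by (rule b2_J_hermitian[symmetric])
        finally show ?thesis by (simp add: b_sym(2))
      qed
      have "conj (b2 (\<tau> z) (U (J y (J x (Ut (\<tau> c)))))) = conj (b2 (Ut (\<tau> z)) (J y (J x (Ut (\<tau> c)))))"
        using Ut(1)[of "J y (J x (Ut (\<tau> c)))" "\<tau> z"] by (simp add: b_sym(2))
      also have "\<dots> = b2 (J y (Ut (\<tau> z))) (J x (Ut (\<tau> c)))"
        unfolding b2_J_hermitian[of "J x (Ut (\<tau> c))" y "Ut (\<tau> z)", symmetric] by (rule b_sym)
      also have "\<dots> = chi3 (a + b) * conj (b2 (\<tau> c) (J x (J y (\<tau> z))))"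
        unfolding b2_expand_right[of "J y (Ut (\<tau> z))"] flip[symmetric]
        by (rule J_J_twisted_symmetry[OF rk_EH[OF x y]])
      also have "b2 (\<tau> c) (J x (J y (\<tau> z))) = b2 (\<tau> z) (J y (J x (\<tau> c)))"
        using b2_J_hermitian[of "\<tau> c" x "J y (\<tau> z)"] b2_J_hermitian[of "J x (\<tau> c)" y "\<tau> z"]
        by (simp add: b_sym(2)[of "J x (\<tau> c)"])
      finally have "conj (b2 (\<tau> z) (U (J y (J x (Ut (\<tau> c)))))) = chi3 (a + b) * conj (b2 (\<tau> z) (J y (J x (\<tau> c))))" .
      from arg_cong[OF this, of conj] show ?thesis by (simp add: conj_mult)
    qed
    from b2_\<tau>_eqI[OF this] show ?thesis by simp
  qed
  have "U (J y (J x (Ut (kk 1 v)))) = kk (conj (chi3 (a + b))) (J y (J x (kk 1 v)))" for v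
  proof (rule \<tau>_basis_eqI)
    show "lin (\<lambda>v. U (J y (J x (Ut v))))"
      by (rule linI') (simp_all add: lin_simps[OF Ut(2)] lin_simps[OF lin_U] J_add)
    show "lin (\<lambda>v. kk (conj (chi3 (a + b))) (J y (J x v)))"
      by (rule linI') (simp_all add: J_add ff_kk_add mult.commute)
  qed (rule on_\<tau>)
  from this[of "U w"] have "U (J y (J x (Ut (U w)))) = kk (conj (chi3 (a + b))) (J y (J x (U w)))" by simp
  moreover have "kk 1 (Ut (U w)) = kk 1 w"
    by (rule b2_eqI) (simp add: b2_U flip: Ut(1))
  then have "J x (Ut (U w)) = J x w" by (metis J_ff_kk(2))
  ultimately show ?thesis by simp
qed

text \<open>
  Multiplication by \<open>\<chi>(k)\<^sup>3\<close> on the part of degree \<open>k\<close>; it is well defined modulo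
  \<open>{0, h, h + h}\<close>. The sum contains each part three times.
\<close>

definition \<Theta> :: "'v \<Rightarrow> 'v" where "\<Theta> w = kk (1 / 3) (\<Sum>g\<in>S. kk (chi3 g) (pr2 g w))"

lemma lin_\<Theta>: "lin \<Theta>"
  by (rule linI')
    (simp_all add: \<Theta>_def lin_simps[OF lin_pr2] pr2_add ff_kk_add sum.distrib ff_kk_sum mult_ac)

lemma kk_\<Theta> [simp]: "kk 1 (\<Theta> w) = \<Theta> w" "\<Theta> (kk 1 w) = \<Theta> w" by (simp_all add: \<Theta>_def)

lemma \<Theta>_V2: assumes w: "w \<in> V2 k" shows "\<Theta> w = kk (chi3 k) w"
proof -
  have "kk (chi3 g) (pr2 g w) = kk (chi3 k) (pr2 g w)" for g
    using V2_pr2[OF w, of g] \<chi>_cong[of g k] by auto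
  then have "\<Theta> w = kk (1 / 3) (\<Sum>g\<in>S. kk (chi3 k) (pr2 g w))" by (simp only: \<Theta>_def)
  also have "\<dots> = kk (1 / 3) (kk (chi3 k) (\<Sum>g\<in>S. pr2 g w))" by (simp only: ff_kk_sum)
  finally show ?thesis by (simp add: sum_pr2)
qed

lemma b2_\<Theta>: assumes v: "v \<in> V2 k" shows "b2 v (\<Theta> w) = conj (chi3 k) * b2 v w"
proof -
  have "b2 v (\<Theta> (kk 1 w)) = conj (chi3 k) * b2 v (kk 1 w)"
  proof (rule V2_induct[where P = "\<lambda>w. b2 v (\<Theta> w) = conj (chi3 k) * b2 v w"])
    fix g w assume w: "w \<in> V2 g"
    show "b2 v (\<Theta> w) = conj (chi3 k) * b2 v w"
    proof (cases "cong (k + g) 0")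
      case True
      have "chi3 k * chi3 g = 1" using \<chi>_cong[OF True] unfolding chi3_add by simp
      then have "conj (chi3 k) * (chi3 k * chi3 g) = conj (chi3 k)" by simp
      then have "(chi3 k * conj (chi3 k)) * chi3 g = conj (chi3 k)" by (simp only: mult_ac)
      then have "chi3 g = conj (chi3 k)" unfolding unitary_chi3 by simp
      then show ?thesis by (simp only: \<Theta>_V2[OF w] b_ff_kk)
    qed (simp add: \<Theta>_V2[OF w] b2_V2[OF v w])
  qed (simp add: lin_simps[OF lin_\<Theta>] b_add distrib_left)
  then show ?thesis by simp
qed

lemma b2_\<Theta>_\<Theta>: "b2 (\<Theta> v) (\<Theta> w) = b2 v w"
proof -
  have "b2 (\<Theta> (kk 1 v)) (\<Theta> w) = b2 (kk 1 v) w"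
  proof (rule V2_induct[where P = "\<lambda>v. b2 (\<Theta> v) (\<Theta> w) = b2 v w"])
    fix g v assume v: "v \<in> V2 g"
    have "b2 (\<Theta> v) (\<Theta> w) = (chi3 g * conj (chi3 g)) * b2 v w"
      by (simp only: \<Theta>_V2[OF v] b_ff_kk b2_\<Theta>[OF v] mult.assoc)
    then show "b2 (\<Theta> v) (\<Theta> w) = b2 v w" unfolding unitary_chi3 by simp
  qed (simp add: lin_simps[OF lin_\<Theta>] b_add)
  then show ?thesis by simp
qed

lemma \<Theta>_J_J: assumes x: "x \<in> V1 a" and y: "y \<in> V1 b"
  shows "\<Theta> (J x (J y v)) = kk (chi3 (a + b)) (J x (J y (\<Theta> v)))"
proof -
  have "\<Theta> (J x (J y (kk 1 v))) = kk (chi3 (a + b)) (J x (J y (\<Theta> (kk 1 v))))"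
  proof (rule V2_induct[where P = "\<lambda>v. \<Theta> (J x (J y v)) = kk (chi3 (a + b)) (J x (J y (\<Theta> v)))"])
    fix k v assume v: "v \<in> V2 k"
    have "J x (J y v) \<in> V2 (a + b + k)" using J_V2[OF x J_V2[OF y v]] by (simp add: add.assoc)
    then show "\<Theta> (J x (J y v)) = kk (chi3 (a + b)) (J x (J y (\<Theta> v)))"
      by (simp only: \<Theta>_V2 \<Theta>_V2[OF v] chi3_add J_kk conj_simps ff_kk_comp)
  qed (simp add: lin_simps[OF lin_\<Theta>] J_add ff_kk_add)
  then show ?thesis by simp
qed

lemma \<Theta>_U_J_J: "\<Theta> (U (J x (J y w))) = J x (J y (\<Theta> (U w)))"
proof -
  have hom: "\<Theta> (U (J x (J y w))) = J x (J y (\<Theta> (U w)))" if x: "x \<in> V1 a" and y: "y \<in> V1 b" for x y a b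
  proof -
    have "\<Theta> (U (J x (J y w))) = kk (conj (chi3 (b + a)) * chi3 (a + b)) (J x (J y (\<Theta> (U w))))"
      by (simp only: U_J_J[OF y x] lin_simps(4)[OF lin_\<Theta>] \<Theta>_J_J[OF x y] ff_kk_comp)
    also have "conj (chi3 (b + a)) * chi3 (a + b) = 1"
      using unitary_chi3[of "a + b"] by (simp only: mult.commute add.commute)
    finally show ?thesis by simp
  qed
  have "\<Theta> (U (J (ff 1 x) (J (ff 1 y) w))) = J (ff 1 x) (J (ff 1 y) (\<Theta> (U w)))"
  proof (rule V1_induct[where P = "\<lambda>x. \<Theta> (U (J x (J (ff 1 y) w))) = J x (J (ff 1 y) (\<Theta> (U w)))"])
    fix a x assume x: "x \<in> V1 a"
    show "\<Theta> (U (J x (J (ff 1 y) w))) = J x (J (ff 1 y) (\<Theta> (U w)))"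
      by (rule V1_induct[where P = "\<lambda>y. \<Theta> (U (J x (J y w))) = J x (J y (\<Theta> (U w)))"])
        (simp_all add: hom[OF x] J_add lin_simps[OF lin_U] lin_simps[OF lin_\<Theta>])
  qed (simp add: J_add lin_simps[OF lin_U] lin_simps[OF lin_\<Theta>])
  then show ?thesis by simp
qed

lemma J_\<tau>_nonzero:
  obtains c y z k l m where "c \<in> V1 k" "y \<in> V1 l" "z \<in> V1 m" "b2 (\<tau> c) (J y (\<tau> z)) \<noteq> 0"
proof (rule ccontr)
  assume "\<not> thesis"
  note none = \<open>\<not> thesis\<close> and obt = that
  have 0: "b2 (\<tau> c) (J y (\<tau> z)) = 0" if "c \<in> V1 k" "y \<in> V1 l" "z \<in> V1 m" for c y z k l m
    using none obt[OF that] by blast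
  have 1: "b2 (\<tau> (ff 1 c)) (J y (\<tau> z)) = 0" if "y \<in> V1 l" "z \<in> V1 m" for c y z l m
    by (rule V1_induct[where P = "\<lambda>c. b2 (\<tau> c) (J y (\<tau> z)) = 0"]) (simp_all add: 0[OF _ that] \<tau>_add b_add)
  have 2: "b2 (\<tau> (ff 1 c)) (J (ff 1 y) (\<tau> z)) = 0" if "z \<in> V1 m" for c y z m
    by (rule V1_induct[where P = "\<lambda>y. b2 (\<tau> (ff 1 c)) (J y (\<tau> z)) = 0"]) (simp_all only: 1[OF _ that] J_add b_add add_0)
  have 3: "b2 (\<tau> (ff 1 c)) (J (ff 1 y) (\<tau> (ff 1 z))) = 0" for c y z
    by (rule V1_induct[where P = "\<lambda>z. b2 (\<tau> (ff 1 c)) (J (ff 1 y) (\<tau> z)) = 0"]) (simp_all only: 2 \<tau>_add J_add b_add add_0)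
  have "b2 (\<tau> c) (J (e 0) (\<tau> (e 0))) = b2 (\<tau> c) 0" for c using 3[of c "e 0" "e 0"] by simp
  from b2_\<tau>_eqI[OF this] have "J (e 0) (\<tau> (e 0)) = 0" by simp
  then have "b2 (J (e 0) (\<tau> (e 0))) (J (e 0) (\<tau> (e 0))) = 0" by simp
  then show False by (simp add: b2_J_\<tau>0)
qed

text \<open>
  \<open>\<Theta> \<circ> U\<close> commutes with the even Clifford algebra, so it is a scalar
  \<open>\<kappa>\<close>, and the assertion holds up to \<open>\<kappa>\<close>. As a composition of isometries,
  \<open>\<kappa>\<close> has square 1; and three cyclic shifts of a nonzero value show
  \<open>\<kappa>\<^sup>3 = 1\<close>, since the degrees of its arguments sum to zero.
\<close>

theorem trilinear_cyclic:
  assumes c: "c \<in> V1 k" shows "b2 (\<tau> y) (J z (\<tau> c)) = chi3 k * b2 (\<tau> c) (J y (\<tau> z))"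
proof -
  have "lin (\<lambda>w. \<Theta> (U w))" using lin_comp[OF lin_\<Theta> lin_U] by (simp add: comp_def)
  then obtain \<kappa> where "\<And>w. kk 1 (\<Theta> (U w)) = kk \<kappa> w"
    using even_clifford_commutant[of "\<lambda>w. \<Theta> (U w)"] \<Theta>_U_J_J by blast
  then have \<kappa>: "\<Theta> (U w) = kk \<kappa> w" for w by simp
  have cyc: "b2 (\<tau> y) (J z (\<tau> c)) = \<kappa> * chi3 k * b2 (\<tau> c) (J y (\<tau> z))" if c: "c \<in> V1 k" for c k y z
  proof -
    have "\<kappa> * b2 (\<tau> c) (J y (\<tau> z)) = b2 (\<tau> c) (\<Theta> (U (J y (\<tau> z))))" by (simp add: \<kappa>)
    also have "\<dots> = conj (chi3 k) * b2 (\<tau> c) (conj2 (J z (\<tau> y)))"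
      by (simp only: b2_\<Theta>[OF \<tau>_V1(1)[OF c]] U_J)
    also have "b2 (\<tau> c) (conj2 (J z (\<tau> y))) = conj (b2 (\<tau> c) (J z (\<tau> y)))"
      using b2_conj2[of "J z (\<tau> y)" "\<tau> c"] by (simp add: b_sym(2))
    also have "\<dots> = b2 (\<tau> y) (J z (\<tau> c))" by (rule b2_J_hermitian[symmetric])
    finally have "chi3 k * (\<kappa> * b2 (\<tau> c) (J y (\<tau> z))) = (chi3 k * conj (chi3 k)) * b2 (\<tau> y) (J z (\<tau> c))"
      by (simp only: mult.assoc)
    then show ?thesis unfolding unitary_chi3 by (simp add: mult_ac)
  qed
  have "\<kappa> * \<kappa> = 1"
  proof -
    obtain v w where vw: "b2 v w = 1" using complex_component_nonzero by blast
    have "b2 (\<Theta> (U v)) (\<Theta> (U w)) = b2 v w" by (simp only: b2_\<Theta>_\<Theta> b2_U)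
    then show ?thesis by (simp add: \<kappa> vw)
  qed
  moreover have "\<kappa> * \<kappa> * \<kappa> = 1"
  proof -
    obtain c y z k l m where cyz: "c \<in> V1 k" "y \<in> V1 l" "z \<in> V1 m" and nz: "b2 (\<tau> c) (J y (\<tau> z)) \<noteq> 0"
      by (rule J_\<tau>_nonzero)
    have "cong (k + (l + m)) 0"
      using b2_V2[OF \<tau>_V1(1)[OF cyz(1)] J_V2[OF cyz(2) \<tau>_V1(1)[OF cyz(3)]]] nz by blast
    then have "chi3 (k + (l + m)) = 1" using \<chi>_cong by fastforce
    then have "chi3 k * (chi3 l * chi3 m) = 1" unfolding chi3_add .
    moreover have "b2 (\<tau> c) (J y (\<tau> z)) = \<kappa> * \<kappa> * \<kappa> * (chi3 k * (chi3 l * chi3 m)) * b2 (\<tau> c) (J y (\<tau> z))"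
    proof -
      have "b2 (\<tau> c) (J y (\<tau> z)) = \<kappa> * chi3 m * (\<kappa> * chi3 l * (\<kappa> * chi3 k * b2 (\<tau> c) (J y (\<tau> z))))"
        using cyc[OF cyz(3), of c y] cyc[OF cyz(2), of z c] cyc[OF cyz(1), of y z] by simp
      then show ?thesis by (simp only: mult_ac)
    qed
    ultimately show ?thesis using nz by simp
  qed
  ultimately have "\<kappa> = 1" by simp
  then show ?thesis using cyc[OF c, of y z] by simp
qed

end

section \<open>The two gradings of the twisted composition\<close>

text \<open>A grading cannot be properly contained in another one, by uniqueness of components.\<close>

lemma decomposes_mono_eq:
  assumes A: "decomposes C A" and B: "decomposes C B" and sub: "\<And>g. A g \<subseteq> B g"
  shows "A = B"
proof (rule ext, rule equalityI[OF sub], rule subsetI)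
  fix g x assume x: "x \<in> B g"
  then have C: "x \<in> C" by (rule decomposes_closed(1)[OF B])
  define f where "f k = component A k x" for k
  have f: "f k \<in> A k" "finite {k. f k \<noteq> 0}" "x = (\<Sum>k | f k \<noteq> 0. f k)" for k
    unfolding f_def by (rule component_spec[OF A C])+
  have "component B g x = (if g \<in> {k. f k \<noteq> 0} then f g else 0)"
    by (rule component_eqI[OF B C f(2) _ f(3)]) (use f(1) sub in blast)
  then have "x = f g" using component_homogeneous[OF B x, of g] by (simp split: if_splits)
  then show "x \<in> A g" using f(1)[of g] by simp
qed

lemma decomposes_image:
  fixes \<phi> :: "'a::ab_group_add \<Rightarrow> 'a"
  assumes W: "decomposes UNIV W" and \<phi>: "\<And>x y. \<phi> (x + y) = \<phi> x + \<phi> y" "\<And>x. \<phi> (\<phi> x) = x"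
  shows "decomposes UNIV (\<lambda>g. \<phi> ` W g)"
proof -
  have zero: "\<phi> 0 = 0" using \<phi>(1)[of 0 0] by simp
  have eq0: "\<phi> x = 0 \<longleftrightarrow> x = 0" for x using \<phi>(2)[of x] zero by metis
  have minus: "\<phi> (- x) = - \<phi> x" for x using \<phi>(1)[of x "- x"] zero by (simp add: eq_neg_iff_add_eq_0 add.commute)
  have sum: "\<phi> (sum f I) = (\<Sum>i\<in>I. \<phi> (f i))" for f and I :: "'b set"
    by (induction I rule: infinite_finite_induct) (simp_all add: zero \<phi>(1))
  have mem: "y \<in> \<phi> ` W g \<longleftrightarrow> \<phi> y \<in> W g" for y g by (metis \<phi>(2) image_iff)
  define dec where "dec W x f \<longleftrightarrow> (\<forall>g. f g \<in> W g) \<and> finite {g. f g \<noteq> 0} \<and> x = (\<Sum>g | f g \<noteq> 0. f g)"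
    for W :: "'b \<Rightarrow> 'a set" and x f
  have move: "dec W (\<phi> x) (\<lambda>g. \<phi> (f g))" if "dec (\<lambda>g. \<phi> ` W g) x f" for x f
    using that unfolding dec_def mem eq0 by (auto simp: sum)
  have pull: "dec (\<lambda>g. \<phi> ` W g) x (\<lambda>g. \<phi> (f g))" if "dec W (\<phi> x) f" for x f
  proof -
    have "x = \<phi> (\<Sum>g | f g \<noteq> 0. f g)" using that unfolding dec_def by (metis \<phi>(2))
    then show ?thesis using that unfolding dec_def by (simp add: mem \<phi>(2) eq0 sum)
  qed
  have "\<exists>!f. dec (\<lambda>g. \<phi> ` W g) x f" for x
  proof -
    have "\<exists>!f. dec W (\<phi> x) f" using W unfolding decomposes_def dec_def by blast
    then obtain f where f: "dec W (\<phi> x) f" "\<And>f'. dec W (\<phi> x) f' \<Longrightarrow> f' = f" by blast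
    show ?thesis
    proof (rule ex1I)
      show "dec (\<lambda>g. \<phi> ` W g) x (\<lambda>g. \<phi> (f g))" by (rule pull[OF f(1)])
      fix f' assume "dec (\<lambda>g. \<phi> ` W g) x f'"
      from f(2)[OF move[OF this]] show "f' = (\<lambda>g. \<phi> (f g))" using \<phi>(2) by (metis (no_types))
    qed
  qed
  then have "\<forall>x\<in>UNIV. \<exists>!f. (\<forall>g. f g \<in> \<phi> ` W g) \<and> finite {g. f g \<noteq> 0} \<and> x = (\<Sum>g | f g \<noteq> 0. f g)"
    by (simp only: dec_def) simp
  moreover have "\<phi> ` W g \<subseteq> UNIV \<and> 0 \<in> \<phi> ` W g \<and> (\<forall>x\<in>\<phi> ` W g. \<forall>y\<in>\<phi> ` W g. x + y \<in> \<phi> ` W g)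
      \<and> (\<forall>x\<in>\<phi> ` W g. - x \<in> \<phi> ` W g)" for g
    using decomposes_closed(2-4)[OF W] by (simp add: mem \<phi> minus zero)
  ultimately show ?thesis unfolding decomposes_def by blast
qed

context twisted_composition
begin

lemma polar_beta_s: "polar \<beta> (s l v) (s l w) = s (sharp l) (polar \<beta> v w)"
  unfolding polar_def by (simp add: beta_s S.scale_right_diff_distrib flip: S.scale_right_distrib)

lemma tc_grading_iff: "twisted_composition_grading s \<beta> Q \<Lambda> W \<longleftrightarrow>
  algebra_grading (L_alg :: ('f, 'f cubic) module) \<Lambda> \<and> decomposes UNIV W \<and> (\<forall>g c. \<forall>x\<in>W g. s (of_F c) x \<in> W g) \<and>
  (\<forall>g h. \<forall>l\<in>\<Lambda> g. \<forall>v\<in>W h. s l v \<in> W (g + h)) \<and>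
  (\<forall>g h. \<forall>v\<in>W g. \<forall>w\<in>W h. polar \<beta> v w \<in> W (g + h)) \<and>
  (\<forall>g h. \<forall>v\<in>W g. \<forall>w\<in>W h. polar Q v w \<in> \<Lambda> (g + h))"
  unfolding twisted_composition_grading_def V_grading_iff by blast

text \<open>
  \<open>a = (1, - 1)\<close> satisfies \<open>a\<^sup>2 = 1\<close> and \<open>a\<^sup>\<sharp> = a\<close>, so
  multiplication by it is an automorphism of the twisted composition; being central in \<open>E\<close>, it does not
  affect the induced grading.
\<close>

lemma inducing_gradings_center:
  assumes "(\<Lambda>, W) \<in> inducing_gradings s \<beta> Q \<Gamma>"
  shows "(\<Lambda>, \<lambda>g. s (Cubic 1 (- 1)) ` W g) \<in> inducing_gradings s \<beta> Q \<Gamma>"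
proof -
  define a :: "'f cubic" where "a = Cubic 1 (- 1)"
  have a: "a * a = 1" "sharp a = a" by (simp_all add: a_def cubic_eq_iff conj_minus)
  have saa: "s a (s a x) = x" for x by (simp add: a(1))
  have mem: "y \<in> s a ` W g \<longleftrightarrow> s a y \<in> W g" for y g by (metis saa image_iff)
  have tcg: "twisted_composition_grading s \<beta> Q \<Lambda> W" and ind: "induced_grading s W = \<Gamma>"
    using assms by (simp_all add: inducing_gradings_def)
  have comm: "s a (s l v) = s l (s a v)" for l v by (simp add: mult.commute)
  have "decomposes UNIV (\<lambda>g. s a ` W g)"
    by (rule decomposes_image) (use tcg in \<open>simp_all add: tc_grading_iff S.scale_right_distrib a(1)\<close>)
  moreover have pol: "polar \<beta> (s a v) (s a w) = s a (polar \<beta> v w)" "polar Q (s a v) (s a w) = polar Q v w" for v w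
    by (simp_all add: polar_beta_s a polar_Q_scale flip: mult.assoc)
  moreover have "s l (s a v) \<in> s a ` W (g + k)" if "l \<in> \<Lambda> g" "v \<in> W k" for g k l v
    using tcg that unfolding comm[symmetric] tc_grading_iff by (intro imageI) blast
  moreover have "s (of_F c) (s a v) \<in> s a ` W g" if "v \<in> W g" for g c v
    using tcg that unfolding comm[symmetric] tc_grading_iff by (intro imageI) blast
  ultimately have "twisted_composition_grading s \<beta> Q \<Lambda> (\<lambda>g. s a ` W g)"
    using tcg unfolding tc_grading_iff ball_simps(9) pol by (auto simp del: S.scale_scale)
  moreover have "induced_grading s (\<lambda>g. s a ` W g) = induced_grading s W"
  proof
    fix g
    have "f \<in> induced_grading s (\<lambda>g. s a ` W g) g \<longleftrightarrow> f \<in> induced_grading s W g" for f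
    proof (cases "lin f")
      case True
      have "(\<forall>k. f ` s a ` W k \<subseteq> s a ` W (g + k)) \<longleftrightarrow> (\<forall>k. f ` W k \<subseteq> W (g + k))"
        by (auto simp: mem lin_simps(2)[OF True] saa image_subset_iff simp del: S.scale_scale)
      then show ?thesis using True unfolding induced_grading_def by simp
    qed (simp add: induced_grading_def)
    then show "induced_grading s (\<lambda>g. s a ` W g) g = induced_grading s W g" by blast
  qed
  ultimately show ?thesis using ind unfolding inducing_gradings_def a_def by simp
qed

end

context trialitarian_isometry
begin

text \<open>Twisting with \<open>\<chi>\<close> refines the grading of \<open>V\<close> modulo the degrees of \<open>L\<close>.\<close>

definition VG :: "'g \<Rightarrow> 'v set" where "VG g = {x + kk (\<chi> g) (\<tau> x) | x. x \<in> V1 g}"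

lemma VGI: "x \<in> V1 g \<Longrightarrow> x + kk (\<chi> g) (\<tau> x) \<in> VG g" unfolding VG_def by blast

lemma VGE: assumes "v \<in> VG g" obtains x where "x \<in> V1 g" "v = x + kk (\<chi> g) (\<tau> x)"
  using assms unfolding VG_def by blast

text \<open>
  The vector of \<open>V\<^sub>1\<close> that corresponds to the real part for the conjugation \<open>conj2\<close>.
\<close>

definition re_part :: "'v \<Rightarrow> 'v" where "re_part y = (\<Sum>k<8. ff (re (b2 y (\<tau> (e k))) / n k) (e k))"

lemma re_part_add: "re_part (v + w) = re_part v + re_part w"
  by (simp add: re_part_def b_add add_divide_distrib ff_add_left sum.distrib)

lemma ff_re_part [simp]: "ff 1 (re_part w) = re_part w" by (simp add: re_part_def ff_kk_sum)

lemma \<tau>_re_part: "\<tau> (re_part w) = kk (1 / 2) (w + conj2 w)"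
proof -
  have half: "inc (re z) = (z + conj z) / 2" for z :: "'f cplx" by (simp add: add_conj inc_mult)
  have "b2 (\<tau> c) (\<tau> (re_part w)) = b2 (\<tau> c) (kk (1 / 2) (w + conj2 w))" for c
  proof -
    have "b2 (\<tau> c) (conj2 w) = conj (b2 w (\<tau> c))"
      using b2_conj2[of w "\<tau> c"] by (simp add: b_sym(2))
    then have "b2 (\<tau> c) (kk (1 / 2) (w + conj2 w)) = inc (re (b2 w (\<tau> c)))"
      by (simp add: b_add half b_sym(2)[of _ w])
    also have "b2 w (\<tau> c) = (\<Sum>k<8. inc (b1 c (e k) / n k) * b2 w (\<tau> (e k)))"
      by (subst \<tau>_expand) (simp add: b_sum)
    also have "inc (re \<dots>) = b2 (\<tau> c) (\<tau> (re_part w))"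
      by (simp add: re_part_def b2_\<tau> b_sum re_sum mult.commute)
    finally show ?thesis by simp
  qed
  from b2_\<tau>_eqI[OF this] show "\<tau> (re_part w) = kk (1 / 2) (w + conj2 w)" by simp
qed

lemma re_part_zero [simp]: "re_part 0 = 0" by (simp add: re_part_def)

lemma re_part_V1: "w \<in> V2 g \<Longrightarrow> re_part w \<in> V1 g"
  by (simp add: V1_def \<tau>_re_part V2_kk V2_add conj2_V2)

text \<open>
  The vector \<open>x\<close> such that \<open>x + \<chi>(g) \<tau> x\<close> is the component of \<open>v\<close> of
  degree \<open>g\<close>. Modulo \<open>{0, h, h + h}\<close> the degrees are separated by \<open>pr1\<close> and
  \<open>pr2\<close>, and within a class by summing over the three embeddings of \<open>L\<close> into
  \<open>K\<close>: if \<open>g\<close> and \<open>k\<close> are congruent, then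
  \<open>1 + 2 Re (conj (\<chi> g) \<chi> k)\<close> is 3 for \<open>g = k\<close> and 0 otherwise.
\<close>

definition VG_part :: "'g \<Rightarrow> 'v \<Rightarrow> 'v" where
  "VG_part g v = ff (1 / 3) (pr1 g v + ff 2 (re_part (kk (conj (\<chi> g)) (pr2 g v))))"

lemma VG_part_V1: "VG_part g v \<in> V1 g"
  unfolding VG_part_def by (intro V1_ff V1_add pr1_V1 re_part_V1 V2_kk pr2_V2)

lemma VG_part_add: "VG_part g (v + w) = VG_part g v + VG_part g w"
  by (simp add: VG_part_def pr1_add pr2_add re_part_add ff_kk_add add_ac)

lemma VG_part_outside: "g \<notin> S \<Longrightarrow> VG_part g v = 0" by (simp add: VG_part_def pr1_outside pr2_outside)

lemma re_\<omega>: "re \<omega> = - 1 / 2" "re (conj \<omega>) = - 1 / 2"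
proof -
  have "re (\<omega> + conj \<omega>) = - 1" using \<omega>(1) unfolding conj_\<omega> by (metis add.commute add_eq_0_iff re_im_ring_simps(1) re_im_simps(7))
  then show "re \<omega> = - 1 / 2" "re (conj \<omega>) = - 1 / 2" by simp_all
qed

lemma VG_part_VG: assumes v: "v \<in> VG k" shows "VG_part g v = (if g = k then ff 1 v else 0)"
proof -
  obtain x where x: "x \<in> V1 k" and v: "v = x + kk (\<chi> k) (\<tau> x)" using v by (rule VGE)
  have fx: "ff 1 x = x" by (rule \<tau>_V1(2)[OF x])
  have pi: "pr1 g v = (if cong g k then x else 0)"
    using V1_pr1[OF x, of g] unfolding v by (simp add: pr1_add) (simp add: pr1_def lin_simps(5)[OF lin_pr2])
  have kx: "pr2 g x = 0" using lin_simps(3)[OF lin_pr2, of g 1 x] fx ff_kk_comp(3)[of 1 1 "pr2 g x"] by simp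
  have pr2: "pr2 g v = (if cong g k then kk (\<chi> k) (\<tau> x) else 0)"
    unfolding v using V2_pr2[OF \<tau>_V1(1)[OF x], of g] by (simp add: pr2_add kx)
  have rx: "re_part (kk c (\<tau> x)) = ff (re c) x" for c
  proof (rule \<tau>_inject')
    have "(c + conj c) / 2 = inc (re c)" by (simp add: add_conj inc_mult)
    then show "\<tau> (re_part (kk c (\<tau> x))) = \<tau> (ff (re c) x)"
      by (simp add: \<tau>_re_part add_divide_distrib ff_kk_add flip: kk_add_left)
  qed (simp_all add: fx)
  have eq: "VG_part g v = (if cong g k then ff ((1 + 2 * re (conj (\<chi> g) * \<chi> k)) / 3) x else 0)"
    unfolding VG_part_def pi pr2
    by (simp add: rx add_divide_distrib ff_add_left ff_kk_add del: re_im_ring_simps)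
  have v1: "ff 1 v = x" unfolding v by (simp add: ff_kk_add fx)
  have uk: "conj (\<chi> g) * \<chi> g = 1" for g using \<chi>(1)[of g] by (simp add: mult.commute)
  show ?thesis
  proof (cases "g = k")
    case True
    have "VG_part g v = ff ((1 + 2 * re (conj (\<chi> k) * \<chi> k)) / 3) x" using eq True by simp
    then show ?thesis unfolding uk v1 using True by (simp add: fx)
  next
    case False
    show ?thesis
    proof (cases "cong g k")
      case True
      then consider "k = g + h" | "k = g + h + h" using False unfolding cong_def by blast
      then have "re (conj (\<chi> g) * \<chi> k) = - 1 / 2"
      proof cases
        case 1
        have "conj (\<chi> g) * \<chi> k = (conj (\<chi> g) * \<chi> g) * \<omega>" unfolding 1 \<chi>(2,3) by (simp only: mult.assoc)
        then show ?thesis unfolding uk by (simp only: mult_1 re_\<omega>)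
      next
        case 2
        have "conj (\<chi> g) * \<chi> k = (conj (\<chi> g) * \<chi> g) * (\<omega> * \<omega>)" unfolding 2 \<chi>(2,3) by (simp only: mult.assoc)
        then show ?thesis unfolding uk conj_\<omega>[symmetric] by (simp only: mult_1 re_\<omega>)
      qed
      then show ?thesis unfolding eq using False by simp
    qed (use False in \<open>simp add: eq\<close>)
  qed
qed

text \<open>Shifting the summation by \<open>h\<close> multiplies the sum by \<open>c\<close>.\<close>

lemma sum_twisted_zero:
  assumes F: "\<And>g. F (g + h) = kk c (F g)" "\<And>g. kk 1 (F g) = F g" and c: "c \<noteq> 1"
  shows "(\<Sum>g\<in>S. F g) = 0"
proof -
  have "(\<Sum>g\<in>S. F g) = kk c (\<Sum>g\<in>S. F g)"
    using sum_S_shift[of F] by (simp add: F(1) ff_kk_sum)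
  moreover have "kk 1 (\<Sum>g\<in>S. F g) = (\<Sum>g\<in>S. F g)" by (simp add: F(2) ff_kk_sum)
  ultimately have "kk (c - 1) (\<Sum>g\<in>S. F g) = kk (c - 1) 0" by (simp add: kk_diff_left)
  then have "kk 1 (\<Sum>g\<in>S. F g) = kk 1 0" using c by (intro kk_cancel[of "c - 1"]) simp_all
  then show ?thesis by (simp add: F(2) ff_kk_sum)
qed

lemma pr2_h: "pr2 (g + h) w = pr2 g w"
proof -
  have "pr2 (g + h) w = kk (1 / 3) (pr2 (g + h) (kk 3 w))" by simp
  also have "\<dots> = kk (1 / 3) (\<Sum>l\<in>S. pr2 (g + h) (pr2 l w))"
    unfolding sum_pr2[symmetric] by (simp only: lin_simps(8)[OF lin_pr2])
  also have "\<dots> = kk (1 / 3) (\<Sum>l\<in>S. pr2 g (pr2 l w))"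
  proof -
    have "pr2 (g + h) (pr2 l w) = pr2 g (pr2 l w)" for l
      unfolding V2_pr2[OF pr2_V2] using cong_trans cong_h(1,2) by (metis (full_types))
    then show ?thesis by (simp only:)
  qed
  also have "\<dots> = kk (1 / 3) (pr2 g (kk 3 w))"
    unfolding sum_pr2[symmetric] by (simp only: lin_simps(8)[OF lin_pr2])
  finally show ?thesis by simp
qed

lemma \<omega>_ne_1: "\<omega> \<noteq> 1" "\<omega> * \<omega> \<noteq> 1"
  using re_\<omega> unfolding conj_\<omega>[symmetric] by (auto simp del: re_im_conj)

lemma VG_sum: "v = (\<Sum>g\<in>S. VG_part g v + kk (\<chi> g) (\<tau> (VG_part g v)))"
proof -
  have re_part_sum: "(\<Sum>g\<in>S. re_part (F g)) = re_part (\<Sum>g\<in>S. F g)" for F :: "'g \<Rightarrow> 'v"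
  proof -
    have "(\<Sum>g\<in>I. re_part (F g)) = re_part (\<Sum>g\<in>I. F g)" for I
      by (induction I rule: infinite_finite_induct) (simp_all add: re_part_add)
    then show ?thesis .
  qed
  have z1: "(\<Sum>g\<in>S. kk (conj (\<chi> g)) (pr2 g w)) = 0" for w
    by (rule sum_twisted_zero[of _ "conj \<omega>"])
      (use \<omega>_ne_1 in \<open>simp_all add: pr2_h \<chi>(2,3) conj_mult conj_\<omega> mult.commute\<close>)
  have z2: "(\<Sum>g\<in>S. kk (\<chi> g) (pr2 g w)) = 0" for w
    by (rule sum_twisted_zero[of _ \<omega>]) (use \<omega>_ne_1 in \<open>simp_all add: pr2_h \<chi>(2,3) mult.commute\<close>)
  have z3: "(\<Sum>g\<in>S. kk (\<chi> g * \<chi> g) (pr2 g w)) = 0" for w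
    by (rule sum_twisted_zero[of _ "\<omega> * \<omega>"]) (use \<omega>_ne_1 in \<open>simp_all add: pr2_h \<chi>(2,3) mult_ac\<close>)
  have "(\<Sum>g\<in>S. VG_part g v) = ff (1 / 3) ((\<Sum>g\<in>S. pr1 g v) + ff 2 (\<Sum>g\<in>S. re_part (kk (conj (\<chi> g)) (pr2 g v))))"
    by (simp only: VG_part_def ff_kk_sum sum.distrib ff_kk_add)
  then have 1: "(\<Sum>g\<in>S. VG_part g v) = ff 1 v" by (simp add: sum_pr1 re_part_sum z1)
  have "kk (\<chi> g) (\<tau> (VG_part g v)) = kk (1 / 3) (kk (\<chi> g) (pr2 g (\<tau> v)) + pr2 g v + kk (\<chi> g * \<chi> g) (pr2 g (conj2 v)))" for g
  proof -
    have uk: "\<chi> g * conj (\<chi> g) = 1" by (rule \<chi>(1))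
    have "kk (\<chi> g) (\<tau> (VG_part g v)) = kk (1 / 3 * \<chi> g) (pr2 g (\<tau> v)) + kk (1 / 3 * (\<chi> g * conj (\<chi> g))) (pr2 g v)
        + kk (1 / 3 * (\<chi> g * \<chi> g)) (conj2 (pr2 g v))"
      by (simp add: VG_part_def \<tau>_add \<tau>_pr1 \<tau>_re_part ff_kk_add inc_divide mult_ac add_ac del: \<chi>(1))
    then show ?thesis unfolding uk by (simp add: ff_kk_add pr2_conj2)
  qed
  then have "(\<Sum>g\<in>S. kk (\<chi> g) (\<tau> (VG_part g v))) = kk (1 / 3) ((\<Sum>g\<in>S. kk (\<chi> g) (pr2 g (\<tau> v))) + (\<Sum>g\<in>S. pr2 g v)
      + (\<Sum>g\<in>S. kk (\<chi> g * \<chi> g) (pr2 g (conj2 v))))"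
    by (simp only: ff_kk_sum sum.distrib ff_kk_add)
  then have 2: "(\<Sum>g\<in>S. kk (\<chi> g) (\<tau> (VG_part g v))) = kk 1 v" unfolding z2 z3 sum_pr2 by simp
  show ?thesis unfolding sum.distrib 1 2 by (simp add: ff_kk_split)
qed

lemma VG_decomposes: "decomposes UNIV VG"
proof (rule decomposesI[where \<pi> = "\<lambda>g v. VG_part g v + kk (\<chi> g) (\<tau> (VG_part g v))" and S = S])
  show "0 \<in> VG g" for g using VGI[OF V1_zero, of g] by simp
  show "x + y \<in> VG g" if x: "x \<in> VG g" and y: "y \<in> VG g" for g x y
  proof -
    obtain x' where x': "x' \<in> V1 g" "x = x' + kk (\<chi> g) (\<tau> x')" using x by (rule VGE)
    obtain y' where y': "y' \<in> V1 g" "y = y' + kk (\<chi> g) (\<tau> y')" using y by (rule VGE)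
    show ?thesis using VGI[OF V1_add[OF x'(1) y'(1)]] by (simp add: x'(2) y'(2) \<tau>_add ff_kk_add add_ac)
  qed
  show "- x \<in> VG g" if x: "x \<in> VG g" for g x
  proof -
    obtain x' where x': "x' \<in> V1 g" "x = x' + kk (\<chi> g) (\<tau> x')" using x by (rule VGE)
    have "ff (- 1) x' = - x'" using \<tau>_V1(2)[OF x'(1)] by (simp add: ff_minus_left)
    moreover have "\<tau> (ff (- 1) x') = - \<tau> x'" by (simp add: inc_minus kk_minus_left)
    ultimately show ?thesis using VGI[OF V1_ff[OF x'(1)], of "- 1"] by (simp add: x'(2) ff_kk_minus)
  qed
  show "VG_part g (x + y) + kk (\<chi> g) (\<tau> (VG_part g (x + y))) = VG_part g x + kk (\<chi> g) (\<tau> (VG_part g x)) + (VG_part g y + kk (\<chi> g) (\<tau> (VG_part g y)))" for g x y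
    by (simp add: VG_part_add \<tau>_add ff_kk_add add_ac)
  show "VG_part g x + kk (\<chi> g) (\<tau> (VG_part g x)) \<in> VG g" for g x by (rule VGI[OF VG_part_V1])
  show "VG_part g x + kk (\<chi> g) (\<tau> (VG_part g x)) = x" if x: "x \<in> VG g" for g x
  proof -
    obtain x' where x': "x' \<in> V1 g" "x = x' + kk (\<chi> g) (\<tau> x')" using x by (rule VGE)
    have "VG_part g x = x'" using VG_part_VG[OF x, of g] \<tau>_V1(2)[OF x'(1)] by (simp add: x'(2) ff_kk_add)
    then show ?thesis by (simp add: x'(2))
  qed
  show "VG_part k x + kk (\<chi> k) (\<tau> (VG_part k x)) = 0" if "x \<in> VG g" "k \<noteq> g" for g k x
    using VG_part_VG[OF that(1), of k] that(2) by simp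
  show "VG_part g x + kk (\<chi> g) (\<tau> (VG_part g x)) = 0" if "g \<notin> S" for g x by (simp add: VG_part_outside[OF that])
  show "x = (\<Sum>g\<in>S. VG_part g x + kk (\<chi> g) (\<tau> (VG_part g x)))" for x by (rule VG_sum)
qed (simp_all add: S(1))

lemma VG_F: "v \<in> VG g \<Longrightarrow> s (of_F c) v \<in> VG g"
proof -
  assume "v \<in> VG g"
  then obtain x where x: "x \<in> V1 g" "v = x + kk (\<chi> g) (\<tau> x)" by (rule VGE)
  have "s (of_F c) x = ff c x" using \<tau>_V1(2)[OF x(1)] by (metis ff_fixed_F_scale F_scale_def)
  then have "s (of_F c) v = ff c x + kk (\<chi> g) (\<tau> (ff c x))" by (simp add: x(2) S.scale_right_distrib mult.commute)
  then show ?thesis using VGI[OF V1_ff[OF x(1)]] by simp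
qed

lemma \<Gamma>_V1: assumes f: "f \<in> \<Gamma> a" and x: "x \<in> V1 k" shows "f x \<in> V1 (a + k)"
proof -
  note lf = \<Gamma>_lin[OF f]
  have "ff 1 (f x) = f x" using \<tau>_V1(2)[OF x] lin_simps(3)[OF lf, of 1 x] by simp
  moreover have "\<tau> (f x) \<in> V2 (a + k)"
    using EH_V2[OF \<Psi>_EH[OF \<Gamma>_EH[OF f cong_refl]] \<tau>_V1(1)[OF x]] by (simp add: \<tau>_lin[OF lf])
  ultimately show ?thesis by (simp add: V1_def)
qed

lemma \<Gamma>_VG: assumes f: "f \<in> \<Gamma> a" and v: "v \<in> VG k" shows "f v \<in> VG (a + k)"
proof -
  obtain x where x: "x \<in> V1 k" "v = x + kk (\<chi> k) (\<tau> x)" using v by (rule VGE)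
  have "f v = f x + kk (\<chi> (a + k)) (\<tau> (f x))"
    unfolding x(2) by (simp add: lin_simps[OF \<Gamma>_lin[OF f]] \<Gamma>_\<tau>[OF f] \<chi>(2) mult.commute)
  then show ?thesis using VGI[OF \<Gamma>_V1[OF f x(1)]] by simp
qed

text \<open>
  It suffices that each \<open>\<Gamma> g\<close> is contained in the induced one: the other components of an operator
  of degree \<open>g\<close> vanish on homogeneous vectors.
\<close>

lemma induced_eq_\<Gamma>:
  assumes W: "decomposes UNIV W" and sub: "\<And>g k f v. f \<in> \<Gamma> g \<Longrightarrow> v \<in> W k \<Longrightarrow> f v \<in> W (g + k)"
  shows "induced_grading s W = \<Gamma>"
proof (rule ext, rule equalityI; rule subsetI)
  fix g f assume "f \<in> \<Gamma> g"
  then show "f \<in> induced_grading s W g" using \<Gamma>_lin sub unfolding induced_grading_def by auto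
next
  fix g f assume f: "f \<in> induced_grading s W g"
  then have lf: "lin f" and fW: "\<And>k v. v \<in> W k \<Longrightarrow> f v \<in> W (g + k)"
    unfolding induced_grading_def by (auto simp: image_subset_iff)
  have hom: "f v = pr g f v" if v: "v \<in> W k" for v k
  proof -
    have fv: "f v = (\<Sum>i\<in>S. pr i f v)"
      using arg_cong[OF sum_pr[OF lf], of "\<lambda>f. f v"] by (simp add: fun_sum_apply)
    have "component W (g + k) (f v) = (if g + k \<in> (\<lambda>i. i + k) ` S then pr (g + k - k) f v else 0)"
    proof (rule component_eqI[OF W, where f = "\<lambda>i. pr (i - k) f v"])
      show "f v = (\<Sum>i\<in>(\<lambda>i. i + k) ` S. pr (i - k) f v)"
        unfolding fv by (simp add: sum.reindex inj_on_def comp_apply)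
      show "pr (i - k) f v \<in> W i" for i using sub[OF pr_in[OF lf] v, of "i - k"] by simp
    qed (simp_all add: S(1))
    also have "\<dots> = pr g f v"
    proof (cases "g \<in> S")
      case False
      then show ?thesis using S(2)[OF lf False] by (simp add: zero_fun_apply)
    qed simp
    finally show ?thesis using component_homogeneous[OF W fW[OF v], of "g + k"] by simp
  qed
  have "f = pr g f"
  proof
    fix v
    have v: "v = (\<Sum>k | component W k v \<noteq> 0. component W k v)" by (rule component_spec[OF W]) simp
    have "f v = (\<Sum>k | component W k v \<noteq> 0. f (component W k v))"
      by (subst v) (rule lin_simps(8)[OF lf])
    also have "\<dots> = (\<Sum>k | component W k v \<noteq> 0. pr g f (component W k v))"
      using component_spec(1)[OF W] by (intro sum.cong refl hom) auto
    also have "\<dots> = pr g f v"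
      by (subst (3) v) (rule lin_simps(8)[OF pr_lin[OF lf], symmetric])
    finally show "f v = pr g f v" .
  qed
  then show "f \<in> \<Gamma> g" using pr_in[OF lf, of g] by simp
qed

lemma \<Lambda>_grading: "algebra_grading (L_alg :: ('f, 'f cubic) module) \<Lambda>"
proof -
  define c where "c g l = (SOME m. pr g (s l) = s m)" for g l
  have c: "s (c g l) = pr g (s l)" for g l unfolding c_def using someI_ex[OF pr_s] by metis
  have sum: "s (\<Sum>g\<in>I. c g l) = (\<Sum>g\<in>I. pr g (s l))" for I l
  proof -
    have "s (\<Sum>g\<in>I. c g l) v = (\<Sum>g\<in>I. pr g (s l)) v" for v
      by (simp add: fun_sum_apply S.scale_sum_left c)
    then show ?thesis by blast
  qed
  have s0: "s 0 = 0" and s_add: "s (l + m) = s l + s m" for l m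
    by (simp_all add: fun_eq_iff pointwise S.scale_left_distrib)
  have "decomposes UNIV \<Lambda>"
  proof (rule decomposesI[where \<pi> = c and S = S])
    show "0 \<in> \<Lambda> g" for g using \<Gamma>_zero[of g] by (simp add: \<Lambda>_def s0)
    show "l + m \<in> \<Lambda> g" if "l \<in> \<Lambda> g" "m \<in> \<Lambda> g" for g l m by (rule \<Lambda>_closed(1)[OF that])
    show "- l \<in> \<Lambda> g" if "l \<in> \<Lambda> g" for g l
      using \<Lambda>_closed(2)[OF that, of "- 1"] by (simp add: of_F_def inc_minus cubic_eq_iff uminus_cubic_def times_cubic_def)
    show "c g (l + m) = c g l + c g m" for g l m
      unfolding s_inj[symmetric] s_add c pr_add[OF lin_s lin_s] ..
    show "c g l \<in> \<Lambda> g" for g l by (simp add: \<Lambda>_def c pr_in lin_s)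
    show "c g l = l" if "l \<in> \<Lambda> g" for g l
      using that pr_hom[of "s l" g g] unfolding s_inj[symmetric] c by (simp add: \<Lambda>_def)
    show "c k l = 0" if "l \<in> \<Lambda> g" "k \<noteq> g" for g k l
      using that pr_hom[of "s l" g k] unfolding s_inj[symmetric] c s0 by (simp add: \<Lambda>_def)
    show "c g l = 0" if "g \<notin> S" for g l
      unfolding s_inj[symmetric] c s0 by (rule S(2)[OF lin_s that])
    show "l = (\<Sum>g\<in>S. c g l)" for l
      unfolding s_inj[symmetric] sum sum_pr[OF lin_s] ..
  qed (simp_all add: S(1))
  then show ?thesis unfolding L_grading_iff using \<Lambda>_closed by blast
qed

lemma u_powers: "1 \<in> \<Lambda> 0" "u \<in> \<Lambda> h" "u * u \<in> \<Lambda> (h + h)"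
  using \<Lambda>_h \<Lambda>_closed(3)[OF \<Lambda>_h \<Lambda>_h] \<Lambda>_closed(4) by (simp_all add: u_def)

lemma \<Lambda>_coordinates: assumes l: "l \<in> \<Lambda> d"
  shows "\<exists>r. l = of_F r * (if d = h then u else if d = h + h then u * u else 1) \<and> (d \<in> {0, h, h + h} \<or> r = 0)"
proof -
  have dec: "decomposes UNIV \<Lambda>" using \<Lambda>_grading unfolding L_grading_iff by blast
  define p where "p d = (if d = h then (fst_part l + 2 * re (snd_part l * conj \<omega>)) / 3
    else if d = h + h then (fst_part l + 2 * re (snd_part l * \<omega>)) / 3 else (fst_part l + 2 * re (snd_part l)) / 3)" for d
  define f where "f d = of_F (p d) * (if d = h then u else if d = h + h then u * u else 1)" for d
  have h0: "h \<noteq> 0" using hh by auto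
  have "component \<Lambda> d l = (if d \<in> {0, h, h + h} then f d else 0)"
  proof (rule component_eqI[OF dec])
    show "l = (\<Sum>d\<in>{0, h, h + h}. f d)"
      using L_coordinates[of l] hh h0 by (simp add: f_def p_def add.assoc)
    show "f d \<in> \<Lambda> d" if "d \<in> {0, h, h + h}" for d
      unfolding f_def using that u_powers h0 hh \<Lambda>_closed(2)[OF u_powers(1)] by (auto intro: \<Lambda>_closed(2))
  qed simp_all
  then have "l = (if d \<in> {0, h, h + h} then f d else 0)" using component_homogeneous[OF dec l, of d] by simp
  then show ?thesis
  proof (cases "d \<in> {0, h, h + h}")
    case False
    then have "l = 0" using \<open>l = _\<close> by simp
    then show ?thesis by (intro exI[of _ 0]) (simp add: cubic_eq_iff)
  qed (auto simp: f_def)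
qed

lemma \<Lambda>_0: "l \<in> \<Lambda> 0 \<Longrightarrow> \<exists>r. l = of_F r"
proof -
  have "h \<noteq> 0" using hh by auto
  then show "l \<in> \<Lambda> 0 \<Longrightarrow> \<exists>r. l = of_F r" using \<Lambda>_coordinates[of l 0] hh by auto
qed

text \<open>
  \<open>L\<close> is a graded field: its homogeneous elements are multiples of \<open>1\<close>, \<open>u\<close> and
  \<open>u\<^sup>2\<close>.
\<close>

lemma \<Lambda>_unit: assumes "l \<in> \<Lambda> d" "l \<noteq> 0" shows "fst_part l \<noteq> 0" "snd_part l \<noteq> 0"
proof -
  have w: "\<omega> \<noteq> 0" using \<omega>(2) by auto
  obtain r where r: "l = of_F r * (if d = h then u else if d = h + h then u * u else 1)"
    using \<Lambda>_coordinates[OF assms(1)] by blast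
  have "r \<noteq> 0" using assms(2) unfolding r by (auto simp: cubic_eq_iff)
  then show "fst_part l \<noteq> 0" "snd_part l \<noteq> 0" unfolding r using w by simp_all
qed

lemma \<Lambda>_twist: assumes "cong 0 d" shows "Cubic r (\<chi> d * inc r) \<in> \<Lambda> d"
proof -
  have "Cubic r (\<chi> d * inc r) = of_F r * Cubic 1 (\<chi> d)" by (simp add: cubic_eq_iff mult.commute)
  moreover have "Cubic 1 (\<chi> d) \<in> \<Lambda> d"
  proof -
    consider "d = 0" | "d = h" | "d = h + h" using assms unfolding cong_def by auto
    then show ?thesis
    proof cases
      case 1
      have "Cubic 1 1 = (1 :: 'f cubic)" by (simp add: cubic_eq_iff)
      then show ?thesis using u_powers(1) 1 by simp
    next
      case 2
      then show ?thesis using \<Lambda>_h \<chi>(3) by simp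
    next
      case 3
      have "Cubic 1 (\<chi> (h + h)) = u * u" by (simp add: cubic_eq_iff \<chi>(2,3))
      then show ?thesis using u_powers(3) 3 by simp
    qed
  qed
  ultimately show ?thesis using \<Lambda>_closed(2) by simp
qed

text \<open>
  \<open>b\<^sub>Q(v, w)\<close> is the multiple \<open>b1 x y\<close> of \<open>(1, \<chi>(g + k))\<close>, and
  vanishes unless \<open>g + k \<in> {0, h, h + h}\<close>.
\<close>

lemma polar_Q_VG: assumes "v \<in> VG g" "w \<in> VG k" shows "polar Q v w \<in> \<Lambda> (g + k)"
proof -
  obtain x where x: "x \<in> V1 g" "v = x + kk (\<chi> g) (\<tau> x)" using assms(1) by (rule VGE)
  obtain y where y: "y \<in> V1 k" "w = y + kk (\<chi> k) (\<tau> y)" using assms(2) by (rule VGE)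
  have b2x: "b2 x z = 0" "b2 z x = 0" "b2 y z = 0" "b2 z y = 0" for z
    using \<tau>_V1(2)[OF x(1)] \<tau>_V1(2)[OF y(1)] by (metis b_ff_kk(7,8))+
  have eq: "polar Q v w = Cubic (b1 x y) (\<chi> (g + k) * inc (b1 x y))"
    unfolding polar_Q x(2) y(2) by (simp add: b_add b2x b2_\<tau> \<chi>(2) mult.assoc)
  show ?thesis
  proof (cases "cong (g + k) 0")
    case True
    then show ?thesis unfolding eq by (rule \<Lambda>_twist[OF cong_sym])
  next
    case False
    have "polar Q v w = 0" unfolding eq b1_V1[OF x(1) y(1) False] by (simp add: cubic_eq_iff)
    moreover have "0 \<in> \<Lambda> (g + k)"
      using \<Lambda>_grading[unfolded L_grading_iff, THEN conjunct1] by (rule decomposes_closed(2))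
    ultimately show ?thesis by simp
  qed
qed

text \<open>
  Pairing the complex component of \<open>\<beta>(v, w)\<close> and \<open>\<chi>(g + k)\<close> times
  \<open>\<tau>\<close> of the real one with a vector \<open>\<tau> c\<close> leads to the same two values of the
  trilinear form, by its cyclic symmetry.
\<close>

lemma polar_beta_VG: assumes "v \<in> VG g" "w \<in> VG k" shows "polar \<beta> v w \<in> VG (g + k)"
proof -
  obtain x where x: "x \<in> V1 g" "v = x + kk (\<chi> g) (\<tau> x)" using assms(1) by (rule VGE)
  obtain y where y: "y \<in> V1 k" "w = y + kk (\<chi> k) (\<tau> y)" using assms(2) by (rule VGE)
  have zero: "J z x = 0" "J z y = 0" "hh x z = 0" "hh z x = 0" "hh y z = 0" "hh z y = 0" for z
  proof -
    have "kk 1 x = 0" "kk 1 y = 0" using V1_kk x(1) y(1) by blast+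
    then show "J z x = 0" "J z y = 0" "hh x z = 0" "hh z x = 0" "hh y z = 0" "hh z y = 0"
      using J_ff_kk(2)[of z x] J_ff_kk(2)[of z y] polar_beta_add(1)[of _ 0 0] polar_beta_add(2)[of 0 0]
      by (simp_all add: hh_def)
  qed
  define z where "z = hh v w"
  define P where "P = kk (conj (\<chi> k)) (J x (\<tau> y)) + kk (conj (\<chi> g)) (J y (\<tau> x))"
  have pol: "polar \<beta> v w = z + P"
    unfolding polar_beta z_def P_def by (simp add: x(2) y(2) J_add zero hh_add)
  have P: "P \<in> V2 (g + k)"
    unfolding P_def using J_V2[OF x(1) \<tau>_V1(1)[OF y(1)]] J_V2[OF y(1) \<tau>_V1(1)[OF x(1)]]
    by (intro V2_add V2_kk) (simp_all add: add.commute)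
  have uk: "\<chi> g * conj (\<chi> g) = 1" for g by (rule \<chi>(1))
  have "b2 (\<tau> c) (kk (\<chi> (g + k)) (\<tau> z)) = b2 (\<tau> c) P" for c
  proof -
    define a b where "a = b2 (\<tau> c) (J y (\<tau> x))" and "b = b2 (\<tau> c) (J x (\<tau> y))"
    have a: "conj (chi3 g) * a = b2 (\<tau> x) (J c (\<tau> y))"
    proof -
      have "a = chi3 g * b2 (\<tau> x) (J c (\<tau> y))" unfolding a_def by (rule trilinear_cyclic[OF x(1)])
      then have "conj (chi3 g) * a = (chi3 g * conj (chi3 g)) * b2 (\<tau> x) (J c (\<tau> y))" by (simp only: mult_ac)
      then show ?thesis unfolding unitary_chi3 by simp
    qed
    have b: "conj (chi3 k) * b = conj (b2 (\<tau> x) (J c (\<tau> y)))"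
    proof -
      have "b = chi3 k * b2 (\<tau> y) (J c (\<tau> x))" unfolding b_def by (rule trilinear_cyclic[OF y(1)])
      then have "conj (chi3 k) * b = (chi3 k * conj (chi3 k)) * b2 (\<tau> y) (J c (\<tau> x))" by (simp only: mult_ac)
      then show ?thesis unfolding unitary_chi3 b2_J_hermitian[of "\<tau> y" c "\<tau> x"] by simp
    qed
    define T where "T = b2 (\<tau> x) (J c (\<tau> y))"
    have "b2 v (J c w) = \<chi> g * conj (\<chi> k) * T"
    proof -
      have "b2 x q = 0" for q using \<tau>_V1(2)[OF x(1)] by (metis b_ff_kk(8))
      then show ?thesis unfolding x(2) y(2) T_def by (simp add: b_add J_add zero mult_ac)
    qed
    then have "inc (b1 c z) = \<chi> g * conj (\<chi> k) * T + conj (\<chi> g) * \<chi> k * conj T"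
      unfolding z_def b1_hh_re using add_conj[of "\<chi> g * conj (\<chi> k) * T"]
      by (simp only: conj_mult conj_simps) 
    then have "b2 (\<tau> c) (kk (\<chi> (g + k)) (\<tau> z))
        = \<chi> g * \<chi> k * (\<chi> g * conj (\<chi> k) * T + conj (\<chi> g) * \<chi> k * conj T)"
      by (simp only: b_ff_kk b2_\<tau> \<chi>(2))
    also have "\<dots> = \<chi> g * \<chi> g * (\<chi> k * conj (\<chi> k)) * T + \<chi> k * \<chi> k * (\<chi> g * conj (\<chi> g)) * conj T"
      by (simp only: distrib_left mult_ac)
    also have "\<dots> = \<chi> g * \<chi> g * (conj (chi3 g) * a) + \<chi> k * \<chi> k * (conj (chi3 k) * b)"
      unfolding a b T_def[symmetric] uk by simp
    also have "\<dots> = (\<chi> g * conj (\<chi> g)) * (\<chi> g * conj (\<chi> g)) * (conj (\<chi> g) * a)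
        + (\<chi> k * conj (\<chi> k)) * (\<chi> k * conj (\<chi> k)) * (conj (\<chi> k) * b)"
      by (simp only: conj_mult mult_ac)
    also have "\<dots> = b2 (\<tau> c) P" unfolding uk by (simp add: P_def b_add a_def b_def add.commute)
    finally show ?thesis .
  qed
  from b2_\<tau>_eqI[OF this] have zP: "kk (\<chi> (g + k)) (\<tau> z) = P"
    using P by (simp add: V2_iff)
  have "\<tau> z = kk (conj (\<chi> (g + k)) * \<chi> (g + k)) (\<tau> z)"
    using uk[of "g + k"] by (simp add: mult.commute)
  also have "\<dots> = kk (conj (\<chi> (g + k))) P" by (simp flip: zP)
  finally have "z \<in> V1 (g + k)" using V2_kk[OF P] by (simp add: V1_def z_def)
  then show ?thesis unfolding pol zP[symmetric] by (rule VGI)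
qed

theorem VG_inducing: "(\<Lambda>, VG) \<in> inducing_gradings s \<beta> Q \<Gamma>"
  unfolding inducing_gradings_def tc_grading_iff mem_Collect_eq case_prod_conv
proof (intro conjI allI ballI)
  show "s l v \<in> VG (g + k)" if "l \<in> \<Lambda> g" "v \<in> VG k" for g k l v
    using \<Gamma>_VG[OF _ that(2), of "s l" g] that(1) by (simp add: \<Lambda>_def)
  show "induced_grading s VG = \<Gamma>" by (rule induced_eq_\<Gamma>[OF VG_decomposes]) (rule \<Gamma>_VG)
qed (simp_all add: \<Lambda>_grading VG_decomposes VG_F polar_beta_VG polar_Q_VG)

section \<open>Uniqueness\<close>

lemma inducing_center_eq: assumes "(\<Lambda>', W) \<in> inducing_gradings s \<beta> Q \<Gamma>" shows "\<Lambda>' = \<Lambda>"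
proof (rule decomposes_mono_eq)
  have tc: "twisted_composition_grading s \<beta> Q \<Lambda>' W" and ind: "induced_grading s W = \<Gamma>"
    using assms by (simp_all add: inducing_gradings_def)
  show "decomposes UNIV \<Lambda>'" using tc unfolding tc_grading_iff L_grading_iff by blast
  show "decomposes UNIV \<Lambda>" using \<Lambda>_grading unfolding L_grading_iff by blast
  show "\<Lambda>' g \<subseteq> \<Lambda> g" for g
  proof
    fix l assume l: "l \<in> \<Lambda>' g"
    have "s l ` W k \<subseteq> W (g + k)" for k using tc l unfolding tc_grading_iff by blast
    then have "s l \<in> induced_grading s W g" using lin_s by (simp add: induced_grading_def)
    then show "l \<in> \<Lambda> g" unfolding ind by (simp add: \<Lambda>_def)
  qed
qed

lemma inducing_rk:
  assumes W: "(\<Lambda>, W) \<in> inducing_gradings s \<beta> Q \<Gamma>" and v: "v \<in> W g" and w: "w \<in> W k"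
  shows "rk v w \<in> \<Gamma> (g + k)"
proof -
  have tc: "twisted_composition_grading s \<beta> Q \<Lambda> W" and ind: "induced_grading s W = \<Gamma>"
    using W by (simp_all add: inducing_gradings_def)
  have "rk v w z \<in> W (g + k + i)" if "z \<in> W i" for z i
  proof -
    have "polar Q w z \<in> \<Lambda> (k + i)" using tc w that unfolding tc_grading_iff by blast
    then have "s (polar Q w z) v \<in> W (k + i + g)" using tc v unfolding tc_grading_iff by blast
    then show ?thesis by (simp add: rk_def ac_simps)
  qed
  then have "rk v w \<in> induced_grading s W (g + k)" by (auto simp: induced_grading_def lin_rk)
  then show ?thesis unfolding ind .
qed

lemma inducing_apply:
  assumes W: "(\<Lambda>, W) \<in> inducing_gradings s \<beta> Q \<Gamma>" and f: "f \<in> \<Gamma> g" and v: "v \<in> W k"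
  shows "f v \<in> W (g + k)"
proof -
  have "f \<in> induced_grading s W g" using W f by (simp add: inducing_gradings_def)
  then show ?thesis using v unfolding induced_grading_def by blast
qed

lemma VG_dual_pair: obtains k v w where "v \<in> VG k" "w \<in> VG (- k)" "polar Q v w = 1" "ff 1 v \<noteq> 0"
proof -
  have "\<exists>x y k l. x \<in> V1 k \<and> y \<in> V1 l \<and> b1 x y \<noteq> 0"
  proof (rule ccontr)
    assume "\<not> ?thesis"
    then have 0: "b1 x y = 0" if "x \<in> V1 k" "y \<in> V1 l" for x y k l using that by blast
    have 1: "b1 x (ff 1 y) = 0" if "x \<in> V1 k" for x y k
      by (rule V1_induct[where P = "\<lambda>y. b1 x y = 0"]) (simp_all add: 0[OF that] b_add)
    have "b1 (ff 1 (e 0)) (ff 1 (e 0)) = 0"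
      by (rule V1_induct[where P = "\<lambda>x. b1 x (ff 1 (e 0)) = 0"]) (simp_all only: 1 b_add add_0)
    then show False by (simp add: b1_e)
  qed
  then obtain x y k l where x: "x \<in> V1 k" and y: "y \<in> V1 l" and nz: "b1 x y \<noteq> 0" by blast
  have "cong (k + l) 0" using b1_V1[OF x y] nz by blast
  then have "cong (- k) l" using cong_uminus_left by blast
  then have y': "ff (1 / b1 x y) y \<in> V1 (- k)" using V1_ff[OF V1_cong[OF y cong_sym]] by blast
  define z where "z = ff (1 / b1 x y) y"
  have b2: "b2 x q = 0" "b2 q z = 0" for q
    using \<tau>_V1(2)[OF x] by (metis b_ff_kk(8)) (simp add: z_def)
  have one: "polar Q (x + kk (\<chi> k) (\<tau> x)) (z + kk (\<chi> (- k)) (\<tau> z)) = 1"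
    unfolding polar_Q using nz by (simp add: b_add b2 b2_\<tau> cubic_eq_iff) (simp add: z_def)
  have "x \<noteq> 0" using nz by auto
  then have "ff 1 (x + kk (\<chi> k) (\<tau> x)) \<noteq> 0" using \<tau>_V1(2)[OF x] by (simp add: ff_kk_add)
  then show ?thesis using that[OF VGI[OF x] VGI[OF y'[folded z_def]] one] by blast
qed

lemma polar_beta_VG_nonzero: obtains g k v w where "v \<in> VG g" "w \<in> VG k" "polar \<beta> v w \<noteq> 0"
proof -
  have "\<exists>v w g k. v \<in> VG g \<and> w \<in> VG k \<and> polar \<beta> v w \<noteq> 0"
  proof (rule ccontr)
    assume "\<not> ?thesis"
    then have 0: "polar \<beta> v w = 0" if "v \<in> VG g" "w \<in> VG k" for v w g k using that by blast
    have zero: "polar \<beta> v 0 = 0" "polar \<beta> 0 v = 0" for v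
      using polar_beta_add(1)[of v 0 0] polar_beta_add(2)[of 0 0 v] by simp_all
    have sum: "polar \<beta> v (\<Sum>i\<in>I. f i) = (\<Sum>i\<in>I. polar \<beta> v (f i))"
      "polar \<beta> (\<Sum>i\<in>I. f i) v = (\<Sum>i\<in>I. polar \<beta> (f i) v)" for v f and I :: "'g set"
      by (induction I rule: infinite_finite_induct) (simp_all add: zero polar_beta_add)
    have "polar \<beta> v w = 0" for v w
      by (subst VG_sum[of v], subst VG_sum[of w]) (simp add: sum 0[OF VGI[OF VG_part_V1] VGI[OF VG_part_V1]])
    then have "J (e 0) (\<tau> (e 0)) = 0" by (simp add: J_def)
    then have "b2 (J (e 0) (\<tau> (e 0))) (J (e 0) (\<tau> (e 0))) = 0" by simp
    then show False by (simp add: b2_J_\<tau>0)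
  qed
  then show ?thesis using that by blast
qed

lemma VG_shift: assumes v: "v \<in> VG g" "v \<noteq> 0" and l: "fst_part l \<noteq> 0" and sv: "s l v \<in> VG k"
  shows "cong g k"
proof (rule ccontr)
  assume nc: "\<not> cong g k"
  obtain x where x: "x \<in> V1 g" "v = x + kk (\<chi> g) (\<tau> x)" using v(1) by (rule VGE)
  obtain y where y: "y \<in> V1 k" "s l v = y + kk (\<chi> k) (\<tau> y)" using sv by (rule VGE)
  have "ff 1 (s l v) = ff (fst_part l) x" unfolding x(2) by (simp add: S.scale_right_distrib ff_kk_add)
  moreover have "ff 1 (s l v) = y" unfolding y(2) using \<tau>_V1(2)[OF y(1)] by (simp add: ff_kk_add)
  ultimately have "y = ff (fst_part l) x" by simp
  then have "pr1 g (ff (fst_part l) x) = 0" using V1_pr1[OF y(1), of g] nc by simp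
  moreover have "pr1 g (ff (fst_part l) x) = ff (fst_part l) x" using V1_pr1[OF V1_ff[OF x(1)], of g] by simp
  ultimately have "ff (1 / fst_part l) (ff (fst_part l) x) = 0" by simp
  then have "x = 0" using l \<tau>_V1(2)[OF x(1)] by simp
  then show False using v(2) x(2) by simp
qed

text \<open>
  The component of \<open>v\<^sub>0\<close> in any inducing grading is preserved by an idempotent of rank one, hence
  a multiple of \<open>v\<^sub>0\<close>; its coefficient determines that grading.
\<close>

lemma inducing_scaled:
  assumes W: "(\<Lambda>, W) \<in> inducing_gradings s \<beta> Q \<Gamma>"
  obtains l d where "fst_part l \<noteq> 0" "snd_part l \<noteq> 0" "\<And>m v. v \<in> VG m \<Longrightarrow> s l v \<in> W (d + m)"
    "l * l \<in> \<Lambda> (d + d)"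
proof -
  obtain k v0 w0 where v0: "v0 \<in> VG k" and w0: "w0 \<in> VG (- k)" and vw: "polar Q v0 w0 = 1"
    by (rule VG_dual_pair)
  have wv: "polar Q w0 v0 = 1" using vw polar_sym by metis
  have tc: "twisted_composition_grading s \<beta> Q \<Lambda> W" using W by (simp add: inducing_gradings_def)
  then have dec: "decomposes UNIV W" unfolding tc_grading_iff by blast
  have idem: "rk v0 w0 \<in> \<Gamma> 0" "rk w0 v0 \<in> \<Gamma> 0"
    using inducing_rk[OF VG_inducing v0 w0] inducing_rk[OF VG_inducing w0 v0] by simp_all
  have multiple: "\<exists>j l. fst_part l \<noteq> 0 \<and> s l x \<in> W j"
    if id: "rk x y \<in> \<Gamma> 0" and xy: "polar Q y x = 1" for x y
  proof -
    have x_sum: "x = (\<Sum>j | component W j x \<noteq> 0. component W j x)" by (rule component_spec[OF dec]) simp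
    define l where "l j = polar Q y (component W j x)" for j
    have "1 = polar Q y (\<Sum>j | component W j x \<noteq> 0. component W j x)" using xy x_sum by simp
    also have "\<dots> = (\<Sum>j | component W j x \<noteq> 0. l j)"
    proof -
      have "polar Q y 0 = 0" using polar_Q_add(1)[of y 0 0] by simp
      then have "polar Q y (sum f I) = (\<Sum>j\<in>I. polar Q y (f j))" for f and I :: "'g set"
        by (induction I rule: infinite_finite_induct) (simp_all add: polar_Q_add)
      then show ?thesis by (simp add: l_def)
    qed
    finally have "fst_part (\<Sum>j | component W j x \<noteq> 0. l j) = 1" by (metis cubic_simps(3))
    then have "\<exists>j. fst_part (l j) \<noteq> 0" unfolding fst_part_sum by (metis sum.neutral zero_neq_one)
    then obtain j where j: "fst_part (l j) \<noteq> 0" by blast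
    have "rk x y (component W j x) \<in> W (0 + j)"
      by (rule inducing_apply[OF W id component_spec(1)[OF dec]]) simp
    then have "s (l j) x \<in> W j" by (simp add: rk_def l_def)
    then show ?thesis using j by blast
  qed
  obtain j l where l: "fst_part l \<noteq> 0" "s l v0 \<in> W j" using multiple[OF idem(1) wv] by blast
  obtain i m where m: "fst_part m \<noteq> 0" "s m w0 \<in> W i" using multiple[OF idem(2) vw] by blast
  have lm: "l * m \<in> \<Lambda> (j + i)"
  proof -
    have "polar Q (s l v0) (s m w0) \<in> \<Lambda> (j + i)" using tc l m unfolding tc_grading_iff by blast
    then show ?thesis by (simp add: polar_Q_scale vw mult.commute)
  qed
  have "l * m \<noteq> 0" using l(1) m(1) by (metis cubic_simps(1,11) mult_eq_0_iff)
  then have snd: "snd_part l \<noteq> 0" using \<Lambda>_unit(2)[OF lm] by auto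
  have mv: "s l v \<in> W (j - k + n)" if v: "v \<in> VG n" for v n
  proof -
    have "rk v w0 (s l v0) \<in> W (n + - k + j)"
      by (rule inducing_apply[OF W inducing_rk[OF VG_inducing v w0] l(2)])
    moreover have "rk v w0 (s l v0) = s l v" by (simp add: rk_def polar_Q_scale wv)
    ultimately show ?thesis by (simp add: algebra_simps)
  qed
  have "l * l \<in> \<Lambda> ((j - k) + (j - k))"
  proof -
    have "polar Q (s l v0) (s l w0) \<in> \<Lambda> ((j - k + k) + (j - k + - k))"
      using tc mv[OF v0] mv[OF w0] unfolding tc_grading_iff by blast
    then show ?thesis by (simp add: polar_Q_scale vw algebra_simps)
  qed
  then show ?thesis using that[OF l(1) snd mv] by blast
qed

text \<open>
  After \<open>inducing_scaled\<close>, two things remain: \<open>\<beta>\<close> scales with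
  \<open>l\<^sup>\<sharp>\<close> and not with \<open>l\<close>, which bounds the shift \<open>d\<close> to
  \<open>{0, h, h + h}\<close>; then a homogeneous unit of degree \<open>- d\<close> removes the shift, and the
  resulting scalar \<open>m\<close> has \<open>m\<^sup>2 \<in> F\<close>, whence \<open>m\<close> is a multiple of
  \<open>(1, 1)\<close> or \<open>(1, - 1)\<close>.
\<close>

lemma inducing_unique:
  assumes W: "(\<Lambda>, W) \<in> inducing_gradings s \<beta> Q \<Gamma>"
  shows "W = VG \<or> W = (\<lambda>g. s (Cubic 1 (- 1)) ` VG g)"
proof -
  have tc: "twisted_composition_grading s \<beta> Q \<Lambda> W" using W by (simp add: inducing_gradings_def)
  then have dec: "decomposes UNIV W" and WF: "\<And>g c x. x \<in> W g \<Longrightarrow> s (of_F c) x \<in> W g"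
    unfolding tc_grading_iff by blast+
  obtain l d where l: "fst_part l \<noteq> 0" "snd_part l \<noteq> 0" and sl: "\<And>m v. v \<in> VG m \<Longrightarrow> s l v \<in> W (d + m)"
    and ll: "l * l \<in> \<Lambda> (d + d)"
    by (rule inducing_scaled[OF W]) (rule that; assumption)
  define l' where "l' = Cubic (1 / fst_part l) (1 / snd_part l)"
  have l'l: "l' * l = 1" using l by (simp add: l'_def cubic_eq_iff)
  have W_eq: "W = (\<lambda>g. s l ` VG (g - d))"
  proof (rule decomposes_mono_eq[symmetric, OF _ dec])
    show "s l ` VG (g - d) \<subseteq> W g" for g using sl[of _ "g - d"] by auto
    show "decomposes UNIV (\<lambda>g. s l ` VG (g - d))"
    proof (rule decomposesI[where \<pi> = "\<lambda>g v. s l (component VG (g - d) (s l' v))" and S = "(\<lambda>i. i + d) ` S"])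
      have mem: "y \<in> s l ` VG g \<longleftrightarrow> s l' y \<in> VG g" for y g
      proof
        assume "s l' y \<in> VG g"
        then have "s l (s l' y) \<in> s l ` VG g" by (rule imageI)
        then show "y \<in> s l ` VG g" using l'l by (simp add: mult.commute)
      qed (use l'l in auto)
      have sll: "s l (s l' v) = v" "s l' (s l v) = v" for v using l'l by (simp_all add: mult.commute)
      note VGd = decomposes_closed(2-4)[OF VG_decomposes]
      show "0 \<in> s l ` VG (g - d)" for g by (simp add: mem VGd)
      show "x + y \<in> s l ` VG (g - d)" if "x \<in> s l ` VG (g - d)" "y \<in> s l ` VG (g - d)" for g x y
        using that by (simp add: mem VGd S.scale_right_distrib)
      show "- x \<in> s l ` VG (g - d)" if "x \<in> s l ` VG (g - d)" for g x
        using that by (simp add: mem VGd)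
      show "s l (component VG (g - d) (s l' (x + y))) = s l (component VG (g - d) (s l' x)) + s l (component VG (g - d) (s l' y))" for g x y
        by (simp add: S.scale_right_distrib component_add[OF VG_decomposes])
      show "s l (component VG (g - d) (s l' x)) \<in> s l ` VG (g - d)" for g x
        by (intro imageI component_spec[OF VG_decomposes]) simp
      show "s l (component VG (g - d) (s l' x)) = x" if "x \<in> s l ` VG (g - d)" for g x
        using component_homogeneous[OF VG_decomposes that[unfolded mem], of "g - d"] sll by simp
      show "s l (component VG (k - d) (s l' x)) = 0" if "x \<in> s l ` VG (g - d)" "k \<noteq> g" for g k x
        using component_homogeneous[OF VG_decomposes that(1)[unfolded mem], of "k - d"] that(2) by simp
      have comp: "component VG g v = (if g \<in> S then VG_part g v + kk (\<chi> g) (\<tau> (VG_part g v)) else 0)" for g v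
        by (rule component_eqI[OF VG_decomposes _ S(1)]) (simp_all add: VGI[OF VG_part_V1], rule VG_sum)
      show "s l (component VG (g - d) (s l' x)) = 0" if "g \<notin> (\<lambda>i. i + d) ` S" for g x
      proof -
        have "g - d \<notin> S" using that by (metis diff_add_cancel image_eqI)
        then show ?thesis by (simp add: comp)
      qed
      show "x = (\<Sum>g\<in>(\<lambda>i. i + d) ` S. s l (component VG (g - d) (s l' x)))" for x
      proof -
        have "s l' x = (\<Sum>g\<in>S. component VG g (s l' x))"
          by (rule component_sum_superset[OF VG_decomposes _ S(1)]) (simp_all add: comp)
        then have "s l (s l' x) = (\<Sum>g\<in>S. s l (component VG g (s l' x)))"
          by (metis S.scale_sum_right)
        then show ?thesis by (simp only: sll) (simp add: sum.reindex inj_on_def comp_apply)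
      qed
    qed (simp_all add: S(1))
  qed
  have d: "cong 0 d"
  proof -
    obtain g k v w where v: "v \<in> VG g" and w: "w \<in> VG k" and nz: "polar \<beta> v w \<noteq> 0"
      by (rule polar_beta_VG_nonzero)
    have pVG: "polar \<beta> v w \<in> VG (g + k)" by (rule polar_beta_VG[OF v w])
    have "polar \<beta> (s l v) (s l w) \<in> W ((d + g) + (d + k))"
      using tc sl[OF v] sl[OF w] unfolding tc_grading_iff by blast
    then have "s (sharp l) (polar \<beta> v w) \<in> s l ` VG ((d + g) + (d + k) - d)"
      unfolding polar_beta_s W_eq .
    then obtain z where z: "z \<in> VG ((d + g) + (d + k) - d)" "s (sharp l) (polar \<beta> v w) = s l z" by blast
    have "s (l' * sharp l) (polar \<beta> v w) = s l' (s (sharp l) (polar \<beta> v w))" by simp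
    also have "\<dots> = z" unfolding z(2) using l'l by simp
    finally have "s (l' * sharp l) (polar \<beta> v w) \<in> VG (d + (g + k))" using z(1) by (simp add: algebra_simps)
    moreover have "fst_part (l' * sharp l) \<noteq> 0"
    proof -
      have "re (snd_part l * conj (snd_part l)) \<noteq> 0"
      proof
        assume "re (snd_part l * conj (snd_part l)) = 0"
        then have "snd_part l * conj (snd_part l) = 0" by (simp add: cplx_eq_iff)
        then show False using l(2) by simp
      qed
      then show ?thesis using l(1) by (simp add: l'_def del: re_im_ring_simps)
    qed
    ultimately have "cong (g + k) (d + (g + k))" using VG_shift[OF pVG nz] by blast
    then show ?thesis using cong_add_cancel(1)[of 0 "g + k" d] by simp
  qed
  define m where "m = l * Cubic 1 (\<chi> (- d))"
  have sm: "s m v \<in> W g" if "v \<in> VG g" for v g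
  proof -
    have "Cubic 1 (\<chi> (- d)) \<in> \<Lambda> (- d)" using \<Lambda>_twist[of "- d" 1] cong_minus[OF d] by simp
    then have "s (Cubic 1 (\<chi> (- d))) \<in> \<Gamma> (- d)" by (simp add: \<Lambda>_def)
    from \<Gamma>_VG[OF this that] have "s (Cubic 1 (\<chi> (- d))) v \<in> VG (- d + g)" .
    from sl[OF this] show ?thesis by (simp add: m_def)
  qed
  have "m * m \<in> \<Lambda> 0"
  proof -
    have "Cubic 1 (\<chi> (- d)) \<in> \<Lambda> (- d)" using \<Lambda>_twist[of "- d" 1] cong_minus[OF d] by simp
    from \<Lambda>_closed(3)[OF ll \<Lambda>_closed(3)[OF this this]] show ?thesis
      by (simp add: m_def mult_ac algebra_simps)
  qed
  then obtain r where r: "m * m = of_F r" using \<Lambda>_0 by blast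
  have "snd_part m * snd_part m = inc (fst_part m) * inc (fst_part m)"
    using arg_cong[OF r, of fst_part] arg_cong[OF r, of snd_part] by (simp flip: inc_mult)
  then have sgn: "snd_part m = inc (fst_part m) \<or> snd_part m = - inc (fst_part m)"
    by (simp add: square_eq_iff)
  have f: "fst_part m \<noteq> 0" using l(1) by (simp add: m_def)
  show ?thesis
  proof (rule disjE[OF sgn])
    assume "snd_part m = inc (fst_part m)"
    then have "of_F (1 / fst_part m) * m = 1" using f by (simp add: cubic_eq_iff flip: inc_mult)
    then have "v \<in> W g" if "v \<in> VG g" for v g using WF[OF sm[OF that], of "1 / fst_part m"] by simp
    then have "VG = W" by (intro decomposes_mono_eq[OF VG_decomposes dec]) blast
    then show ?thesis by simp
  next
    assume "snd_part m = - inc (fst_part m)"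
    then have "of_F (1 / fst_part m) * m = Cubic 1 (- 1)" using f by (simp add: cubic_eq_iff flip: inc_mult)
    then have "s (Cubic 1 (- 1)) ` VG g \<subseteq> W g" for g
      using WF[OF sm, of _ g "1 / fst_part m"] by auto
    moreover have "decomposes UNIV (\<lambda>g. s (Cubic 1 (- 1)) ` VG g)"
    proof -
      have "Cubic 1 (- 1) * Cubic 1 (- 1) = (1 :: 'f cubic)" by (simp add: cubic_eq_iff)
      then show ?thesis by (intro decomposes_image VG_decomposes) (simp_all add: S.scale_right_distrib)
    qed
    ultimately have "(\<lambda>g. s (Cubic 1 (- 1)) ` VG g) = W" using decomposes_mono_eq[OF _ dec] by blast
    then show ?thesis by simp
  qed
qed

text \<open>
  A homogeneous vector \<open>x + \<chi>(k) \<tau> x\<close> and \<open>x - \<chi>(k) \<tau> x\<close> cannot both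
  have degree \<open>k\<close>, as the first component determines the second one.
\<close>

lemma center_moves_VG: "(\<lambda>g. s (Cubic 1 (- 1)) ` VG g) \<noteq> VG"
proof
  assume eq: "(\<lambda>g. s (Cubic 1 (- 1)) ` VG g) = VG"
  obtain k v w where v: "v \<in> VG k" "ff 1 v \<noteq> 0" by (rule VG_dual_pair)
  obtain x where x: "x \<in> V1 k" "v = x + kk (\<chi> k) (\<tau> x)" using v(1) by (rule VGE)
  have "s (Cubic 1 (- 1)) v \<in> VG k" using v(1) fun_cong[OF eq, of k] by blast
  then obtain y where y: "y \<in> V1 k" "s (Cubic 1 (- 1)) v = y + kk (\<chi> k) (\<tau> y)" by (rule VGE)
  have fx: "ff 1 x = x" "ff 1 y = y" using \<tau>_V1(2) x(1) y(1) by blast+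
  have 1: "ff 1 (s (Cubic 1 (- 1)) v) = x" "kk 1 (s (Cubic 1 (- 1)) v) = - kk (\<chi> k) (\<tau> x)"
    unfolding x(2) using V1_kk[OF x(1)] by (simp_all add: fx ff_kk_add ff_kk_diff S.scale_right_distrib kk_minus_left)
  have 2: "ff 1 (s (Cubic 1 (- 1)) v) = y" "kk 1 (s (Cubic 1 (- 1)) v) = kk (\<chi> k) (\<tau> y)"
    unfolding y(2) using V1_kk[OF y(1)] by (simp_all add: fx ff_kk_add)
  have "x = y" by (rule trans[OF 1(1)[symmetric] 2(1)])
  have neg: "- kk (\<chi> k) (\<tau> x) = kk (\<chi> k) (\<tau> x)"
    using trans[OF 1(2)[symmetric] 2(2)] by (simp only: \<open>x = y\<close>)
  have "kk (2 * \<chi> k) (\<tau> x) = kk (\<chi> k) (\<tau> x) + kk (\<chi> k) (\<tau> x)" by (simp only: mult_2 kk_add_left)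
  also have "\<dots> = - kk (\<chi> k) (\<tau> x) + kk (\<chi> k) (\<tau> x)" by (simp only: neg)
  finally have "kk (2 * \<chi> k) (\<tau> x) = kk (2 * \<chi> k) 0" by simp
  then have "\<tau> x = \<tau> 0" using kk_cancel[of "2 * \<chi> k" "\<tau> x" 0] by simp
  then have "x = 0" using \<tau>_inject'[of x 0] fx by simp
  then show False using v(2) x(2) by (simp add: ff_kk_add)
qed

lemma inducing_gradings_eq:
  "inducing_gradings s \<beta> Q \<Gamma> = {(\<Lambda>, VG), (\<Lambda>, \<lambda>g. s (Cubic 1 (- 1)) ` VG g)}"
proof (rule equalityI)
  show "inducing_gradings s \<beta> Q \<Gamma> \<subseteq> {(\<Lambda>, VG), (\<Lambda>, \<lambda>g. s (Cubic 1 (- 1)) ` VG g)}"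
  proof (rule subsetI)
    fix p assume p: "p \<in> inducing_gradings s \<beta> Q \<Gamma>"
    obtain L W where LW: "p = (L, W)" by (cases p)
    have "L = \<Lambda>" using inducing_center_eq p unfolding LW by blast
    moreover have "W = VG \<or> W = (\<lambda>g. s (Cubic 1 (- 1)) ` VG g)"
      using inducing_unique p unfolding LW calculation by blast
    ultimately show "p \<in> {(\<Lambda>, VG), (\<Lambda>, \<lambda>g. s (Cubic 1 (- 1)) ` VG g)}" unfolding LW by blast
  qed
  show "{(\<Lambda>, VG), (\<Lambda>, \<lambda>g. s (Cubic 1 (- 1)) ` VG g)} \<subseteq> inducing_gradings s \<beta> Q \<Gamma>"
    using VG_inducing inducing_gradings_center[OF VG_inducing] by blast
qed

lemma inducing_gradings_pair:
  "card (inducing_gradings s \<beta> Q \<Gamma>) = 2 \<and>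
    (\<forall>(\<Lambda>, W) \<in> inducing_gradings s \<beta> Q \<Gamma>.
       inducing_gradings s \<beta> Q \<Gamma> = {(\<Lambda>, W), (\<Lambda>, \<lambda>g. s (Cubic 1 (- 1)) ` W g)})"
proof
  show "card (inducing_gradings s \<beta> Q \<Gamma>) = 2"
    unfolding inducing_gradings_eq using center_moves_VG by (subst card_2_iff) (metis prod.inject)
  have "Cubic 1 (- 1) * Cubic 1 (- 1) = (1 :: 'f cubic)" by (simp add: cubic_eq_iff)
  then have "(\<lambda>g. s (Cubic 1 (- 1)) ` s (Cubic 1 (- 1)) ` VG g) = VG" by (simp add: image_image)
  then show "\<forall>(\<Lambda>, W) \<in> inducing_gradings s \<beta> Q \<Gamma>.
       inducing_gradings s \<beta> Q \<Gamma> = {(\<Lambda>, W), (\<Lambda>, \<lambda>g. s (Cubic 1 (- 1)) ` W g)}"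
    unfolding inducing_gradings_eq by (auto simp: insert_commute)
qed

end

theorem theorem17:
  fixes s :: "'f::real_closed_field cubic \<Rightarrow> 'v::ab_group_add \<Rightarrow> 'v"
    and \<beta> :: "'v \<Rightarrow> 'v" and Q :: "'v \<Rightarrow> 'f cubic"
    and \<Gamma> :: "'g::ab_group_add \<Rightarrow> ('v \<Rightarrow> 'v) set"
    and a :: "'f cubic"
  defines "a \<equiv> Cubic 1 (- 1)"
  assumes "twisted_composition8 s \<beta> Q"
    and "trialitarian_grading_III s \<beta> Q \<Gamma>"
  shows "card (inducing_gradings s \<beta> Q \<Gamma>) = 2 \<and>
    (\<forall>(\<Lambda>, W) \<in> inducing_gradings s \<beta> Q \<Gamma>.
       inducing_gradings s \<beta> Q \<Gamma> = {(\<Lambda>, W), (\<Lambda>, \<lambda>g. s a ` W g)}) \<and>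
    spin_center s \<beta> Q - {id} = {s a}"
proof -
  interpret twisted_composition s \<beta> Q by (rule twisted_composition.intro) (rule assms)
  obtain e where e: "orth_family 8 e" "\<And>x. ff 1 x = orth_proj 8 e x" using orth_basis_exists by blast
  interpret twisted_composition_basis s \<beta> Q e by unfold_locales (rule e)+
  interpret trialitarian_graded s \<beta> Q e \<Gamma> by unfold_locales (rule assms)
  obtain h \<omega> S \<chi> where char: "h + h + h = 0" "h + h \<noteq> 0" "h + h \<noteq> h" "\<omega> * \<omega> + \<omega> + 1 = 0" "unitary \<omega>"
    "Cubic 1 \<omega> \<in> \<Lambda> h" "finite S" "\<And>f g. lin f \<Longrightarrow> g \<notin> S \<Longrightarrow> pr g f = 0" "\<And>g. g \<in> S \<Longrightarrow> g + h \<in> S"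
    "\<And>g. unitary (\<chi> g)" "\<And>g k. \<chi> (g + k) = \<chi> g * \<chi> k" "\<chi> h = \<omega>"
    using degree_character by blast
  interpret trialitarian_character s \<beta> Q e \<Gamma> h \<omega> S \<chi> by unfold_locales (fact char)+
  obtain \<tau> where \<tau>: "\<And>x y. \<tau> (x + y) = \<tau> x + \<tau> y" "\<And>x. kk 1 (\<tau> x) = \<tau> x"
    "\<And>f x. lin f \<Longrightarrow> \<tau> (f x) = \<Psi> f (\<tau> x)" "\<And>x y. b2 (\<tau> x) (\<tau> y) = inc (b1 x y)"
    using equivariant_isometry_exists by blast
  interpret trialitarian_isometry s \<beta> Q e \<Gamma> h \<omega> S \<chi> \<tau> by unfold_locales (fact \<tau>)+
  show ?thesis unfolding a_def using inducing_gradings_pair spin_center_eq by blast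
qed

end
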